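(* Let $\tau:I\to I$ be piecewise monotonic and transitive, and not essentially injective, with associated local homeomorphism $\sigma:X\to X$. Let $X_1,\ldots,X_N$ be the unique partition of $X$ into clopen sets such that $\sigma(X_i)=X_{i+1\bmod N}$ and $\sigma^N|_{X_i}$ is topologically exact for each $i$, and let $\mu$ be the unique probability measure on $X$ scaled by $\sigma$. Then $[f]\mapsto\bigoplus_i[f\chi_{X_i}]$ is a unital dimension group isomorphism of $DG(\tau)$ onto $\bigoplus_i G_i$, where $G_i=\{[f]\in DG(\tau)\mid \operatorname{supp} f\subset X_i\}$, with distinguished order unit $[\chi_{X_i}]$. Each $G_i$ is isomorphic to the dimension group $G_{\sigma^N|_{X_i}}$ associated with $\sigma^N|_{X_i}$, and is a simple dimension group, with a unique state $\mu_i$, given by $\mu_i([f])=\mu(X_i)^{-1}\mu(f)$, and with the strict order given by that state. Furthermore, the state $[f]\mapsto\mu(f)$ on $DG(\tau)$ induced by $\mu$ is the unique state scaled by $(\mathcal L_\sigma)_*$, and $(\mathcal L_\sigma)_*$ maps $G_i$ onto $G_{i+1\bmod N}$ for each $i$. The scaling factor is $s=\exp h_\tau$.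
   Context: Let $I=[0,1]$. A (not necessarily continuous) map $\tau:I\to I$ is piecewise monotonic if there are points $0=a_0<a_1<\dots<a_n=1$ such that each $\tau|_{(a_{i-1},a_i)}$ is continuous and strictly monotonic; the points are chosen so that no $(a_{i-1},a_i)$ is contained in a larger open interval on which $\tau$ is continuous and strictly monotonic. Then $\{a_0,\dots,a_n\}$ is the partition associated with $\tau$, and $\tau_i:[a_{i-1},a_i]\to I$ denotes the continuous extension of $\tau|_{(a_{i-1},a_i)}$. Actual values of $\tau$ at partition points of discontinuity are ignored: $\widehat\tau(x)$ is the set of left and right limits of $\tau$ at $x$, $\widehat\tau(A)=\bigcup_i\tau_i(A\cap[a_{i-1},a_i])$, and $\widehat\tau^{-1}(A)=\bigcup_i\{x\in[a_{i-1},a_i]:\tau_i(x)\in A\}$. $\tau$ (viewed as undefined at the partition points) is transitive if for all non-empty open $U,V\subset I$ there is $n\ge 0$ with $\tau^n(U)\cap V\ne\emptyset$. $\tau$ is essentially injective if there are no disjoint (nondegenerate) intervals $J,J'$ with $\tau(J)=\tau(J')$; equivalently, $\tau$ is injective on the complement of the set of partition points. The generalized orbit of $x\in I$ is the smallest subset of $I$ containing $x$ that is forward and backward invariant under $\widehat\tau$. $I_1$ is the union of the generalized orbits of $a_0,\dots,a_n$, and $I_0=I\setminus I_1$. $X$ is the totally ordered set obtained from $I$ by replacing each $x\in I_1\setminus\{0,1\}$ by two points $x^-<x^+$, with the order topology (homeomorphic to a compact subset of $\mathbb R$); $\pi:X\to I$ is the collapse map ($\pi(x^\pm)=x$), and $X_0=\pi^{-1}(I_0)$.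 The local homeomorphism associated with $\tau$ is the unique continuous map $\sigma:X\to X$ with $\pi\circ\sigma=\tau\circ\pi$ on $X_0$. For a piecewise homeomorphism $\rho:Y\to Y$ of a compact metric space (continuous, open, with a finite clopen partition of $Y$ on each member of which $\rho$ is a homeomorphism onto its image; $\sigma$ and $\sigma^N|_{X_i}$ are such), the transfer operator is $(\mathcal L_\rho f)(x)=\sum_{\rho y=x}f(y)$. $G_\rho$ is $C(Y,\mathbb Z)$ modulo $f\sim g$ iff $\mathcal L_\rho^nf=\mathcal L_\rho^ng$ for some $n\ge0$, ordered by $[f]\ge0$ iff $\mathcal L_\rho^nf\ge0$ for some $n$; it is a dimension group. $DG(\tau):=G_\sigma$, with distinguished order unit $[1]$, and $(\mathcal L_\sigma)_*[f]=[\mathcal L_\sigma f]$. The $G_i$ carry the order inherited from $DG(\tau)$; a dimension group isomorphism is a group isomorphism that is also an order isomorphism. A state on a dimension group $G$ with distinguished order unit $e$ is a positive homomorphism $\omega:G\to\mathbb R$ with $\omega(e)=1$; the strict order given by $\omega$ is: $x\le y$ iff $\omega(x)<\omega(y)$ or $x=y$. $\omega$ is scaled by a positive endomorphism $\Phi$ by the factor $s$ if $\omega(\Phi(x))=s\,\omega(x)$ for all $x$. A probability measure $\mu$ on $X$ is scaled by $\sigma$ by a factor $s>0$ if $\mu(\sigma(E))=s\mu(E)$ for all Borel sets $E$ on which $\sigma$ is one-to-one; $\mu(f)=\int f\,d\mu$. Under the hypotheses of the claim the partition $X_1,\dots,X_N$ and the scaled measure $\mu$ exist and are unique. A continuous map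 $g:Y\to Y$ is topologically exact if for each non-empty open $V\subset Y$ there is $n\ge0$ with $g^n(V)=Y$. The entropy $h_\tau$ is the topological entropy of $\tau$ if $\tau$ is continuous, and in general the topological entropy of the shift on $\Sigma_\tau=\{(s_i)_{i\ge0}\in\{1,\dots,n\}^{\mathbb N}:\bigcap_{i=0}^k\tau^{-i}((a_{s_i-1},a_{s_i}))\neq\emptyset\ \text{for all }k\ge 0\}$ (these agree for continuous $\tau$). Indices mod $N$ are taken in $\{1,\dots,N\}$. *)

theory Defs
  imports "HOL-Probability.Probability_Measure" "HOL-Algebra.Product_Groups"
begin

section \<open>Piecewise monotonic maps of the unit interval\<close>

text \<open>The pair \<open>n\<close>, \<open>a\<close> represents the partition \<open>a 0 < \<dots> < a n\<close> associated with \<open>\<tau>\<close>. The last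
  conjunct is the maximality requirement, which makes the partition unique.\<close>

definition continuous_strictly_monotonic_on :: "real set \<Rightarrow> (real \<Rightarrow> real) \<Rightarrow> bool" where
  "continuous_strictly_monotonic_on A \<tau> \<longleftrightarrow>
     continuous_on A \<tau> \<and> (strict_mono_on A \<tau> \<or> strict_antimono_on A \<tau>)"

definition piecewise_monotonic :: "(real \<Rightarrow> real) \<Rightarrow> nat \<Rightarrow> (nat \<Rightarrow> real) \<Rightarrow> bool" where
  "piecewise_monotonic \<tau> n a \<longleftrightarrow>
     \<tau> \<in> {0..1} \<rightarrow> {0..1} \<and>
     a 0 = 0 \<and> a n = 1 \<and> strict_mono_on {0..n} a \<and>
     (\<forall>i\<in>{1..n}. continuous_strictly_monotonic_on {a (i - 1)<..<a i} \<tau>) \<and>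
     (\<forall>i\<in>{1..n}. \<forall>c d. 0 \<le> c \<and> d \<le> 1 \<and> {a (i - 1)<..<a i} \<subset> {c<..<d} \<longrightarrow>
        \<not> continuous_strictly_monotonic_on {c<..<d} \<tau>)"

definition partition_points :: "nat \<Rightarrow> (nat \<Rightarrow> real) \<Rightarrow> real set" where
  "partition_points n a = a ` {0..n}"

text \<open>The continuous extension \<open>\<tau>\<^sub>i\<close> of \<open>\<tau>\<close> to \<open>[a (i - 1), a i]\<close>, for \<open>i \<in> {1..n}\<close>.\<close>

definition branch :: "(real \<Rightarrow> real) \<Rightarrow> (nat \<Rightarrow> real) \<Rightarrow> nat \<Rightarrow> real \<Rightarrow> real" where
  "branch \<tau> a i x =
     (if x = a (i - 1) then Lim (at_right x) \<tau>
      else if x = a i then Lim (at_left x) \<tau>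
      else \<tau> x)"

definition hat_image :: "(real \<Rightarrow> real) \<Rightarrow> nat \<Rightarrow> (nat \<Rightarrow> real) \<Rightarrow> real set \<Rightarrow> real set" where
  "hat_image \<tau> n a A = (\<Union>i\<in>{1..n}. branch \<tau> a i ` (A \<inter> {a (i - 1)..a i}))"

definition hat_preimage :: "(real \<Rightarrow> real) \<Rightarrow> nat \<Rightarrow> (nat \<Rightarrow> real) \<Rightarrow> real set \<Rightarrow> real set" where
  "hat_preimage \<tau> n a A = (\<Union>i\<in>{1..n}. {x \<in> {a (i - 1)..a i}. branch \<tau> a i x \<in> A})"

text \<open>Here \<open>\<tau>\<close> is regarded as undefined at the partition points, so these are removed before each
  application of \<open>\<tau>\<close>.\<close>

definition transitive_map :: "(real \<Rightarrow> real) \<Rightarrow> nat \<Rightarrow> (nat \<Rightarrow> real) \<Rightarrow> bool" where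
  "transitive_map \<tau> n a \<longleftrightarrow>
     (\<forall>U V. openin (top_of_set {0..1}) U \<and> U \<noteq> {} \<and> openin (top_of_set {0..1}) V \<and> V \<noteq> {} \<longrightarrow>
        (\<exists>k. ((\<lambda>A. \<tau> ` (A - partition_points n a)) ^^ k) U \<inter> V \<noteq> {}))"

definition essentially_injective :: "(real \<Rightarrow> real) \<Rightarrow> bool" where
  "essentially_injective \<tau> \<longleftrightarrow>
     \<not> (\<exists>J J'. is_interval J \<and> J \<subseteq> {0..1} \<and> \<not> (\<exists>x. J \<subseteq> {x}) \<and>
             is_interval J' \<and> J' \<subseteq> {0..1} \<and> \<not> (\<exists>x. J' \<subseteq> {x}) \<and>
             J \<inter> J' = {} \<and> \<tau> ` J = \<tau> ` J')"

definition generalized_orbit ::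
    "(real \<Rightarrow> real) \<Rightarrow> nat \<Rightarrow> (nat \<Rightarrow> real) \<Rightarrow> real \<Rightarrow> real set" where
  "generalized_orbit \<tau> n a x =
     \<Inter>{A. A \<subseteq> {0..1} \<and> x \<in> A \<and> hat_image \<tau> n a A \<subseteq> A \<and> hat_preimage \<tau> n a A \<subseteq> A}"

definition I1 :: "(real \<Rightarrow> real) \<Rightarrow> nat \<Rightarrow> (nat \<Rightarrow> real) \<Rightarrow> real set" where
  "I1 \<tau> n a = (\<Union>x\<in>partition_points n a. generalized_orbit \<tau> n a x)"

definition I0 :: "(real \<Rightarrow> real) \<Rightarrow> nat \<Rightarrow> (nat \<Rightarrow> real) \<Rightarrow> real set" where
  "I0 \<tau> n a = {0..1} - I1 \<tau> n a"

section \<open>The associated local homeomorphism\<close>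

text \<open>For \<open>x \<in> I1 - {0, 1}\<close> the points \<open>x\<^sup>-\<close> and \<open>x\<^sup>+\<close> are \<open>(x, False)\<close> and \<open>(x, True)\<close>; every other
  \<open>x \<in> {0..1}\<close> gives the single point \<open>(x, False)\<close>. The collapse map \<open>X \<rightarrow> {0..1}\<close> is \<open>fst\<close>.\<close>

type_synonym point = "real \<times> bool"

definition X_points :: "(real \<Rightarrow> real) \<Rightarrow> nat \<Rightarrow> (nat \<Rightarrow> real) \<Rightarrow> point set" where
  "X_points \<tau> n a = {0..1} \<times> {False} \<union> (I1 \<tau> n a - {0, 1}) \<times> {True}"

definition point_less :: "point \<Rightarrow> point \<Rightarrow> bool" where
  "point_less p q \<longleftrightarrow> fst p < fst q \<or> fst p = fst q \<and> snd p < snd q"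

definition order_topology :: "point set \<Rightarrow> point topology" where
  "order_topology S = topology_generated_by
     (insert S ((\<lambda>p. {q \<in> S. point_less q p}) ` S \<union> (\<lambda>p. {q \<in> S. point_less p q}) ` S))"

definition X_top :: "(real \<Rightarrow> real) \<Rightarrow> nat \<Rightarrow> (nat \<Rightarrow> real) \<Rightarrow> point topology" where
  "X_top \<tau> n a = order_topology (X_points \<tau> n a)"

text \<open>On \<open>X\<close> there is exactly one such \<open>\<sigma>\<close>; its values outside \<open>X\<close> play no role.\<close>

definition associated_local_homeomorphism ::
    "(real \<Rightarrow> real) \<Rightarrow> nat \<Rightarrow> (nat \<Rightarrow> real) \<Rightarrow> (point \<Rightarrow> point) \<Rightarrow> bool" where
  "associated_local_homeomorphism \<tau> n a \<sigma> \<longleftrightarrow>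
     continuous_map (X_top \<tau> n a) (X_top \<tau> n a) \<sigma> \<and>
     (\<forall>p\<in>X_points \<tau> n a. fst p \<in> I0 \<tau> n a \<longrightarrow> fst (\<sigma> p) = \<tau> (fst p))"

definition topologically_exact :: "'a topology \<Rightarrow> ('a \<Rightarrow> 'a) \<Rightarrow> bool" where
  "topologically_exact T g \<longleftrightarrow>
     continuous_map T T g \<and>
     (\<forall>V. openin T V \<and> V \<noteq> {} \<longrightarrow> (\<exists>k. (g ^^ k) ` V = topspace T))"

text \<open>The successor of \<open>i\<close> modulo \<open>N\<close>, with representatives taken in \<open>{1..N}\<close>.\<close>

definition next_index :: "nat \<Rightarrow> nat \<Rightarrow> nat" where
  "next_index N i = i mod N + 1"

definition cyclic_exact_partition ::
    "'a topology \<Rightarrow> ('a \<Rightarrow> 'a) \<Rightarrow> nat \<Rightarrow> (nat \<Rightarrow> 'a set) \<Rightarrow> bool" where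
  "cyclic_exact_partition T \<sigma> N Xs \<longleftrightarrow>
     1 \<le> N \<and>
     disjoint_family_on Xs {1..N} \<and> (\<Union>i\<in>{1..N}. Xs i) = topspace T \<and>
     (\<forall>i\<in>{1..N}. Xs i \<noteq> {} \<and> openin T (Xs i) \<and> closedin T (Xs i) \<and>
        \<sigma> ` Xs i = Xs (next_index N i) \<and>
        topologically_exact (subtopology T (Xs i)) (\<sigma> ^^ N))"

definition scaled_probability_measure ::
    "'a topology \<Rightarrow> ('a \<Rightarrow> 'a) \<Rightarrow> real \<Rightarrow> 'a measure \<Rightarrow> bool" where
  "scaled_probability_measure T \<sigma> s \<mu> \<longleftrightarrow>
     sets \<mu> = sigma_sets (topspace T) {U. openin T U} \<and> prob_space \<mu> \<and> 0 < s \<and>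
     (\<forall>E\<in>sets \<mu>. inj_on \<sigma> E \<longrightarrow> measure \<mu> (\<sigma> ` E) = s * measure \<mu> E)"

section \<open>Ordered abelian groups with a distinguished element\<close>

text \<open>The order is given by its positive cone: \<open>x \<le> y\<close> iff \<open>y - x\<close> is in \<open>nonneg\<close>. The groups are
  abelian but written multiplicatively, following HOL-Algebra. The field \<open>ounit\<close> is the
  distinguished order unit.\<close>

record 'a ordered_group = "'a monoid" +
  nonneg :: "'a set"
  ounit :: 'a

definition ole :: "('a, 'b) ordered_group_scheme \<Rightarrow> 'a \<Rightarrow> 'a \<Rightarrow> bool" where
  "ole G x y \<longleftrightarrow> y \<otimes>\<^bsub>G\<^esub> inv\<^bsub>G\<^esub> x \<in> nonneg G"

definition ordered_abelian_group :: "('a, 'b) ordered_group_scheme \<Rightarrow> bool" where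
  "ordered_abelian_group G \<longleftrightarrow>
     comm_group G \<and> nonneg G \<subseteq> carrier G \<and> \<one>\<^bsub>G\<^esub> \<in> nonneg G \<and>
     (\<forall>x\<in>nonneg G. \<forall>y\<in>nonneg G. x \<otimes>\<^bsub>G\<^esub> y \<in> nonneg G) \<and>
     (\<forall>x\<in>nonneg G. inv\<^bsub>G\<^esub> x \<in> nonneg G \<longrightarrow> x = \<one>\<^bsub>G\<^esub>) \<and>
     (\<forall>x\<in>carrier G. \<exists>y\<in>nonneg G. \<exists>z\<in>nonneg G. x = y \<otimes>\<^bsub>G\<^esub> inv\<^bsub>G\<^esub> z)"

definition unperforated :: "('a, 'b) ordered_group_scheme \<Rightarrow> bool" where
  "unperforated G \<longleftrightarrow>
     (\<forall>x\<in>carrier G. \<forall>k::nat. 1 \<le> k \<and> x [^]\<^bsub>G\<^esub> k \<in> nonneg G \<longrightarrow> x \<in> nonneg G)"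

definition riesz_interpolation :: "('a, 'b) ordered_group_scheme \<Rightarrow> bool" where
  "riesz_interpolation G \<longleftrightarrow>
     (\<forall>x\<in>carrier G. \<forall>x'\<in>carrier G. \<forall>y\<in>carrier G. \<forall>y'\<in>carrier G.
        ole G x y \<and> ole G x y' \<and> ole G x' y \<and> ole G x' y' \<longrightarrow>
        (\<exists>z\<in>carrier G. ole G x z \<and> ole G x' z \<and> ole G z y \<and> ole G z y'))"

definition dimension_group :: "('a, 'b) ordered_group_scheme \<Rightarrow> bool" where
  "dimension_group G \<longleftrightarrow>
     ordered_abelian_group G \<and> countable (carrier G) \<and> unperforated G \<and> riesz_interpolation G"

definition order_unit :: "('a, 'b) ordered_group_scheme \<Rightarrow> 'a \<Rightarrow> bool" where
  "order_unit G u \<longleftrightarrow> u \<in> nonneg G \<and> (\<forall>x\<in>carrier G. \<exists>k::nat. ole G x (u [^]\<^bsub>G\<^esub> k))"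

definition order_ideal :: "'a set \<Rightarrow> ('a, 'b) ordered_group_scheme \<Rightarrow> bool" where
  "order_ideal J G \<longleftrightarrow>
     subgroup J G \<and>
     (\<forall>x\<in>J. \<exists>y\<in>J \<inter> nonneg G. \<exists>z\<in>J \<inter> nonneg G. x = y \<otimes>\<^bsub>G\<^esub> inv\<^bsub>G\<^esub> z) \<and>
     (\<forall>x\<in>nonneg G. \<forall>y\<in>J. ole G x y \<longrightarrow> x \<in> J)"

definition simple_dimension_group :: "('a, 'b) ordered_group_scheme \<Rightarrow> bool" where
  "simple_dimension_group G \<longleftrightarrow>
     dimension_group G \<and> carrier G \<noteq> {\<one>\<^bsub>G\<^esub>} \<and>
     (\<forall>J. order_ideal J G \<longrightarrow> J = {\<one>\<^bsub>G\<^esub>} \<or> J = carrier G)"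

definition dimension_group_iso ::
    "('a, 'c) ordered_group_scheme \<Rightarrow> ('b, 'd) ordered_group_scheme \<Rightarrow> ('a \<Rightarrow> 'b) \<Rightarrow> bool" where
  "dimension_group_iso G H h \<longleftrightarrow>
     h \<in> iso G H \<and> (\<forall>x\<in>carrier G. \<forall>y\<in>carrier G. ole G x y \<longleftrightarrow> ole H (h x) (h y))"

definition unital_dimension_group_iso ::
    "('a, 'c) ordered_group_scheme \<Rightarrow> ('b, 'd) ordered_group_scheme \<Rightarrow> ('a \<Rightarrow> 'b) \<Rightarrow> bool" where
  "unital_dimension_group_iso G H h \<longleftrightarrow> dimension_group_iso G H h \<and> h (ounit G) = ounit H"

definition ordered_direct_sum ::
    "'i set \<Rightarrow> ('i \<Rightarrow> ('a, 'b) ordered_group_scheme) \<Rightarrow> ('i \<Rightarrow> 'a) ordered_group" where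
  "ordered_direct_sum I G =
     \<lparr>carrier = carrier (sum_group I G),
      monoid.mult = monoid.mult (sum_group I G),
      one = one (sum_group I G),
      nonneg = {x \<in> carrier (sum_group I G). \<forall>i\<in>I. x i \<in> nonneg (G i)},
      ounit = (\<lambda>i\<in>I. ounit (G i))\<rparr>"

definition is_state :: "('a, 'b) ordered_group_scheme \<Rightarrow> ('a \<Rightarrow> real) \<Rightarrow> bool" where
  "is_state G \<omega> \<longleftrightarrow>
     (\<forall>x\<in>carrier G. \<forall>y\<in>carrier G. \<omega> (x \<otimes>\<^bsub>G\<^esub> y) = \<omega> x + \<omega> y) \<and>
     (\<forall>x\<in>nonneg G. 0 \<le> \<omega> x) \<and> \<omega> (ounit G) = 1"

definition has_strict_order :: "('a, 'b) ordered_group_scheme \<Rightarrow> ('a \<Rightarrow> real) \<Rightarrow> bool" where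
  "has_strict_order G \<omega> \<longleftrightarrow>
     (\<forall>x\<in>carrier G. \<forall>y\<in>carrier G. ole G x y \<longleftrightarrow> \<omega> x < \<omega> y \<or> x = y)"

definition state_scaled_by ::
    "('a, 'b) ordered_group_scheme \<Rightarrow> ('a \<Rightarrow> 'a) \<Rightarrow> real \<Rightarrow> ('a \<Rightarrow> real) \<Rightarrow> bool" where
  "state_scaled_by G \<Phi> s \<omega> \<longleftrightarrow> (\<forall>x\<in>carrier G. \<omega> (\<Phi> x) = s * \<omega> x)"

section \<open>The dimension group of a piecewise homeomorphism\<close>

text \<open>A map on a space \<open>Y\<close> is given by the topology \<open>T\<close> of \<open>Y\<close> and a function \<open>\<rho>\<close> on the ambient
  type. Elements of \<open>C(Y, \<int>)\<close> are extended by \<open>0\<close> outside \<open>Y\<close>.\<close>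

definition C_int :: "'a topology \<Rightarrow> ('a \<Rightarrow> int) set" where
  "C_int T = {f. continuous_map T (discrete_topology UNIV) f \<and> (\<forall>x. x \<notin> topspace T \<longrightarrow> f x = 0)}"

text \<open>For a piecewise homeomorphism all these sums are finite.\<close>

definition transfer :: "'a topology \<Rightarrow> ('a \<Rightarrow> 'a) \<Rightarrow> ('a \<Rightarrow> int) \<Rightarrow> ('a \<Rightarrow> int)" where
  "transfer T \<rho> f x = (\<Sum>y\<in>{y \<in> topspace T. \<rho> y = x}. f y)"

definition eventually_equal ::
    "'a topology \<Rightarrow> ('a \<Rightarrow> 'a) \<Rightarrow> (('a \<Rightarrow> int) \<times> ('a \<Rightarrow> int)) set" where
  "eventually_equal T \<rho> =
     {(f, g). f \<in> C_int T \<and> g \<in> C_int T \<and> (\<exists>k. (transfer T \<rho> ^^ k) f = (transfer T \<rho> ^^ k) g)}"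

definition cls :: "'a topology \<Rightarrow> ('a \<Rightarrow> 'a) \<Rightarrow> ('a \<Rightarrow> int) \<Rightarrow> ('a \<Rightarrow> int) set" where
  "cls T \<rho> f = eventually_equal T \<rho> `` {f}"

definition G_group :: "'a topology \<Rightarrow> ('a \<Rightarrow> 'a) \<Rightarrow> ('a \<Rightarrow> int) set ordered_group" where
  "G_group T \<rho> =
     \<lparr>carrier = C_int T // eventually_equal T \<rho>,
      monoid.mult = (\<lambda>c d. \<Union>f\<in>c. \<Union>g\<in>d. cls T \<rho> (\<lambda>x. f x + g x)),
      one = cls T \<rho> (\<lambda>x. 0),
      nonneg = {cls T \<rho> f |f. f \<in> C_int T \<and> (\<exists>k. \<forall>x. 0 \<le> (transfer T \<rho> ^^ k) f x)},
      ounit = cls T \<rho> (indicator (topspace T))\<rparr>"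

text \<open>The class of \<open>transfer T \<rho> f\<close> does not depend on the representative \<open>f\<close>.\<close>

definition transfer_star ::
    "'a topology \<Rightarrow> ('a \<Rightarrow> 'a) \<Rightarrow> ('a \<Rightarrow> int) set \<Rightarrow> ('a \<Rightarrow> int) set" where
  "transfer_star T \<rho> c = the_elem ((\<lambda>f. cls T \<rho> (transfer T \<rho> f)) ` c)"

definition supp :: "'a topology \<Rightarrow> ('a \<Rightarrow> int) \<Rightarrow> 'a set" where
  "supp T f = T closure_of {x \<in> topspace T. f x \<noteq> 0}"

definition times_chi :: "('a \<Rightarrow> int) \<Rightarrow> 'a set \<Rightarrow> ('a \<Rightarrow> int)" where
  "times_chi f A = (\<lambda>x. f x * indicator A x)"

text \<open>The subgroup of classes represented by functions supported in \<open>A\<close>, with the inherited order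
  and the class of the characteristic function of \<open>A\<close> as its distinguished order unit.\<close>

definition G_part :: "'a topology \<Rightarrow> ('a \<Rightarrow> 'a) \<Rightarrow> 'a set \<Rightarrow> ('a \<Rightarrow> int) set ordered_group" where
  "G_part T \<rho> A =
     (let S = {cls T \<rho> f |f. f \<in> C_int T \<and> supp T f \<subseteq> A}
      in (G_group T \<rho>)\<lparr>carrier := S, nonneg := nonneg (G_group T \<rho>) \<inter> S,
                        ounit := cls T \<rho> (indicator A)\<rparr>)"

definition DG :: "(real \<Rightarrow> real) \<Rightarrow> nat \<Rightarrow> (nat \<Rightarrow> real) \<Rightarrow> (point \<Rightarrow> point) \<Rightarrow>
    (point \<Rightarrow> int) set ordered_group" where
  "DG \<tau> n a \<sigma> = G_group (X_top \<tau> n a) \<sigma>"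

section \<open>Entropy\<close>

text \<open>Topological entropy of a continuous self-map of a compact space, defined through open covers
  (Adler, Konheim and McAndrew).\<close>

definition open_cover :: "'a topology \<Rightarrow> 'a set set \<Rightarrow> bool" where
  "open_cover T \<U> \<longleftrightarrow> (\<forall>U\<in>\<U>. openin T U) \<and> \<Union>\<U> = topspace T"

definition cover_number :: "'a topology \<Rightarrow> 'a set set \<Rightarrow> nat" where
  "cover_number T \<U> = (LEAST k. \<exists>\<V>\<subseteq>\<U>. finite \<V> \<and> card \<V> = k \<and> \<Union>\<V> = topspace T)"

definition iterated_cover :: "'a topology \<Rightarrow> ('a \<Rightarrow> 'a) \<Rightarrow> 'a set set \<Rightarrow> nat \<Rightarrow> 'a set set" where
  "iterated_cover T g \<U> m =
     {{x \<in> topspace T. \<forall>k<m. (g ^^ k) x \<in> W k} |W. \<forall>k<m. W k \<in> \<U>}"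

definition topological_entropy :: "'a topology \<Rightarrow> ('a \<Rightarrow> 'a) \<Rightarrow> ereal" where
  "topological_entropy T g =
     (SUP \<U>\<in>{\<U>. open_cover T \<U>}.
        ereal (lim (\<lambda>m. ln (real (cover_number T (iterated_cover T g \<U> m))) / real m)))"

definition itinerary_space :: "(real \<Rightarrow> real) \<Rightarrow> nat \<Rightarrow> (nat \<Rightarrow> real) \<Rightarrow> (nat \<Rightarrow> nat) set" where
  "itinerary_space \<tau> n a =
     {s. (\<forall>i. s i \<in> {1..n}) \<and>
         (\<forall>k. (\<Inter>i\<in>{0..k}. {x \<in> {0..1}. (\<tau> ^^ i) x \<in> {a (s i - 1)<..<a (s i)}}) \<noteq> {})}"

definition itinerary_top :: "(real \<Rightarrow> real) \<Rightarrow> nat \<Rightarrow> (nat \<Rightarrow> real) \<Rightarrow> (nat \<Rightarrow> nat) topology" where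
  "itinerary_top \<tau> n a =
     subtopology (product_topology (\<lambda>_. discrete_topology {1..n}) UNIV) (itinerary_space \<tau> n a)"

definition shift :: "(nat \<Rightarrow> 'a) \<Rightarrow> (nat \<Rightarrow> 'a)" where
  "shift s = (\<lambda>i. s (Suc i))"

definition entropy :: "(real \<Rightarrow> real) \<Rightarrow> nat \<Rightarrow> (nat \<Rightarrow> real) \<Rightarrow> ereal" where
  "entropy \<tau> n a =
     (if continuous_on {0..1} \<tau> then topological_entropy (top_of_set {0..1}) \<tau>
      else topological_entropy (itinerary_top \<tau> n a) shift)"

end

theory Submission
  imports Defs
begin

text \<open>Locally constant functions on \<open>X\<close> are step functions, and their variation is the sum of their
  jumps across the split points. Split points outside the partition have only split points as
  images, so \<open>\<L>\<^sup>k\<close> increases the variation at most to \<open>(1 + k) var f + C \<mu>(\<bar>f\<bar>)\<close>, whereas \<open>\<mu>\<close>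
  grows by the factor \<open>s\<^sup>k\<close>; here \<open>s > 1\<close> because \<open>\<sigma>\<close> is not injective. For a large multiple
  \<open>k\<close> of \<open>N\<close> this makes a cone of functions of small variation on \<open>X\<^sub>i\<close> invariant, and exactness
  turns it into a strict contraction. Hence \<open>\<mu>(f) > 0\<close> implies \<open>\<L>\<^sup>k f \<ge> 0\<close> for large \<open>k\<close> whenever
  \<open>f\<close> lives on \<open>X\<^sub>i\<close>: the order of \<open>G\<^sub>i\<close> is the strict order given by \<open>\<mu>\<close>, which yields
  simplicity and the uniqueness of the states. For the entropy, a set of points with a common
  itinerary of length \<open>k\<close> has measure at most \<open>s\<^sup>-\<^sup>k\<close>, and conversely \<open>\<L>\<^sup>j 1\<close> is bounded
  by a multiple of \<open>s\<^sup>j\<close>, so that the number of distinct itineraries of length \<open>k\<close> grows at most like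
  \<open>k s\<^sup>k\<close>.\<close>

section \<open>Totally disconnected spaces with countably many gaps\<close>

text \<open>Nothing is assumed about derivatives of the branches; \<mu> takes the place of Lebesgue
  measure and is free of distortion. The obstacle lies over the partition points: there a preimage
  of a gap can lack its partner, and a jump comes from a single value of the function instead of a
  jump. Such values are bounded by a local variation plus a local average, which is usable because
  exactness gives \<mu> full support. The cone consists of real functions although the group is made
  of integer ones, since a third of the mean is split off at each stage. From the order on
  \<open>X\<close> only the nested clopen sets above the gaps are used. That they separate points
  requires dense split points, which exactness forces: an interval inside \<open>I0\<close> would
  spread over all of \<open>X\<close> without reaching \<open>I1\<close>. Both definitions of
  entropy concern equivariant images of \<open>X\<close> with covers whose members see at most two
  itineraries of length \<open>k\<close>; the factor two costs \<open>ln 2 / k\<close> in the growth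
  rate and disappears in the limit.\<close>

lemma factor_through:
  assumes "\<And>p q. \<lbrakk>p \<in> A; q \<in> A; g p = g q\<rbrakk> \<Longrightarrow> f p = f q"
  obtains h where "\<And>p. p \<in> A \<Longrightarrow> f p = h (g p)"
proof (rule that)
  fix p assume p: "p \<in> A"
  let ?q = "SOME q. q \<in> A \<and> g q = g p"
  have "?q \<in> A \<and> g ?q = g p" by (rule someI[of _ p]) (use p in auto)
  then show "f p = (\<lambda>c. f (SOME q. q \<in> A \<and> g q = c)) (g p)" using assms p by metis
qed

text \<open>For a gap \<open>t\<close> the points \<open>(t, False)\<close> and \<open>(t, True)\<close> are its lower and upper side, and \<open>H t\<close>
  stands for the set of points above the gap. The order itself is not needed, only that the sets
  \<open>H t\<close> are nested and generate the topology.\<close>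

locale gap_space =
  fixes T :: "('b \<times> bool) topology" and \<Gamma> :: "'b set" and H :: "'b \<Rightarrow> ('b \<times> bool) set"
  assumes compact: "compact_space T"
    and countable_gaps: "countable \<Gamma>"
    and clopen_H: "t \<in> \<Gamma> \<Longrightarrow> openin T (H t) \<and> closedin T (H t)"
    and lower_mem: "t \<in> \<Gamma> \<Longrightarrow> (t, False) \<in> topspace T - H t"
    and upper_mem: "t \<in> \<Gamma> \<Longrightarrow> (t, True) \<in> H t"
    and adjacent: "\<lbrakk>t \<in> \<Gamma>; u \<in> \<Gamma>; t \<noteq> u\<rbrakk> \<Longrightarrow> (t, False) \<in> H u \<longleftrightarrow> (t, True) \<in> H u"
    and nested: "\<lbrakk>t \<in> \<Gamma>; u \<in> \<Gamma>\<rbrakk> \<Longrightarrow> H t \<subseteq> H u \<or> H u \<subseteq> H t"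
    and separates: "\<lbrakk>p \<in> topspace T; q \<in> topspace T; p \<noteq> q\<rbrakk> \<Longrightarrow> \<exists>t\<in>\<Gamma>. p \<in> H t \<longleftrightarrow> q \<notin> H t"
    and base: "\<lbrakk>openin T U; p \<in> U\<rbrakk> \<Longrightarrow>
      \<exists>D. finite D \<and> D \<subseteq> \<Gamma> \<and> (\<forall>q\<in>topspace T. (\<forall>t\<in>D. p \<in> H t \<longleftrightarrow> q \<in> H t) \<longrightarrow> q \<in> U)"
begin

text \<open>This is the address of \<open>p\<close> relative to \<open>D\<close>. Nestedness makes
  the addresses a chain, so they order the cells although no order on points is assumed.\<close>

definition below :: "'b set \<Rightarrow> 'b \<times> bool \<Rightarrow> 'b set" where
  "below D p = {t \<in> D. p \<in> H t}"

definition cell :: "'b set \<Rightarrow> 'b \<times> bool \<Rightarrow> ('b \<times> bool) set" where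
  "cell D p = {q \<in> topspace T. below D q = below D p}"

definition step :: "'b set \<Rightarrow> ('b \<times> bool \<Rightarrow> 'c) \<Rightarrow> bool" where
  "step D f \<longleftrightarrow> (\<forall>p\<in>topspace T. \<forall>q\<in>topspace T. below D p = below D q \<longrightarrow> f p = f q)"

text \<open>Locally constant functions. The explicit finite set of gaps is what the variation
  estimates use; that continuity into a discrete space provides it is a consequence of
  compactness.\<close>

definition lc :: "('b \<times> bool \<Rightarrow> 'c) \<Rightarrow> bool" where
  "lc f \<longleftrightarrow> (\<exists>D. finite D \<and> D \<subseteq> \<Gamma> \<and> step D f)"

definition jumps :: "('b \<times> bool \<Rightarrow> 'c) \<Rightarrow> 'b set" where
  "jumps f = {t \<in> \<Gamma>. f (t, True) \<noteq> f (t, False)}"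

definition jump :: "('b \<times> bool \<Rightarrow> real) \<Rightarrow> 'b \<Rightarrow> real" where
  "jump f t = \<bar>f (t, True) - f (t, False)\<bar>"

text \<open>A jump is charged to the lower side of its gap, so disjoint sets \<open>B\<close> share
  no jump and their variations add up to at most \<open>var f\<close>.\<close>

definition var_on :: "('b \<times> bool) set \<Rightarrow> ('b \<times> bool \<Rightarrow> real) \<Rightarrow> real" where
  "var_on B f = (\<Sum>t\<in>{t \<in> jumps f. (t, False) \<in> B}. jump f t)"

definition var :: "('b \<times> bool \<Rightarrow> real) \<Rightarrow> real" where
  "var f = sum (jump f) (jumps f)"

section \<open>Addresses and step functions\<close>

lemma upper_in_space: "t \<in> \<Gamma> \<Longrightarrow> (t, True) \<in> topspace T"
  using clopen_H openin_subset upper_mem by blast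

lemma lower_in_space: "t \<in> \<Gamma> \<Longrightarrow> (t, False) \<in> topspace T"
  using lower_mem by blast

lemma below_eq_iff: "below D p = below D q \<longleftrightarrow> (\<forall>t\<in>D. p \<in> H t \<longleftrightarrow> q \<in> H t)"
  by (auto simp: below_def)

lemma below_mono: "below D p = below D q \<Longrightarrow> D' \<subseteq> D \<Longrightarrow> below D' p = below D' q"
  by (auto simp: below_eq_iff)

lemma below_chain:
  assumes "D \<subseteq> \<Gamma>" shows "below D p \<subseteq> below D q \<or> below D q \<subseteq> below D p"
proof (rule ccontr)
  assume "\<not> ?thesis"
  then obtain t u where tu: "t \<in> D" "u \<in> D" "p \<in> H t" "q \<notin> H t" "q \<in> H u" "p \<notin> H u"
    unfolding below_def by auto
  have "H t \<subseteq> H u \<or> H u \<subseteq> H t" by (rule nested) (rule subsetD[OF assms], rule tu)+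
  then show False
  proof
    assume "H t \<subseteq> H u" then show False using subsetD tu(3,6) by fast
  next
    assume "H u \<subseteq> H t" then show False using subsetD tu(4,5) by fast
  qed
qed

lemma stepD: "\<lbrakk>step D f; p \<in> topspace T; q \<in> topspace T; below D p = below D q\<rbrakk> \<Longrightarrow> f p = f q"
  unfolding step_def by blast

lemma step_mono: "step D f \<Longrightarrow> D \<subseteq> D' \<Longrightarrow> step D' f"
  unfolding step_def using below_mono by metis

lemma lcE:
  assumes "lc f" obtains D where "finite D" "D \<subseteq> \<Gamma>" "step D f"
  using assms unfolding lc_def by (elim exE conjE)

lemma lc_common:
  assumes "lc f" "lc g"
  obtains D where "finite D" "D \<subseteq> \<Gamma>" "step D f" "step D g"
proof -
  obtain D where D: "finite D" "D \<subseteq> \<Gamma>" "step D f" by (rule lcE[OF assms(1)])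
  obtain D' where D': "finite D'" "D' \<subseteq> \<Gamma>" "step D' g" by (rule lcE[OF assms(2)])
  have "finite (D \<union> D')" "D \<union> D' \<subseteq> \<Gamma>" "step (D \<union> D') f" "step (D \<union> D') g"
    using D D' step_mono[of D f "D \<union> D'"] step_mono[of D' g "D \<union> D'"] by simp_all
  then show thesis by (rule that)
qed

lemma lc_const [simp]: "lc (\<lambda>x. c)"
  unfolding lc_def step_def by (intro exI[of _ "{}"]) auto

lemma lc_compose: "lc f \<Longrightarrow> lc (\<lambda>x. h (f x))"
  unfolding lc_def step_def by metis

lemma lc_compose2: assumes "lc f" "lc g" shows "lc (\<lambda>x. h (f x) (g x))"
proof -
  obtain D where "finite D" "D \<subseteq> \<Gamma>" "step D f" "step D g" using lc_common[OF assms] .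
  then have "step D (\<lambda>x. h (f x) (g x))" unfolding step_def by metis
  then show ?thesis using \<open>finite D\<close> \<open>D \<subseteq> \<Gamma>\<close> unfolding lc_def by blast
qed

lemma lc_sum:
  assumes "finite K" "\<And>k. k \<in> K \<Longrightarrow> lc (f k)" shows "lc (\<lambda>x. \<Sum>k\<in>K. f k x)"
  using assms by (induction K rule: finite_induct) (auto intro!: lc_compose2[where h = "(+)"])

lemma finite_below_image: "finite D \<Longrightarrow> finite (below D ` A)"
  by (rule finite_subset[of _ "Pow D"]) (auto simp: below_def)

lemma finite_image_step:
  assumes "finite D" "step D f" shows "finite (f ` topspace T)"
proof -
  obtain h where h: "\<And>p. p \<in> topspace T \<Longrightarrow> f p = h (below D p)"
    by (rule factor_through[of "topspace T" "below D" f]) (auto intro: stepD[OF assms(2)])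
  then have "f ` topspace T = h ` below D ` topspace T" by (auto simp: image_iff)
  then show ?thesis using finite_below_image[OF assms(1)] by simp
qed

lemma finite_image_lc: "lc f \<Longrightarrow> finite (f ` topspace T)"
  using finite_image_step unfolding lc_def by blast

text \<open>By \<open>adjacent\<close>, the two sides of a gap outside \<open>D\<close> have the
  same address relative to \<open>D\<close>.\<close>

lemma jumps_subset: assumes "step D f" "D \<subseteq> \<Gamma>" shows "jumps f \<subseteq> D"
proof
  fix t assume t: "t \<in> jumps f"
  show "t \<in> D"
  proof (rule ccontr)
    assume "t \<notin> D"
    then have "below D (t, True) = below D (t, False)"
      using t assms adjacent unfolding below_eq_iff jumps_def by blast
    moreover have "(t, True) \<in> topspace T" "(t, False) \<in> topspace T"
      using t lower_in_space upper_in_space by (auto simp: jumps_def)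
    ultimately have "f (t, True) = f (t, False)" using assms(1) unfolding step_def by blast
    then show False using t by (simp add: jumps_def)
  qed
qed

lemma finite_jumps: assumes "lc f" shows "finite (jumps f)"
proof -
  obtain D where "finite D" "D \<subseteq> \<Gamma>" "step D f" using assms unfolding lc_def by auto
  then show ?thesis using jumps_subset[of D f] finite_subset by auto
qed

section \<open>Oscillation controlled by jumps\<close>

lemma jump_nonneg [simp]: "0 \<le> jump f t"
  by (simp add: jump_def)

lemma var_nonneg: "0 \<le> var f" "0 \<le> var_on B f"
  by (simp_all add: var_def var_on_def sum_nonneg)

text \<open>Induction on the number of gaps of \<open>D\<close> between \<open>p\<close> and
  \<open>q\<close>. Any separating gap \<open>t\<close> splits the comparison into \<open>p\<close>
  against the lower side of \<open>t\<close>, the jump at \<open>t\<close>, and the upper side of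
  \<open>t\<close> against \<open>q\<close>, with fewer gaps in both remaining pieces.\<close>

lemma step_osc_aux:
  assumes "finite D" "D \<subseteq> \<Gamma>" "step D f"
  shows "p \<in> topspace T \<Longrightarrow> q \<in> topspace T \<Longrightarrow> below D p \<subseteq> below D q \<Longrightarrow>
    \<bar>f p - f q\<bar> \<le> (\<Sum>t\<in>below D q - below D p. jump f t)"
proof (induction "card (below D q - below D p)" arbitrary: p q rule: less_induct)
  case less
  show ?case
  proof (cases "below D q = below D p")
    case True
    then have "f p = f q" using less.prems assms unfolding step_def by metis
    then show ?thesis by (simp add: True)
  next
    case False
    then obtain t where t: "t \<in> D" "q \<in> H t" "p \<notin> H t" using less.prems by (auto simp: below_def)
    have tG: "t \<in> \<Gamma>" using t assms by blast
    let ?l = "(t, False)" and ?u = "(t, True)"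
    have lu: "?l \<in> topspace T" "?u \<in> topspace T" "?l \<notin> H t" "?u \<in> H t"
      using tG lower_mem upper_mem upper_in_space by auto
    have eq: "?l \<in> H v \<longleftrightarrow> ?u \<in> H v" if "v \<in> D" "v \<noteq> t" for v
      using adjacent that tG assms by blast
    have le: "below D p \<subseteq> below D ?l" 
    proof
      fix v assume v: "v \<in> below D p"
      then have "H t \<subseteq> H v" "v \<noteq> t" using t nested[of t v] tG assms unfolding below_def by auto
      then show "v \<in> below D ?l" using eq v lu unfolding below_def by blast
    qed
    have above: "below D ?u \<subseteq> below D q"
    proof
      fix v assume v: "v \<in> below D ?u"
      show "v \<in> below D q"
      proof (cases "v = t")
        case False
        then have "?l \<in> H v" using eq v by (auto simp: below_def)
        then have "H t \<subseteq> H v" using nested[of t v] tG v assms lu by (auto simp: below_def)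
        then show ?thesis using t v by (auto simp: below_def)
      qed (use t in \<open>auto simp: below_def\<close>)
    qed
    have mid: "below D ?u = insert t (below D ?l)" "t \<notin> below D ?l"
      using eq lu t by (auto simp: below_def)
    have fin: "finite (below D z)" for z using assms(1) by (simp add: below_def)
    have c1: "card (below D ?l - below D p) < card (below D q - below D p)"
      by (rule psubset_card_mono) (use fin above mid le in auto)
    have c2: "card (below D q - below D ?u) < card (below D q - below D p)"
      by (rule psubset_card_mono) (use fin above mid le in auto)
    have split: "below D q - below D p =
        (below D ?l - below D p) \<union> ({t} \<union> (below D q - below D ?u))"
      using above mid le by auto
    have "(\<Sum>v\<in>below D q - below D p. jump f v) =
        (\<Sum>v\<in>below D ?l - below D p. jump f v) + (jump f t + (\<Sum>v\<in>below D q - below D ?u. jump f v))"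
      unfolding split using fin mid by (subst sum.union_disjoint) auto
    moreover have "\<bar>f p - f ?l\<bar> \<le> (\<Sum>v\<in>below D ?l - below D p. jump f v)"
      by (rule less.hyps) (use c1 less.prems lu le in auto)
    moreover have "\<bar>f ?u - f q\<bar> \<le> (\<Sum>v\<in>below D q - below D ?u. jump f v)"
      by (rule less.hyps) (use c2 less.prems lu above in auto)
    ultimately show ?thesis unfolding jump_def[of f t] by linarith
  qed
qed

text \<open>Gaps of \<open>D\<close> at which \<open>f\<close> does not jump contribute nothing, so
  the bound no longer mentions the set \<open>D\<close> that witnesses local constancy. The chain
  property supplies the comparability that the directed version requires.\<close>

lemma lc_osc:
  assumes "lc f" "p \<in> topspace T" "q \<in> topspace T"
  shows "\<bar>f p - f q\<bar> \<le> (\<Sum>t\<in>{t \<in> jumps f. p \<in> H t \<longleftrightarrow> q \<notin> H t}. jump f t)"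
proof -
  obtain D where D: "finite D" "D \<subseteq> \<Gamma>" "step D f" using assms unfolding lc_def by blast
  have main: "\<bar>f p - f q\<bar> \<le> (\<Sum>t\<in>{t \<in> jumps f. p \<in> H t \<longleftrightarrow> q \<notin> H t}. jump f t)"
    if "below D p \<subseteq> below D q" "p \<in> topspace T" "q \<in> topspace T" for p q
  proof -
    have "(\<Sum>t\<in>below D q - below D p. jump f t) = (\<Sum>t\<in>{t \<in> jumps f. p \<in> H t \<longleftrightarrow> q \<notin> H t}. jump f t)"
      using that jumps_subset[OF D(3,2)] D
      by (intro sum.mono_neutral_right) (auto simp: below_def jumps_def jump_def)
    then show ?thesis using step_osc_aux[OF D that(2,3,1)] by simp
  qed
  consider "below D p \<subseteq> below D q" | "below D q \<subseteq> below D p" using below_chain D by blast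
  then show ?thesis
  proof cases
    case 2
    have eq: "{t \<in> jumps f. q \<in> H t \<longleftrightarrow> p \<notin> H t} = {t \<in> jumps f. p \<in> H t \<longleftrightarrow> q \<notin> H t}" by auto
    show ?thesis using main[OF 2 assms(3,2)] unfolding eq by (simp add: abs_minus_commute)
  qed (use main assms in blast)
qed

text \<open>The points \<open>p\<close> and \<open>q\<close> agree at every gap \<open>u\<close> of
  \<open>D\<close>. Since \<open>H t\<close> and \<open>H u\<close> are comparable, the lower side
  of \<open>t\<close>, caught between them, must agree as well. Thus all the variation between two
  points of a cell is charged to that cell.\<close>

lemma separating_gap_in_cell:
  assumes "D \<subseteq> \<Gamma>" "t \<in> \<Gamma>" "below D p = below D q" "p \<notin> H t" "q \<in> H t"
  shows "(t, False) \<in> cell D p"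
proof -
  have "(t, False) \<in> H u \<longleftrightarrow> p \<in> H u" if u: "u \<in> D" for u
  proof -
    have ne: "u \<noteq> t" and pq: "p \<in> H u \<longleftrightarrow> q \<in> H u" using assms u by (auto simp: below_eq_iff)
    consider "H t \<subseteq> H u" | "H u \<subseteq> H t" using nested assms u by blast
    then show ?thesis
    proof cases
      case 1
      then show ?thesis using adjacent[of t u] upper_mem[of t] ne pq assms u by blast
    next
      case 2
      then show ?thesis using lower_mem[of t] assms by blast
    qed
  qed
  then show ?thesis using assms lower_in_space by (simp add: cell_def below_eq_iff)
qed

lemma cell_osc:
  assumes "lc f" "D \<subseteq> \<Gamma>" "p \<in> cell D r" "q \<in> cell D r"
  shows "f p \<le> f q + var_on (cell D r) f"
proof -
  have pq: "p \<in> topspace T" "q \<in> topspace T" "below D p = below D q" "below D p = below D r"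
    using assms by (auto simp: cell_def)
  then have eq: "cell D p = cell D r" "cell D q = cell D r" by (auto simp: cell_def)
  have "(t, False) \<in> cell D r" if t: "t \<in> jumps f" "p \<in> H t \<longleftrightarrow> q \<notin> H t" for t
  proof (cases "p \<in> H t")
    case True
    then show ?thesis using separating_gap_in_cell[of D t q p] t pq eq assms(2) by (simp add: jumps_def)
  next
    case False
    then show ?thesis using separating_gap_in_cell[of D t p q] t pq eq assms(2) by (simp add: jumps_def)
  qed
  then have "(\<Sum>t\<in>{t \<in> jumps f. p \<in> H t \<longleftrightarrow> q \<notin> H t}. jump f t) \<le> var_on (cell D r) f"
    unfolding var_on_def by (intro sum_mono2) (use finite_jumps[OF assms(1)] in auto)
  then show ?thesis using lc_osc[OF assms(1) pq(1,2)] by linarith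
qed

lemma sum_var_on_le:
  assumes "lc f" "finite K" "disjoint_family_on B K"
  shows "(\<Sum>k\<in>K. var_on (B k) f) \<le> var f"
proof -
  have "(\<Sum>k\<in>K. var_on (B k) f) = sum (jump f) (\<Union>k\<in>K. {t \<in> jumps f. (t, False) \<in> B k})"
    unfolding var_on_def
    by (rule sum.UNION_disjoint[symmetric])
      (use assms finite_jumps[OF assms(1)] in \<open>auto simp: disjoint_family_on_def\<close>)
  also have "\<dots> \<le> var f" unfolding var_def by (rule sum_mono2) (use finite_jumps[OF assms(1)] in auto)
  finally show ?thesis .
qed

text \<open>The values of \<open>f\<close> need not be numbers. The real indicator of the level set
  of \<open>f p\<close> jumps only where \<open>f\<close> does, and the oscillation bound applies to
  it.\<close>

lemma jump_between:
  assumes "lc f" "p \<in> topspace T" "q \<in> topspace T" "f p \<noteq> f q"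
  shows "\<exists>t\<in>jumps f. p \<in> H t \<longleftrightarrow> q \<notin> H t"
proof (rule ccontr)
  assume neg: "\<not> ?thesis"
  define g where "g = (\<lambda>x. if f x = f p then 1 else 0 :: real)"
  have "lc g" unfolding g_def by (rule lc_compose) (rule assms)
  have "jumps g \<subseteq> jumps f" by (auto simp: jumps_def g_def)
  then have empty: "{t \<in> jumps g. p \<in> H t \<longleftrightarrow> q \<notin> H t} = {}" using neg by blast
  have "\<bar>g p - g q\<bar> \<le> 0" using lc_osc[OF \<open>lc g\<close> assms(2,3)] unfolding empty by simp
  then show False using assms by (auto simp: g_def)
qed

text \<open>The sets of jumps below a point form a chain, so their cardinality already determines
  the value of \<open>f\<close>, and it is at most \<open>card (jumps f)\<close>. This turns a count
  of jumps of the label map into a count of labels.\<close>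

lemma card_image_le_jumps:
  assumes "lc f" shows "card (f ` topspace T) \<le> card (jumps f) + 1"
proof -
  let ?J = "jumps f"
  have fin: "finite ?J" using finite_jumps assms by blast
  have J: "?J \<subseteq> \<Gamma>" by (auto simp: jumps_def)
  have det: "f p = f q"
    if pq: "p \<in> topspace T" "q \<in> topspace T" and eq: "card (below ?J p) = card (below ?J q)" for p q
  proof (rule ccontr)
    assume "f p \<noteq> f q"
    then obtain t where "t \<in> ?J" "p \<in> H t \<longleftrightarrow> q \<notin> H t"
      using jump_between[OF assms pq] by auto
    then have "below ?J p \<noteq> below ?J q" by (auto simp: below_def)
    moreover have "finite (below ?J p)" "finite (below ?J q)" using fin by (auto simp: below_def)
    ultimately show False using below_chain[OF J, of p q] eq card_subset_eq by metis
  qed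
  obtain h where h: "\<And>p. p \<in> topspace T \<Longrightarrow> f p = h (card (below ?J p))"
    by (rule factor_through[of "topspace T" "\<lambda>p. card (below ?J p)" f]) (erule (2) det, iprover)
  have "card (below ?J p) \<le> card ?J" for p by (rule card_mono[OF fin]) (auto simp: below_def)
  then have "f ` topspace T \<subseteq> h ` {..card ?J}" using h by auto
  then have "card (f ` topspace T) \<le> card (h ` {..card ?J})" by (intro card_mono) auto
  also have "\<dots> \<le> card ?J + 1" using card_image_le[of "{..card ?J}" h] by simp
  finally show ?thesis .
qed

section \<open>Clopen cells and compactness\<close>

lemma openin_cell: assumes "finite D" "D \<subseteq> \<Gamma>" shows "openin T (cell D p)"
  using assms
proof (induction D rule: finite_induct)
  case empty
  then show ?case by (simp add: cell_def below_def)
next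
  case (insert t D)
  have "cell (insert t D) p = cell D p \<inter> (if p \<in> H t then H t else topspace T - H t)"
    by (auto simp: cell_def below_eq_iff)
  then show ?case using insert clopen_H[of t] by (auto intro!: openin_Int)
qed

lemma mem_cell: "p \<in> topspace T \<Longrightarrow> p \<in> cell D p"
  by (simp add: cell_def)

lemma cell_base:
  assumes "openin T U" "p \<in> U" obtains D where "finite D" "D \<subseteq> \<Gamma>" "cell D p \<subseteq> U"
proof -
  obtain D where "finite D" "D \<subseteq> \<Gamma>" "\<forall>q\<in>topspace T. (\<forall>t\<in>D. p \<in> H t \<longleftrightarrow> q \<in> H t) \<longrightarrow> q \<in> U"
    using base[OF assms] by auto
  then show thesis by (intro that[of D]) (auto simp: cell_def below_eq_iff)
qed

text \<open>Compactness in the form of a Lebesgue number: the union of the gap sets of a finite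
  subcover gives cells that refine the chosen ones, and \<open>mono\<close> passes \<open>Q\<close>
  down to them.\<close>

lemma uniform_cells:
  assumes "\<And>p. p \<in> topspace T \<Longrightarrow> \<exists>D. finite D \<and> D \<subseteq> \<Gamma> \<and> Q (cell D p)"
    and mono: "\<And>A B. Q A \<Longrightarrow> B \<subseteq> A \<Longrightarrow> Q B"
  obtains D where "finite D" "D \<subseteq> \<Gamma>" "\<And>p. p \<in> topspace T \<Longrightarrow> Q (cell D p)"
proof -
  obtain d where d: "\<And>p. p \<in> topspace T \<Longrightarrow> finite (d p) \<and> d p \<subseteq> \<Gamma> \<and> Q (cell (d p) p)"
    using assms(1) by metis
  let ?\<U> = "(\<lambda>p. cell (d p) p) ` topspace T"
  have "\<forall>U\<in>?\<U>. openin T U" "topspace T \<subseteq> \<Union>?\<U>"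
    using d openin_cell mem_cell by auto
  then obtain \<F> where \<F>: "finite \<F>" "\<F> \<subseteq> ?\<U>" "topspace T \<subseteq> \<Union>\<F>"
    using compact[unfolded compact_space_alt, rule_format, of ?\<U>] by auto
  obtain S where S: "finite S" "S \<subseteq> topspace T" "\<F> = (\<lambda>p. cell (d p) p) ` S"
    using finite_subset_image[OF \<F>(1,2)] by auto
  then have cover: "topspace T \<subseteq> (\<Union>p\<in>S. cell (d p) p)" using \<F> by simp
  show thesis
  proof (rule that[of "\<Union>p\<in>S. d p"])
    show "finite (\<Union>p\<in>S. d p)" "(\<Union>p\<in>S. d p) \<subseteq> \<Gamma>" using S d by auto
    fix p assume p: "p \<in> topspace T"
    then obtain z where z: "z \<in> S" "p \<in> cell (d z) z" using cover by auto
    have "cell (\<Union>p\<in>S. d p) p \<subseteq> cell (d z) z"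
      using z by (auto simp: cell_def below_eq_iff)
    moreover have "Q (cell (d z) z)" using d[of z] z S by auto
    ultimately show "Q (cell (\<Union>p\<in>S. d p) p)" by (rule mono[rotated])
  qed
qed

text \<open>For the converse, every point has a cell inside its level set, and
  \<open>uniform_cells\<close> makes one finite set of gaps serve all points.\<close>

lemma lc_iff_continuous: "lc f \<longleftrightarrow> continuous_map T (discrete_topology UNIV) f"
proof
  assume "lc f"
  then obtain D where D: "finite D" "D \<subseteq> \<Gamma>" "step D f" unfolding lc_def by blast
  show "continuous_map T (discrete_topology UNIV) f"
    unfolding continuous_map_def
  proof (intro conjI allI impI)
    fix V
    show "openin T {x \<in> topspace T. f x \<in> V}"
    proof (subst openin_subopen, intro ballI)
      fix p assume "p \<in> {x \<in> topspace T. f x \<in> V}"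
      then have p: "p \<in> topspace T" "f p \<in> V" by auto
      have "cell D p \<subseteq> {x \<in> topspace T. f x \<in> V}"
      proof
        fix q assume "q \<in> cell D p"
        then have q: "q \<in> topspace T" "below D q = below D p" by (auto simp: cell_def)
        then show "q \<in> {x \<in> topspace T. f x \<in> V}" using stepD[OF D(3) q(1) p(1) q(2)] p by simp
      qed
      then show "\<exists>W. openin T W \<and> p \<in> W \<and> W \<subseteq> {x \<in> topspace T. f x \<in> V}"
        using openin_cell[OF D(1,2)] mem_cell[OF p(1)] by (intro exI[of _ "cell D p"]) simp
    qed
  qed auto
next
  assume cont: "continuous_map T (discrete_topology UNIV) f"
  have "\<exists>D. finite D \<and> D \<subseteq> \<Gamma> \<and> (\<exists>c. cell D p \<subseteq> {q. f q = c})" if p: "p \<in> topspace T" for p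
  proof -
    have "openin T {q \<in> topspace T. f q \<in> {f p}}"
      by (rule openin_continuous_map_preimage[OF cont]) simp
    then obtain D where "finite D" "D \<subseteq> \<Gamma>" "cell D p \<subseteq> {q \<in> topspace T. f q \<in> {f p}}"
      by (rule cell_base[of _ p]) (use p in auto)
    then show ?thesis by (intro exI[of _ D]) auto
  qed
  moreover have "\<exists>c. B \<subseteq> {q. f q = c}" if "\<exists>c. A \<subseteq> {q. f q = c}" "B \<subseteq> A" for A B
    using that by (elim exE) (rule exI, erule (1) subset_trans[rotated])
  ultimately obtain D where D: "finite D" "D \<subseteq> \<Gamma>"
      "\<And>p. p \<in> topspace T \<Longrightarrow> \<exists>c. cell D p \<subseteq> {q. f q = c}"
    by (rule uniform_cells[of "\<lambda>A. \<exists>c. A \<subseteq> {q. f q = c}"]) iprover+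
  have "step D f"
    unfolding step_def
  proof (intro ballI impI)
    fix p q assume "p \<in> topspace T" "q \<in> topspace T" "below D p = below D q"
    moreover from this obtain c where "cell D p \<subseteq> {q. f q = c}" using D by blast
    ultimately show "f p = f q" unfolding cell_def by auto
  qed
  then show "lc f" using D unfolding lc_def by blast
qed

lemma lc_indicator:
  assumes "openin T C" "closedin T C" shows "lc (indicator C :: _ \<Rightarrow> 'c::zero_neq_one)"
proof -
  have "openin T {x \<in> topspace T. indicator C x \<in> V}" for V :: "'c set"
  proof -
    have "{x \<in> topspace T. indicator C x \<in> V} =
        (if 1 \<in> V then C else {}) \<union> (if 0 \<in> V then topspace T - C else {})"
      using openin_subset[OF assms(1)] by (auto simp: indicator_def)
    moreover have "openin T (if 1 \<in> V then C else {})" "openin T (if 0 \<in> V then topspace T - C else {})"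
      using assms by auto
    ultimately show ?thesis by (metis openin_Un)
  qed
  then show ?thesis unfolding lc_iff_continuous by (simp add: continuous_map_def)
qed

lemma clopen_cell:
  assumes "finite D" "D \<subseteq> \<Gamma>" shows "openin T (cell D p) \<and> closedin T (cell D p)"
proof -
  have "topspace T - cell D p = (\<Union>q\<in>topspace T - cell D p. cell D q)"
    by (auto simp: cell_def)
  moreover have "openin T (\<Union>q\<in>topspace T - cell D p. cell D q)"
    using openin_cell[OF assms] by blast
  moreover have "cell D p \<subseteq> topspace T" by (auto simp: cell_def)
  ultimately show ?thesis using openin_cell[OF assms] by (simp add: closedin_def)
qed

lemma Hausdorff: "Hausdorff_space T"
  unfolding Hausdorff_space_def
proof (intro allI impI)
  fix p q assume pq: "p \<in> topspace T \<and> q \<in> topspace T \<and> p \<noteq> q"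
  then obtain t where t: "t \<in> \<Gamma>" "p \<in> H t \<longleftrightarrow> q \<notin> H t" using separates by blast
  have "openin T (H t)" "openin T (topspace T - H t)" "disjnt (H t) (topspace T - H t)"
    "disjnt (topspace T - H t) (H t)"
    using clopen_H[OF t(1)] by (auto simp: disjnt_def)
  then show "\<exists>U V. openin T U \<and> openin T V \<and> p \<in> U \<and> q \<in> V \<and> disjnt U V"
    using t pq by (metis DiffI)
qed

text \<open>An integer function is coded by its finite set of gaps and a list pairing addresses with
  values; there are countably many codes because \<Gamma> is countable. The countability of the
  dimension groups rests on this.\<close>

lemma countable_lc_int:
  "countable {f :: _ \<Rightarrow> int. lc f \<and> (\<forall>x. x \<notin> topspace T \<longrightarrow> f x = 0)}"
proof -
  define \<Phi> where "\<Phi> = (\<lambda>(D, l :: ('b set \<times> int) list) x.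
      if x \<in> topspace T then (case map_of l (below D x) of None \<Rightarrow> 0 | Some c \<Rightarrow> c) else 0)"
  let ?S = "{D. finite D \<and> D \<subseteq> \<Gamma>}"
  have cS: "countable ?S" using countable_Collect_finite_subset[OF countable_gaps] by (simp add: conj_commute)
  have "countable (?S \<times> lists (?S \<times> (UNIV :: int set)))"
    using cS by (intro countable_SIGMA countable_lists) auto
  moreover have "{f :: _ \<Rightarrow> int. lc f \<and> (\<forall>x. x \<notin> topspace T \<longrightarrow> f x = 0)} \<subseteq> \<Phi> ` (?S \<times> lists (?S \<times> UNIV))"
  proof (clarify)
    fix f :: "_ \<Rightarrow> int" assume f: "lc f" "\<forall>x. x \<notin> topspace T \<longrightarrow> f x = 0"
    obtain D where D: "finite D" "D \<subseteq> \<Gamma>" "step D f" using f unfolding lc_def by blast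
    obtain ls where ls: "set ls = below D ` topspace T" "distinct ls" using finite_distinct_list[OF finite_below_image[OF D(1), of "topspace T"]] by auto
    obtain v where v: "\<And>p. p \<in> topspace T \<Longrightarrow> f p = v (below D p)"
      by (rule factor_through[of "topspace T" "below D" f]) (auto intro: stepD[OF D(3)])
    have "f = \<Phi> (D, map (\<lambda>l. (l, v l)) ls)"
      using f ls v by (auto simp: \<Phi>_def fun_eq_iff map_of_map_restrict)
    moreover have "(D, map (\<lambda>l. (l, v l)) ls) \<in> ?S \<times> lists (?S \<times> UNIV)"
      using D ls finite_subset[of _ D] by (auto simp: below_def) 
    ultimately show "f \<in> \<Phi> ` (?S \<times> lists (?S \<times> UNIV))" by blast
  qed
  ultimately show ?thesis by (meson countable_image countable_subset)
qed

end

section \<open>Transfer of locally constant functions\<close>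

lemma sum_fibres_le:
  fixes F :: "'a \<Rightarrow> real"
  assumes "finite A" "finite U" "\<And>a. a \<in> A \<Longrightarrow> 0 \<le> F a"
  shows "(\<Sum>u\<in>U. \<Sum>a\<in>{a \<in> A. g a = u}. F a) \<le> sum F A"
proof -
  have "(\<Sum>u\<in>U. \<Sum>a\<in>{a \<in> A. g a = u}. F a) = sum F (\<Union>u\<in>U. {a \<in> A. g a = u})"
    by (rule sum.UNION_disjoint[symmetric]) (use assms in auto)
  also have "\<dots> \<le> sum F A" by (rule sum_mono2) (use assms in auto)
  finally show ?thesis .
qed

text \<open>\<open>P\<close> consists of the gaps across which \<open>\<sigma>\<close> may change its branch, and \<open>E\<close> contains the
  exceptional points, such as one-sided limits at the partition points, that are mapped to a side
  of a gap without being a side of a gap outside \<open>P\<close>.\<close>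

locale gap_map = gap_space T \<Gamma> H
  for T :: "('b \<times> bool) topology" and \<Gamma> :: "'b set" and H :: "'b \<Rightarrow> ('b \<times> bool) set" +
  fixes \<sigma> :: "'b \<times> bool \<Rightarrow> 'b \<times> bool" and P :: "'b set" and E :: "('b \<times> bool) set"
  assumes finite_P: "finite P" and P_gaps: "P \<subseteq> \<Gamma>"
    and cont: "continuous_map T T \<sigma>"
    and opn: "open_map T T \<sigma>"
    and inj_cell: "\<lbrakk>p \<in> topspace T; q \<in> topspace T; below P p = below P q; \<sigma> p = \<sigma> q\<rbrakk> \<Longrightarrow> p = q"
    and gap_to_gap: "\<lbrakk>t \<in> \<Gamma>; t \<notin> P\<rbrakk> \<Longrightarrow>
      fst (\<sigma> (t, True)) = fst (\<sigma> (t, False)) \<and> fst (\<sigma> (t, False)) \<in> \<Gamma>"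
    and finite_E: "finite E" and E_space: "E \<subseteq> topspace T"
    and gap_preimage: "\<lbrakk>p \<in> topspace T; fst (\<sigma> p) \<in> \<Gamma>\<rbrakk> \<Longrightarrow> p \<in> E \<or> fst p \<in> \<Gamma> - P"
begin

definition pull :: "nat \<Rightarrow> 'b \<times> bool \<Rightarrow> ('b \<times> bool) set" where
  "pull m x = {y \<in> topspace T. (\<sigma> ^^ m) y = x}"

text \<open>The \<open>m\<close>-th power of the transfer operator as a single sum over a fibre,
  with values in any additive monoid: the cone argument needs real functions, the dimension group
  integer ones.\<close>

definition tr :: "nat \<Rightarrow> ('b \<times> bool \<Rightarrow> 'c::comm_monoid_add) \<Rightarrow> 'b \<times> bool \<Rightarrow> 'c" where
  "tr m f x = sum f (pull m x)"

text \<open>With \<open>D = P\<close> this is the itinerary of length \<open>m\<close> through the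
  branches; larger \<open>D\<close> are needed to resolve an arbitrary open cover.\<close>

definition lab :: "'b set \<Rightarrow> nat \<Rightarrow> 'b \<times> bool \<Rightarrow> 'b set list" where
  "lab D m p = map (\<lambda>j. below D ((\<sigma> ^^ j) p)) [0..<m]"

section \<open>Iterated fibres and iterated transfer\<close>

lemma map_space: "p \<in> topspace T \<Longrightarrow> \<sigma> p \<in> topspace T"
  using cont unfolding continuous_map_def by auto

lemma funpow_space: "p \<in> topspace T \<Longrightarrow> (\<sigma> ^^ m) p \<in> topspace T"
  by (induction m) (auto intro: map_space)

lemma continuous_funpow: "continuous_map T T (\<sigma> ^^ m)"
proof (induction m)
  case (Suc m)
  then show ?case using continuous_map_compose[OF Suc cont] by (simp add: o_def)
qed (simp add: continuous_map_id[unfolded id_def] id_def)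

lemma pull_add: "pull (m + k) x = (\<Union>z\<in>pull m x. pull k z)"
  unfolding pull_def by (auto simp: funpow_add funpow_space)

lemma pull_0: "pull 0 x = (if x \<in> topspace T then {x} else {})"
  by (auto simp: pull_def)

lemma pull_disjoint: "z \<noteq> w \<Longrightarrow> pull k z \<inter> pull k w = {}"
  by (auto simp: pull_def)

text \<open>Distinct points of a fibre have distinct addresses relative to \<open>P\<close>, and
  addresses are subsets of \<open>P\<close>. The crude bound suffices, because its powers are only
  used over boundedly many steps.\<close>

lemma finite_pull1: "finite (pull 1 x)" and card_pull1: "card (pull 1 x) \<le> 2 ^ card P"
proof -
  have inj: "inj_on (below P) (pull 1 x)"
  proof (rule inj_onI)
    fix p q assume "p \<in> pull 1 x" "q \<in> pull 1 x" and eq: "below P p = below P q"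
    then have "p \<in> topspace T" "q \<in> topspace T" "\<sigma> p = \<sigma> q" by (simp_all add: pull_def)
    then show "p = q" using inj_cell eq by blast
  qed
  have sub: "below P ` pull 1 x \<subseteq> Pow P" by (auto simp: below_def)
  have "finite (below P ` pull 1 x)" by (rule finite_below_image[OF finite_P])
  then show "finite (pull 1 x)" using finite_image_iff[OF inj] by blast
  have "card (below P ` pull 1 x) \<le> card (Pow P)" by (rule card_mono) (use sub finite_P in auto)
  then show "card (pull 1 x) \<le> 2 ^ card P" using card_image[OF inj] card_Pow[OF finite_P] by simp
qed

lemma finite_pull: "finite (pull m x)"
proof (induction m arbitrary: x)
  case 0 then show ?case by (simp add: pull_0)
next
  case (Suc m)
  then show ?case using pull_add[of m 1 x] finite_pull1 by simp
qed

lemma card_pull: "card (pull m x) \<le> (2 ^ card P) ^ m"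
proof (induction m arbitrary: x)
  case 0 then show ?case by (simp add: pull_0)
next
  case (Suc m)
  have "card (pull (m + 1) x) \<le> (\<Sum>z\<in>pull m x. card (pull 1 z))"
    unfolding pull_add by (rule card_UN_le[OF finite_pull])
  also have "\<dots> \<le> (\<Sum>z\<in>pull m x. 2 ^ card P)" by (intro sum_mono card_pull1)
  also have "\<dots> \<le> (2 ^ card P) ^ m * 2 ^ card P" using Suc[of x] by simp
  finally show ?case by (simp add: mult.commute)
qed

lemma tr_add: "tr (m + k) f x = tr m (tr k f) x"
  unfolding tr_def pull_add
  by (rule sum.UNION_disjoint) (auto simp: finite_pull pull_disjoint)

lemma tr_0: "x \<in> topspace T \<Longrightarrow> tr 0 f x = f x"
  by (simp add: tr_def pull_0)

lemma tr_outside: "x \<notin> topspace T \<Longrightarrow> tr m f x = 0"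
  unfolding tr_def by (rule sum.neutral) (auto simp: pull_def funpow_space)

lemma tr_cong: "(\<And>y. y \<in> topspace T \<Longrightarrow> f y = g y) \<Longrightarrow> tr m f x = tr m g x"
  unfolding tr_def by (rule sum.cong) (auto simp: pull_def)

lemma tr_plus: "tr m (\<lambda>x. f x + g x) x = tr m f x + tr m g x"
  by (simp add: tr_def sum.distrib)

lemma tr_diff: "tr m (\<lambda>x. f x - g x) x = tr m f x - (tr m g x :: real)"
  by (simp add: tr_def sum_subtractf)

lemma tr_scale: "tr m (\<lambda>x. c * f x) x = (c :: real) * tr m f x"
  by (simp add: tr_def sum_distrib_left)

lemma tr_sum: "tr m (\<lambda>x. \<Sum>k\<in>K. f k x) x = (\<Sum>k\<in>K. tr m (f k) x)"
  unfolding tr_def by (rule sum.swap)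

lemma tr_mono: "(\<And>y. y \<in> topspace T \<Longrightarrow> f y \<le> g y) \<Longrightarrow> tr m f x \<le> (tr m g x :: real)"
  unfolding tr_def by (rule sum_mono) (auto simp: pull_def)

lemma tr_nonneg: "(\<And>y. y \<in> topspace T \<Longrightarrow> 0 \<le> f y) \<Longrightarrow> 0 \<le> (tr m f x :: real)"
  unfolding tr_def by (rule sum_nonneg) (auto simp: pull_def)

lemma tr_of_int: "tr m (\<lambda>x. real_of_int (f x)) x = real_of_int (tr m f x)"
  by (simp add: tr_def)

text \<open>\<open>tr\<close> vanishes outside the space even for \<open>m = 0\<close>, which is why
  \<open>f\<close> must vanish there too.\<close>

lemma transfer_funpow:
  assumes "\<And>x. x \<notin> topspace T \<Longrightarrow> f x = 0" shows "(transfer T \<sigma> ^^ m) f = tr m f"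
proof (induction m)
  case 0 then show ?case using assms by (auto simp: fun_eq_iff tr_def pull_0)
next
  case (Suc m)
  have "(transfer T \<sigma> ^^ Suc m) f = transfer T \<sigma> (tr m f)" by (simp add: Suc)
  also have "\<dots> = tr (1 + m) f" using tr_add[of 1 m f] by (intro ext) (simp add: transfer_def tr_def pull_def)
  finally show ?case by simp
qed

lemma tr_indicator:
  assumes "C \<subseteq> topspace T" "inj_on (\<sigma> ^^ m) C"
  shows "tr m (indicator C) x = (indicator ((\<sigma> ^^ m) ` C) x :: real)"
proof -
  have "pull m x \<inter> C = {c}" if "c \<in> C" "x = (\<sigma> ^^ m) c" for c
    using that assms by (auto simp: pull_def inj_on_def)
  moreover have "pull m x \<inter> C = {}" if "x \<notin> (\<sigma> ^^ m) ` C" using that by (auto simp: pull_def)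
  ultimately have "real (card (pull m x \<inter> C)) = indicator ((\<sigma> ^^ m) ` C) x"
    by (cases "x \<in> (\<sigma> ^^ m) ` C") auto
  then show ?thesis unfolding tr_def 
    by (simp add: indicator_def of_bool_def sum.If_cases[OF finite_pull] Int_def)
qed

section \<open>Transfer preserves local constancy\<close>

lemma clopen_image:
  assumes "openin T C" "closedin T C" shows "openin T (\<sigma> ` C)" "closedin T (\<sigma> ` C)"
  using opn continuous_imp_closed_map[OF cont compact Hausdorff] assms
  unfolding open_map_def closed_map_def by auto

text \<open>Adding \<open>P\<close> to the gaps of \<open>f\<close> makes \<sigma> injective on
  every cell. Linearity then reduces statements about one transfer step to indicators of clopen sets
  on which \<sigma> is injective.\<close>

lemma lc_decomp:
  fixes f :: "'b \<times> bool \<Rightarrow> real"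
  assumes "lc f"
  obtains L :: "'b set set" and C v where "finite L"
    "\<forall>l\<in>L. openin T (C l) \<and> closedin T (C l) \<and> inj_on \<sigma> (C l)"
    "\<forall>x\<in>topspace T. f x = (\<Sum>l\<in>L. v l * indicator (C l) x)"
proof -
  obtain D0 where D0: "finite D0" "D0 \<subseteq> \<Gamma>" "step D0 f" by (rule lcE[OF assms])
  define D where "D = D0 \<union> P"
  have D: "finite D" "D \<subseteq> \<Gamma>" "step D f" "P \<subseteq> D"
    using D0 finite_P P_gaps step_mono[OF D0(3), of D] by (auto simp: D_def)
  obtain v where v: "\<And>p. p \<in> topspace T \<Longrightarrow> f p = v (below D p)"
    by (rule factor_through[of "topspace T" "below D" f]) (auto intro: stepD[OF D(3)])
  define C where "C l = {q \<in> topspace T. below D q = l}" for l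
  have C: "C l = cell D p" if "below D p = l" "p \<in> topspace T" for l p
    using that by (auto simp: C_def cell_def)
  show thesis
  proof (rule that[of "below D ` topspace T" C v])
    show "finite (below D ` topspace T)" by (rule finite_below_image[OF D(1)])
    show "\<forall>l\<in>below D ` topspace T. openin T (C l) \<and> closedin T (C l) \<and> inj_on \<sigma> (C l)"
    proof (intro ballI conjI)
      fix l assume "l \<in> below D ` topspace T"
      then obtain p where p: "p \<in> topspace T" "below D p = l" by auto
      show "openin T (C l)" "closedin T (C l)" using clopen_cell[OF D(1,2), of p] C[OF p(2,1)] by auto
      show "inj_on \<sigma> (C l)"
      proof (rule inj_onI)
        fix y z assume yz: "y \<in> C l" "z \<in> C l" "\<sigma> y = \<sigma> z"
        then have "below D y = below D z" by (simp add: C_def)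
        then have "below P y = below P z" using D(4) by (rule below_mono)
        then show "y = z" using yz inj_cell by (simp add: C_def)
      qed
    qed
    show "\<forall>x\<in>topspace T. f x = (\<Sum>l\<in>below D ` topspace T. v l * indicator (C l) x)"
    proof
      fix x assume x: "x \<in> topspace T"
      have "(\<Sum>l\<in>below D ` topspace T. v l * indicator (C l) x) =
          (\<Sum>l\<in>below D ` topspace T. if l = below D x then v l else 0)"
        by (rule sum.cong) (use x in \<open>auto simp: C_def indicator_def\<close>)
      also have "\<dots> = v (below D x)"
        using x finite_below_image[OF D(1), of "topspace T"] by simp
      finally show "f x = (\<Sum>l\<in>below D ` topspace T. v l * indicator (C l) x)" using v x by simp
    qed
  qed
qed

lemma tr1_decomp:
  assumes "finite L" "\<forall>l\<in>L. openin T (C l) \<and> closedin T (C l) \<and> inj_on \<sigma> (C l)"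
    "\<forall>x\<in>topspace T. f x = (\<Sum>l\<in>L. v l * indicator (C l) x)"
  shows "tr 1 f x = (\<Sum>l\<in>L. v l * indicator (\<sigma> ` C l) x :: real)"
proof -
  have "tr 1 f x = tr 1 (\<lambda>x. \<Sum>l\<in>L. v l * indicator (C l) x) x" by (rule tr_cong) (use assms(3) in blast)
  also have "\<dots> = (\<Sum>l\<in>L. v l * tr 1 (indicator (C l)) x)" by (simp add: tr_sum tr_scale)
  also have "\<dots> = (\<Sum>l\<in>L. v l * indicator (\<sigma> ` C l) x)"
  proof (rule sum.cong)
    fix l assume "l \<in> L"
    then show "v l * tr 1 (indicator (C l)) x = v l * indicator (\<sigma> ` C l) x"
      using tr_indicator[of "C l" 1 x] assms(2) openin_subset[of T "C l"] by simp
  qed simp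
  finally show ?thesis .
qed

lemma lc_tr1: fixes f :: "'b \<times> bool \<Rightarrow> real" assumes "lc f" shows "lc (tr 1 f)"
proof -
  obtain L :: "'b set set" and C v where L: "finite L"
    "\<forall>l\<in>L. openin T (C l) \<and> closedin T (C l) \<and> inj_on \<sigma> (C l)"
    "\<forall>x\<in>topspace T. f x = (\<Sum>l\<in>L. v l * indicator (C l) x)"
    by (rule lc_decomp[OF assms])
  have "tr 1 f = (\<lambda>x. \<Sum>l\<in>L. v l * indicator (\<sigma> ` C l) x)"
    by (rule ext) (rule tr1_decomp[OF L])
  moreover have "lc (\<lambda>x. \<Sum>l\<in>L. v l * indicator (\<sigma> ` C l) x)"
  proof (rule lc_sum[OF L(1)])
    fix l assume "l \<in> L"
    then have "lc (indicator (\<sigma> ` C l) :: _ \<Rightarrow> real)"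
      using lc_indicator clopen_image L(2) by blast
    then show "lc (\<lambda>x. v l * indicator (\<sigma> ` C l) x)" by (rule lc_compose)
  qed
  ultimately show ?thesis by simp
qed

lemma lc_cong: assumes "lc f" "\<And>x. x \<in> topspace T \<Longrightarrow> f x = g x" shows "lc g"
proof -
  obtain D where "finite D" "D \<subseteq> \<Gamma>" "step D f" by (rule lcE[OF assms(1)])
  moreover have "step D g" unfolding step_def
    using assms(2) stepD[OF calculation(3)] by (intro ballI impI) metis
  ultimately show ?thesis unfolding lc_def by (intro exI[of _ D]) simp
qed

lemma lc_tr: fixes f :: "'b \<times> bool \<Rightarrow> real" assumes "lc f" shows "lc (tr m f)"
proof (induction m)
  case 0 show ?case using assms by (rule lc_cong) (simp add: tr_0)
next
  case (Suc m)
  have "tr (Suc m) f = tr 1 (tr m f)" using tr_add[of 1 m f] by (simp add: fun_eq_iff)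
  then show ?case using lc_tr1[OF Suc] by simp
qed

text \<open>The integer transfer is recovered from the real one by \<open>floor\<close>, which
  preserves local constancy.\<close>

lemma lc_tr_int: fixes f :: "'b \<times> bool \<Rightarrow> int" assumes "lc f" shows "lc (tr m f)"
proof -
  have "lc (\<lambda>x. real_of_int (f x))" using assms by (rule lc_compose)
  then have "lc (tr m (\<lambda>x. real_of_int (f x)))" by (rule lc_tr)
  then have "lc (\<lambda>x. floor (tr m (\<lambda>x. real_of_int (f x)) x))" by (rule lc_compose)
  then show ?thesis by (simp add: tr_of_int)
qed

text \<open>Preimages of a gap point come in adjacent pairs, apart from the finitely many points of \<open>E\<close>;
  this is the jump form of the Lasota-Yorke inequality.\<close>

lemma jump_tr1:
  fixes f :: "'b \<times> bool \<Rightarrow> real"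
  assumes f: "lc f" and u: "u \<in> \<Gamma>"
  shows "jump (tr 1 f) u \<le> (\<Sum>t\<in>{t \<in> jumps f. fst (\<sigma> (t, False)) = u}. jump f t)
    + (\<Sum>e\<in>{e \<in> E. fst (\<sigma> e) = u}. \<bar>f e\<bar>)"
proof -
  define S where "S = {p \<in> topspace T. fst (\<sigma> p) = u}"
  \<comment> \<open>The sign records which side of \<open>u\<close> a preimage hits, so the signed
    sum over both fibres is the difference whose absolute value is the jump at
    \<open>u\<close>.\<close>
  define sg where "sg p = (if snd (\<sigma> p) then 1 else - 1 :: real)" for p
  define U where "U = {t \<in> \<Gamma> - P. fst (\<sigma> (t, False)) = u}"
  have S: "S = pull 1 (u, True) \<union> pull 1 (u, False)"
    unfolding S_def pull_def by (auto simp: prod_eq_iff)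
  then have finS: "finite S" using finite_pull by simp
  have "(\<Sum>p\<in>S. sg p * f p) = (\<Sum>p\<in>pull 1 (u, True). sg p * f p) + (\<Sum>p\<in>pull 1 (u, False). sg p * f p)"
    unfolding S by (rule sum.union_disjoint[OF finite_pull1 finite_pull1]) (auto simp: pull_def)
  also have "(\<Sum>p\<in>pull 1 (u, True). sg p * f p) = tr 1 f (u, True)"
    unfolding tr_def by (rule sum.cong) (auto simp: pull_def sg_def)
  also have "(\<Sum>p\<in>pull 1 (u, False). sg p * f p) = - tr 1 f (u, False)"
    unfolding tr_def sum_negf[symmetric] by (rule sum.cong) (auto simp: pull_def sg_def)
  finally have total: "(\<Sum>p\<in>S. sg p * f p) = tr 1 f (u, True) - tr 1 f (u, False)" by simp
  define S1 where "S1 = {p \<in> S. fst p \<in> \<Gamma> - P}"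
  have S1: "S1 = U \<times> UNIV"
  proof
    show "S1 \<subseteq> U \<times> UNIV"
    proof
      fix p assume "p \<in> S1"
      then show "p \<in> U \<times> UNIV"
        using gap_to_gap[of "fst p"] by (cases p; cases "snd p") (auto simp: S1_def S_def U_def)
    qed
    show "U \<times> UNIV \<subseteq> S1"
    proof
      fix p assume "p \<in> U \<times> (UNIV :: bool set)"
      then show "p \<in> S1"
        using gap_to_gap[of "fst p"] lower_in_space[of "fst p"] upper_in_space[of "fst p"]
        by (cases p; cases "snd p") (auto simp: S1_def S_def U_def)
    qed
  qed
  have "finite (U \<times> (UNIV :: bool set))" unfolding S1[symmetric] S1_def using finS by simp
  then have finU: "finite U" by (metis (full_types) finite_cartesian_productD1 UNIV_not_empty)
  \<comment> \<open>Away from \<open>P\<close> the two sides of \<open>t\<close> have the same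
    address relative to \<open>P\<close>, so injectivity sends them to opposite sides of
    \<open>u\<close>. Their signs differ and together they contribute one jump of
    \<open>f\<close>.\<close>
  have pair: "\<bar>\<Sum>b\<in>UNIV. sg (t, b) * f (t, b)\<bar> = jump f t" if t: "t \<in> U" for t
  proof -
    have tG: "t \<in> \<Gamma>" "t \<notin> P" using t by (auto simp: U_def)
    have "below P (t, True) = below P (t, False)"
      using adjacent[of t] tG P_gaps unfolding below_eq_iff by blast
    then have "\<sigma> (t, True) \<noteq> \<sigma> (t, False)"
      using inj_cell[of "(t, True)" "(t, False)"] lower_in_space[OF tG(1)] upper_in_space[OF tG(1)] by auto
    then have "snd (\<sigma> (t, True)) \<noteq> snd (\<sigma> (t, False))"
      using gap_to_gap[OF tG] by (auto simp: prod_eq_iff)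
    then show ?thesis by (auto simp: UNIV_bool sg_def jump_def)
  qed
  have "\<bar>\<Sum>p\<in>S1. sg p * f p\<bar> = \<bar>\<Sum>t\<in>U. \<Sum>b\<in>UNIV. sg (t, b) * f (t, b)\<bar>"
    unfolding S1 by (subst sum.cartesian_product) (simp add: case_prod_beta)
  also have "\<dots> \<le> (\<Sum>t\<in>U. \<bar>\<Sum>b\<in>UNIV. sg (t, b) * f (t, b)\<bar>)" by (rule sum_abs)
  also have "\<dots> = (\<Sum>t\<in>U. jump f t)" by (rule sum.cong[OF refl pair])
  also have "\<dots> = (\<Sum>t\<in>{t \<in> U. t \<in> jumps f}. jump f t)"
    by (rule sum.mono_neutral_right[OF finU]) (auto simp: jumps_def jump_def U_def)
  also have "\<dots> \<le> (\<Sum>t\<in>{t \<in> jumps f. fst (\<sigma> (t, False)) = u}. jump f t)"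
    by (rule sum_mono2) (use finite_jumps[OF f] in \<open>auto simp: U_def\<close>)
  finally have 1: "\<bar>\<Sum>p\<in>S1. sg p * f p\<bar> \<le> (\<Sum>t\<in>{t \<in> jumps f. fst (\<sigma> (t, False)) = u}. jump f t)" .
  \<comment> \<open>The unpaired preimages lie in \<open>E\<close> by \<open>gap_preimage\<close>;
    no cancellation is available, and they enter with absolute values.\<close>
  have "\<bar>\<Sum>p\<in>S - S1. sg p * f p\<bar> \<le> (\<Sum>p\<in>S - S1. \<bar>f p\<bar>)"
    by (rule order.trans[OF sum_abs]) (auto intro!: sum_mono simp: sg_def abs_mult)
  also have "\<dots> \<le> (\<Sum>e\<in>{e \<in> E. fst (\<sigma> e) = u}. \<bar>f e\<bar>)"
    by (rule sum_mono2) (use finite_E gap_preimage u in \<open>auto simp: S1_def S_def\<close>)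
  finally have 2: "\<bar>\<Sum>p\<in>S - S1. sg p * f p\<bar> \<le> (\<Sum>e\<in>{e \<in> E. fst (\<sigma> e) = u}. \<bar>f e\<bar>)" .
  have "(\<Sum>p\<in>S. sg p * f p) = (\<Sum>p\<in>S - S1. sg p * f p) + (\<Sum>p\<in>S1. sg p * f p)"
    by (rule sum.subset_diff) (auto simp: S1_def finS)
  then show ?thesis using 1 2 total unfolding jump_def[of "tr 1 f"] by linarith
qed

section \<open>Variation under iterated transfer, and labels\<close>

lemma var_tr1:
  fixes f :: "'b \<times> bool \<Rightarrow> real"
  assumes f: "lc f" shows "var (tr 1 f) \<le> var f + (\<Sum>e\<in>E. \<bar>f e\<bar>)"
proof -
  have fin: "finite (jumps (tr 1 f))" using finite_jumps[OF lc_tr[OF f]] .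
  have "var (tr 1 f) \<le> (\<Sum>u\<in>jumps (tr 1 f). (\<Sum>t\<in>{t \<in> jumps f. fst (\<sigma> (t, False)) = u}. jump f t)
    + (\<Sum>e\<in>{e \<in> E. fst (\<sigma> e) = u}. \<bar>f e\<bar>))"
    unfolding var_def[of "tr 1 f"] by (intro sum_mono jump_tr1[OF f]) (simp add: jumps_def)
  also have "\<dots> \<le> var f + (\<Sum>e\<in>E. \<bar>f e\<bar>)"
    unfolding sum.distrib var_def
    by (intro add_mono sum_fibres_le) (use fin finite_jumps[OF f] finite_E in auto)
  finally show ?thesis .
qed

lemma var_cong: "(\<And>x. x \<in> topspace T \<Longrightarrow> f x = g x) \<Longrightarrow> var f = var g"
  unfolding var_def
  by (rule sum.cong) (auto simp: jumps_def jump_def lower_in_space upper_in_space)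

text \<open>Iterating the one-step bound produces values of \<open>tr j f\<close> on
  \<open>E\<close>, hence sums of \<open>f\<close> over iterated preimages of \<open>E\<close>. For
  fixed \<open>k\<close> these preimages form one finite set not depending on \<open>f\<close>, and
  bounding each of the \<open>k\<close> steps by the sum over the whole set is enough.\<close>

lemma var_tr:
  fixes f :: "'b \<times> bool \<Rightarrow> real"
  assumes f: "lc f"
  shows "var (tr k f) \<le> var f + real k * (\<Sum>p\<in>(\<Union>j<k. \<Union>e\<in>E. pull j e). \<bar>f p\<bar>)"
proof -
  let ?F = "\<lambda>k. \<Union>j<k. \<Union>e\<in>E. pull j e"
  have finF: "finite (?F k)" for k using finite_E finite_pull by simp
  have one: "(\<Sum>e\<in>E. \<bar>tr j f e\<bar>) \<le> (\<Sum>p\<in>?F k. \<bar>f p\<bar>)" if "j < k" for j k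
  proof -
    have "(\<Sum>e\<in>E. \<bar>tr j f e\<bar>) \<le> (\<Sum>e\<in>E. \<Sum>p\<in>pull j e. \<bar>f p\<bar>)"
      unfolding tr_def by (intro sum_mono sum_abs)
    also have "\<dots> = (\<Sum>p\<in>(\<Union>e\<in>E. pull j e). \<bar>f p\<bar>)"
      by (rule sum.UNION_disjoint[symmetric]) (auto simp: finite_E finite_pull pull_disjoint)
    also have "\<dots> \<le> (\<Sum>p\<in>?F k. \<bar>f p\<bar>)"
      by (rule sum_mono2[OF finF]) (use that in auto)
    finally show ?thesis .
  qed
  have "var (tr k f) \<le> var f + (\<Sum>j<k. \<Sum>e\<in>E. \<bar>tr j f e\<bar>)"
  proof (induction k)
    case 0
    have "var (tr 0 f) = var f" by (rule var_cong) (simp add: tr_0)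
    then show ?case by simp
  next
    case (Suc k)
    have "tr (Suc k) f = tr 1 (tr k f)" using tr_add[of 1 k f] by (simp add: fun_eq_iff)
    then show ?case using Suc var_tr1[OF lc_tr[OF f], of k] by simp
  qed
  also have "(\<Sum>j<k. \<Sum>e\<in>E. \<bar>tr j f e\<bar>) \<le> (\<Sum>j<k. \<Sum>p\<in>?F k. \<bar>f p\<bar>)"
    by (intro sum_mono one) simp
  finally show ?thesis by simp
qed

lemma lc_lab: assumes "finite D" "D \<subseteq> \<Gamma>" shows "lc (lab D m)"
proof (induction m)
  case 0 then show ?case by (simp add: lab_def)
next
  case (Suc m)
  have "lc (below D)" unfolding lc_def step_def using assms by (intro exI[of _ D]) auto
  then have "continuous_map T (discrete_topology UNIV) (below D \<circ> (\<sigma> ^^ m))"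
    unfolding lc_iff_continuous by (rule continuous_map_compose[OF continuous_funpow])
  then have "lc (\<lambda>p. below D ((\<sigma> ^^ m) p))" unfolding lc_iff_continuous by (simp add: o_def)
  from lc_compose2[OF Suc this, of "\<lambda>l z. l @ [z]"] show ?case by (simp add: lab_def)
qed

text \<open>Points with the same itinerary have the same address relative to \<open>P\<close> at
  every time, so they cannot merge; a collision is undone from the last step backwards.\<close>

lemma inj_on_lab: "inj_on (\<sigma> ^^ m) {q \<in> topspace T. lab P m q = l}"
proof (induction m arbitrary: l)
  case 0 then show ?case by simp
next
  case (Suc m)
  show ?case
  proof (rule inj_onI)
    fix p q assume p: "p \<in> {q \<in> topspace T. lab P (Suc m) q = l}" and q: "q \<in> {q \<in> topspace T. lab P (Suc m) q = l}"
      and eq: "(\<sigma> ^^ Suc m) p = (\<sigma> ^^ Suc m) q"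
    then have "lab P (Suc m) p = lab P (Suc m) q" by simp
    then have lab: "lab P m p = lab P m q" "below P ((\<sigma> ^^ m) p) = below P ((\<sigma> ^^ m) q)"
      by (simp_all add: lab_def)
    have "(\<sigma> ^^ m) p = (\<sigma> ^^ m) q"
      by (rule inj_cell) (use p q eq lab in \<open>auto intro: funpow_space\<close>)
    then show "p = q" using Suc[of "lab P m q"] lab(1) p q by (auto dest: inj_onD)
  qed
qed

end

section \<open>Scaled measures\<close>

text \<open>Representatives run from 1 to \<open>N\<close>, so the index is lowered by one before
  reduction modulo \<open>N\<close> and raised again afterwards.\<close>

lemma cyclic_image:
  assumes "cyclic_exact_partition T \<sigma> N Xs" "i \<in> {1..N}"
  shows "(\<sigma> ^^ m) ` Xs i = Xs ((i - 1 + m) mod N + 1)"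
proof (induction m)
  case 0
  have "i - 1 < N" "1 \<le> i" using assms(2) by auto
  then have "(i - 1) mod N + 1 = i" by simp
  then show ?case by simp
next
  case (Suc m)
  let ?j = "(i - 1 + m) mod N + 1"
  have N: "N > 0" using assms(2) by auto
  then have j: "?j \<in> {1..N}" using mod_less_divisor[OF N, of "i - 1 + m"] by auto
  have "(\<sigma> ^^ Suc m) ` Xs i = \<sigma> ` Xs ?j" using Suc by (metis funpow.simps(2) image_comp)
  also have "\<dots> = Xs (?j mod N + 1)"
    using assms(1) j unfolding cyclic_exact_partition_def next_index_def by blast
  also have "?j mod N = (i - 1 + Suc m) mod N" by (simp add: mod_Suc_eq)
  finally show ?case .
qed

lemma (in gap_space) var_superset:
  assumes "jumps f \<subseteq> S" "finite S" "S \<subseteq> \<Gamma>" shows "var f = sum (jump f) S"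
  unfolding var_def by (rule sum.mono_neutral_left) (use assms in \<open>auto simp: jumps_def jump_def\<close>)

lemma (in gap_space) var_add: assumes "lc f" "lc g" shows "var (\<lambda>x. f x + g x) \<le> var f + var g"
proof -
  let ?S = "jumps f \<union> jumps g"
  have S: "finite ?S" "?S \<subseteq> \<Gamma>" using finite_jumps assms by (auto simp: jumps_def)
  have "var (\<lambda>x. f x + g x) = (\<Sum>t\<in>?S. jump (\<lambda>x. f x + g x) t)"
    by (rule var_superset[OF _ S]) (auto simp: jumps_def)
  also have "\<dots> \<le> (\<Sum>t\<in>?S. jump f t + jump g t)" by (rule sum_mono) (auto simp: jump_def)
  also have "\<dots> = var f + var g"
    unfolding sum.distrib using var_superset[OF _ S, of f] var_superset[OF _ S, of g] by simp
  finally show ?thesis .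
qed

lemma (in gap_space) var_scale: "var (\<lambda>x. c * f x) = \<bar>c\<bar> * var f"
proof (cases "c = 0")
  case True
  have "jumps (\<lambda>x. c * f x) = {}" by (simp add: jumps_def True)
  then show ?thesis using True by (simp add: var_def)
next
  case False
  have 1: "jumps (\<lambda>x. c * f x) = jumps f" using False by (simp add: jumps_def)
  have 2: "jump (\<lambda>x. c * f x) t = \<bar>c\<bar> * jump f t" for t
    unfolding jump_def by (simp add: abs_mult[symmetric] right_diff_distrib)
  show ?thesis unfolding var_def 1 2 by (simp add: sum_distrib_left)
qed

text \<open>\<open>non_injective\<close> is what remains of the failure of essential injectivity; it
  is the source of \<open>1 < s\<close>.\<close>

locale gap_system = gap_map T \<Gamma> H \<sigma> P E
  for T :: "('b \<times> bool) topology" and \<Gamma> H \<sigma> P E +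
  fixes \<mu> :: "('b \<times> bool) measure" and s :: real and N :: nat and Xs :: "nat \<Rightarrow> ('b \<times> bool) set"
  assumes scaled: "scaled_probability_measure T \<sigma> s \<mu>"
    and cyclic: "cyclic_exact_partition T \<sigma> N Xs"
    and non_injective: "\<exists>p\<in>topspace T. \<exists>q\<in>topspace T. p \<noteq> q \<and> \<sigma> p = \<sigma> q"
begin

section \<open>Integration of locally constant functions\<close>

sublocale prob_space \<mu>
  using scaled unfolding scaled_probability_measure_def by blast

abbreviation mean :: "('b \<times> bool \<Rightarrow> real) \<Rightarrow> real" where
  "mean f \<equiv> integral\<^sup>L \<mu> f"

lemma sets_mu: "sets \<mu> = sigma_sets (topspace T) {U. openin T U}"
  using scaled unfolding scaled_probability_measure_def by blast

lemma s_pos: "0 < s"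
  using scaled unfolding scaled_probability_measure_def by blast

lemma scaled_image: "\<lbrakk>A \<in> sets \<mu>; inj_on \<sigma> A\<rbrakk> \<Longrightarrow> measure \<mu> (\<sigma> ` A) = s * measure \<mu> A"
  using scaled unfolding scaled_probability_measure_def by blast

lemma open_sets: "openin T U \<Longrightarrow> U \<in> sets \<mu>"
  unfolding sets_mu by (rule sigma_sets.Basic) simp

lemma space_mu: "space \<mu> = topspace T"
proof
  have "{U. openin T U} \<subseteq> Pow (topspace T)" using openin_subset by auto
  then show "space \<mu> \<subseteq> topspace T"
    using sets.top[of \<mu>] sigma_sets_into_sp[of "{U. openin T U}" "topspace T" "space \<mu>"] unfolding sets_mu by blast
  show "topspace T \<subseteq> space \<mu>" using sets.sets_into_space[OF open_sets[of "topspace T"]] by simp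
qed

lemma openin_lc: assumes "lc f" shows "openin T {x \<in> topspace T. f x \<in> V}"
  using assms unfolding lc_iff_continuous by (rule openin_continuous_map_preimage) simp

lemma lc_bounded: fixes f :: "_ \<Rightarrow> real" assumes "lc f"
  obtains B where "0 \<le> B" "\<forall>x\<in>topspace T. \<bar>f x\<bar> \<le> B"
proof -
  have "bounded (f ` topspace T)" by (rule finite_imp_bounded[OF finite_image_lc[OF assms]])
  then obtain B where "\<forall>y\<in>f ` topspace T. norm y \<le> B" unfolding bounded_iff by auto
  then show thesis by (intro that[of "max B 0"]) (auto simp: max_def)
qed

lemma integrable_lc [intro, simp]: fixes f :: "_ \<Rightarrow> real" assumes "lc f" shows "integrable \<mu> f"
proof -
  obtain B where B: "0 \<le> B" "\<forall>x\<in>topspace T. \<bar>f x\<bar> \<le> B" by (rule lc_bounded[OF assms])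
  have "f \<in> borel_measurable \<mu>"
  proof (rule measurableI)
    fix V
    have "f -` V \<inter> space \<mu> = {x \<in> topspace T. f x \<in> V}" by (auto simp: space_mu)
    then show "f -` V \<inter> space \<mu> \<in> sets \<mu>" using open_sets[OF openin_lc[OF assms]] by simp
  qed simp
  then show ?thesis by (rule integrable_const_bound[rotated, where B = B]) (use B space_mu in auto)
qed

lemma mean_mono: "\<lbrakk>lc f; lc g; \<And>x. x \<in> topspace T \<Longrightarrow> f x \<le> g x\<rbrakk> \<Longrightarrow> mean f \<le> mean g"
  by (rule integral_mono) (simp_all add: space_mu)

lemma mean_nonneg: "(\<And>x. x \<in> topspace T \<Longrightarrow> 0 \<le> f x) \<Longrightarrow> 0 \<le> mean f"
  by (rule Bochner_Integration.integral_nonneg) (simp add: space_mu)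

lemma mean_cong: "(\<And>x. x \<in> topspace T \<Longrightarrow> f x = g x) \<Longrightarrow> mean f = mean g"
  by (rule Bochner_Integration.integral_cong) (simp_all add: space_mu)

lemma mean_indicator: assumes "openin T C" shows "mean (indicator C) = measure \<mu> C"
proof -
  have "C \<inter> space \<mu> = C" using openin_subset[OF assms] by (auto simp: space_mu)
  then show ?thesis by simp
qed

lemma lc_times: fixes f :: "_ \<Rightarrow> real" shows "lc f \<Longrightarrow> lc (\<lambda>x. c * f x)" by (rule lc_compose)

lemma lc_plus: fixes f :: "_ \<Rightarrow> real" shows "\<lbrakk>lc f; lc g\<rbrakk> \<Longrightarrow> lc (\<lambda>x. f x + g x)"
  by (rule lc_compose2)

lemma lc_abs: fixes f :: "_ \<Rightarrow> real" shows "lc f \<Longrightarrow> lc (\<lambda>x. \<bar>f x\<bar>)"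
  by (rule lc_compose)

text \<open>For a clopen set on which \<sigma> is injective, transfer turns its indicator into that
  of the image, and the claim is the scaling property of \<mu>; \<open>lc_decomp\<close> and
  linearity do the rest.\<close>

lemma mean_tr1: assumes "lc f" shows "mean (tr 1 f) = s * mean f"
proof -
  obtain L :: "'b set set" and C v where L: "finite L"
    "\<forall>l\<in>L. openin T (C l) \<and> closedin T (C l) \<and> inj_on \<sigma> (C l)"
    "\<forall>x\<in>topspace T. f x = (\<Sum>l\<in>L. v l * indicator (C l) x)"
    by (rule lc_decomp[OF assms])
  have sum: "mean (\<lambda>x. \<Sum>l\<in>L. v l * indicator (B l) x) = (\<Sum>l\<in>L. v l * measure \<mu> (B l))"
    if "\<forall>l\<in>L. openin T (B l) \<and> closedin T (B l)" for B
  proof -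
    have "lc (indicator (B l) :: _ \<Rightarrow> real)" if "l \<in> L" for l
      using lc_indicator that \<open>\<forall>l\<in>L. openin T (B l) \<and> closedin T (B l)\<close> by blast
    then have "mean (\<lambda>x. \<Sum>l\<in>L. v l * indicator (B l) x) = (\<Sum>l\<in>L. mean (\<lambda>x. v l * indicator (B l) x))"
      by (intro Bochner_Integration.integral_sum integrable_lc lc_times) 
    also have "\<dots> = (\<Sum>l\<in>L. v l * measure \<mu> (B l))"
      by (rule sum.cong[OF refl]) (use mean_indicator that in auto)
    finally show ?thesis .
  qed
  have "mean (tr 1 f) = mean (\<lambda>x. \<Sum>l\<in>L. v l * indicator (\<sigma> ` C l) x)"
    by (rule mean_cong) (rule tr1_decomp[OF L])
  also have "\<dots> = (\<Sum>l\<in>L. v l * measure \<mu> (\<sigma> ` C l))" by (rule sum) (use L clopen_image in blast)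
  also have "\<dots> = (\<Sum>l\<in>L. s * (v l * measure \<mu> (C l)))"
    by (rule sum.cong[OF refl]) (use L(2) in \<open>simp add: scaled_image open_sets\<close>)
  also have "\<dots> = s * mean (\<lambda>x. \<Sum>l\<in>L. v l * indicator (C l) x)"
    using sum[of C] L(2) by (simp add: sum_distrib_left)
  also have "mean (\<lambda>x. \<Sum>l\<in>L. v l * indicator (C l) x) = mean f" by (rule mean_cong) (use L(3) in simp)
  finally show ?thesis .
qed

lemma mean_tr: assumes "lc f" shows "mean (tr m f) = s ^ m * mean f"
proof (induction m)
  case 0
  have "mean (tr 0 f) = mean f" by (rule mean_cong) (rule tr_0)
  then show ?case by simp
next
  case (Suc m)
  have "tr (Suc m) f = tr 1 (tr m f)" using tr_add[of 1 m f] by (simp add: fun_eq_iff)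
  then show ?case using mean_tr1[OF lc_tr[OF assms], of m] Suc by simp
qed

section \<open>Exactness, full support and the scaling factor\<close>

lemma N_pos: "1 \<le> N"
  using cyclic unfolding cyclic_exact_partition_def by blast

lemma part:
  assumes "i \<in> {1..N}"
  shows "Xs i \<noteq> {}" "openin T (Xs i)" "closedin T (Xs i)" "Xs i \<subseteq> topspace T"
    "topologically_exact (subtopology T (Xs i)) (\<sigma> ^^ N)"
  using cyclic assms closedin_subset unfolding cyclic_exact_partition_def by blast+

lemma part_cover: "(\<Union>i\<in>{1..N}. Xs i) = topspace T"
  using cyclic unfolding cyclic_exact_partition_def by blast

lemma map_surj: "\<sigma> ` topspace T = topspace T"
proof
  show "\<sigma> ` topspace T \<subseteq> topspace T" using map_space by blast
  show "topspace T \<subseteq> \<sigma> ` topspace T"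
  proof
    fix x assume "x \<in> topspace T"
    then obtain j where j: "j \<in> {1..N}" "x \<in> Xs j" using part_cover by blast
    \<comment> \<open>The cyclic predecessor of \<open>j\<close>.\<close>
    define i where "i = (if j = 1 then N else j - 1)"
    have i: "i \<in> {1..N}" "next_index N i = j" using j N_pos by (auto simp: i_def next_index_def)
    then have "\<sigma> ` Xs i = Xs j" using cyclic unfolding cyclic_exact_partition_def by auto
    then show "x \<in> \<sigma> ` topspace T" using j part(4)[OF i(1)] by auto
  qed
qed

lemma funpow_surj: "(\<sigma> ^^ m) ` topspace T = topspace T"
proof (induction m)
  case (Suc m)
  have "(\<sigma> ^^ Suc m) ` topspace T = \<sigma> ` (\<sigma> ^^ m) ` topspace T" by (simp add: image_comp)
  then show ?case by (simp add: Suc map_surj)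
qed simp

lemma part_return: assumes "i \<in> {1..N}" "N dvd k" shows "(\<sigma> ^^ k) ` Xs i = Xs i"
proof -
  obtain d where d: "k = N * d" using assms by blast
  have "i - 1 < N" "1 \<le> i" using assms by auto
  then have "(i - 1 + k) mod N + 1 = i" unfolding d by (simp only: mod_mult_self2 mod_less le_add_diff_inverse2)
  then show ?thesis using cyclic_image[OF cyclic assms(1), of k] by (simp only:)
qed

text \<open>Exactness supplies one power of \<open>\<sigma> ^^ N\<close> that fills
  \<open>Xs i\<close>, and further returns keep it full. Multiples of \<open>k\<close> are used
  because the cone argument runs along them.\<close>

lemma exact_eventually:
  assumes "i \<in> {1..N}" "N dvd k" "1 \<le> k" "openin T V" "V \<noteq> {}" "V \<subseteq> Xs i"
  shows "\<forall>\<^sub>F j in sequentially. (\<sigma> ^^ (k * j)) ` V = Xs i"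
proof -
  have "openin (subtopology T (Xs i)) V" using assms by (simp add: openin_subtopology_alt) blast
  moreover have "topspace (subtopology T (Xs i)) = Xs i" using part[OF assms(1)] by auto
  ultimately obtain m where m: "((\<sigma> ^^ N) ^^ m) ` V = Xs i"
    using part(5)[OF assms(1)] assms(5) unfolding topologically_exact_def by metis
  have "(\<sigma> ^^ (k * j)) ` V = Xs i" if "m \<le> j" for j
  proof -
    obtain d where d: "k = N * d" using assms by blast
    then have dj: "m \<le> d * j" using assms that by (metis dvd_triv_right mult_le_mono1 nat_dvd_not_less
        linorder_not_le mult.commute mult_eq_0_iff nat_mult_1_right not_one_le_zero order.trans mult_le_mono2 less_one)
    then have "k * j = N * (d * j - m) + N * m" unfolding d by (simp add: algebra_simps diff_mult_distrib2)
    then have "(\<sigma> ^^ (k * j)) ` V = (\<sigma> ^^ (N * (d * j - m))) ` (\<sigma> ^^ (N * m)) ` V"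
      by (simp add: funpow_add image_comp)
    also have "(\<sigma> ^^ (N * m)) ` V = Xs i" using m by (simp add: funpow_mult)
    finally show ?thesis using part_return[OF assms(1), of "N * (d * j - m)"] by simp
  qed
  then show ?thesis unfolding eventually_sequentially by blast
qed

text \<open>The scaling property speaks only of sets on which \<sigma> is injective, so
  \<open>V\<close> is cut into finitely many pieces of constant address relative to
  \<open>P\<close>.\<close>

lemma null_image: assumes "openin T V" "measure \<mu> V = 0" shows "measure \<mu> (\<sigma> ` V) = 0"
proof -
  let ?L = "below P ` topspace T"
  let ?C = "\<lambda>l. V \<inter> {q \<in> topspace T. below P q = l}"
  have "lc (below P)" unfolding lc_def step_def using finite_P P_gaps by (intro exI[of _ P]) auto
  then have open_C: "openin T (?C l)" for l
    using openin_lc[of "below P" "{l}"] assms(1) by (intro openin_Int) auto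
  have "measure \<mu> (\<sigma> ` ?C l) = 0" for l
  proof -
    have "inj_on \<sigma> (?C l)" by (rule inj_onI, rule inj_cell) auto
    then have "measure \<mu> (\<sigma> ` ?C l) = s * measure \<mu> (?C l)" using open_sets[OF open_C] scaled_image by blast
    moreover have "measure \<mu> (?C l) \<le> measure \<mu> V"
      by (rule finite_measure_mono) (use open_sets assms in auto)
    ultimately show ?thesis using assms(2) by (metis measure_le_0_iff mult_zero_right)
  qed
  moreover have "\<sigma> ` V = (\<Union>l\<in>?L. \<sigma> ` ?C l)" using openin_subset[OF assms(1)] by auto
  moreover have "measure \<mu> (\<Union>l\<in>?L. \<sigma> ` ?C l) \<le> (\<Sum>l\<in>?L. measure \<mu> (\<sigma> ` ?C l))"
  proof (rule finite_measure_subadditive_finite)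
    show "(\<lambda>l. \<sigma> ` ?C l) ` ?L \<subseteq> events" using opn open_C open_sets unfolding open_map_def by blast
  qed (rule finite_below_image[OF finite_P])
  ultimately show ?thesis by (simp add: measure_le_0_iff)
qed

text \<open>By exactness a null open set would fill some \<open>Xs i\<close>, then every part along
  the cycle, and all these images would remain null, against total mass one.\<close>

lemma full_support: assumes "openin T U" "U \<noteq> {}" shows "0 < measure \<mu> U"
proof (rule ccontr)
  assume "\<not> 0 < measure \<mu> U"
  then have U0: "measure \<mu> U = 0" by (simp add: zero_less_measure_iff)
  obtain u where u: "u \<in> U" using assms(2) by auto
  then have "u \<in> (\<Union>i\<in>{1..N}. Xs i)" using openin_subset[OF assms(1)] part_cover by auto
  then obtain i where i: "i \<in> {1..N}" "u \<in> Xs i" by blast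
  then have ne: "U \<inter> Xs i \<noteq> {}" using u by blast
  define V where "V = U \<inter> Xs i"
  have V: "openin T V" "V \<noteq> {}" "V \<subseteq> Xs i" using assms i ne part(2) by (auto simp: V_def)
  have V0: "measure \<mu> V = 0"
    using finite_measure_mono[of V U] open_sets[OF assms(1)] U0 by (simp add: V_def measure_le_0_iff)
  have im: "openin T ((\<sigma> ^^ j) ` V) \<and> measure \<mu> ((\<sigma> ^^ j) ` V) = 0" for j
  proof (induction j)
    case (Suc j)
    have "(\<sigma> ^^ Suc j) ` V = \<sigma> ` (\<sigma> ^^ j) ` V" by (simp add: image_comp)
    then show ?case using Suc null_image opn unfolding open_map_def by metis
  qed (use V V0 in simp)
  obtain j where j: "(\<sigma> ^^ (N * j)) ` V = Xs i"
    using eventually_happens[OF exact_eventually[OF i(1) dvd_refl N_pos V]] by auto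
  have "measure \<mu> (Xs m) = 0" if m: "m \<in> {1..N}" for m
  proof -
    have "i - 1 + (m + N - i) = m - 1 + N" "m - 1 < N" using i(1) m by auto
    then have "(i - 1 + (m + N - i)) mod N + 1 = m" using m by (simp only: mod_add_self2 mod_less) simp
    then have "(\<sigma> ^^ (m + N - i)) ` Xs i = Xs m"
      using cyclic_image[OF cyclic i(1), of "m + N - i"] by simp
    then have "Xs m = (\<sigma> ^^ (m + N - i + N * j)) ` V" unfolding j[symmetric] by (simp add: funpow_add image_comp)
    then show ?thesis using im by simp
  qed
  moreover have "measure \<mu> (\<Union>i\<in>{1..N}. Xs i) \<le> (\<Sum>i\<in>{1..N}. measure \<mu> (Xs i))"
    by (rule finite_measure_subadditive_finite) (use part(2) open_sets in auto)
  ultimately show False using prob_space unfolding space_mu part_cover by simp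
qed

lemma fibre_nonempty: assumes "x \<in> topspace T" shows "pull m x \<noteq> {}"
proof -
  have "x \<in> (\<sigma> ^^ m) ` topspace T" using assms funpow_surj by simp
  then show ?thesis by (auto simp: pull_def)
qed

text \<open>The factor \<open>s\<close> is the integral of the transferred constant
  \<open>1\<close>, which counts preimages: at least one everywhere by surjectivity, and at least
  two on a nonempty clopen set, which has positive measure.\<close>

lemma s_gt_1: "1 < s"
proof -
  let ?h = "tr 1 (\<lambda>_. 1 :: real)"
  have h: "?h x = real (card (pull 1 x))" for x by (simp add: tr_def)
  have ge1: "1 \<le> ?h x" if "x \<in> topspace T" for x
    using fibre_nonempty[OF that, of 1] finite_pull1[of x] unfolding h
    by (metis One_nat_def Suc_leI card_gt_0_iff of_nat_1 of_nat_le_iff)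
  obtain p q where pq: "p \<in> topspace T" "q \<in> topspace T" "p \<noteq> q" "\<sigma> p = \<sigma> q"
    using non_injective by blast
  have "card {p, q} \<le> card (pull 1 (\<sigma> p))"
    by (rule card_mono[OF finite_pull1]) (use pq in \<open>auto simp: pull_def\<close>)
  then have h2: "2 \<le> ?h (\<sigma> p)" using pq unfolding h by simp
  define U where "U = {x \<in> topspace T. ?h x \<in> {2..}}"
  have lch: "lc ?h" by (rule lc_tr) simp
  have U: "openin T U" unfolding U_def by (rule openin_lc[OF lch])
  have "topspace T - U = {x \<in> topspace T. ?h x \<in> - {2..}}" by (auto simp: U_def)
  then have Uc: "closedin T U" using openin_lc[OF lch, of "- {2..}"] openin_subset[OF U] by (simp add: closedin_def)
  have lcU: "lc (indicator U :: _ \<Rightarrow> real)" using lc_indicator U Uc by blast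
  have "\<sigma> p \<in> U" using h2 map_space[OF pq(1)] unfolding U_def by simp
  then have "0 < measure \<mu> U" using full_support[OF U] by blast
  moreover have "mean (\<lambda>x. 1 + indicator U x) \<le> mean ?h"
  proof (rule mean_mono)
    fix x assume "x \<in> topspace T"
    then show "1 + indicator U x \<le> ?h x" using ge1 by (cases "x \<in> U") (auto simp: U_def)
  qed (use lcU lch in \<open>auto intro: lc_plus\<close>)
  moreover have "mean (\<lambda>x. 1 + indicator U x) = 1 + measure \<mu> U"
    using mean_indicator[OF U] integrable_lc[OF lcU] prob_space
    by (subst Bochner_Integration.integral_add) auto
  moreover have "mean ?h = s" using mean_tr1[of "\<lambda>_. 1"] prob_space by simp
  ultimately show ?thesis by linarith
qed

text \<open>On a set with a common itinerary \<open>\<sigma> ^^ m\<close> is injective, so the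
  transferred indicator is at most \<open>1\<close>, while its integral is \<open>s ^ m\<close>
  times the measure of the set.\<close>

lemma label_measure: "s ^ m * measure \<mu> {q \<in> topspace T. lab P m q = l} \<le> 1"
proof -
  define C where "C = {q \<in> topspace T. lab P m q \<in> {l}}"
  have C: "openin T C" unfolding C_def by (rule openin_lc[OF lc_lab[OF finite_P P_gaps]])
  have "topspace T - C = {x \<in> topspace T. lab P m x \<in> - {l}}" by (auto simp: C_def)
  then have Cc: "closedin T C" using openin_lc[OF lc_lab[OF finite_P P_gaps], of m "- {l}"] openin_subset[OF C] by (simp add: closedin_def)
  have lcC: "lc (indicator C :: _ \<Rightarrow> real)" using lc_indicator C Cc by blast
  have inj: "inj_on (\<sigma> ^^ m) C" using inj_on_lab[of m l] by (simp add: C_def)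
  have "mean (tr m (indicator C)) \<le> mean (\<lambda>_. 1)"
  proof (rule mean_mono[OF lc_tr[OF lcC] lc_const])
    fix x show "tr m (indicator C) x \<le> (1 :: real)"
      unfolding tr_indicator[OF openin_subset[OF C] inj] by (simp add: indicator_def)
  qed
  then show ?thesis unfolding mean_tr[OF lcC] mean_indicator[OF C] using prob_space by (simp add: C_def)
qed

text \<open>Values within the cell differ by at most the variation there, so averaging over the cell
  replaces a point value by an integral. This converts point values into the two quantities that the
  cone controls.\<close>

lemma cell_average:
  assumes f: "lc f" and D: "finite D" "D \<subseteq> \<Gamma>" and p: "p \<in> topspace T"
  shows "measure \<mu> (cell D p) * \<bar>f p\<bar> \<le> measure \<mu> (cell D p) * var_on (cell D p) f + mean (\<lambda>x. \<bar>f x\<bar>)"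
proof -
  let ?B = "cell D p" and ?v = "var_on (cell D p) f"
  have B: "openin T ?B" "closedin T ?B" using clopen_cell[OF D] by auto
  have lcB: "lc (indicator ?B :: _ \<Rightarrow> real)" using lc_indicator B by blast
  have "mean (\<lambda>x. \<bar>f p\<bar> * indicator ?B x) \<le> mean (\<lambda>x. ?v * indicator ?B x + \<bar>f x\<bar>)"
  proof (rule mean_mono)
    fix x assume "x \<in> topspace T"
    show "\<bar>f p\<bar> * indicator ?B x \<le> ?v * indicator ?B x + \<bar>f x\<bar>"
    proof (cases "x \<in> ?B")
      case True
      then have "indicator ?B x = (1 :: real)" by simp
      then show ?thesis
        using cell_osc[OF f D(2) True mem_cell[OF p]] cell_osc[OF f D(2) mem_cell[OF p] True] by (simp only:)
    qed simp
  qed (use f lcB in \<open>auto intro!: lc_plus lc_times lc_abs\<close>)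
  also have "\<dots> = mean (\<lambda>x. ?v * indicator ?B x) + mean (\<lambda>x. \<bar>f x\<bar>)"
    by (rule Bochner_Integration.integral_add) (use f lcB in \<open>auto intro!: integrable_lc lc_times lc_abs\<close>)
  finally show ?thesis using mean_indicator[OF B(1)] by (simp add: mult.commute)
qed

lemma sup_bound:
  assumes f: "lc f" and p: "p \<in> topspace T" shows "\<bar>f p\<bar> \<le> var f + mean (\<lambda>x. \<bar>f x\<bar>)"
proof -
  \<comment> \<open>Without gaps the whole space is a single cell, of measure one.\<close>
  have "cell {} p = topspace T" by (auto simp: cell_def below_def)
  then have "\<bar>f p\<bar> \<le> var_on (topspace T) f + mean (\<lambda>x. \<bar>f x\<bar>)"
    using cell_average[OF f _ _ p, of "{}"] prob_space by (simp add: space_mu)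
  moreover have "var_on (topspace T) f \<le> var f"
    unfolding var_on_def var_def by (rule sum_mono2) (use finite_jumps[OF f] in auto)
  ultimately show ?thesis by simp
qed

section \<open>The Lasota-Yorke inequality and the growth of the transferred constant\<close>

lemma separating_gaps:
  assumes "finite F" "F \<subseteq> topspace T"
  obtains D where "finite D" "D \<subseteq> \<Gamma>" "disjoint_family_on (cell D) F"
proof -
  have "\<exists>t. t \<in> \<Gamma> \<and> (p \<in> H t \<longleftrightarrow> q \<notin> H t)" if "p \<in> F" "q \<in> F" "p \<noteq> q" for p q
    using separates[of p q] assms that by auto
  then obtain t where t: "\<And>p q. \<lbrakk>p \<in> F; q \<in> F; p \<noteq> q\<rbrakk> \<Longrightarrow> t p q \<in> \<Gamma> \<and> (p \<in> H (t p q) \<longleftrightarrow> q \<notin> H (t p q))"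
    by metis
  define D where "D = (\<lambda>(p, q). t p q) ` {(p, q) \<in> F \<times> F. p \<noteq> q}"
  have "finite {(p, q) \<in> F \<times> F. p \<noteq> q}" by (rule finite_subset[of _ "F \<times> F"]) (use assms in auto)
  then have "finite D" by (simp add: D_def)
  moreover have "D \<subseteq> \<Gamma>" using t by (auto simp: D_def)
  moreover have "disjoint_family_on (cell D) F"
    unfolding disjoint_family_on_def
  proof (intro ballI impI)
    fix p q assume pq: "p \<in> F" "q \<in> F" "p \<noteq> q"
    then have "t p q \<in> D" by (auto simp: D_def)
    then have "below D p \<noteq> below D q" using t[OF pq] unfolding below_eq_iff by blast
    then show "cell D p \<inter> cell D q = {}" by (auto simp: cell_def)
  qed
  ultimately show thesis by (rule that)
qed

text \<open>With \<open>k\<close> fixed, the relevant preimages of \<open>E\<close> are finitely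
  many points. Placed in disjoint cells, their values cost local variations that sum to at most
  \<open>var f\<close>, plus multiples of the integral; having \<open>k\<close> steps gives the
  coefficient \<open>1 + k\<close>.\<close>

lemma lasota_yorke:
  obtains C where "0 \<le> C"
    "\<forall>f. lc f \<longrightarrow> var (tr k f) \<le> (1 + real k) * var f + C * mean (\<lambda>x. \<bar>f x\<bar>)"
proof -
  define F where "F = (\<Union>j<k. \<Union>e\<in>E. pull j e)"
  have F: "finite F" "F \<subseteq> topspace T" using finite_E finite_pull by (auto simp: F_def pull_def)
  obtain D where D: "finite D" "D \<subseteq> \<Gamma>" "disjoint_family_on (cell D) F" by (rule separating_gaps[OF F])
  \<comment> \<open>The reciprocals come from \<open>cell_average\<close>; dividing by the cell
    measures is possible because of full support.\<close>
  define C where "C = (\<Sum>p\<in>F. inverse (measure \<mu> (cell D p)))"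
  have pos: "0 < measure \<mu> (cell D p)" if "p \<in> F" for p
    using full_support[OF openin_cell[OF D(1,2)], of p] mem_cell[of p D] F that by auto
  show thesis
  proof (rule that[of "real k * C"])
    show "0 \<le> real k * C" unfolding C_def by (intro mult_nonneg_nonneg sum_nonneg) auto
    show "\<forall>f. lc f \<longrightarrow> var (tr k f) \<le> (1 + real k) * var f + real k * C * mean (\<lambda>x. \<bar>f x\<bar>)"
    proof (intro allI impI)
      fix f :: "_ \<Rightarrow> real" assume f: "lc f"
      let ?m = "mean (\<lambda>x. \<bar>f x\<bar>)"
      have "\<bar>f p\<bar> \<le> var_on (cell D p) f + inverse (measure \<mu> (cell D p)) * ?m" if p: "p \<in> F" for p
        using cell_average[OF f D(1,2), of p] F p pos[OF p] by (auto simp: field_simps)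
      then have "(\<Sum>p\<in>F. \<bar>f p\<bar>) \<le> (\<Sum>p\<in>F. var_on (cell D p) f + inverse (measure \<mu> (cell D p)) * ?m)"
        by (rule sum_mono)
      also have "\<dots> = (\<Sum>p\<in>F. var_on (cell D p) f) + C * ?m"
        by (simp add: sum.distrib C_def sum_distrib_right)
      also have "\<dots> \<le> var f + C * ?m" using sum_var_on_le[OF f F(1) D(3)] by simp
      finally have "real k * (\<Sum>p\<in>F. \<bar>f p\<bar>) \<le> real k * (var f + C * ?m)" by (rule mult_left_mono) simp
      then show "var (tr k f) \<le> (1 + real k) * var f + real k * C * ?m"
        using var_tr[OF f, of k] by (simp add: F_def algebra_simps)
    qed
  qed
qed

text \<open>Exponential growth beats linear growth. The reserve of 4 leaves room for halving the
  cone constant, and divisibility by \<open>N\<close> lets \<open>tr k\<close> preserve functions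
  living on one part.\<close>

lemma good_exponent: obtains k where "1 \<le> k" "N dvd k" "4 * (1 + real k) \<le> s ^ k"
proof -
  have s1: "norm (1 / s) < 1" using s_gt_1 by simp
  have "(\<lambda>k. 4 * ((1 / s) ^ k + real k * (1 / s) ^ k)) \<longlonglongrightarrow> 4 * (0 + 0)"
    by (intro tendsto_intros LIMSEQ_power_zero powser_times_n_limit_0 s1)
  then have "\<forall>\<^sub>F k in sequentially. 4 * ((1 / s) ^ k + real k * (1 / s) ^ k) < 1"
    by (rule order_tendstoD) simp
  then obtain M where M: "\<And>k. M \<le> k \<Longrightarrow> 4 * ((1 / s) ^ k + real k * (1 / s) ^ k) < 1"
    unfolding eventually_sequentially by blast
  let ?k = "N * (M + 1)"
  have "1 * M \<le> N * (M + 1)" by (rule mult_le_mono) (use N_pos in auto)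
  then have "4 * ((1 / s) ^ ?k + real ?k * (1 / s) ^ ?k) < 1" by (intro M) simp
  then have "4 * (1 + real ?k) \<le> s ^ ?k" using s_gt_1 by (simp add: field_simps power_one_over)
  moreover have "1 \<le> ?k" using N_pos by simp
  ultimately show thesis by (intro that[of ?k]) auto
qed

lemma var_const: "var (\<lambda>_. c) = 0"
  by (simp add: var_def jumps_def)

text \<open>Along multiples of \<open>k\<close> the variation of the transferred constant is at most
  proportional to its integral \<open>s ^ (k * j)\<close>, hence so is its supremum. The fewer than
  \<open>k\<close> leftover steps multiply it by at most a power of the crude fibre bound.\<close>

lemma tr_growth: obtains K where "0 < K" "\<forall>m x. tr m (\<lambda>_. 1) x \<le> K * s ^ m"
proof -
  let ?one = "\<lambda>_ :: 'b \<times> bool. 1 :: real"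
  obtain k where k: "1 \<le> k" "N dvd k" "4 * (1 + real k) \<le> s ^ k" by (rule good_exponent)
  obtain C where C: "0 \<le> C"
    "\<forall>f. lc f \<longrightarrow> var (tr k f) \<le> (1 + real k) * var f + C * mean (\<lambda>x. \<bar>f x\<bar>)" by (rule lasota_yorke)
  have lc1: "lc (tr m ?one)" for m by (rule lc_tr) simp
  have nn: "0 \<le> tr m ?one x" for m x by (rule tr_nonneg) simp
  have mean1: "mean (\<lambda>x. \<bar>tr m ?one x\<bar>) = s ^ m" for m
    using mean_tr[of ?one m] nn prob_space by simp
  have sk: "1 \<le> s ^ m" for m using s_gt_1 by (simp add: one_le_power)
  \<comment> \<open>The constant \<open>2 * C\<close> reproduces itself: a quarter of it plus
    \<open>C\<close> is \<open>3 / 2 * C\<close>.\<close>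
  have v: "var (tr (k * j) ?one) \<le> 2 * C * s ^ (k * j)" for j
  proof (induction j)
    case 0
    have "var (tr 0 ?one) = var ?one" by (rule var_cong) (simp add: tr_0)
    then show ?case using C by (simp add: var_const)
  next
    case (Suc j)
    have "tr (k * Suc j) ?one = tr k (tr (k * j) ?one)" using tr_add[of k "k * j" ?one] by (simp add: fun_eq_iff)
    then have "var (tr (k * Suc j) ?one) \<le> (1 + real k) * var (tr (k * j) ?one) + C * s ^ (k * j)"
      using C(2) lc1[of "k * j"] mean1[of "k * j"] by auto
    also have "\<dots> \<le> (s ^ k / 4) * (2 * C * s ^ (k * j)) + C * s ^ (k * j) * s ^ k"
    proof (rule add_mono)
      show "(1 + real k) * var (tr (k * j) ?one) \<le> (s ^ k / 4) * (2 * C * s ^ (k * j))"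
        by (rule mult_mono) (use k Suc var_nonneg s_gt_1 in auto)
      have "0 \<le> C * s ^ (k * j)" using C s_pos by simp
      then show "C * s ^ (k * j) \<le> C * s ^ (k * j) * s ^ k"
        using sk[of k] mult_left_mono[of 1 "s ^ k" "C * s ^ (k * j)"] by simp
    qed
    also have "\<dots> = (3 / 2) * (C * s ^ (k * Suc j))" by (simp add: power_add algebra_simps)
    also have "\<dots> \<le> 2 * (C * s ^ (k * Suc j))" using C s_pos by (intro mult_right_mono) auto
    finally show ?case by simp
  qed
  have sup: "tr (k * j) ?one x \<le> (2 * C + 1) * s ^ (k * j)" for j x
  proof (cases "x \<in> topspace T")
    case True
    then show ?thesis using sup_bound[OF lc1 True, of "k * j"] mean1[of "k * j"] v[of j] by (simp add: algebra_simps)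
  next
    case False
    then show ?thesis using C s_pos by (simp add: tr_outside)
  qed
  define c where "c = (2 :: real) ^ card P"
  have c1: "1 \<le> c" by (simp add: c_def)
  \<comment> \<open>\<open>2 * C + 1\<close> bounds variation plus integral along multiples of
    \<open>k\<close>, and \<open>c ^ k\<close> absorbs the remainder of the division by
    \<open>k\<close>.\<close>
  define K where "K = (2 * C + 1) * c ^ k"
  have "0 < K" using C c1 by (simp add: K_def)
  moreover have "\<forall>m x. tr m ?one x \<le> K * s ^ m"
  proof (intro allI)
    fix m x
    let ?j = "m div k" and ?r = "m mod k"
    have m: "m = ?r + k * ?j" by simp
    have "tr m ?one x = tr ?r (tr (k * ?j) ?one) x" by (subst m) (rule tr_add)
    also have "\<dots> \<le> tr ?r (\<lambda>y. ((2 * C + 1) * s ^ (k * ?j)) * ?one y) x" by (rule tr_mono) (use sup in simp)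
    also have "\<dots> = ((2 * C + 1) * s ^ (k * ?j)) * tr ?r ?one x" by (rule tr_scale)
    also have "\<dots> \<le> ((2 * C + 1) * s ^ (k * ?j)) * c ^ k"
    proof (rule mult_left_mono)
      have "tr ?r ?one x = real (card (pull ?r x))" by (simp add: tr_def)
      also have "\<dots> \<le> real ((2 ^ card P) ^ ?r)" by (rule of_nat_mono[OF card_pull])
      also have "\<dots> = c ^ ?r" by (simp add: c_def)
      also have "\<dots> \<le> c ^ k" by (rule power_increasing) (use c1 k in auto)
      finally show "tr ?r ?one x \<le> c ^ k" .
    qed (use C s_pos in simp)
    also have "\<dots> = K * s ^ (k * ?j)" by (simp add: K_def)
    also have "\<dots> \<le> K * s ^ m"
    proof (rule mult_left_mono)
      show "s ^ (k * ?j) \<le> s ^ m" by (rule power_increasing) (use s_gt_1 in auto)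
    qed (use \<open>0 < K\<close> in simp)
    finally show "tr m ?one x \<le> K * s ^ m" .
  qed
  ultimately show thesis by (rule that)
qed

end

section \<open>Cone contraction\<close>

context gap_system begin

text \<open>Real values are needed because fractions of the mean are split off. The bound of the
  variation by the mean is what forces a member to be large on an entire cell.\<close>

definition cone :: "('b \<times> bool) set \<Rightarrow> real \<Rightarrow> ('b \<times> bool \<Rightarrow> real) set" where
  "cone A c = {f. lc f \<and> (\<forall>x. x \<notin> A \<longrightarrow> f x = 0) \<and> (\<forall>x. 0 \<le> f x) \<and> var f \<le> c * mean f}"

lemma coneD:
  assumes "f \<in> cone A c"
  shows "lc f" "\<forall>x. x \<notin> A \<longrightarrow> f x = 0" "\<forall>x. 0 \<le> f x" "var f \<le> c * mean f"
  using assms unfolding cone_def by blast+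

lemma tr_supported:
  assumes "i \<in> {1..N}" "N dvd k" "\<forall>x. x \<notin> Xs i \<longrightarrow> f x = 0" "x \<notin> Xs i"
  shows "tr k f x = 0"
proof -
  have "y \<notin> Xs i" if "y \<in> pull k x" for y
    using that assms(4) part_return[OF assms(1,2)] by (auto simp: pull_def)
  then show ?thesis unfolding tr_def using assms(3) by (intro sum.neutral) auto
qed

lemma lc_part: "i \<in> {1..N} \<Longrightarrow> lc (indicator (Xs i) :: _ \<Rightarrow> real)"
  using lc_indicator part(2,3) by blast

text \<open>By the choice of \<open>k\<close> and by \<open>4 * C \<le> c\<close>, the two terms of
  the Lasota-Yorke bound are each at most \<open>c / 4\<close> times the new mean. The half of
  \<open>c\<close> gained here pays later for subtracting a multiple of the indicator.\<close>

lemma cone_tr: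
  assumes i: "i \<in> {1..N}" and k: "N dvd k" "4 * (1 + real k) \<le> s ^ k"
    and C: "0 \<le> C" "\<forall>f. lc f \<longrightarrow> var (tr k f) \<le> (1 + real k) * var f + C * mean (\<lambda>x. \<bar>f x\<bar>)"
    and c: "4 * C \<le> c" and f: "f \<in> cone (Xs i) c"
  shows "var (tr k f) \<le> c / 2 * mean (tr k f)" "tr k f \<in> cone (Xs i) c"
proof -
  note F = coneD[OF f]
  have m0: "0 \<le> mean f" by (rule mean_nonneg) (use F(3) in blast)
  have c0: "0 \<le> c" using C c by linarith
  have sk: "1 \<le> s ^ k" using s_gt_1 by (simp add: one_le_power)
  have mabs: "mean (\<lambda>x. \<bar>f x\<bar>) = mean f" by (rule mean_cong) (use F(3) abs_of_nonneg in blast)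
  have "var (tr k f) \<le> (1 + real k) * var f + C * mean f" using C(2)[rule_format, OF F(1)] unfolding mabs .
  also have "\<dots> \<le> (s ^ k / 4) * (c * mean f) + (c / 4) * (s ^ k * mean f)"
  proof (rule add_mono)
    show "(1 + real k) * var f \<le> s ^ k / 4 * (c * mean f)"
      by (rule mult_mono) (use F k var_nonneg s_pos in auto)
    show "C * mean f \<le> c / 4 * (s ^ k * mean f)"
    proof (rule mult_mono)
      show "mean f \<le> s ^ k * mean f" using mult_right_mono[OF sk m0] by simp
    qed (use c c0 m0 in auto)
  qed
  also have "\<dots> = c / 2 * mean (tr k f)" unfolding mean_tr[OF F(1)] by simp
  finally show v: "var (tr k f) \<le> c / 2 * mean (tr k f)" .
  have nn: "0 \<le> tr k f x" for x by (rule tr_nonneg) (use F in auto)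
  then have "c / 2 * mean (tr k f) \<le> c * mean (tr k f)"
    using c0 mean_nonneg[of "tr k f"] by (intro mult_right_mono) auto
  then show "tr k f \<in> cone (Xs i) c"
    using v nn tr_supported[OF i k(1) F(2)] lc_tr[OF F(1)] by (auto simp: cone_def)
qed

lemma cone_tr_iterate:
  assumes i: "i \<in> {1..N}" and k: "N dvd k" "4 * (1 + real k) \<le> s ^ k"
    and C: "0 \<le> C" "\<forall>f. lc f \<longrightarrow> var (tr k f) \<le> (1 + real k) * var f + C * mean (\<lambda>x. \<bar>f x\<bar>)"
    and c: "4 * C \<le> c" and f: "f \<in> cone (Xs i) c"
  shows "tr (k * j) f \<in> cone (Xs i) c"
    "1 \<le> j \<Longrightarrow> var (tr (k * j) f) \<le> c / 2 * mean (tr (k * j) f)"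
proof -
  note F = coneD[OF f]
  have tr0: "tr 0 f = f"
  proof
    fix x show "tr 0 f x = f x"
      using F(2) part(4)[OF i] tr_0[of x f] tr_outside[of x 0 f] by (metis subsetD)
  qed
  have step: "tr (k * Suc j) f = tr k (tr (k * j) f)" for j
    using tr_add[of k "k * j" f] by (simp add: fun_eq_iff)
  have all: "tr (k * j) f \<in> cone (Xs i) c" for j
  proof (induction j)
    case 0 then show ?case using f tr0 by simp
  next
    case (Suc j) then show ?case unfolding step by (intro cone_tr(2)[OF i k C c])
  qed
  then show "tr (k * j) f \<in> cone (Xs i) c" .
  assume "1 \<le> j"
  then obtain j' where "j = Suc j'" by (cases j) auto
  then show "var (tr (k * j) f) \<le> c / 2 * mean (tr (k * j) f)"
    using cone_tr(1)[OF i k C c all[of j']] by (simp only: step)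
qed

lemma large_power: obtains m where "B \<le> s ^ m"
  using real_arch_pow[OF s_gt_1, of B] by (meson less_imp_le)

lemma sum_cell_measure_le:
  assumes "finite D" "D \<subseteq> \<Gamma>" shows "(\<Sum>c\<in>cell D ` A. measure \<mu> c) \<le> 1" "finite (cell D ` A)"
    "disjoint_family_on (\<lambda>c. c) (cell D ` A)"
proof -
  have "cell D ` A \<subseteq> (\<lambda>l. {q \<in> topspace T. below D q = l}) ` below D ` A" by (auto simp: cell_def)
  then show fin: "finite (cell D ` A)" using finite_below_image[OF assms(1)] by (meson finite_imageI finite_subset)
  show dis: "disjoint_family_on (\<lambda>c. c) (cell D ` A)" by (auto simp: disjoint_family_on_def cell_def)
  have "(\<Sum>c\<in>cell D ` A. measure \<mu> c) = measure \<mu> (\<Union>c\<in>cell D ` A. c)"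
    by (rule finite_measure_finite_Union[symmetric, OF fin _ dis]) (use openin_cell[OF assms] open_sets in auto)
  then show "(\<Sum>c\<in>cell D ` A. measure \<mu> c) \<le> 1" by simp
qed

text \<open>A function in the cone is at least half its mean on some cell of small measure, and exactness
  spreads that cell over the whole part.\<close>

lemma minorization:
  assumes i: "i \<in> {1..N}" and k: "1 \<le> k" "N dvd k" and c: "0 \<le> c"
  obtains p where "1 \<le> p" "\<forall>f\<in>cone (Xs i) c. \<forall>x\<in>Xs i. mean f / 2 \<le> tr (k * p) f x"
proof -
  let ?A = "Xs i"
  note A = part[OF i]
  \<comment> \<open>Cells inside an itinerary class of this length are so small that
    \<open>c\<close> times their measure is at most one quarter.\<close>
  obtain m where m: "4 * c \<le> s ^ m" by (rule large_power)
  have lcA: "lc (indicator ?A :: _ \<Rightarrow> real)" by (rule lc_part[OF i])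
  \<comment> \<open>Pairing the itinerary with the indicator yields gaps whose cells refine both, so
    a cell meeting \<open>Xs i\<close> lies inside it and inside one itinerary class.\<close>
  have "lc (\<lambda>q. (lab P m q, indicator ?A q :: real))" by (rule lc_compose2[OF lc_lab[OF finite_P P_gaps] lcA])
  then obtain D where D: "finite D" "D \<subseteq> \<Gamma>" "step D (\<lambda>q. (lab P m q, indicator ?A q :: real))" by (rule lcE)
  have st: "lab P m q = lab P m p" "q \<in> ?A" if "p \<in> ?A" "q \<in> cell D p" for p q
  proof -
    have "(lab P m q, indicator ?A q :: real) = (lab P m p, indicator ?A p)"
      by (rule stepD[OF D(3)]) (use that A(4) in \<open>auto simp: cell_def\<close>)
    then show "lab P m q = lab P m p" "q \<in> ?A" using that(1) by (auto simp: indicator_def split: if_splits)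
  qed
  let ?K = "cell D ` ?A"
  note K = sum_cell_measure_le[OF D(1,2), of ?A]
  have small: "s ^ m * measure \<mu> B \<le> 1" if B: "B \<in> ?K" for B
  proof -
    obtain p where p: "p \<in> ?A" "B = cell D p" using B by blast
    have sub: "B \<subseteq> {q \<in> topspace T. lab P m q = lab P m p}" using st(1)[OF p(1)] p by (auto simp: cell_def)
    have "{q \<in> topspace T. lab P m q \<in> {lab P m p}} \<in> events" by (rule open_sets[OF openin_lc[OF lc_lab[OF finite_P P_gaps]]])
    then have "{q \<in> topspace T. lab P m q = lab P m p} \<in> events" by simp
    then have "measure \<mu> B \<le> measure \<mu> {q \<in> topspace T. lab P m q = lab P m p}"
      by (rule finite_measure_mono[OF sub])
    then have "s ^ m * measure \<mu> B \<le> s ^ m * measure \<mu> {q \<in> topspace T. lab P m q = lab P m p}"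
      using s_pos by (intro mult_left_mono) auto
    then show ?thesis using label_measure[of m "lab P m p"] by linarith
  qed
  have "\<forall>\<^sub>F j in sequentially. \<forall>B\<in>?K. (\<sigma> ^^ (k * j)) ` B = ?A"
  proof (rule eventually_ball_finite[OF K(2)], intro ballI)
    fix B assume "B \<in> ?K"
    then obtain p where p: "p \<in> ?A" "B = cell D p" by blast
    have "B \<noteq> {}" using p(2) mem_cell[OF subsetD[OF A(4) p(1)]] by blast
    moreover have "B \<subseteq> ?A" using st(2)[OF p(1)] p by auto
    ultimately show "\<forall>\<^sub>F j in sequentially. (\<sigma> ^^ (k * j)) ` B = ?A"
      using exact_eventually[OF i k(2,1)] openin_cell[OF D(1,2)] p(2) by blast
  qed
  then obtain p0 where p0: "\<And>j. p0 \<le> j \<Longrightarrow> \<forall>B\<in>?K. (\<sigma> ^^ (k * j)) ` B = ?A"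
    unfolding eventually_sequentially by blast
  define p where "p = Suc p0"
  have cover: "(\<sigma> ^^ (k * p)) ` B = ?A" if "B \<in> ?K" for B using p0[of p] that by (auto simp: p_def)
  show thesis
  proof (rule that[of p])
    show "1 \<le> p" by (simp add: p_def)
    show "\<forall>f\<in>cone ?A c. \<forall>x\<in>?A. mean f / 2 \<le> tr (k * p) f x"
    proof (intro ballI)
      fix f x assume f: "f \<in> cone ?A c" and x: "x \<in> ?A"
      note F = coneD[OF f]
      have m0: "0 \<le> mean f" by (rule mean_nonneg) (use F(3) in blast)
      show "mean f / 2 \<le> tr (k * p) f x"
      proof (cases "mean f = 0")
        case True
        then show ?thesis using tr_nonneg[of f "k * p" x] F(3) by simp
      next
        case False
        then have mp: "0 < mean f" using m0 by simp
        \<comment> \<open>Otherwise every cell has a point with value below half the mean, and on it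
          \<open>f\<close> is at most half the mean plus the local variation. Integration bounds the
          mean by three quarters of itself.\<close>
        have "\<exists>B\<in>?K. \<forall>q\<in>B. mean f / 2 \<le> f q"
        proof (rule ccontr)
          assume neg: "\<not> ?thesis"
          let ?g = "\<lambda>x. \<Sum>B\<in>?K. (mean f / 2 + var_on B f) * indicator B x"
          have lcB: "lc (indicator B :: _ \<Rightarrow> real)" if "B \<in> ?K" for B
            using that clopen_cell[OF D(1,2)] lc_indicator by blast
          have lcg: "lc ?g" by (intro lc_sum[OF K(2)] lc_times lcB)
          have "mean f \<le> mean ?g"
          proof (rule mean_mono[OF F(1) lcg])
            fix x assume xT: "x \<in> topspace T"
            have nn: "0 \<le> (mean f / 2 + var_on B f) * indicator B x" for B
              using m0 var_nonneg(2)[of B f] by (simp add: indicator_def)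
            show "f x \<le> ?g x"
            proof (cases "x \<in> ?A")
              case True
              then have B: "cell D x \<in> ?K" "x \<in> cell D x" using mem_cell[OF xT] by auto
              then obtain q where q: "q \<in> cell D x" "f q < mean f / 2" using neg by force
              have "f x \<le> (mean f / 2 + var_on (cell D x) f) * indicator (cell D x) x"
                using cell_osc[OF F(1) D(2) B(2) q(1)] q(2) B(2) by simp
              also have "\<dots> \<le> ?g x" by (rule member_le_sum[OF B(1) _ K(2)]) (rule nn)
              finally show ?thesis .
            next
              case False
              then show ?thesis using F(2)[rule_format, of x] nn by (simp add: sum_nonneg)
            qed
          qed
          also have "mean ?g = (\<Sum>B\<in>?K. mean (\<lambda>x. (mean f / 2 + var_on B f) * indicator B x))"
            by (intro Bochner_Integration.integral_sum integrable_lc lc_times lcB)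
          also have "\<dots> = (\<Sum>B\<in>?K. (mean f / 2 + var_on B f) * measure \<mu> B)"
            by (rule sum.cong[OF refl]) (use mean_indicator openin_cell[OF D(1,2)] in auto)
          also have "\<dots> = mean f / 2 * (\<Sum>B\<in>?K. measure \<mu> B) + (\<Sum>B\<in>?K. var_on B f * measure \<mu> B)"
            by (simp add: distrib_right sum.distrib sum_distrib_left)
          finally have le: "mean f \<le> mean f / 2 * (\<Sum>B\<in>?K. measure \<mu> B) + (\<Sum>B\<in>?K. var_on B f * measure \<mu> B)" .
          have 1: "mean f / 2 * (\<Sum>B\<in>?K. measure \<mu> B) \<le> mean f / 2"
            using mult_left_mono[OF K(1), of "mean f / 2"] m0 by simp
          have "s ^ m * (\<Sum>B\<in>?K. var_on B f * measure \<mu> B) = (\<Sum>B\<in>?K. var_on B f * (s ^ m * measure \<mu> B))"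
            by (simp add: sum_distrib_left mult.left_commute)
          also have "\<dots> \<le> (\<Sum>B\<in>?K. var_on B f * 1)"
            by (intro sum_mono mult_left_mono small var_nonneg)
          also have "\<dots> \<le> var f" using sum_var_on_le[OF F(1) K(2,3)] by simp
          also have "\<dots> \<le> s ^ m / 4 * mean f"
            using F(4) mult_right_mono[OF m m0] by simp
          finally have "s ^ m * (\<Sum>B\<in>?K. var_on B f * measure \<mu> B) \<le> s ^ m * (mean f / 4)" by simp
          then have "(\<Sum>B\<in>?K. var_on B f * measure \<mu> B) \<le> mean f / 4"
            using s_pos by (simp add: mult_le_cancel_left_pos)
          then show False using le 1 mp by linarith
        qed
        then obtain B where B: "B \<in> ?K" "\<forall>q\<in>B. mean f / 2 \<le> f q" by blast
        then obtain y where y: "y \<in> B" "x = (\<sigma> ^^ (k * p)) y" using cover x by blast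
        have "y \<in> topspace T" using y B by (auto simp: cell_def)
        then have "y \<in> pull (k * p) x" using y by (simp add: pull_def)
        then have "f y \<le> tr (k * p) f x"
          unfolding tr_def by (rule member_le_sum) (use F(3) finite_pull in auto)
        then show ?thesis using B y by force
      qed
    qed
  qed
qed

text \<open>Doeblin-type contraction: under \<open>tr q\<close> with \<open>q = k * p\<close> every function of the cone splits off a
  third of its mean on \<open>Xs i\<close>, and the remainder stays in the cone. So the iterates of two
  functions with the same mean differ by functions whose size is small compared with \<open>s ^ (q * j)\<close>.\<close>

lemma eventually_nonneg:
  assumes i: "i \<in> {1..N}" and F: "lc F" "\<forall>x. x \<notin> Xs i \<longrightarrow> F x = 0" "0 < mean F"
  obtains m where "\<forall>x. 0 \<le> tr m F x"
proof -
  let ?A = "Xs i" and ?\<chi> = "indicator (Xs i) :: _ \<Rightarrow> real"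
  note A = part[OF i]
  obtain k where k: "1 \<le> k" "N dvd k" "4 * (1 + real k) \<le> s ^ k" by (rule good_exponent)
  obtain C where C: "0 \<le> C"
    "\<forall>f. lc f \<longrightarrow> var (tr k f) \<le> (1 + real k) * var f + C * mean (\<lambda>x. \<bar>f x\<bar>)" by (rule lasota_yorke)
  define w where "w = measure \<mu> ?A"
  have w: "0 < w" "w \<le> 1" using full_support[OF A(2,1)] by (auto simp: w_def)
  have lc\<chi>: "lc ?\<chi>" by (rule lc_part[OF i])
  have mean\<chi>: "mean ?\<chi> = w" using mean_indicator[OF A(2)] by (simp add: w_def)
  \<comment> \<open>Large enough for invariance of the cone, and for the indicator of
    \<open>Xs i\<close> to use at most half of the variation that its mean allows.\<close>
  define c where "c = max (4 * C) (2 * var ?\<chi> / w) + 1"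
  have c: "4 * C \<le> c" "1 \<le> c" "2 * var ?\<chi> / w \<le> c" using C by (auto simp: c_def)
  then have c2: "2 * var ?\<chi> \<le> c * w" using w by (simp add: pos_divide_le_eq)
  have \<chi>_cone: "?\<chi> \<in> cone ?A c"
    unfolding cone_def mem_Collect_eq mean\<chi> using lc\<chi> c2 var_nonneg(1)[of ?\<chi>] by simp
  obtain p where p: "1 \<le> p" "\<forall>f\<in>cone ?A c. \<forall>x\<in>?A. mean f / 2 \<le> tr (k * p) f x"
    by (rule minorization[OF i k(1,2), of c]) (use c in auto)
  define q where "q = k * p"
  have Nq: "N dvd q" using k by (simp add: q_def)
  note cone_q = cone_tr_iterate[OF i k(2,3) C c(1), of _ p, folded q_def]
  have sq: "1 \<le> s ^ q" using s_gt_1 by (simp add: one_le_power)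
  \<comment> \<open>Removing a third of the mean on \<open>Xs i\<close> from \<open>tr q f\<close>
    leaves \<open>r\<close> times the mean of \<open>f\<close>; \<open>r < s ^ q\<close> is the
    contraction.\<close>
  define r where "r = s ^ q - w / 3"
  have r: "0 \<le> r" "r < s ^ q" using sq w by (auto simp: r_def)
  \<comment> \<open>Minorization would allow one half of the mean to be removed without losing
    positivity. One third also keeps the remainder in the cone, given the gain of
    \<open>c / 2\<close> and \<open>w \<le> 1 \<le> s ^ q\<close>.\<close>
  have split: "\<exists>h\<in>cone ?A c. mean h = r * mean f \<and> (\<forall>x. tr q f x = mean f / 3 * ?\<chi> x + h x)"
    if f: "f \<in> cone ?A c" for f
  proof -
    note f' = coneD[OF f]
    have m0: "0 \<le> mean f" by (rule mean_nonneg) (use f'(3) in blast)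
    define h where "h = (\<lambda>x. tr q f x + (- (mean f / 3)) * ?\<chi> x)"
    have lch: "lc h" unfolding h_def by (intro lc_plus lc_times lc_tr f' lc\<chi>)
    have mh: "mean h = r * mean f"
      using Bochner_Integration.integral_add[OF integrable_lc[OF lc_tr[OF f'(1)]] integrable_lc[OF lc_times[OF lc\<chi>]],
          of q "- (mean f / 3)"]
      unfolding h_def integral_mult_right_zero mean_tr[OF f'(1)] mean\<chi> r_def by (simp only: algebra_simps) simp
    have "var h \<le> var (tr q f) + mean f / 3 * var ?\<chi>"
      using var_add[OF lc_tr[OF f'(1)] lc_times[OF lc\<chi>], of q "- (mean f / 3)"] m0
      unfolding h_def var_scale by simp
    also have "\<dots> \<le> c / 2 * (s ^ q * mean f) + mean f / 3 * (c * w / 2)"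
      using cone_q(2)[OF f p(1)] c2 m0 unfolding mean_tr[OF f'(1)]
      by (intro add_mono mult_left_mono) auto
    also have "\<dots> \<le> c * (r * mean f)"
    proof -
      have "c / 2 * s ^ q + c * w / 6 \<le> c * r"
      proof -
        have "s ^ q / 2 + w / 6 \<le> r" using sq w by (simp add: r_def)
        then have "c * (s ^ q / 2 + w / 6) \<le> c * r" using c by (intro mult_left_mono) auto
        then show ?thesis by (simp add: algebra_simps)
      qed
      from mult_right_mono[OF this m0] show ?thesis by (simp add: algebra_simps)
    qed
    finally have varh: "var h \<le> c * mean h" by (simp add: mh)
    have "0 \<le> h x" for x
    proof (cases "x \<in> ?A")
      case True
      then show ?thesis using p(2) f m0 unfolding h_def q_def by force
    next
      case False
      then show ?thesis using tr_nonneg[of f q x] f'(3) by (simp add: h_def)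
    qed
    moreover have "\<forall>x. x \<notin> ?A \<longrightarrow> h x = 0" using tr_supported[OF i Nq f'(2)] by (simp add: h_def)
    ultimately have "h \<in> cone ?A c" using lch varh by (auto simp: cone_def)
    then show ?thesis using mh by (intro bexI[of _ h]) (auto simp: h_def)
  qed
  have tr_q: "tr (q * Suc j) f = tr q (tr (q * j) f)" for j and f :: "_ \<Rightarrow> real"
    using tr_add[of q "q * j" f] by (simp add: fun_eq_iff)
  \<comment> \<open>The pieces split off from two functions of equal mean cancel in the difference,
    so only remainders, whose mean is \<open>r ^ j\<close> times the original, survive.\<close>
  have contract: "\<exists>f'\<in>cone ?A c. \<exists>g'\<in>cone ?A c. mean f' = r ^ j * mean f \<and> mean g' = r ^ j * mean f \<and>
      (\<forall>x\<in>topspace T. tr (q * j) f x - tr (q * j) g x = f' x - g' x)"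
    if fg: "f \<in> cone ?A c" "g \<in> cone ?A c" "mean f = mean g" for f g j
  proof (induction j)
    case 0
    show ?case using fg by (intro bexI[of _ f] bexI[of _ g]) (auto simp: tr_0)
  next
    case (Suc j)
    then obtain f' g' where *: "f' \<in> cone ?A c" "g' \<in> cone ?A c" "mean f' = r ^ j * mean f"
      "mean g' = r ^ j * mean f" "\<forall>x\<in>topspace T. tr (q * j) f x - tr (q * j) g x = f' x - g' x" by blast
    obtain f'' where f'': "f'' \<in> cone ?A c" "mean f'' = r * mean f'" "\<forall>x. tr q f' x = mean f' / 3 * ?\<chi> x + f'' x"
      using split[OF *(1)] by blast
    obtain g'' where g'': "g'' \<in> cone ?A c" "mean g'' = r * mean g'" "\<forall>x. tr q g' x = mean g' / 3 * ?\<chi> x + g'' x"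
      using split[OF *(2)] by blast
    have "tr (q * Suc j) f x - tr (q * Suc j) g x = f'' x - g'' x" for x
    proof -
      have "tr (q * Suc j) f x - tr (q * Suc j) g x = tr q (\<lambda>x. tr (q * j) f x - tr (q * j) g x) x"
        unfolding tr_q by (rule tr_diff[symmetric])
      also have "\<dots> = tr q (\<lambda>x. f' x - g' x) x" by (rule tr_cong) (use * in auto)
      also have "\<dots> = f'' x - g'' x" using spec[OF f''(3), of x] spec[OF g''(3), of x] *(3,4) by (simp add: tr_diff)
      finally show ?thesis .
    qed
    then show ?case using f'' g'' * by (intro bexI[of _ f''] bexI[of _ g'']) auto
  qed
  define M where "M = mean F"
  obtain B where B: "0 \<le> B" "\<forall>x\<in>topspace T. \<bar>F x\<bar> \<le> B" by (rule lc_bounded[OF F(1)])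
  \<comment> \<open>Adding \<open>b\<close> times the indicator makes \<open>F\<close> nonnegative
    through the first summand and brings its variation under the cone bound through the
    second.\<close>
  define b where "b = B + 2 * var F / (c * w)"
  have cw: "0 < c * w" using c w by simp
  have b: "B \<le> b" "var F \<le> b * (c * w / 2)" "0 \<le> b"
    using cw B var_nonneg(1)[of F] by (auto simp: b_def field_simps)
  define f1 where "f1 = (\<lambda>x. F x + b * ?\<chi> x)"
  \<comment> \<open>The multiple of the indicator with the same mean as \<open>f1\<close>. Then
    \<open>F\<close> is \<open>f1 - g1\<close> plus the constant \<open>M / w\<close> on
    \<open>Xs i\<close>, and the last term decides the sign.\<close>
  define g1 where "g1 = (\<lambda>x. (b + M / w) * ?\<chi> x)"
  have M: "0 < M" using F by (simp add: M_def)
  have mf1: "mean f1 = M + b * w" unfolding f1_def M_def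
    using Bochner_Integration.integral_add[OF integrable_lc[OF F(1)] integrable_lc[OF lc_times[OF lc\<chi>]], of b]
    unfolding integral_mult_right_zero mean\<chi> .
  have mg1: "mean g1 = M + b * w" unfolding g1_def integral_mult_right_zero mean\<chi> using w by (simp add: field_simps)
  have f1: "f1 \<in> cone ?A c"
  proof -
    have "0 \<le> f1 x" for x
    proof (cases "x \<in> ?A")
      case True
      then have "x \<in> topspace T" using A(4) by auto
      then have "\<bar>F x\<bar> \<le> B" using B by auto
      then show ?thesis using True b(1) by (simp add: f1_def)
    next
      case False then show ?thesis using F(2)[rule_format, of x] by (simp add: f1_def)
    qed
    moreover have "var f1 \<le> c * mean f1"
    proof -
      have "var f1 \<le> var F + b * var ?\<chi>"
        unfolding f1_def using var_add[OF F(1) lc_times[OF lc\<chi>, of b]] b(3) by (simp add: var_scale)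
      also have "\<dots> \<le> b * (c * w / 2) + b * (c * w / 2)"
        using b c2 by (intro add_mono mult_left_mono) auto
      also have "\<dots> \<le> c * mean f1" using M c by (simp add: mf1 algebra_simps)
      finally show ?thesis .
    qed
    ultimately show ?thesis using F by (auto simp: cone_def f1_def intro!: lc_plus lc_times lc\<chi>)
  qed
  have g1: "g1 \<in> cone ?A c"
  proof -
    have d: "0 \<le> b + M / w" using b M w by simp
    have "var g1 = (b + M / w) * var ?\<chi>" unfolding g1_def using d by (simp add: var_scale)
    also have "\<dots> \<le> (b + M / w) * (c * w)" using d c2 var_nonneg(1)[of ?\<chi>] by (intro mult_left_mono) auto
    also have "\<dots> = c * mean g1" unfolding g1_def integral_mult_right_zero mean\<chi> by simp
    finally show ?thesis using d by (auto simp: cone_def g1_def intro!: lc_times lc\<chi>)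
  qed
  \<comment> \<open>\<open>c + 1\<close> bounds the supremum by the mean in the cone. The threshold
    is chosen so that the error stays below the main term, which is at least
    \<open>M * s ^ (q * j) / 2\<close>.\<close>
  have "(\<lambda>j. (c + 1) * mean f1 * (r / s ^ q) ^ j) \<longlonglongrightarrow> (c + 1) * mean f1 * 0"
    using r sq by (intro tendsto_mult_left LIMSEQ_power_zero) simp
  then have "\<forall>\<^sub>F j in sequentially. (c + 1) * mean f1 * (r / s ^ q) ^ j < M / (2 * s ^ q)"
    by (rule order_tendstoD) (use M sq in auto)
  then obtain j where j: "(c + 1) * mean f1 * (r / s ^ q) ^ Suc j < M / (2 * s ^ q)"
    unfolding eventually_sequentially by (meson Suc_n_not_le_n le_SucI nat_le_linear)
  obtain f' g' where fg': "f' \<in> cone ?A c" "g' \<in> cone ?A c" "mean f' = r ^ Suc j * mean f1"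
      "mean g' = r ^ Suc j * mean f1"
      "\<forall>x\<in>topspace T. tr (q * Suc j) f1 x - tr (q * Suc j) g1 x = f' x - g' x"
    using contract[OF f1 g1, of "Suc j"] mf1 mg1 by auto
  have small: "(c + 1) * mean g' \<le> M * s ^ (q * j) / 2"
  proof -
    have "s ^ (q * Suc j) = (s ^ q) ^ Suc j" by (rule power_mult)
    then have "(c + 1) * mean g' = s ^ (q * Suc j) * ((c + 1) * mean f1 * (r / s ^ q) ^ Suc j)"
      using fg'(4) s_pos by (simp only: power_divide) simp
    also have "\<dots> \<le> s ^ (q * Suc j) * (M / (2 * s ^ q))" using j s_pos by (intro mult_left_mono) auto
    also have "\<dots> = M * s ^ (q * j) / 2" using s_pos by (simp add: power_add field_simps)
    finally show ?thesis .
  qed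
  have "0 \<le> tr (q * Suc j) F x" for x
  proof (cases "x \<in> ?A")
    case False
    then show ?thesis using tr_supported[OF i _ F(2), of "q * Suc j" x] Nq by simp
  next
    case True
    then have xT: "x \<in> topspace T" using A by auto
    have Feq: "F = (\<lambda>x. (f1 x - g1 x) + M / w * ?\<chi> x)" by (simp add: f1_def g1_def fun_eq_iff algebra_simps)
    have "tr (q * Suc j) F x = (tr (q * Suc j) f1 x - tr (q * Suc j) g1 x) + M / w * tr (q * Suc j) ?\<chi> x"
      by (subst Feq) (simp only: tr_plus tr_diff tr_scale)
    also have "tr (q * Suc j) f1 x - tr (q * Suc j) g1 x = f' x - g' x" using fg'(5) xT by blast
    finally have eq: "tr (q * Suc j) F x = f' x - g' x + M / w * tr (q * Suc j) ?\<chi> x" .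
    have "tr (q * j) ?\<chi> \<in> cone ?A c"
      using cone_tr_iterate(1)[OF i k(2,3) C c(1) \<chi>_cone, of "p * j"] by (simp add: q_def mult.assoc)
    then have "mean (tr (q * j) ?\<chi>) / 2 \<le> tr q (tr (q * j) ?\<chi>) x" using p(2) True by (simp add: q_def)
    then have "s ^ (q * j) * w / 2 \<le> tr (q * Suc j) ?\<chi> x" by (simp only: tr_q mean_tr[OF lc\<chi>] mean\<chi>)
    then have "M / w * (s ^ (q * j) * w / 2) \<le> M / w * tr (q * Suc j) ?\<chi> x"
      using M w by (intro mult_left_mono) auto
    then have 1: "M * s ^ (q * j) / 2 \<le> M / w * tr (q * Suc j) ?\<chi> x" using w by simp
    have g': "lc g'" "\<forall>x. 0 \<le> g' x" "var g' \<le> c * mean g'" using fg'(2) by (auto simp: cone_def)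
    have "mean (\<lambda>x. \<bar>g' x\<bar>) = mean g'" by (rule mean_cong) (use g'(2) abs_of_nonneg in blast)
    then have "g' x \<le> (c + 1) * mean g'" using sup_bound[OF g'(1) xT] g'(3) by (simp add: distrib_right)
    moreover have "0 \<le> f' x" using coneD(3)[OF fg'(1)] by blast
    ultimately show ?thesis using eq 1 small by linarith
  qed
  then show thesis using that by blast
qed

end

section \<open>Entropy of factors\<close>

text \<open>Fekete's subadditivity argument. The entropy is defined through \<open>lim\<close>,
  which is informative only once convergence is known.\<close>

lemma fekete:
  fixes u :: "nat \<Rightarrow> real"
  assumes sub: "\<And>m k. u (m + k) \<le> u m + u k" and nonneg: "\<And>m. 0 \<le> u m"
  shows "convergent (\<lambda>m. u m / real m)"
proof -
  define L where "L = (INF m\<in>{1..}. u m / real m)"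
  have bdd: "bdd_below ((\<lambda>m. u m / real m) ` {1..})"
    by (rule bdd_belowI2[of _ 0]) (simp add: nonneg)
  have low: "L \<le> u m / real m" if "1 \<le> m" for m
    unfolding L_def by (rule cINF_lower[OF bdd]) (use that in simp)
  have mult: "u (m0 * q + r) \<le> real q * u m0 + u r" for m0 q r
  proof (induction q)
    case (Suc q)
    have "u (m0 * Suc q + r) \<le> u m0 + u (m0 * q + r)" using sub[of m0 "m0 * q + r"] by (simp add: add.assoc)
    then show ?case using Suc by (simp add: algebra_simps)
  qed simp
  have "(\<lambda>m. u m / real m) \<longlonglongrightarrow> L"
  proof (rule LIMSEQ_I)
    fix e :: real assume e: "0 < e"
    obtain m0 where m0: "1 \<le> m0" "u m0 / real m0 < L + e / 2"
    proof -
      have "\<exists>m\<in>{1..}. u m / real m < L + e / 2"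
        using cINF_less_iff[OF _ bdd, of "L + e / 2"] e unfolding L_def by auto
      then show thesis using that by auto
    qed
    define B where "B = (\<Sum>r<m0. u r)"
    have B: "u r \<le> B" if "r < m0" for r
      unfolding B_def by (rule member_le_sum) (use that nonneg in auto)
    have B0: "0 \<le> B" unfolding B_def by (rule sum_nonneg) (rule nonneg)
    obtain M where M: "2 * B / e < real M" using reals_Archimedean2 by blast
    have "norm (u m / real m - L) < e" if m: "max M 1 \<le> m" for m
    proof -
      have m1: "1 \<le> m" "0 < real m" and "M \<le> m" using m by auto
      have "2 * B / e < real m" using M \<open>M \<le> m\<close> by linarith
      then have Bm: "B / real m < e / 2" using e m1 by (simp add: field_simps)
      have "u m \<le> real (m div m0) * u m0 + u (m mod m0)" using mult[of m0 "m div m0" "m mod m0"] by simp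
      also have "\<dots> \<le> real (m div m0) * u m0 + B" using B[of "m mod m0"] m0 by simp
      finally have 1: "u m / real m \<le> (real (m div m0) * u m0 + B) / real m" using m1 by (intro divide_right_mono) auto
      have "real (m div m0) * real m0 \<le> real m"
        by (metis of_nat_le_iff of_nat_mult div_times_less_eq_dividend)
      then have "real (m div m0) * real m0 * (u m0 / real m0) \<le> real m * (u m0 / real m0)"
        by (rule mult_right_mono) (simp add: nonneg)
      then have "real (m div m0) * u m0 \<le> real m * (u m0 / real m0)" using m0 by simp
      then have "real (m div m0) * u m0 / real m \<le> u m0 / real m0" using m1 by (simp add: pos_divide_le_eq mult.commute)
      then have "u m / real m < L + e" using 1 m0(2) Bm unfolding add_divide_distrib by linarith
      then show ?thesis using low[OF m1(1)] e by (simp add: abs_less_iff)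
    qed
    then show "\<exists>no. \<forall>m\<ge>no. norm (u m / real m - L) < e" by blast
  qed
  then show ?thesis by (rule convergentI)
qed

section \<open>Cover numbers of iterated covers\<close>

lemma cover_number_le:
  assumes "V \<subseteq> W" "finite V" "\<Union>V = topspace Y" shows "cover_number Y W \<le> card V"
  unfolding cover_number_def by (rule Least_le) (use assms in blast)

text \<open>\<open>LEAST\<close> is meaningful only if some finite subcover exists, hence the
  hypothesis.\<close>

lemma cover_number_witness:
  assumes "\<exists>V\<subseteq>W. finite V \<and> \<Union>V = topspace Y"
  obtains V where "V \<subseteq> W" "finite V" "card V = cover_number Y W" "\<Union>V = topspace Y"
proof -
  have "\<exists>k. \<exists>V\<subseteq>W. finite V \<and> card V = k \<and> \<Union>V = topspace Y" using assms by blast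
  then have "\<exists>V\<subseteq>W. finite V \<and> card V = cover_number Y W \<and> \<Union>V = topspace Y"
    unfolding cover_number_def by (rule LeastI_ex)
  then show thesis using that by blast
qed

text \<open>Members of a subcover for the first \<open>m\<close> times are intersected with
  preimages under \<open>g ^^ m\<close> of members for the next \<open>k\<close> times; the choices
  of open sets are concatenated.\<close>

lemma cover_number_submultiplicative:
  assumes g: "g \<in> topspace Y \<rightarrow> topspace Y"
    and m: "\<exists>V\<subseteq>iterated_cover Y g U m. finite V \<and> \<Union>V = topspace Y"
    and k: "\<exists>V\<subseteq>iterated_cover Y g U k. finite V \<and> \<Union>V = topspace Y"
  shows "cover_number Y (iterated_cover Y g U (m + k)) \<le>
    cover_number Y (iterated_cover Y g U m) * cover_number Y (iterated_cover Y g U k)"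
proof -
  have gpow: "(g ^^ j) x \<in> topspace Y" if "x \<in> topspace Y" for j x
    using that g by (induction j) auto
  obtain V where V: "V \<subseteq> iterated_cover Y g U m" "finite V"
    "card V = cover_number Y (iterated_cover Y g U m)" "\<Union>V = topspace Y" by (rule cover_number_witness[OF m])
  obtain V' where V': "V' \<subseteq> iterated_cover Y g U k" "finite V'"
    "card V' = cover_number Y (iterated_cover Y g U k)" "\<Union>V' = topspace Y" by (rule cover_number_witness[OF k])
  let ?h = "\<lambda>(A, B). A \<inter> {x \<in> topspace Y. (g ^^ m) x \<in> B}"
  have "?h ` (V \<times> V') \<subseteq> iterated_cover Y g U (m + k)"
  proof clarify
    fix A B assume "A \<in> V" "B \<in> V'"
    then have "A \<in> iterated_cover Y g U m" "B \<in> iterated_cover Y g U k" using V V' by auto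
    then obtain w w' where w: "A = {x \<in> topspace Y. \<forall>j<m. (g ^^ j) x \<in> w j}" "\<forall>j<m. w j \<in> U"
      and w': "B = {x \<in> topspace Y. \<forall>j<k. (g ^^ j) x \<in> w' j}" "\<forall>j<k. w' j \<in> U"
      unfolding iterated_cover_def by auto
    define v where "v j = (if j < m then w j else w' (j - m))" for j
    have "A \<inter> {x \<in> topspace Y. (g ^^ m) x \<in> B} = {x \<in> topspace Y. \<forall>j<m + k. (g ^^ j) x \<in> v j}"
    proof (rule equalityI; rule subsetI)
      fix x assume x: "x \<in> A \<inter> {x \<in> topspace Y. (g ^^ m) x \<in> B}"
      have "(g ^^ j) x \<in> v j" if "j < m + k" for j
      proof (cases "j < m")
        case False
        then have "(g ^^ (j - m)) ((g ^^ m) x) \<in> w' (j - m)" using x w' that by auto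
        then show ?thesis using False by (simp add: v_def funpow_add[symmetric, THEN fun_cong, unfolded o_apply])
      qed (use x w in \<open>auto simp: v_def\<close>)
      then show "x \<in> {x \<in> topspace Y. \<forall>j<m + k. (g ^^ j) x \<in> v j}" using x by auto
    next
      fix x assume x: "x \<in> {x \<in> topspace Y. \<forall>j<m + k. (g ^^ j) x \<in> v j}"
      have "(g ^^ j) x \<in> w j" if "j < m" for j
      proof -
        have "(g ^^ j) x \<in> v j" using x that by simp
        then show ?thesis using that by (simp add: v_def)
      qed
      moreover have "(g ^^ j) ((g ^^ m) x) \<in> w' j" if "j < k" for j
      proof -
        have "(g ^^ (j + m)) x \<in> v (j + m)" using x that by simp
        then show ?thesis by (simp add: v_def funpow_add)
      qed
      ultimately show "x \<in> A \<inter> {x \<in> topspace Y. (g ^^ m) x \<in> B}" using x w w' gpow by simp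
    qed
    moreover have "\<forall>j<m + k. v j \<in> U" using w(2) w'(2) by (auto simp: v_def)
    ultimately show "A \<inter> {x \<in> topspace Y. (g ^^ m) x \<in> B} \<in> iterated_cover Y g U (m + k)"
      unfolding iterated_cover_def by blast
  qed
  moreover have "\<Union>(?h ` (V \<times> V')) = topspace Y"
  proof
    show "\<Union>(?h ` (V \<times> V')) \<subseteq> topspace Y" by auto
    show "topspace Y \<subseteq> \<Union>(?h ` (V \<times> V'))"
    proof
      fix x assume x: "x \<in> topspace Y"
      then obtain A where A: "A \<in> V" "x \<in> A" using V(4) by blast
      have "(g ^^ m) x \<in> \<Union>V'" using gpow[OF x] V'(4) by simp
      then obtain B where B: "B \<in> V'" "(g ^^ m) x \<in> B" by blast
      have "x \<in> ?h (A, B)" using A B x by simp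
      then show "x \<in> \<Union>(?h ` (V \<times> V'))" using A(1) B(1) by blast
    qed
  qed
  ultimately have "cover_number Y (iterated_cover Y g U (m + k)) \<le> card (?h ` (V \<times> V'))"
    by (intro cover_number_le) (use V V' in auto)
  also have "\<dots> \<le> card (V \<times> V')" by (rule card_image_le) (use V V' in auto)
  finally show ?thesis using V V' by (simp add: card_cartesian_product)
qed

context gap_system begin

section \<open>Counting labels\<close>

lemma lab_add: "lab D (m + k) p = lab D m p @ lab D k ((\<sigma> ^^ m) p)"
  by (rule nth_equalityI) (auto simp: lab_def nth_append funpow_add[symmetric, THEN fun_cong, unfolded o_apply])

text \<open>Cutting a label into blocks of length \<open>k\<close> lets a bound on labels of length
  \<open>k\<close> be multiplied up to length \<open>k * j\<close>.\<close>

lemma lab_blocks: "lab D (k * j) p = concat (map (\<lambda>i. lab D k ((\<sigma> ^^ (k * i)) p)) [0..<j])"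
proof (induction j)
  case (Suc j)
  have "lab D (k * Suc j) p = lab D (k * j + k) p" by (simp add: add.commute)
  then show ?case using Suc by (simp add: lab_add)
qed (simp add: lab_def)

lemma lab_eq_iff: "lab D m p = lab D m q \<longleftrightarrow> (\<forall>j<m. below D ((\<sigma> ^^ j) p) = below D ((\<sigma> ^^ j) q))"
  by (auto simp: lab_def)

lemma below_gap: assumes "D \<subseteq> \<Gamma>" "u \<in> \<Gamma>" shows "below D (u, True) = below D (u, False) \<longleftrightarrow> u \<notin> D"
proof
  assume "below D (u, True) = below D (u, False)"
  then show "u \<notin> D" using upper_mem[OF assms(2)] lower_mem[OF assms(2)] unfolding below_eq_iff by blast
next
  assume "u \<notin> D"
  then show "below D (u, True) = below D (u, False)"
    using adjacent[OF assms(2)] assms(1) unfolding below_eq_iff by blast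
qed

text \<open>While the two sides of a gap are not separated by \<open>D\<close>, their images are again the two sides of
  a gap. Hence the first separation happens at a preimage of a gap in \<open>D\<close>.\<close>

lemma jumps_lab:
  assumes D: "finite D" "D \<subseteq> \<Gamma>" "P \<subseteq> D" and t: "t \<in> jumps (lab D m)"
  shows "\<exists>j<m. \<exists>z\<in>D \<times> UNIV. (t, False) \<in> pull j z"
proof -
  have tG: "t \<in> \<Gamma>" and ne: "lab D m (t, True) \<noteq> lab D m (t, False)" using t by (auto simp: jumps_def)
  let ?sep = "\<lambda>j. below D ((\<sigma> ^^ j) (t, True)) \<noteq> below D ((\<sigma> ^^ j) (t, False))"
  have ex: "\<exists>j. j < m \<and> ?sep j" using ne unfolding lab_eq_iff by blast
  define j where "j = (LEAST j. j < m \<and> ?sep j)"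
  have j: "j < m" "?sep j" using LeastI_ex[OF ex] by (auto simp: j_def)
  have before: "\<not> ?sep i" if "i < j" for i
    using not_less_Least[of i "\<lambda>j. j < m \<and> ?sep j"] that j(1) by (auto simp: j_def)
  \<comment> \<open>The flag \<open>b\<close> records which image is the upper side, since \<sigma>
    may exchange the two sides at every step.\<close>
  have pair: "i \<le> j \<Longrightarrow> \<exists>u\<in>\<Gamma>. \<exists>b. (\<sigma> ^^ i) (t, True) = (u, b) \<and> (\<sigma> ^^ i) (t, False) = (u, \<not> b)" for i
  proof (induction i)
    case 0 then show ?case using tG by auto
  next
    case (Suc i)
    then obtain u b where u: "u \<in> \<Gamma>" "(\<sigma> ^^ i) (t, True) = (u, b)" "(\<sigma> ^^ i) (t, False) = (u, \<not> b)" by auto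
    have "\<not> ?sep i" using before Suc by simp
    then have same: "below D (u, True) = below D (u, False)" using u by (cases b) auto
    then have "u \<notin> D" using below_gap[OF D(2) u(1)] by blast
    then have "u \<notin> P" using D by blast
    then have f: "fst (\<sigma> (u, True)) = fst (\<sigma> (u, False))" "fst (\<sigma> (u, False)) \<in> \<Gamma>"
      using gap_to_gap[OF u(1)] by auto
    have "below P (u, True) = below P (u, False)" using same D(3) by (rule below_mono)
    then have "\<sigma> (u, True) \<noteq> \<sigma> (u, False)"
      using inj_cell[of "(u, True)" "(u, False)"] lower_in_space[OF u(1)] upper_in_space[OF u(1)] by blast
    then have "snd (\<sigma> (u, True)) \<noteq> snd (\<sigma> (u, False))" using f(1) by (simp add: prod_eq_iff)
    then have "\<sigma> (u, b) = (fst (\<sigma> (u, False)), snd (\<sigma> (u, b)))"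
      "\<sigma> (u, \<not> b) = (fst (\<sigma> (u, False)), \<not> snd (\<sigma> (u, b)))"
      using f(1) by (cases b; auto simp: prod_eq_iff)+
    then show ?case using f(2) u by auto
  qed
  then obtain u b where u: "u \<in> \<Gamma>" "(\<sigma> ^^ j) (t, True) = (u, b)" "(\<sigma> ^^ j) (t, False) = (u, \<not> b)" by blast
  have "below D (u, True) \<noteq> below D (u, False)" using j(2) u by (cases b) auto
  then have "u \<in> D" using below_gap[OF D(2) u(1)] by blast
  moreover have "(t, False) \<in> pull j (u, \<not> b)" using u lower_in_space[OF tG] by (simp add: pull_def)
  ultimately show ?thesis using j(1) by blast
qed

text \<open>There is at most one label more than there are jumps, and each jump is a preimage of a
  side of a gap of \<open>D\<close> at one of \<open>m\<close> times. \<open>tr_growth\<close>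
  counts these preimages; the extra factor \<open>m\<close> does not affect the exponential
  rate.\<close>

lemma card_labels:
  assumes D: "finite D" "D \<subseteq> \<Gamma>" "P \<subseteq> D"
  obtains c where "0 \<le> c" "\<forall>m. real (card (lab D m ` topspace T)) \<le> 1 + real m * c * s ^ m"
proof -
  obtain K where K: "0 < K" "\<forall>m x. tr m (\<lambda>_. 1) x \<le> K * s ^ m" by (rule tr_growth)
  define c where "c = real (card (D \<times> (UNIV :: bool set))) * K"
  have fin: "finite (D \<times> (UNIV :: bool set))" using D by simp
  have "real (card (lab D m ` topspace T)) \<le> 1 + real m * c * s ^ m" for m
  proof -
    let ?S = "\<Union>j<m. \<Union>z\<in>D \<times> UNIV. pull j z"
    have finS: "finite ?S" using fin finite_pull by auto
    have "jumps (lab D m) \<subseteq> fst ` ?S"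
    proof
      fix t assume "t \<in> jumps (lab D m)"
      then obtain j z where "j < m" "z \<in> D \<times> UNIV" "(t, False) \<in> pull j z" using jumps_lab[OF D] by blast
      then show "t \<in> fst ` ?S" by (intro image_eqI[of _ _ "(t, False)"]) auto
    qed
    then have "card (jumps (lab D m)) \<le> card (fst ` ?S)" by (rule card_mono[rotated]) (use finS in simp)
    also have "\<dots> \<le> card ?S" by (rule card_image_le[OF finS])
    finally have "real (card (jumps (lab D m))) \<le> real (card ?S)" by simp
    also have "\<dots> \<le> real (\<Sum>j<m. \<Sum>z\<in>D \<times> UNIV. card (pull j z))"
      unfolding of_nat_le_iff by (rule order.trans[OF card_UN_le]) (auto intro!: sum_mono card_UN_le fin)
    also have "\<dots> = (\<Sum>j<m. \<Sum>z\<in>D \<times> UNIV. real (card (pull j z)))" by simp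
    also have "\<dots> \<le> (\<Sum>j<m. \<Sum>z\<in>D \<times> (UNIV :: bool set). K * s ^ m)"
    proof (intro sum_mono)
      fix j z assume "j \<in> {..<m}"
      have "real (card (pull j z)) = tr j (\<lambda>_. 1) z" by (simp add: tr_def)
      also have "\<dots> \<le> K * s ^ j" using K by blast
      also have "\<dots> \<le> K * s ^ m"
        by (intro mult_left_mono power_increasing) (use \<open>j \<in> {..<m}\<close> K s_gt_1 in auto)
      finally show "real (card (pull j z)) \<le> K * s ^ m" .
    qed
    also have "\<dots> = real m * c * s ^ m" by (simp add: c_def)
    finally have "real (card (jumps (lab D m))) \<le> real m * c * s ^ m" .
    moreover have "card (lab D m ` topspace T) \<le> card (jumps (lab D m)) + 1"
      by (rule card_image_le_jumps[OF lc_lab[OF D(1,2)]])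
    ultimately show ?thesis by linarith
  qed
  moreover have "0 \<le> c" using K by (simp add: c_def)
  ultimately show thesis using that by blast
qed

text \<open>The label classes cover a space of measure one, and each has measure at most the
  reciprocal of \<open>s ^ m\<close>.\<close>

lemma many_labels: "s ^ m \<le> real (card (lab P m ` topspace T))"
proof -
  let ?L = "lab P m ` topspace T" and ?C = "\<lambda>l. {q \<in> topspace T. lab P m q = l}"
  have fin: "finite ?L" by (rule finite_image_lc[OF lc_lab[OF finite_P P_gaps]])
  have ev: "?C l \<in> events" for l
    using open_sets[OF openin_lc[OF lc_lab[OF finite_P P_gaps], of m "{l}"]] by simp
  have "(\<Union>l\<in>?L. ?C l) = space \<mu>" by (auto simp: space_mu)
  then have "1 \<le> (\<Sum>l\<in>?L. measure \<mu> (?C l))"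
    using finite_measure_subadditive_finite[OF fin, of ?C] ev prob_space by (auto simp: image_subset_iff)
  then have "s ^ m * 1 \<le> s ^ m * (\<Sum>l\<in>?L. measure \<mu> (?C l))" using s_pos by (intro mult_left_mono) auto
  also have "\<dots> = (\<Sum>l\<in>?L. s ^ m * measure \<mu> (?C l))" by (rule sum_distrib_left)
  also have "\<dots> \<le> (\<Sum>l\<in>?L. 1)" by (rule sum_mono) (rule label_measure)
  finally show ?thesis by simp
qed

section \<open>Entropy of an equivariant image of the gap system\<close>

context
  fixes Y :: "'y topology" and g :: "'y \<Rightarrow> 'y" and \<pi> :: "'b \<times> bool \<Rightarrow> 'y"
  assumes pi_cont: "continuous_map T Y \<pi>" and pi_surj: "\<pi> ` topspace T = topspace Y"
    and equivariant: "\<And>p. p \<in> topspace T \<Longrightarrow> \<pi> (\<sigma> p) = g (\<pi> p)"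
begin

lemma equivariant_funpow: "p \<in> topspace T \<Longrightarrow> \<pi> ((\<sigma> ^^ m) p) = (g ^^ m) (\<pi> p)"
  by (induction m) (simp_all add: equivariant funpow_space)

lemma pi_space: "p \<in> topspace T \<Longrightarrow> \<pi> p \<in> topspace Y"
  using pi_surj by (metis imageI)

lemma g_space: "g \<in> topspace Y \<rightarrow> topspace Y"
proof
  fix y assume "y \<in> topspace Y"
  then obtain p where "p \<in> topspace T" "y = \<pi> p" using pi_surj by blast
  then have "g y = \<pi> (\<sigma> p)" "\<sigma> p \<in> topspace T" using equivariant map_space by auto
  then show "g y \<in> topspace Y" using pi_surj by blast
qed

text \<open>The gaps are chosen so fine that every cell maps into one member of the cover. A label
  of length \<open>m\<close> then determines a member of the iterated cover that contains the images
  of all points with that label.\<close>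

lemma subcover_by_labels:
  assumes U: "open_cover Y U"
  obtains D where "finite D" "D \<subseteq> \<Gamma>" "P \<subseteq> D"
    "\<forall>m. \<exists>V\<subseteq>iterated_cover Y g U m. finite V \<and> \<Union>V = topspace Y \<and> card V \<le> card (lab D m ` topspace T)"
proof -
  have "\<exists>D. finite D \<and> D \<subseteq> \<Gamma> \<and> (\<exists>W\<in>U. \<pi> ` cell D p \<subseteq> W)" if p: "p \<in> topspace T" for p
  proof -
    have "\<pi> p \<in> \<Union>U" using U pi_space[OF p] unfolding open_cover_def by simp
    then obtain W where W: "W \<in> U" "\<pi> p \<in> W" by blast
    have "openin T {q \<in> topspace T. \<pi> q \<in> W}"
      by (rule openin_continuous_map_preimage[OF pi_cont]) (use U W in \<open>auto simp: open_cover_def\<close>)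
    then obtain D where D: "finite D" "D \<subseteq> \<Gamma>" "cell D p \<subseteq> {q \<in> topspace T. \<pi> q \<in> W}"
      by (rule cell_base[of _ p]) (use p W in auto)
    then have "\<pi> ` cell D p \<subseteq> W" by blast
    then show ?thesis using D W by blast
  qed
  moreover have "\<exists>W\<in>U. \<pi> ` B \<subseteq> W" if "\<exists>W\<in>U. \<pi> ` A \<subseteq> W" "B \<subseteq> A" for A B
    using that by (meson image_mono subset_trans)
  ultimately obtain D0 where D0: "finite D0" "D0 \<subseteq> \<Gamma>" "\<And>p. p \<in> topspace T \<Longrightarrow> \<exists>W\<in>U. \<pi> ` cell D0 p \<subseteq> W"
    by (rule uniform_cells[of "\<lambda>A. \<exists>W\<in>U. \<pi> ` A \<subseteq> W"]) iprover+
  \<comment> \<open>\<open>P\<close> is included because counting labels requires it.\<close>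
  define D where "D = D0 \<union> P"
  have D: "finite D" "D \<subseteq> \<Gamma>" "P \<subseteq> D" using D0 finite_P P_gaps by (auto simp: D_def)
  have "\<exists>W. W \<in> U \<and> \<pi> ` cell D p \<subseteq> W" if p: "p \<in> topspace T" for p
  proof -
    have "cell D p \<subseteq> cell D0 p"
    proof
      fix q assume "q \<in> cell D p"
      then have q: "q \<in> topspace T" "below D q = below D p" by (simp_all add: cell_def)
      have "below D0 q = below D0 p" by (rule below_mono[OF q(2)]) (simp add: D_def)
      then show "q \<in> cell D0 p" using q(1) by (simp add: cell_def)
    qed
    then show ?thesis using D0(3)[OF p] by (meson image_mono subset_trans)
  qed
  then obtain w where w: "\<And>p. p \<in> topspace T \<Longrightarrow> w p \<in> U \<and> \<pi> ` cell D p \<subseteq> w p" by metis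
  have "\<exists>V\<subseteq>iterated_cover Y g U m. finite V \<and> \<Union>V = topspace Y \<and> card V \<le> card (lab D m ` topspace T)" for m
  proof -
    define M where "M p = {y \<in> topspace Y. \<forall>k<m. (g ^^ k) y \<in> w ((\<sigma> ^^ k) p)}" for p
    have M: "M p \<in> iterated_cover Y g U m" if "p \<in> topspace T" for p
    proof -
      have "\<forall>k<m. w ((\<sigma> ^^ k) p) \<in> U" using w[OF funpow_space[OF that]] by simp
      then show ?thesis unfolding M_def iterated_cover_def mem_Collect_eq
        by (intro exI[of _ "\<lambda>k. w ((\<sigma> ^^ k) p)"]) simp
    qed
    have in_M: "\<pi> q \<in> M p" if pq: "p \<in> topspace T" "q \<in> topspace T" "lab D m q = lab D m p" for p q
    proof -
      have "(g ^^ k) (\<pi> q) \<in> w ((\<sigma> ^^ k) p)" if "k < m" for k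
      proof -
        have "below D ((\<sigma> ^^ k) q) = below D ((\<sigma> ^^ k) p)" using pq(3) that unfolding lab_eq_iff by blast
        then have "(\<sigma> ^^ k) q \<in> cell D ((\<sigma> ^^ k) p)" using funpow_space[OF pq(2)] by (simp add: cell_def)
        then have "\<pi> ((\<sigma> ^^ k) q) \<in> w ((\<sigma> ^^ k) p)" using w[OF funpow_space[OF pq(1)]] by blast
        then show ?thesis using equivariant_funpow[OF pq(2)] by simp
      qed
      moreover have "\<pi> q \<in> topspace Y" by (rule pi_space[OF pq(2)])
      ultimately show ?thesis by (simp add: M_def)
    qed
    have "\<exists>p. p \<in> topspace T \<and> lab D m p = l" if "l \<in> lab D m ` topspace T" for l using that by blast
    then obtain r where r: "\<And>l. l \<in> lab D m ` topspace T \<Longrightarrow> r l \<in> topspace T \<and> lab D m (r l) = l" by metis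
    let ?L = "lab D m ` topspace T"
    have fin: "finite ?L" by (rule finite_image_lc[OF lc_lab[OF D(1,2)]])
    show ?thesis
    proof (intro exI[of _ "(\<lambda>l. M (r l)) ` ?L"] conjI)
      show "(\<lambda>l. M (r l)) ` ?L \<subseteq> iterated_cover Y g U m" using M r by blast
      show "finite ((\<lambda>l. M (r l)) ` ?L)" "card ((\<lambda>l. M (r l)) ` ?L) \<le> card ?L"
        using fin card_image_le by auto
      show "\<Union>((\<lambda>l. M (r l)) ` ?L) = topspace Y"
      proof
        show "\<Union>((\<lambda>l. M (r l)) ` ?L) \<subseteq> topspace Y" by (auto simp: M_def)
        show "topspace Y \<subseteq> \<Union>((\<lambda>l. M (r l)) ` ?L)"
        proof
          fix y assume "y \<in> topspace Y"
          then obtain q where q: "q \<in> topspace T" "y = \<pi> q" using pi_surj by blast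
          then have l: "lab D m q \<in> ?L" by blast
          then have "\<pi> q \<in> M (r (lab D m q))" using in_M[of "r (lab D m q)" q] r[OF l] q by simp
          then show "y \<in> \<Union>((\<lambda>l. M (r l)) ` ?L)" using l q by blast
        qed
      qed
    qed
  qed
  then show thesis using that[OF D] by blast
qed

text \<open>Labels give subcovers of size at most a constant times \<open>m * s ^ m\<close>, so the
  growth rate is at most \<open>ln s\<close>; submultiplicativity of the cover numbers supplies the
  limit.\<close>

lemma cover_growth:
  assumes U: "open_cover Y U"
  defines "u \<equiv> \<lambda>m. ln (real (cover_number Y (iterated_cover Y g U m)))"
  shows "(\<lambda>m. u m / real m) \<longlonglongrightarrow> lim (\<lambda>m. u m / real m)" "lim (\<lambda>m. u m / real m) \<le> ln s"
    "0 < cover_number Y (iterated_cover Y g U m)"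
    "\<exists>V\<subseteq>iterated_cover Y g U m. finite V \<and> \<Union>V = topspace Y"
proof -
  obtain D where D: "finite D" "D \<subseteq> \<Gamma>" "P \<subseteq> D"
    "\<forall>m. \<exists>V\<subseteq>iterated_cover Y g U m. finite V \<and> \<Union>V = topspace Y \<and> card V \<le> card (lab D m ` topspace T)"
    by (rule subcover_by_labels[OF U])
  have sub: "\<exists>V\<subseteq>iterated_cover Y g U m. finite V \<and> \<Union>V = topspace Y" for m
    using spec[OF D(4), of m] by (elim exE conjE) (intro exI conjI)
  then show "\<exists>V\<subseteq>iterated_cover Y g U m. finite V \<and> \<Union>V = topspace Y" .
  let ?c = "\<lambda>m. cover_number Y (iterated_cover Y g U m)"
  have ne: "topspace Y \<noteq> {}" using pi_surj part(1)[of 1] part(4)[of 1] N_pos by force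
  have pos: "0 < ?c m" for m
  proof (rule ccontr)
    assume "\<not> 0 < ?c m"
    moreover obtain V where "V \<subseteq> iterated_cover Y g U m" "finite V" "card V = ?c m" "\<Union>V = topspace Y"
      by (rule cover_number_witness[OF sub])
    ultimately show False using ne by auto
  qed
  then show "0 < ?c m" .
  have "u (m + k) \<le> u m + u k" for m k
  proof -
    have "real (?c (m + k)) \<le> real (?c m) * real (?c k)"
      using cover_number_submultiplicative[OF g_space sub sub, of m k] by (metis of_nat_le_iff of_nat_mult)
    then have "ln (real (?c (m + k))) \<le> ln (real (?c m) * real (?c k))" using pos by simp
    then show ?thesis unfolding u_def using pos by (simp add: ln_mult)
  qed
  moreover have "0 \<le> u m" for m
    unfolding u_def using pos[of m] by (intro ln_ge_zero) linarith
  ultimately have "convergent (\<lambda>m. u m / real m)" by (rule fekete)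
  then show lim: "(\<lambda>m. u m / real m) \<longlonglongrightarrow> lim (\<lambda>m. u m / real m)"
    by (simp add: convergent_LIMSEQ_iff)
  obtain c where c: "0 \<le> c" "\<forall>m. real (card (lab D m ` topspace T)) \<le> 1 + real m * c * s ^ m"
    by (rule card_labels[OF D(1-3)])
  have bound: "u m / real m \<le> ln (1 + c) * (1 / real m) + ln (real m) / real m + ln s" if m: "1 \<le> m" for m
  proof -
    obtain V where V: "V \<subseteq> iterated_cover Y g U m" "finite V" "\<Union>V = topspace Y"
      "card V \<le> card (lab D m ` topspace T)" using spec[OF D(4), of m] by (elim exE conjE)
    have "real (?c m) \<le> real (card (lab D m ` topspace T))"
      using cover_number_le[OF V(1-3)] V(4) by simp
    also have "\<dots> \<le> 1 + real m * c * s ^ m" using c by blast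
    also have "\<dots> \<le> real m * s ^ m + real m * c * s ^ m"
    proof -
      have "1 * 1 \<le> real m * s ^ m" by (rule mult_mono) (use m s_gt_1 one_le_power[of s m] in auto)
      then show ?thesis by simp
    qed
    also have "\<dots> = (1 + c) * (real m * s ^ m)" by (simp add: algebra_simps)
    finally have "u m \<le> ln ((1 + c) * (real m * s ^ m))" unfolding u_def using pos[of m] by simp
    also have "\<dots> = ln (1 + c) + (ln (real m) + real m * ln s)"
      using c m s_pos by (simp add: ln_mult ln_realpow)
    finally have "u m / real m \<le> (ln (1 + c) + (ln (real m) + real m * ln s)) / real m"
      by (rule divide_right_mono) simp
    then show ?thesis using m by (simp add: add_divide_distrib)
  qed
  have "(\<lambda>m. ln (1 + c) * (1 / real m) + ln (real m) / real m + ln s) \<longlonglongrightarrow> ln (1 + c) * 0 + 0 + ln s"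
    by (intro tendsto_intros lim_1_over_n lim_ln_over_n)
  then show "lim (\<lambda>m. u m / real m) \<le> ln s"
    using LIMSEQ_le[OF lim, of _ "ln s"] bound by auto
qed

text \<open>If each member of \<open>U\<close> meets at most two labels of length \<open>k\<close>,
  a member of the iterated cover meets at most \<open>2 ^ j\<close> labels of length
  \<open>k * j\<close>. There are at least \<open>s ^ (k * j)\<close> such labels, and dividing
  logarithms by \<open>k * j\<close> leaves the error \<open>ln 2 / k\<close>.\<close>

lemma cover_growth_lower:
  assumes U: "open_cover Y U" and k: "1 \<le> k"
    and two: "\<forall>W\<in>U. card (lab P k ` {p \<in> topspace T. \<pi> p \<in> W}) \<le> 2"
  shows "ln s - ln 2 / real k \<le> lim (\<lambda>m. ln (real (cover_number Y (iterated_cover Y g U m))) / real m)"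
proof -
  let ?c = "\<lambda>m. cover_number Y (iterated_cover Y g U m)"
  let ?u = "\<lambda>m. ln (real (?c m)) / real m"
  have fin: "finite (lab P m ` A)" if "A \<subseteq> topspace T" for m A
    using finite_image_lc[OF lc_lab[OF finite_P P_gaps]] that by (meson finite_subset image_mono)
  have "ln s - ln 2 / real k \<le> ?u (k * j)" if j: "1 \<le> j" for j
  proof -
    obtain V where V: "V \<subseteq> iterated_cover Y g U (k * j)" "finite V" "card V = ?c (k * j)" "\<Union>V = topspace Y"
      by (rule cover_number_witness[OF cover_growth(4)[OF U]])
    have each: "card (lab P (k * j) ` {p \<in> topspace T. \<pi> p \<in> W}) \<le> 2 ^ j" if W: "W \<in> V" for W
    proof -
      obtain w where w: "W = {y \<in> topspace Y. \<forall>i<k * j. (g ^^ i) y \<in> w i}" "\<forall>i<k * j. w i \<in> U"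
        using V(1) W unfolding iterated_cover_def by blast
      define B where "B i = lab P k ` {p \<in> topspace T. \<pi> p \<in> w (k * i)}" for i
      have lt: "k * i < k * j" if "i < j" for i using that k by simp
      have finB: "finite (B i)" for i unfolding B_def by (rule fin) blast
      have finPi: "finite (PiE {..<j} B)" by (rule finite_PiE) (auto simp: finB)
      have "lab P (k * j) ` {p \<in> topspace T. \<pi> p \<in> W} \<subseteq> (\<lambda>h. concat (map h [0..<j])) ` PiE {..<j} B"
      proof
        fix l assume "l \<in> lab P (k * j) ` {p \<in> topspace T. \<pi> p \<in> W}"
        then obtain p where p: "p \<in> topspace T" "\<pi> p \<in> W" "l = lab P (k * j) p" by blast
        let ?h = "\<lambda>i\<in>{..<j}. lab P k ((\<sigma> ^^ (k * i)) p)"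
        have "lab P k ((\<sigma> ^^ (k * i)) p) \<in> B i" if "i < j" for i
        proof -
          have "(g ^^ (k * i)) (\<pi> p) \<in> w (k * i)" using p(2) w(1) lt[OF that] by blast
          then have "\<pi> ((\<sigma> ^^ (k * i)) p) \<in> w (k * i)" using equivariant_funpow[OF p(1)] by simp
          then show ?thesis using funpow_space[OF p(1)] unfolding B_def by blast
        qed
        then have "?h \<in> PiE {..<j} B" by auto
        moreover have "map ?h [0..<j] = map (\<lambda>i. lab P k ((\<sigma> ^^ (k * i)) p)) [0..<j]" by simp
        then have "l = concat (map ?h [0..<j])" using p(3) lab_blocks by metis
        ultimately show "l \<in> (\<lambda>h. concat (map h [0..<j])) ` PiE {..<j} B" by blast
      qed
      then have "card (lab P (k * j) ` {p \<in> topspace T. \<pi> p \<in> W}) \<le> card (PiE {..<j} B)"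
        using finPi by (meson card_image_le card_mono finite_imageI le_trans)
      also have "\<dots> = (\<Prod>i<j. card (B i))" by (rule card_PiE) simp
      also have "\<dots> \<le> (\<Prod>i<j. 2)"
      proof (rule prod_mono, intro conjI)
        fix i assume "i \<in> {..<j}"
        then have "w (k * i) \<in> U" using w(2) lt by blast
        then show "card (B i) \<le> 2" using two by (simp add: B_def)
      qed simp
      finally show ?thesis by simp
    qed
    have "lab P (k * j) ` topspace T = (\<Union>W\<in>V. lab P (k * j) ` {p \<in> topspace T. \<pi> p \<in> W})"
    proof
      show "lab P (k * j) ` topspace T \<subseteq> (\<Union>W\<in>V. lab P (k * j) ` {p \<in> topspace T. \<pi> p \<in> W})"
      proof
        fix l assume "l \<in> lab P (k * j) ` topspace T"
        then obtain p where p: "p \<in> topspace T" "l = lab P (k * j) p" by blast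
        then have "\<pi> p \<in> \<Union>V" using V(4) pi_space by simp
        then show "l \<in> (\<Union>W\<in>V. lab P (k * j) ` {p \<in> topspace T. \<pi> p \<in> W})" using p by blast
      qed
    qed blast
    then have "card (lab P (k * j) ` topspace T) \<le> (\<Sum>W\<in>V. card (lab P (k * j) ` {p \<in> topspace T. \<pi> p \<in> W}))"
      using card_UN_le[OF V(2)] by simp
    also have "\<dots> \<le> (\<Sum>W\<in>V. 2 ^ j)" by (rule sum_mono) (rule each)
    also have "\<dots> = ?c (k * j) * 2 ^ j" using V(3) by simp
    finally have "real (card (lab P (k * j) ` topspace T)) \<le> real (?c (k * j) * 2 ^ j)" by (rule of_nat_mono)
    then have "s ^ (k * j) \<le> real (?c (k * j)) * 2 ^ j" using many_labels[of "k * j"] by simp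
    then have "ln (s ^ (k * j)) \<le> ln (real (?c (k * j)) * 2 ^ j)"
      using s_pos cover_growth(3)[OF U, of "k * j"] by (subst ln_le_cancel_iff) auto
    then have "real (k * j) * ln s - real j * ln 2 \<le> ln (real (?c (k * j)))"
      using s_pos cover_growth(3)[OF U, of "k * j"] by (simp add: ln_mult ln_realpow)
    then have "(real (k * j) * ln s - real j * ln 2) / real (k * j) \<le> ?u (k * j)"
      by (rule divide_right_mono) simp
    moreover have "(real (k * j) * ln s - real j * ln 2) / real (k * j) = ln s - ln 2 / real k"
      using k j by (simp add: field_simps)
    ultimately show ?thesis by linarith
  qed
  moreover have "(\<lambda>j. ?u (k * j)) \<longlonglongrightarrow> lim ?u"
    using LIMSEQ_subseq_LIMSEQ[OF cover_growth(1)[OF U], of "\<lambda>j. k * j"] k by (simp add: strict_mono_def o_def)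
  ultimately show ?thesis by (intro LIMSEQ_le_const) auto
qed

text \<open>The bound two allows for points whose fibre is a pair of sides with different labels;
  its cost \<open>ln 2 / k\<close> vanishes as \<open>k\<close> grows.\<close>

lemma topological_entropy_factor:
  assumes "\<And>k. 1 \<le> k \<Longrightarrow> \<exists>U. open_cover Y U \<and> (\<forall>W\<in>U. card (lab P k ` {p \<in> topspace T. \<pi> p \<in> W}) \<le> 2)"
  shows "topological_entropy Y g = ereal (ln s)"
proof (rule antisym)
  show "topological_entropy Y g \<le> ereal (ln s)"
    unfolding topological_entropy_def by (rule SUP_least) (use cover_growth(2) in auto)
  have "ereal (ln s - ln 2 / real k) \<le> topological_entropy Y g" if k: "1 \<le> k" for k
  proof -
    obtain U where U: "open_cover Y U" "\<forall>W\<in>U. card (lab P k ` {p \<in> topspace T. \<pi> p \<in> W}) \<le> 2"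
      using assms[OF k] by blast
    show ?thesis
      unfolding topological_entropy_def using cover_growth_lower[OF U(1) k U(2)]
      by (intro SUP_upper2[of U]) (use U(1) in auto)
  qed
  moreover have "(\<lambda>k. ln s - ln 2 * (1 / real k)) \<longlonglongrightarrow> ln s - ln 2 * 0"
    by (intro tendsto_intros lim_1_over_n)
  then have "(\<lambda>k. ereal (ln s - ln 2 / real k)) \<longlonglongrightarrow> ereal (ln s)" by simp
  ultimately show "ereal (ln s) \<le> topological_entropy Y g"
    by (intro LIMSEQ_le_const2[where X = "\<lambda>k. ereal (ln s - ln 2 / real k)"]) (auto intro!: exI[of _ 1])
qed

end

end

section \<open>Dimension groups of transfer operators\<close>

lemma C_int_preimage: assumes "f \<in> C_int T" shows "openin T {x \<in> topspace T. f x \<in> V}"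
proof -
  have "continuous_map T (discrete_topology UNIV) f" using assms by (simp add: C_int_def)
  then show ?thesis by (rule openin_continuous_map_preimage) simp
qed

text \<open>The condition at zero preserves extension by zero. Since the values are discrete, the
  preimage is a union over pairs of values.\<close>

lemma C_int_combine:
  assumes f: "f \<in> C_int T" and g: "g \<in> C_int T" and h: "h 0 0 = (0 :: int)"
  shows "(\<lambda>x. h (f x) (g x)) \<in> C_int T"
proof -
  have "openin T {x \<in> topspace T. h (f x) (g x) \<in> V}" for V
  proof -
    have "{x \<in> topspace T. h (f x) (g x) \<in> V} =
        (\<Union>(a, b)\<in>{(a, b). h a b \<in> V}. {x \<in> topspace T. f x \<in> {a}} \<inter> {x \<in> topspace T. g x \<in> {b}})"
      by auto
    moreover have "openin T ({x \<in> topspace T. f x \<in> {a}} \<inter> {x \<in> topspace T. g x \<in> {b}})" for a b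
      by (intro openin_Int C_int_preimage f g)
    ultimately show ?thesis by (auto intro!: openin_Union)
  qed
  then show ?thesis using f g h unfolding C_int_def by (auto simp: continuous_map_def)
qed

lemma C_int_plus: "f \<in> C_int T \<Longrightarrow> g \<in> C_int T \<Longrightarrow> (\<lambda>x. f x + g x) \<in> C_int T"
  by (rule C_int_combine) auto

lemma C_int_diff: "f \<in> C_int T \<Longrightarrow> g \<in> C_int T \<Longrightarrow> (\<lambda>x. f x - g x) \<in> C_int T"
  by (rule C_int_combine) auto

lemma C_int_max: "f \<in> C_int T \<Longrightarrow> g \<in> C_int T \<Longrightarrow> (\<lambda>x. max (f x) (g x)) \<in> C_int T"
  by (rule C_int_combine) auto

lemma C_int_cmult: "f \<in> C_int T \<Longrightarrow> (\<lambda>x. c * f x) \<in> C_int T"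
  by (rule C_int_combine[of f T f "\<lambda>a b. c * a"]) auto

lemma C_int_zero: "(\<lambda>x. 0) \<in> C_int T"
  by (simp add: C_int_def)

lemma C_int_sum: "finite I \<Longrightarrow> (\<And>i. i \<in> I \<Longrightarrow> f i \<in> C_int T) \<Longrightarrow> (\<lambda>x. \<Sum>i\<in>I. f i x) \<in> C_int T"
  by (induction I rule: finite_induct) (auto intro: C_int_zero C_int_plus)

lemma C_int_indicator: assumes "openin T A" "closedin T A" shows "indicator A \<in> C_int T"
proof -
  have "openin T {x \<in> topspace T. indicator A x \<in> V}" for V :: "int set"
  proof -
    have "{x \<in> topspace T. indicator A x \<in> V} =
        (if 1 \<in> V then A else {}) \<union> (if 0 \<in> V then topspace T - A else {})"
      using openin_subset[OF assms(1)] by (auto simp: indicator_def)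
    moreover have "openin T (if 1 \<in> V then A else {})" "openin T (if 0 \<in> V then topspace T - A else {})"
      using assms by auto
    ultimately show ?thesis by (metis openin_Un)
  qed
  then show ?thesis
    using openin_subset[OF assms(1)] by (auto simp: C_int_def continuous_map_def indicator_def)
qed

lemma C_int_times_chi:
  assumes "f \<in> C_int T" "openin T A" "closedin T A" shows "times_chi f A \<in> C_int T"
  unfolding times_chi_def by (rule C_int_combine[OF assms(1) C_int_indicator[OF assms(2,3)]]) simp

text \<open>Pointwise vanishing replaces the closed support; for closed supports nothing changes,
  because a continuous integer function is nonzero on a closed set.\<close>

definition part_fun :: "'a topology \<Rightarrow> 'a set \<Rightarrow> ('a \<Rightarrow> int) set" where
  "part_fun T A = {f \<in> C_int T. \<forall>x. x \<notin> A \<longrightarrow> f x = 0}"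

lemma supp_subset_iff:
  assumes "f \<in> C_int T" shows "supp T f \<subseteq> A \<longleftrightarrow> (\<forall>x. x \<notin> A \<longrightarrow> f x = 0)"
proof -
  have "openin T {x \<in> topspace T. f x \<in> {0}}"
    by (rule C_int_preimage[OF assms])
  moreover have "topspace T - {x \<in> topspace T. f x \<noteq> 0} = {x \<in> topspace T. f x \<in> {0}}" by auto
  ultimately have "closedin T {x \<in> topspace T. f x \<noteq> 0}" by (simp add: closedin_def)
  then have "supp T f = {x \<in> topspace T. f x \<noteq> 0}" unfolding supp_def by (rule closure_of_closedin)
  then show ?thesis using assms by (auto simp: C_int_def)
qed

lemma part_fun_iff: "f \<in> part_fun T A \<longleftrightarrow> f \<in> C_int T \<and> supp T f \<subseteq> A"
  unfolding part_fun_def using supp_subset_iff by blast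

lemma part_funD: "f \<in> part_fun T A \<Longrightarrow> f \<in> C_int T" "f \<in> part_fun T A \<Longrightarrow> x \<notin> A \<Longrightarrow> f x = 0"
  by (auto simp: part_fun_def)

lemma part_fun_plus: "f \<in> part_fun T A \<Longrightarrow> g \<in> part_fun T A \<Longrightarrow> (\<lambda>x. f x + g x) \<in> part_fun T A"
  and part_fun_diff: "f \<in> part_fun T A \<Longrightarrow> g \<in> part_fun T A \<Longrightarrow> (\<lambda>x. f x - g x) \<in> part_fun T A"
  and part_fun_cmult: "f \<in> part_fun T A \<Longrightarrow> (\<lambda>x. c * f x) \<in> part_fun T A"
  and part_fun_zero: "(\<lambda>x. 0) \<in> part_fun T A"
  and part_fun_max: "f \<in> part_fun T A \<Longrightarrow> (\<lambda>x. max (f x) 0) \<in> part_fun T A"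
  by (auto simp: part_fun_def C_int_zero intro: C_int_plus C_int_diff C_int_cmult C_int_max[OF _ C_int_zero])

lemma part_fun_topspace: "part_fun T (topspace T) = C_int T"
  by (auto simp: part_fun_def C_int_def)

lemma part_fun_times_chi: "f \<in> part_fun T A \<Longrightarrow> times_chi f A = f"
  by (auto simp: part_fun_def times_chi_def fun_eq_iff indicator_def)

lemma times_chi_part:
  assumes "f \<in> C_int T" "openin T A" "closedin T A" shows "times_chi f A \<in> part_fun T A"
  using C_int_times_chi[OF assms] by (simp add: part_fun_def times_chi_def)

lemma indicator_part: "openin T A \<Longrightarrow> closedin T A \<Longrightarrow> indicator A \<in> part_fun T A"
  using C_int_indicator[of T A] by (simp add: part_fun_def)

lemma dimension_group_iso_intro:
  assumes G: "group G" and H: "group H" and h: "h \<in> iso G H"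
    and pos: "\<And>x. x \<in> carrier G \<Longrightarrow> x \<in> nonneg G \<longleftrightarrow> h x \<in> nonneg H"
  shows "dimension_group_iso G H h"
  unfolding dimension_group_iso_def
proof (intro conjI ballI)
  interpret G: group G by (rule G)
  interpret H: group H by (rule H)
  have hom: "h \<in> hom G H" using h by (simp add: iso_def)
  interpret group_hom G H h by unfold_locales (rule hom)
  fix x y assume xy: "x \<in> carrier G" "y \<in> carrier G"
  then have "h (y \<otimes>\<^bsub>G\<^esub> inv\<^bsub>G\<^esub> x) = h y \<otimes>\<^bsub>H\<^esub> inv\<^bsub>H\<^esub> h x" by simp
  then show "ole G x y \<longleftrightarrow> ole H (h x) (h y)"
    unfolding ole_def using pos[of "y \<otimes>\<^bsub>G\<^esub> inv\<^bsub>G\<^esub> x"] xy by simp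
qed (rule h)

text \<open>Both groups are presented by classes of the same set \<open>F\<close> of functions;
  equal kernels, a common addition and matching positivity then suffice. It serves both the direct
  sum and the return map.\<close>

lemma dimension_group_iso_classes:
  assumes G: "group G" and H: "group H"
    and c: "carrier G = c ` F" and d: "carrier H = d ` F"
    and eq: "\<And>f g. f \<in> F \<Longrightarrow> g \<in> F \<Longrightarrow> c f = c g \<longleftrightarrow> d f = d g"
    and closed: "\<And>f g. f \<in> F \<Longrightarrow> g \<in> F \<Longrightarrow> add f g \<in> F"
    and cm: "\<And>f g. f \<in> F \<Longrightarrow> g \<in> F \<Longrightarrow> c f \<otimes>\<^bsub>G\<^esub> c g = c (add f g)"
    and dm: "\<And>f g. f \<in> F \<Longrightarrow> g \<in> F \<Longrightarrow> d f \<otimes>\<^bsub>H\<^esub> d g = d (add f g)"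
    and pos: "\<And>f. f \<in> F \<Longrightarrow> c f \<in> nonneg G \<longleftrightarrow> d f \<in> nonneg H"
  shows "\<exists>h. (\<forall>f\<in>F. h (c f) = d f) \<and> dimension_group_iso G H h"
proof -
  define h where "h x = d (SOME f. f \<in> F \<and> c f = x)" for x
  have h: "h (c f) = d f" if f: "f \<in> F" for f
  proof -
    have "(SOME g. g \<in> F \<and> c g = c f) \<in> F \<and> c (SOME g. g \<in> F \<and> c g = c f) = c f"
      by (rule someI[of _ f]) (use f in simp)
    then show ?thesis unfolding h_def using eq f by blast
  qed
  have "h \<in> hom G H"
    by (rule homI) (use h c d cm dm closed in auto)
  moreover have "bij_betw h (carrier G) (carrier H)"
    unfolding bij_betw_def
  proof
    show "inj_on h (carrier G)" by (rule inj_onI) (use h c eq in auto)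
    show "h ` carrier G = carrier H" using h unfolding c d by (force simp: image_iff)
  qed
  ultimately have "h \<in> iso G H" by (simp add: iso_def)
  then have "dimension_group_iso G H h"
    by (rule dimension_group_iso_intro[OF G H]) (use h c pos in auto)
  then show ?thesis using h by blast
qed

text \<open>Closure of \<open>C_int\<close> under transfer is enough for the ordered group itself,
  so the results apply to \<sigma> on the whole space and to return maps on the parts.\<close>

locale transfer_group =
  fixes T :: "'a topology" and \<rho> :: "'a \<Rightarrow> 'a"
  assumes transfer_C: "f \<in> C_int T \<Longrightarrow> transfer T \<rho> f \<in> C_int T"
begin

abbreviation L :: "('a \<Rightarrow> int) \<Rightarrow> 'a \<Rightarrow> int" where "L \<equiv> transfer T \<rho>"

section \<open>Powers of the transfer operator and their classes\<close>

lemma Lk_C: "f \<in> C_int T \<Longrightarrow> (L ^^ k) f \<in> C_int T"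
  by (induction k) (auto intro: transfer_C)

lemma Lk_plus: "(L ^^ k) (\<lambda>x. f x + g x) = (\<lambda>x. (L ^^ k) f x + (L ^^ k) g x)"
  by (induction k) (auto simp: transfer_def sum.distrib fun_eq_iff)

lemma Lk_diff: "(L ^^ k) (\<lambda>x. f x - g x) = (\<lambda>x. (L ^^ k) f x - (L ^^ k) g x)"
  by (induction k) (auto simp: transfer_def sum_subtractf fun_eq_iff)

lemma Lk_cmult: "(L ^^ k) (\<lambda>x. c * f x) = (\<lambda>x. c * (L ^^ k) f x)"
  by (induction k) (auto simp: transfer_def sum_distrib_left fun_eq_iff)

lemma Lk_zero: "(L ^^ k) (\<lambda>x. 0) = (\<lambda>x. 0)"
  using Lk_cmult[of k 0 "\<lambda>_. 0"] by simp

lemma Lk_sum: "(L ^^ k) (\<lambda>x. \<Sum>i\<in>I. f i x) = (\<lambda>x. \<Sum>i\<in>I. (L ^^ k) (f i) x)"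
proof (induction k)
  case (Suc k)
  have "L (\<lambda>x. \<Sum>i\<in>I. (L ^^ k) (f i) x) = (\<lambda>x. \<Sum>i\<in>I. L ((L ^^ k) (f i)) x)"
    by (rule ext) (simp add: transfer_def sum.swap[of _ I])
  then show ?case using Suc by simp
qed simp

lemma Lk_nonneg: assumes "\<forall>x. 0 \<le> f x" shows "\<forall>x. 0 \<le> (L ^^ k) f x"
  using assms by (induction k) (auto simp: transfer_def intro!: sum_nonneg)

lemma Lk_add: "(L ^^ (j + k)) f = (L ^^ j) ((L ^^ k) f)"
  by (simp add: funpow_add)

lemma Lk_eq_mono: "(L ^^ k) f = (L ^^ k) g \<Longrightarrow> k \<le> j \<Longrightarrow> (L ^^ j) f = (L ^^ j) g"
  using Lk_add[of "j - k" k f] Lk_add[of "j - k" k g] by simp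

lemma Lk_nonneg_mono: "\<forall>x. 0 \<le> (L ^^ k) f x \<Longrightarrow> k \<le> j \<Longrightarrow> \<forall>x. 0 \<le> (L ^^ j) f x"
  using Lk_add[of "j - k" k f] Lk_nonneg[of "(L ^^ k) f" "j - k"] by simp

abbreviation c :: "('a \<Rightarrow> int) \<Rightarrow> ('a \<Rightarrow> int) set" where "c \<equiv> cls T \<rho>"

lemma equiv_ee: "equiv (C_int T) (eventually_equal T \<rho>)"
proof (rule equivI)
  show "refl_on (C_int T) (eventually_equal T \<rho>)"
    by (auto simp: refl_on_def eventually_equal_def)
  show "sym (eventually_equal T \<rho>)" unfolding eventually_equal_def by (rule symI) (auto, metis)
  show "trans (eventually_equal T \<rho>)"
  proof (rule transI)
    fix f g h assume "(f, g) \<in> eventually_equal T \<rho>" "(g, h) \<in> eventually_equal T \<rho>"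
    then obtain j k where jk: "f \<in> C_int T" "g \<in> C_int T" "h \<in> C_int T"
      "(L ^^ j) f = (L ^^ j) g" "(L ^^ k) g = (L ^^ k) h" unfolding eventually_equal_def by auto
    then have "(L ^^ (max j k)) f = (L ^^ (max j k)) h"
      using Lk_eq_mono[OF jk(4), of "max j k"] Lk_eq_mono[OF jk(5), of "max j k"] by simp
    then show "(f, h) \<in> eventually_equal T \<rho>" using jk unfolding eventually_equal_def by blast
  qed
qed (auto simp: eventually_equal_def)

lemma c_eq_iff: "f \<in> C_int T \<Longrightarrow> g \<in> C_int T \<Longrightarrow> c f = c g \<longleftrightarrow> (\<exists>k. (L ^^ k) f = (L ^^ k) g)"
  unfolding cls_def using eq_equiv_class_iff[OF equiv_ee, of f g] by (simp add: eventually_equal_def)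

lemma mem_c: "f \<in> C_int T \<Longrightarrow> f \<in> c f"
  unfolding cls_def by (rule equiv_class_self[OF equiv_ee])

lemma c_memD: assumes "g \<in> c f" shows "g \<in> C_int T" "f \<in> C_int T" "c g = c f"
proof -
  have e: "(f, g) \<in> eventually_equal T \<rho>" using assms by (simp add: cls_def)
  then show "g \<in> C_int T" "f \<in> C_int T" by (auto simp: eventually_equal_def)
  show "c g = c f" unfolding cls_def using equiv_class_eq[OF equiv_ee e] by simp
qed

lemma c_plus_cong:
  assumes "f \<in> C_int T" "g \<in> C_int T" "f' \<in> C_int T" "g' \<in> C_int T" "c f = c f'" "c g = c g'"
  shows "c (\<lambda>x. f x + g x) = c (\<lambda>x. f' x + g' x)"
proof -
  have "\<exists>j. (L ^^ j) f = (L ^^ j) f'" "\<exists>k. (L ^^ k) g = (L ^^ k) g'"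
    using assms by (simp_all add: c_eq_iff)
  then obtain j k where jk: "(L ^^ j) f = (L ^^ j) f'" "(L ^^ k) g = (L ^^ k) g'" by (elim exE)
  have "(L ^^ max j k) f = (L ^^ max j k) f'" "(L ^^ max j k) g = (L ^^ max j k) g'"
    by (rule Lk_eq_mono[OF jk(1)], simp) (rule Lk_eq_mono[OF jk(2)], simp)
  then have "(L ^^ max j k) (\<lambda>x. f x + g x) = (L ^^ max j k) (\<lambda>x. f' x + g' x)"
    by (simp add: Lk_plus)
  then show ?thesis using assms c_eq_iff C_int_plus by blast
qed

text \<open>The union over representatives in the group operation collapses, since every choice
  gives the same class.\<close>

lemma mult_c:
  assumes "f \<in> C_int T" "g \<in> C_int T"
  shows "c f \<otimes>\<^bsub>G_group T \<rho>\<^esub> c g = c (\<lambda>x. f x + g x)"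
proof -
  have "(\<Union>f'\<in>c f. \<Union>g'\<in>c g. c (\<lambda>x. f' x + g' x)) = (\<Union>f'\<in>c f. \<Union>g'\<in>c g. c (\<lambda>x. f x + g x))"
    using c_memD assms by (intro SUP_cong refl c_plus_cong) auto
  also have "\<dots> = c (\<lambda>x. f x + g x)" using mem_c assms by auto
  finally show ?thesis by (simp add: G_group_def)
qed

lemma nonneg_c:
  assumes "f \<in> C_int T" shows "c f \<in> nonneg (G_group T \<rho>) \<longleftrightarrow> (\<exists>k. \<forall>x. 0 \<le> (L ^^ k) f x)"
proof
  assume "c f \<in> nonneg (G_group T \<rho>)"
  then obtain g k where g: "g \<in> C_int T" "c f = c g" "\<forall>x. 0 \<le> (L ^^ k) g x" by (auto simp: G_group_def)
  then obtain j where "(L ^^ j) f = (L ^^ j) g" using c_eq_iff assms by blast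
  then have "(L ^^ max j k) f = (L ^^ max j k) g" by (rule Lk_eq_mono) simp
  moreover have "\<forall>x. 0 \<le> (L ^^ max j k) g x" by (rule Lk_nonneg_mono[OF g(3)]) simp
  ultimately show "\<exists>k. \<forall>x. 0 \<le> (L ^^ k) f x" by (intro exI[of _ "max j k"]) simp
next
  assume "\<exists>k. \<forall>x. 0 \<le> (L ^^ k) f x"
  then show "c f \<in> nonneg (G_group T \<rho>)" using assms by (auto simp: G_group_def)
qed

text \<open>Through this identity the properties of \<open>G_part\<close> cover the full group as
  well.\<close>

lemma G_group_eq_part: "G_group T \<rho> = G_part T \<rho> (topspace T)"
proof -
  let ?S = "{c f |f. f \<in> C_int T \<and> supp T f \<subseteq> topspace T}"
  have S: "C_int T // eventually_equal T \<rho> = ?S"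
    using part_fun_iff[of _ T "topspace T"] unfolding part_fun_topspace quotient_def cls_def by auto
  have "nonneg (G_group T \<rho>) \<subseteq> C_int T // eventually_equal T \<rho>"
    by (auto simp: G_group_def cls_def quotient_def)
  then have "nonneg (G_group T \<rho>) \<inter> ?S = nonneg (G_group T \<rho>)" unfolding S by (rule Int_absorb2)
  then show ?thesis unfolding G_part_def Let_def by (simp add: G_group_def S)
qed

section \<open>Group structure and order of the parts\<close>

lemma carrier_part: "carrier (G_part T \<rho> A) = c ` part_fun T A"
  by (auto simp: G_part_def Let_def part_fun_iff)

lemma mult_part: "monoid.mult (G_part T \<rho> A) = monoid.mult (G_group T \<rho>)"
  and one_part: "one (G_part T \<rho> A) = c (\<lambda>x. 0)"
  and ounit_part: "ounit (G_part T \<rho> A) = c (indicator A)"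
  by (simp_all add: G_part_def Let_def G_group_def)

lemma nonneg_part_iff:
  assumes "f \<in> part_fun T A" shows "c f \<in> nonneg (G_part T \<rho> A) \<longleftrightarrow> (\<exists>k. \<forall>x. 0 \<le> (L ^^ k) f x)"
  using assms nonneg_c[of f] part_fun_iff[of f T A] by (auto simp: G_part_def Let_def)

lemma nonneg_part_sub: "nonneg (G_part T \<rho> A) \<subseteq> c ` part_fun T A"
  by (auto simp: G_part_def Let_def part_fun_iff)

lemma comm_group_part: "comm_group (G_part T \<rho> A)"
proof (rule comm_groupI)
  let ?G = "G_part T \<rho> A"
  note car = carrier_part mult_part one_part
  show "\<one>\<^bsub>?G\<^esub> \<in> carrier ?G" using part_fun_zero by (auto simp: car)
  show "x \<otimes>\<^bsub>?G\<^esub> y \<in> carrier ?G" if "x \<in> carrier ?G" "y \<in> carrier ?G" for x y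
    using that part_fun_plus[of _ T A] by (auto simp: car mult_c part_funD)
  show "x \<otimes>\<^bsub>?G\<^esub> y \<otimes>\<^bsub>?G\<^esub> z = x \<otimes>\<^bsub>?G\<^esub> (y \<otimes>\<^bsub>?G\<^esub> z)"
    if "x \<in> carrier ?G" "y \<in> carrier ?G" "z \<in> carrier ?G" for x y z
    using that by (auto simp: car mult_c part_funD C_int_plus add.assoc)
  show "x \<otimes>\<^bsub>?G\<^esub> y = y \<otimes>\<^bsub>?G\<^esub> x" if "x \<in> carrier ?G" "y \<in> carrier ?G" for x y
    using that by (auto simp: car mult_c part_funD add.commute)
  show "\<one>\<^bsub>?G\<^esub> \<otimes>\<^bsub>?G\<^esub> x = x" if "x \<in> carrier ?G" for x
    using that by (auto simp: car mult_c part_funD C_int_zero)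
  show "\<exists>y\<in>carrier ?G. y \<otimes>\<^bsub>?G\<^esub> x = \<one>\<^bsub>?G\<^esub>" if x: "x \<in> carrier ?G" for x
  proof -
    obtain f where f: "f \<in> part_fun T A" "x = c f" using x by (auto simp: car)
    have g: "(\<lambda>x. (- 1) * f x) \<in> part_fun T A" using part_fun_cmult[OF f(1)] .
    have "c (\<lambda>x. (- 1) * f x) \<otimes>\<^bsub>?G\<^esub> x = \<one>\<^bsub>?G\<^esub>"
      unfolding f(2) car using mult_c[OF part_funD(1)[OF g] part_funD(1)[OF f(1)]] by simp
    then show ?thesis using g by (auto simp: car)
  qed
qed

lemma mult_part_c:
  assumes "f \<in> part_fun T A" "g \<in> part_fun T A"
  shows "c f \<otimes>\<^bsub>G_part T \<rho> A\<^esub> c g = c (\<lambda>x. f x + g x)"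
  unfolding mult_part using assms by (intro mult_c part_funD)

lemma diff_part:
  assumes f: "f \<in> part_fun T A" and g: "g \<in> part_fun T A"
  shows "c f \<otimes>\<^bsub>G_part T \<rho> A\<^esub> inv\<^bsub>G_part T \<rho> A\<^esub> c g = c (\<lambda>x. f x - g x)"
proof -
  let ?G = "G_part T \<rho> A"
  interpret comm_group ?G by (rule comm_group_part)
  have d: "(\<lambda>x. f x - g x) \<in> part_fun T A" by (rule part_fun_diff[OF f g])
  have car: "c f \<in> carrier ?G" "c g \<in> carrier ?G" "c (\<lambda>x. f x - g x) \<in> carrier ?G"
    using f g d by (auto simp: carrier_part)
  have "c (\<lambda>x. f x - g x) \<otimes>\<^bsub>?G\<^esub> c g = c f" using mult_part_c[OF d g] by simp
  then show ?thesis using inv_solve_right[OF car(3,1,2)] by simp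
qed

lemma ole_part_iff:
  assumes f: "f \<in> part_fun T A" and g: "g \<in> part_fun T A"
  shows "ole (G_part T \<rho> A) (c f) (c g) \<longleftrightarrow> (\<exists>k. \<forall>x. (L ^^ k) f x \<le> (L ^^ k) g x)"
  unfolding ole_def diff_part[OF g f] nonneg_part_iff[OF part_fun_diff[OF g f]] by (simp add: Lk_diff)

lemma pow_part:
  assumes f: "f \<in> part_fun T A" shows "c f [^]\<^bsub>G_part T \<rho> A\<^esub> (k :: nat) = c (\<lambda>x. int k * f x)"
proof (induction k)
  case 0 show ?case by (simp add: one_part)
next
  case (Suc k)
  interpret comm_group "G_part T \<rho> A" by (rule comm_group_part)
  have "c f [^]\<^bsub>G_part T \<rho> A\<^esub> Suc k = c (\<lambda>x. int k * f x) \<otimes>\<^bsub>G_part T \<rho> A\<^esub> c f"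
    using Suc by simp
  also have "\<dots> = c (\<lambda>x. int k * f x + f x)" by (rule mult_part_c[OF part_fun_cmult[OF f] f])
  finally show ?case by (simp add: algebra_simps)
qed

lemma ordered_part: "ordered_abelian_group (G_part T \<rho> A)"
  unfolding ordered_abelian_group_def
proof (intro conjI ballI impI)
  let ?G = "G_part T \<rho> A"
  interpret comm_group ?G by (rule comm_group_part)
  show "comm_group ?G" by (rule comm_group_part)
  show "nonneg ?G \<subseteq> carrier ?G" using nonneg_part_sub carrier_part by simp
  show "\<one>\<^bsub>?G\<^esub> \<in> nonneg ?G"
    unfolding one_part nonneg_part_iff[OF part_fun_zero] by (rule exI[of _ 0]) simp
  fix x assume x: "x \<in> nonneg ?G"
  then obtain f where f: "f \<in> part_fun T A" "x = c f" using nonneg_part_sub by blast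
  then obtain j where j: "\<forall>x. 0 \<le> (L ^^ j) f x" using x nonneg_part_iff by blast
  { fix y assume y: "y \<in> nonneg ?G"
    then obtain g where g: "g \<in> part_fun T A" "y = c g" using nonneg_part_sub by blast
    then obtain k where k: "\<forall>x. 0 \<le> (L ^^ k) g x" using y nonneg_part_iff by blast
    have "\<forall>x. 0 \<le> (L ^^ max j k) (\<lambda>x. f x + g x) x"
      unfolding Lk_plus using Lk_nonneg_mono[OF j, of "max j k"] Lk_nonneg_mono[OF k, of "max j k"] by simp
    then show "x \<otimes>\<^bsub>?G\<^esub> y \<in> nonneg ?G"
      unfolding f g mult_part_c[OF f(1) g(1)] using nonneg_part_iff[OF part_fun_plus[OF f(1) g(1)]] by blast }
  assume "inv\<^bsub>?G\<^esub> x \<in> nonneg ?G"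
  moreover have "inv\<^bsub>?G\<^esub> x = c (\<lambda>x. 0 - f x)"
  proof -
    have "x \<in> carrier ?G" using f by (simp add: carrier_part)
    then have "inv\<^bsub>?G\<^esub> x = \<one>\<^bsub>?G\<^esub> \<otimes>\<^bsub>?G\<^esub> inv\<^bsub>?G\<^esub> x" by simp
    then show ?thesis unfolding f(2) one_part diff_part[OF part_fun_zero f(1)] .
  qed
  ultimately obtain k where k: "\<forall>x. 0 \<le> (L ^^ k) (\<lambda>x. 0 - f x) x"
    using nonneg_part_iff[OF part_fun_diff[OF part_fun_zero f(1)]] by auto
  \<comment> \<open>At a common power the function is both nonnegative and nonpositive.\<close>
  have "(L ^^ max j k) f x = 0" for x
    using spec[OF Lk_nonneg_mono[OF j, of "max j k"], of x] spec[OF Lk_nonneg_mono[OF k, of "max j k"], of x]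
    unfolding Lk_diff Lk_zero by simp
  then have "(L ^^ max j k) f = (L ^^ max j k) (\<lambda>x. 0)" unfolding Lk_zero by (simp add: fun_eq_iff)
  then show "x = \<one>\<^bsub>?G\<^esub>"
    unfolding f one_part using c_eq_iff[OF part_funD(1)[OF f(1)] C_int_zero] by blast
next
  let ?G = "G_part T \<rho> A"
  fix x assume "x \<in> carrier ?G"
  then obtain f where f: "f \<in> part_fun T A" "x = c f" by (auto simp: carrier_part)
  \<comment> \<open>The positive and negative parts of \<open>f\<close> exhibit its class as a
    difference of positive classes.\<close>
  have p: "(\<lambda>x. max (f x) 0) \<in> part_fun T A" by (rule part_fun_max[OF f(1)])
  have q: "(\<lambda>x. max (f x) 0 - f x) \<in> part_fun T A" by (rule part_fun_diff[OF p f(1)])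
  have "c (\<lambda>x. max (f x) 0) \<in> nonneg ?G" "c (\<lambda>x. max (f x) 0 - f x) \<in> nonneg ?G"
    unfolding nonneg_part_iff[OF p] nonneg_part_iff[OF q] by (intro exI[of _ 0]; simp)+
  moreover have "x = c (\<lambda>x. max (f x) 0) \<otimes>\<^bsub>?G\<^esub> inv\<^bsub>?G\<^esub> c (\<lambda>x. max (f x) 0 - f x)"
    unfolding diff_part[OF p q] f(2) by simp
  ultimately show "\<exists>y\<in>nonneg ?G. \<exists>z\<in>nonneg ?G. x = y \<otimes>\<^bsub>?G\<^esub> inv\<^bsub>?G\<^esub> z" by blast
qed

lemma unperforated_part: "unperforated (G_part T \<rho> A)"
  unfolding unperforated_def
proof (intro ballI allI impI)
  let ?G = "G_part T \<rho> A"
  fix x and k :: nat assume x: "x \<in> carrier ?G" and k: "1 \<le> k \<and> x [^]\<^bsub>?G\<^esub> k \<in> nonneg ?G"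
  obtain f where f: "f \<in> part_fun T A" "x = c f" using x by (auto simp: carrier_part)
  then obtain j where "\<forall>x. 0 \<le> (L ^^ j) (\<lambda>x. int k * f x) x"
    using k pow_part[OF f(1)] nonneg_part_iff[OF part_fun_cmult[OF f(1), of "int k"]] by auto
  then have "\<forall>x. 0 \<le> (L ^^ j) f x" using k by (simp add: Lk_cmult zero_le_mult_iff)
  then show "x \<in> nonneg ?G" unfolding f(2) nonneg_part_iff[OF f(1)] by blast
qed

lemma transfer_star_c: assumes "f \<in> C_int T" shows "transfer_star T \<rho> (c f) = c (L f)"
proof -
  have "c (L g) = c (L f)" if "g \<in> c f" for g
  proof -
    have g: "g \<in> C_int T" "c g = c f" using c_memD that by auto
    then obtain k where "(L ^^ k) g = (L ^^ k) f" using c_eq_iff assms by blast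
    then have "(L ^^ Suc k) g = (L ^^ Suc k) f" by simp
    then have "(L ^^ k) (L g) = (L ^^ k) (L f)" by (simp add: funpow_swap1)
    then show ?thesis using c_eq_iff transfer_C g assms by blast
  qed
  then have "(\<lambda>f. c (L f)) ` c f = {c (L f)}" using mem_c[OF assms] by blast
  then show ?thesis by (simp add: transfer_star_def)
qed

end

section \<open>Cyclic decomposition of the dimension group\<close>

lemma next_index_funpow:
  assumes "i \<in> {1..N}" shows "(next_index N ^^ k) i = (i - 1 + k) mod N + 1"
proof (induction k)
  case 0
  have "i - 1 < N" "1 \<le> i" using assms by auto
  then show ?case by simp
next
  case (Suc k)
  then show ?case by (simp add: next_index_def mod_Suc_eq)
qed

lemma next_index_funpow_mem:
  assumes "i \<in> {1..N}" shows "(next_index N ^^ k) i \<in> {1..N}"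
proof -
  have "(i - 1 + k) mod N < N" by (rule mod_less_divisor) (use assms in auto)
  then show ?thesis unfolding next_index_funpow[OF assms] by simp
qed

lemma next_index_funpow_N:
  assumes "i \<in> {1..N}" shows "(next_index N ^^ (N * k)) i = i"
proof -
  have "i - 1 < N" "1 \<le> i" using assms by auto
  then have "(i - 1 + N * k) mod N + 1 = i" by (simp only: mod_mult_self2 mod_less le_add_diff_inverse2)
  then show ?thesis by (simp only: next_index_funpow[OF assms])
qed

lemma next_index_reach:
  assumes "i \<in> {1..N}" "j \<in> {1..N}" obtains k where "(next_index N ^^ k) i = j"
proof -
  have "i - 1 + (j + N - i) = j - 1 + N" "j - 1 < N" "1 \<le> j" using assms by auto
  then have "(i - 1 + (j + N - i)) mod N + 1 = j" by (simp only: mod_add_self2 mod_less)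
  then show thesis using that[of "j + N - i"] by (simp only: next_index_funpow[OF assms(1)])
qed

text \<open>Following the cycle for \<open>N - 1\<close> further steps returns to the starting
  index.\<close>

lemma next_index_inj: "inj_on (next_index N) {1..N}"
proof (rule inj_onI)
  fix i j assume ij: "i \<in> {1..N}" "j \<in> {1..N}" "next_index N i = next_index N j"
  then have N: "N = Suc (N - 1)" by auto
  have "(next_index N ^^ (N - 1)) (next_index N i) = (next_index N ^^ (N - 1)) (next_index N j)"
    using ij by simp
  then have "(next_index N ^^ N) i = (next_index N ^^ N) j"
    by (subst (1 2) N) (simp add: funpow_swap1)
  then show "i = j" using next_index_funpow_N[of i N 1] next_index_funpow_N[of j N 1] ij by simp
qed

lemma additive_cmult:
  fixes \<phi> :: "('a \<Rightarrow> int) \<Rightarrow> real"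
  assumes add: "\<And>f g. f \<in> part_fun T A \<Longrightarrow> g \<in> part_fun T A \<Longrightarrow> \<phi> (\<lambda>x. f x + g x) = \<phi> f + \<phi> g"
    and f: "f \<in> part_fun T A"
  shows "\<phi> (\<lambda>x. k * f x) = real_of_int k * \<phi> f"
proof -
  have zero: "\<phi> (\<lambda>x. 0) = 0" using add[OF part_fun_zero part_fun_zero] by simp
  have nat: "\<phi> (\<lambda>x. int n * f x) = real n * \<phi> f" for n
  proof (induction n)
    case (Suc n)
    have "(\<lambda>x. int (Suc n) * f x) = (\<lambda>x. int n * f x + f x)" by (simp add: fun_eq_iff algebra_simps)
    then show ?case using add[OF part_fun_cmult[OF f] f, of "int n"] Suc by (simp add: algebra_simps)
  qed (simp add: zero)
  show ?thesis
  proof (cases "0 \<le> k")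
    case True then show ?thesis using nat[of "nat k"] by simp
  next
    case False
    have "\<phi> (\<lambda>x. k * f x + int (nat (- k)) * f x) = \<phi> (\<lambda>x. k * f x) + \<phi> (\<lambda>x. int (nat (- k)) * f x)"
      by (rule add[OF part_fun_cmult[OF f] part_fun_cmult[OF f]])
    moreover have "(\<lambda>x. k * f x + int (nat (- k)) * f x) = (\<lambda>x. 0)" using False by (simp add: fun_eq_iff)
    ultimately show ?thesis using nat[of "nat (- k)"] zero False by simp
  qed
qed

text \<open>The algebraic half of the proof: \<open>m\<close> stands for the integral, and
  \<open>eventually_pos\<close> is the outcome of the cone argument. Neither gaps nor measures are
  mentioned here.\<close>

locale cyclic_transfer =
  fixes T :: "'a topology" and \<sigma> :: "'a \<Rightarrow> 'a" and N :: nat and Xs :: "nat \<Rightarrow> 'a set"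
    and m :: "('a \<Rightarrow> int) \<Rightarrow> real" and s :: real
  assumes cyclic: "cyclic_exact_partition T \<sigma> N Xs"
    and transfer_closed: "f \<in> C_int T \<Longrightarrow> transfer T \<sigma> f \<in> C_int T"
    and transfer_onto: "f \<in> C_int T \<Longrightarrow> \<exists>g\<in>C_int T. transfer T \<sigma> g = f"
    and transfer_pow: "f \<in> C_int T \<Longrightarrow>
      (transfer T \<sigma> ^^ k) f x = (\<Sum>y\<in>{y \<in> topspace T. (\<sigma> ^^ k) y = x}. f y)"
    and finite_fibre: "finite {y \<in> topspace T. (\<sigma> ^^ k) y = x}"
    and countable_C: "countable (C_int T)"
    and m_plus: "\<lbrakk>f \<in> C_int T; g \<in> C_int T\<rbrakk> \<Longrightarrow> m (\<lambda>x. f x + g x) = m f + m g"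
    and m_transfer: "f \<in> C_int T \<Longrightarrow> m (transfer T \<sigma> f) = s * m f"
    and m_one: "m (indicator (topspace T)) = 1"
    and m_pos: "\<lbrakk>f \<in> C_int T; \<forall>x. 0 \<le> f x; \<exists>x. f x \<noteq> 0\<rbrakk> \<Longrightarrow> 0 < m f"
    and s_pos: "0 < s"
    and eventually_pos: "\<lbrakk>i \<in> {1..N}; f \<in> part_fun T (Xs i); 0 < m f\<rbrakk> \<Longrightarrow>
      \<exists>k. \<forall>x. 0 \<le> (transfer T \<sigma> ^^ k) f x"
begin

sublocale transfer_group T \<sigma>
  by unfold_locales (rule transfer_closed)

abbreviation G :: "nat \<Rightarrow> ('a \<Rightarrow> int) set ordered_group" where "G i \<equiv> G_part T \<sigma> (Xs i)"

abbreviation chi :: "nat \<Rightarrow> 'a \<Rightarrow> int" where "chi i \<equiv> indicator (Xs i)"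

section \<open>Restriction to the parts of the cycle\<close>

lemma N_pos: "1 \<le> N"
  using cyclic unfolding cyclic_exact_partition_def by blast

lemma part:
  assumes "i \<in> {1..N}"
  shows "Xs i \<noteq> {}" "openin T (Xs i)" "closedin T (Xs i)" "Xs i \<subseteq> topspace T"
    "\<sigma> ` Xs i = Xs (next_index N i)"
  using cyclic assms closedin_subset unfolding cyclic_exact_partition_def by blast+

lemma part_cover: "(\<Union>i\<in>{1..N}. Xs i) = topspace T"
  using cyclic unfolding cyclic_exact_partition_def by blast

lemma part_unique: assumes "x \<in> Xs i" "x \<in> Xs j" "i \<in> {1..N}" "j \<in> {1..N}" shows "i = j"
  using cyclic assms unfolding cyclic_exact_partition_def disjoint_family_on_def by blast

lemma sum_times_chi:
  assumes f: "f \<in> C_int T" shows "(\<lambda>x. \<Sum>i\<in>{1..N}. times_chi f (Xs i) x) = f"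
proof
  fix x
  show "(\<Sum>i\<in>{1..N}. times_chi f (Xs i) x) = f x"
  proof (cases "x \<in> topspace T")
    case True
    then obtain j where j: "j \<in> {1..N}" "x \<in> Xs j" using part_cover by blast
    have "(\<Sum>i\<in>{1..N}. times_chi f (Xs i) x) = (\<Sum>i\<in>{1..N}. if i = j then f x else 0)"
      by (rule sum.cong) (use j part_unique in \<open>auto simp: times_chi_def indicator_def\<close>)
    then show ?thesis using j by simp
  next
    case False
    then have "f x = 0" using f by (simp add: C_int_def)
    then show ?thesis by (simp add: times_chi_def)
  qed
qed

lemma chi_part: "i \<in> {1..N} \<Longrightarrow> chi i \<in> part_fun T (Xs i)"
  by (rule indicator_part[OF part(2,3)])

lemma times_chi_mem: "f \<in> C_int T \<Longrightarrow> i \<in> {1..N} \<Longrightarrow> times_chi f (Xs i) \<in> part_fun T (Xs i)"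
  by (rule times_chi_part[OF _ part(2,3)])

text \<open>The successor map on indices is injective, so a preimage of a point of the next part
  must lie in \<open>Xs i\<close>; restriction therefore commutes with transfer up to that
  shift.\<close>

lemma L_times_chi:
  assumes "i \<in> {1..N}" shows "L (times_chi f (Xs i)) = times_chi (L f) (Xs (next_index N i))"
proof
  fix x
  have iff: "y \<in> Xs i \<longleftrightarrow> x \<in> Xs (next_index N i)" if y: "y \<in> topspace T" "\<sigma> y = x" for y
  proof
    assume "y \<in> Xs i" then show "x \<in> Xs (next_index N i)" using part(5)[OF assms] y by blast
  next
    assume x: "x \<in> Xs (next_index N i)"
    obtain j where j: "j \<in> {1..N}" "y \<in> Xs j" using part_cover y(1) by blast
    then have "x \<in> Xs (next_index N j)" using part(5)[OF j(1)] y by blast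
    then have "next_index N i = next_index N j"
      using part_unique[OF x] next_index_funpow_mem[OF assms, of 1] next_index_funpow_mem[OF j(1), of 1] by simp
    then have "i = j" using inj_onD[OF next_index_inj _ assms j(1)] by blast
    then show "y \<in> Xs i" using j by simp
  qed
  show "L (times_chi f (Xs i)) x = times_chi (L f) (Xs (next_index N i)) x"
    unfolding transfer_def times_chi_def sum_distrib_right
    by (rule sum.cong) (use iff in \<open>auto simp: indicator_def\<close>)
qed

lemma Lk_times_chi:
  assumes i: "i \<in> {1..N}"
  shows "(L ^^ k) (times_chi f (Xs i)) = times_chi ((L ^^ k) f) (Xs ((next_index N ^^ k) i))"
proof (induction k)
  case (Suc k)
  then show ?case using L_times_chi[OF next_index_funpow_mem[OF i, of k]] by simp
qed simp

lemma Lk_part: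
  assumes i: "i \<in> {1..N}" and f: "f \<in> part_fun T (Xs i)"
  shows "(L ^^ k) f \<in> part_fun T (Xs ((next_index N ^^ k) i))"
proof -
  have "(L ^^ k) f = times_chi ((L ^^ k) f) (Xs ((next_index N ^^ k) i))"
    using Lk_times_chi[OF i, of k f] part_fun_times_chi[OF f] by simp
  then show ?thesis
    using times_chi_mem[OF Lk_C[OF part_funD(1)[OF f], of k] next_index_funpow_mem[OF i]] by metis
qed

text \<open>Surjectivity of transfer is localized by cutting a preimage down to \<open>Xs i\<close>.
  Functions constructed after \<open>k\<close> steps can thus be pulled back.\<close>

lemma Lk_onto:
  assumes i: "i \<in> {1..N}" and f: "f \<in> part_fun T (Xs ((next_index N ^^ k) i))"
  obtains g where "g \<in> part_fun T (Xs i)" "(L ^^ k) g = f"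
proof -
  have "\<exists>g\<in>C_int T. (L ^^ k) g = f" if "f \<in> C_int T" for f
    using that
  proof (induction k arbitrary: f)
    case (Suc k)
    obtain g where g: "g \<in> C_int T" "L g = f" using transfer_onto[OF Suc.prems] by blast
    obtain h where h: "h \<in> C_int T" "(L ^^ k) h = g" using Suc.IH[OF g(1)] by blast
    then have "(L ^^ Suc k) h = f" using g by simp
    then show ?case using h by blast
  qed auto
  then obtain g where g: "g \<in> C_int T" "(L ^^ k) g = f" using part_funD(1)[OF f] by blast
  have "(L ^^ k) (times_chi g (Xs i)) = f"
    unfolding Lk_times_chi[OF i] g(2) by (rule part_fun_times_chi[OF f])
  then show thesis using times_chi_mem[OF g(1) i] that by blast
qed

section \<open>The invariant functional and the strict order\<close>

lemma m_zero: "m (\<lambda>x. 0) = 0"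
  using m_plus[OF C_int_zero C_int_zero] by simp

lemma m_cmult: "f \<in> C_int T \<Longrightarrow> m (\<lambda>x. k * f x) = real_of_int k * m f"
  by (rule additive_cmult[of T "topspace T" m f k]) (simp_all add: part_fun_topspace m_plus)

lemma m_diff: assumes "f \<in> C_int T" "g \<in> C_int T" shows "m (\<lambda>x. f x - g x) = m f - m g"
  using m_plus[OF assms(1) C_int_cmult[OF assms(2), of "- 1"]] m_cmult[OF assms(2), of "- 1"] by simp

lemma m_sum: "finite I \<Longrightarrow> (\<And>i. i \<in> I \<Longrightarrow> f i \<in> C_int T) \<Longrightarrow> m (\<lambda>x. \<Sum>i\<in>I. f i x) = (\<Sum>i\<in>I. m (f i))"
  by (induction I rule: finite_induct) (auto simp: m_zero m_plus C_int_sum)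

lemma m_nonneg: assumes "f \<in> C_int T" "\<forall>x. 0 \<le> f x" shows "0 \<le> m f"
proof (cases "\<exists>x. f x \<noteq> 0")
  case True then show ?thesis using m_pos[OF assms] by simp
next
  case False
  then have "f = (\<lambda>x. 0)" by (simp add: fun_eq_iff)
  then show ?thesis using m_zero by simp
qed

lemma m_Lk: "f \<in> C_int T \<Longrightarrow> m ((L ^^ k) f) = s ^ k * m f"
  by (induction k) (simp_all add: m_transfer Lk_C)

lemma m_cong: assumes "f \<in> C_int T" "g \<in> C_int T" "c f = c g" shows "m f = m g"
proof -
  obtain k where "(L ^^ k) f = (L ^^ k) g" using assms c_eq_iff by blast
  then have "s ^ k * m f = s ^ k * m g" using m_Lk assms by metis
  then show ?thesis using s_pos by simp
qed

lemma m_chi_pos: assumes "i \<in> {1..N}" shows "0 < m (chi i)"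
proof -
  obtain x where "x \<in> Xs i" using part(1)[OF assms] by blast
  then have "\<exists>x. chi i x \<noteq> 0" by (intro exI[of _ x]) simp
  then show ?thesis using m_pos[OF part_funD(1)[OF chi_part[OF assms]]] by simp
qed

text \<open>A nonnegative function with \<open>m\<close> equal to zero vanishes by
  \<open>m_pos\<close>, and a power of transfer only rescales \<open>m\<close> by
  \<open>s ^ k\<close>. Conversely \<open>eventually_pos\<close> turns positive \<open>m\<close>
  into positivity of the class.\<close>

lemma nonneg_iff:
  assumes i: "i \<in> {1..N}" and f: "f \<in> part_fun T (Xs i)"
  shows "c f \<in> nonneg (G i) \<longleftrightarrow> 0 < m f \<or> c f = c (\<lambda>x. 0)"
proof
  assume "c f \<in> nonneg (G i)"
  then obtain k where k: "\<forall>x. 0 \<le> (L ^^ k) f x" using nonneg_part_iff[OF f] by blast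
  have C: "(L ^^ k) f \<in> C_int T" by (rule Lk_C[OF part_funD(1)[OF f]])
  show "0 < m f \<or> c f = c (\<lambda>x. 0)"
  proof (cases "\<exists>x. (L ^^ k) f x \<noteq> 0")
    case True
    then have "0 < m ((L ^^ k) f)" using m_pos[OF C k] by blast
    then have "0 < s ^ k * m f" using m_Lk[OF part_funD(1)[OF f], of k] by simp
    then show ?thesis using s_pos by (simp add: zero_less_mult_iff)
  next
    case False
    then have "(L ^^ k) f = (L ^^ k) (\<lambda>x. 0)" unfolding Lk_zero by (simp add: fun_eq_iff)
    then show ?thesis using c_eq_iff[OF part_funD(1)[OF f] C_int_zero] by blast
  qed
next
  assume "0 < m f \<or> c f = c (\<lambda>x. 0)"
  then show "c f \<in> nonneg (G i)"
  proof
    assume "0 < m f" then show ?thesis using eventually_pos[OF i f] nonneg_part_iff[OF f] by blast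
  next
    assume "c f = c (\<lambda>x. 0)"
    moreover have "c (\<lambda>x. 0) \<in> nonneg (G i)"
      unfolding nonneg_part_iff[OF part_fun_zero] by (rule exI[of _ 0]) simp
    ultimately show ?thesis by simp
  qed
qed

lemma ole_iff:
  assumes i: "i \<in> {1..N}" and f: "f \<in> part_fun T (Xs i)" and g: "g \<in> part_fun T (Xs i)"
  shows "ole (G i) (c f) (c g) \<longleftrightarrow> m f < m g \<or> c f = c g"
proof -
  have "c (\<lambda>x. g x - f x) = c (\<lambda>x. 0) \<longleftrightarrow> (\<exists>k. (L ^^ k) (\<lambda>x. g x - f x) = (L ^^ k) (\<lambda>x. 0))"
    by (rule c_eq_iff) (use part_funD(1)[OF part_fun_diff[OF g f]] C_int_zero in auto)
  also have "\<dots> \<longleftrightarrow> (\<exists>k. (L ^^ k) f = (L ^^ k) g)" unfolding Lk_diff Lk_zero by (simp add: fun_eq_iff) metis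
  also have "\<dots> \<longleftrightarrow> c f = c g" using c_eq_iff part_funD(1) f g by blast
  finally show ?thesis
    unfolding ole_def diff_part[OF g f] nonneg_iff[OF i part_fun_diff[OF g f]]
    using m_diff[OF part_funD(1)[OF g] part_funD(1)[OF f]] by simp
qed

text \<open>At a common power the four inequalities hold pointwise, and the maximum of the two lower
  functions interpolates. Since transfer is onto, this maximum comes from a function on
  \<open>Xs i\<close>.\<close>

lemma riesz_part: assumes i: "i \<in> {1..N}" shows "riesz_interpolation (G i)"
  unfolding riesz_interpolation_def
proof (intro ballI impI)
  fix x x' y y' assume car: "x \<in> carrier (G i)" "x' \<in> carrier (G i)" "y \<in> carrier (G i)" "y' \<in> carrier (G i)"
    and le: "ole (G i) x y \<and> ole (G i) x y' \<and> ole (G i) x' y \<and> ole (G i) x' y'"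
  obtain f f' g g' where f: "f \<in> part_fun T (Xs i)" "x = c f" and f': "f' \<in> part_fun T (Xs i)" "x' = c f'"
    and g: "g \<in> part_fun T (Xs i)" "y = c g" and g': "g' \<in> part_fun T (Xs i)" "y' = c g'"
    using car unfolding carrier_part by blast
  have up: "\<exists>k. \<forall>j\<ge>k. \<forall>x. (L ^^ j) u x \<le> (L ^^ j) v x"
    if uv: "u \<in> part_fun T (Xs i)" "v \<in> part_fun T (Xs i)" "ole (G i) (c u) (c v)" for u v
  proof -
    obtain k where "\<forall>x. (L ^^ k) u x \<le> (L ^^ k) v x" using ole_part_iff uv by blast
    then have k: "\<forall>x. 0 \<le> (L ^^ k) (\<lambda>x. v x - u x) x" by (simp add: Lk_diff)
    have "(L ^^ j) u x \<le> (L ^^ j) v x" if "k \<le> j" for j x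
      using spec[OF Lk_nonneg_mono[OF k that], of x] by (simp add: Lk_diff)
    then show ?thesis by blast
  qed
  obtain k1 where k1: "\<forall>j\<ge>k1. \<forall>x. (L ^^ j) f x \<le> (L ^^ j) g x" using up[OF f(1) g(1)] le f g by blast
  obtain k2 where k2: "\<forall>j\<ge>k2. \<forall>x. (L ^^ j) f x \<le> (L ^^ j) g' x" using up[OF f(1) g'(1)] le f g' by blast
  obtain k3 where k3: "\<forall>j\<ge>k3. \<forall>x. (L ^^ j) f' x \<le> (L ^^ j) g x" using up[OF f'(1) g(1)] le f' g by blast
  obtain k4 where k4: "\<forall>j\<ge>k4. \<forall>x. (L ^^ j) f' x \<le> (L ^^ j) g' x" using up[OF f'(1) g'(1)] le f' g' by blast
  define k where "k = k1 + k2 + k3 + k4"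
  let ?X = "Xs ((next_index N ^^ k) i)"
  have "(\<lambda>x. max ((L ^^ k) f x) ((L ^^ k) f' x)) \<in> part_fun T ?X"
    using Lk_part[OF i f(1), of k] Lk_part[OF i f'(1), of k] by (auto simp: part_fun_def intro: C_int_max)
  then obtain h where h: "h \<in> part_fun T (Xs i)" "(L ^^ k) h = (\<lambda>x. max ((L ^^ k) f x) ((L ^^ k) f' x))"
    by (rule Lk_onto[OF i])
  have hk: "(L ^^ k) h x = max ((L ^^ k) f x) ((L ^^ k) f' x)" for x using fun_cong[OF h(2), of x] .
  have k: "k1 \<le> k" "k2 \<le> k" "k3 \<le> k" "k4 \<le> k" by (simp_all add: k_def)
  have "\<forall>x. (L ^^ k) f x \<le> (L ^^ k) h x" "\<forall>x. (L ^^ k) f' x \<le> (L ^^ k) h x"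
    "\<forall>x. (L ^^ k) h x \<le> (L ^^ k) g x" "\<forall>x. (L ^^ k) h x \<le> (L ^^ k) g' x"
    using k1 k2 k3 k4 k unfolding hk by simp_all
  then have "ole (G i) x (c h)" "ole (G i) x' (c h)" "ole (G i) (c h) y" "ole (G i) (c h) y'"
    unfolding f(2) f'(2) g(2) g'(2) ole_part_iff[OF f(1) h(1)] ole_part_iff[OF f'(1) h(1)]
      ole_part_iff[OF h(1) g(1)] ole_part_iff[OF h(1) g'(1)] by blast+
  then show "\<exists>z\<in>carrier (G i). ole (G i) x z \<and> ole (G i) x' z \<and> ole (G i) z y \<and> ole (G i) z y'"
    using h(1) unfolding carrier_part by blast
qed

lemma dimension_part: assumes "i \<in> {1..N}" shows "dimension_group (G i)"
proof -
  have "countable (carrier (G i))"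
    unfolding carrier_part by (rule countable_image, rule countable_subset[OF _ countable_C]) (auto simp: part_fun_def)
  then show ?thesis
    unfolding dimension_group_def using ordered_part unperforated_part riesz_part[OF assms] by blast
qed

lemma order_unit_part: assumes i: "i \<in> {1..N}" shows "order_unit (G i) (ounit (G i))"
  unfolding order_unit_def ounit_part
proof (intro conjI ballI)
  show "c (chi i) \<in> nonneg (G i)" using nonneg_iff[OF i chi_part[OF i]] m_chi_pos[OF i] by blast
  fix x assume "x \<in> carrier (G i)"
  then obtain f where f: "f \<in> part_fun T (Xs i)" "x = c f" unfolding carrier_part by blast
  obtain k :: nat where "m f < real k * m (chi i)"
    using reals_Archimedean3[OF m_chi_pos[OF i]] by blast
  then have "m f < m (\<lambda>x. int k * chi i x)" using m_cmult[OF part_funD(1)[OF chi_part[OF i]], of "int k"] by simp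
  then show "\<exists>k::nat. ole (G i) x (c (chi i) [^]\<^bsub>G i\<^esub> k)"
    using ole_iff[OF i f(1) part_fun_cmult[OF chi_part[OF i]], of "int k"]
    unfolding f(2) pow_part[OF chi_part[OF i]] by blast
qed

text \<open>A nontrivial ideal contains a positive element with positive \<open>m\<close>. By the
  strict order its multiples dominate every positive element, and positive elements generate the
  group.\<close>

lemma simple_part: assumes i: "i \<in> {1..N}" shows "simple_dimension_group (G i)"
  unfolding simple_dimension_group_def
proof (intro conjI allI impI)
  let ?G = "G i"
  interpret comm_group ?G by (rule comm_group_part)
  show "dimension_group ?G" by (rule dimension_part[OF i])
  have "c (chi i) \<noteq> c (\<lambda>x. 0)"
    using m_cong[OF part_funD(1)[OF chi_part[OF i]] C_int_zero] m_chi_pos[OF i] m_zero by auto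
  then show "carrier ?G \<noteq> {\<one>\<^bsub>?G\<^esub>}" using chi_part[OF i] unfolding carrier_part one_part by blast
  fix J assume J: "order_ideal J ?G"
  then have sub: "subgroup J ?G" by (simp add: order_ideal_def)
  have gen: "\<exists>y\<in>J \<inter> nonneg ?G. \<exists>z\<in>J \<inter> nonneg ?G. x = y \<otimes>\<^bsub>?G\<^esub> inv\<^bsub>?G\<^esub> z" if "x \<in> J" for x
    using J that by (simp add: order_ideal_def)
  have her: "x \<in> J" if "x \<in> nonneg ?G" "y \<in> J" "ole ?G x y" for x y
    using J that unfolding order_ideal_def by blast
  show "J = {\<one>\<^bsub>?G\<^esub>} \<or> J = carrier ?G"
  proof (cases "J \<subseteq> {\<one>\<^bsub>?G\<^esub>}")
    case True
    then show ?thesis using subgroup.one_closed[OF sub] by blast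
  next
    case False
    then obtain x where x: "x \<in> J" "x \<noteq> \<one>\<^bsub>?G\<^esub>" by blast
    obtain y z where yz: "y \<in> J \<inter> nonneg ?G" "z \<in> J \<inter> nonneg ?G" "x = y \<otimes>\<^bsub>?G\<^esub> inv\<^bsub>?G\<^esub> z"
      using gen[OF x(1)] by blast
    have "y \<noteq> \<one>\<^bsub>?G\<^esub> \<or> z \<noteq> \<one>\<^bsub>?G\<^esub>" using x(2) yz(3) by auto
    then obtain v where v: "v \<in> J" "v \<in> nonneg ?G" "v \<noteq> \<one>\<^bsub>?G\<^esub>" using yz by blast
    obtain g where g: "g \<in> part_fun T (Xs i)" "v = c g" using v(2) nonneg_part_sub by blast
    have mg: "0 < m g" using v(2,3) nonneg_iff[OF i g(1)] unfolding g(2) one_part by blast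
    have pow: "v [^]\<^bsub>?G\<^esub> (k :: nat) \<in> J" for k
      by (induction k) (use v(1) sub in \<open>auto simp: subgroup.one_closed subgroup.m_closed\<close>)
    have pos: "w \<in> J" if w: "w \<in> nonneg ?G" for w
    proof -
      obtain f where f: "f \<in> part_fun T (Xs i)" "w = c f" using w nonneg_part_sub by blast
      obtain k :: nat where "m f < real k * m g" using reals_Archimedean3[OF mg] by blast
      then have "m f < m (\<lambda>x. int k * g x)" using m_cmult[OF part_funD(1)[OF g(1)], of "int k"] by simp
      then have "ole ?G w (v [^]\<^bsub>?G\<^esub> k)"
        unfolding f(2) g(2) pow_part[OF g(1)] ole_iff[OF i f(1) part_fun_cmult[OF g(1)]] by blast
      then show ?thesis using her[OF w pow] by blast
    qed
    have "carrier ?G \<subseteq> J"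
    proof
      fix w assume "w \<in> carrier ?G"
      moreover have "\<forall>x\<in>carrier ?G. \<exists>y\<in>nonneg ?G. \<exists>z\<in>nonneg ?G. x = y \<otimes>\<^bsub>?G\<^esub> inv\<^bsub>?G\<^esub> z"
        using ordered_part[of "Xs i"] unfolding ordered_abelian_group_def by (elim conjE)
      ultimately obtain y z where "y \<in> nonneg ?G" "z \<in> nonneg ?G" "w = y \<otimes>\<^bsub>?G\<^esub> inv\<^bsub>?G\<^esub> z"
        by (elim ballE bexE) auto
      then show "w \<in> J" using pos sub by (simp add: subgroup.m_closed subgroup.m_inv_closed)
    qed
    then show ?thesis using subgroup.subset[OF sub] by blast
  qed
qed

text \<open>Since the order of \<open>G i\<close> is the strict order of \<open>m\<close>, comparing \<open>k f\<close> with \<open>l \<chi>\<close> for all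
  integers \<open>k\<close> and \<open>l\<close> determines every positive additive functional up to a factor.\<close>

lemma positive_functional:
  assumes i: "i \<in> {1..N}"
    and add: "\<And>f g. f \<in> part_fun T (Xs i) \<Longrightarrow> g \<in> part_fun T (Xs i) \<Longrightarrow> \<phi> (\<lambda>x. f x + g x) = \<phi> f + \<phi> g"
    and pos: "\<And>f. f \<in> part_fun T (Xs i) \<Longrightarrow> c f \<in> nonneg (G i) \<Longrightarrow> 0 \<le> (\<phi> f :: real)"
    and f: "f \<in> part_fun T (Xs i)"
  shows "\<phi> f = m f / m (chi i) * \<phi> (chi i)"
proof -
  let ?w = "m (chi i)" and ?x = "\<phi> (chi i)"
  have w: "0 < ?w" by (rule m_chi_pos[OF i])
  note chi = chi_part[OF i]
  have x: "0 \<le> ?x" using pos[OF chi] nonneg_iff[OF i chi] w by blast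
  have le: "m f / ?w * ?x \<le> \<phi> f" if f: "f \<in> part_fun T (Xs i)" for f
  proof (rule ccontr)
    assume "\<not> m f / ?w * ?x \<le> \<phi> f"
    then have d: "0 < m f / ?w * ?x - \<phi> f" by simp
    obtain k :: nat where k: "?x < real k * (m f / ?w * ?x - \<phi> f)" using reals_Archimedean3[OF d] by blast
    \<comment> \<open>The largest integer strictly below \<open>k * m f / m (chi i)\<close>;
      strictness makes the class of \<open>k * f - l * chi i\<close> positive in the strict
      order.\<close>
    define l where "l = \<lceil>real k * (m f / ?w)\<rceil> - 1"
    have l: "real_of_int l < real k * (m f / ?w)" "real k * (m f / ?w) - 1 \<le> real_of_int l"
      unfolding l_def by linarith+
    let ?h = "\<lambda>x. int k * f x - l * chi i x"
    have h: "?h \<in> part_fun T (Xs i)" by (intro part_fun_diff part_fun_cmult f chi)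
    have "m ?h = real k * m f - real_of_int l * ?w"
      using m_diff[OF part_funD(1)[OF part_fun_cmult[OF f]] part_funD(1)[OF part_fun_cmult[OF chi]]]
        m_cmult[OF part_funD(1)[OF f]] m_cmult[OF part_funD(1)[OF chi]] by simp
    moreover have "real_of_int l * ?w < real k * m f"
      using mult_strict_right_mono[OF l(1) w] w by simp
    ultimately have "0 \<le> \<phi> ?h" using pos[OF h] nonneg_iff[OF i h] by simp
    moreover have "\<phi> ?h = real k * \<phi> f - real_of_int l * ?x"
    proof -
      have "?h = (\<lambda>x. int k * f x + (- l) * chi i x)" by simp
      then have "\<phi> ?h = \<phi> (\<lambda>x. int k * f x) + \<phi> (\<lambda>x. (- l) * chi i x)"
        using add[OF part_fun_cmult[OF f, of "int k"] part_fun_cmult[OF chi, of "- l"]] by (simp only:)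
      also have "\<phi> (\<lambda>x. int k * f x) = real_of_int (int k) * \<phi> f"
        by (rule additive_cmult[of T "Xs i" \<phi>, OF add f])
      also have "\<phi> (\<lambda>x. (- l) * chi i x) = real_of_int (- l) * ?x"
        by (rule additive_cmult[of T "Xs i" \<phi>, OF add chi])
      finally show ?thesis by simp
    qed
    moreover have "(real k * (m f / ?w) - 1) * ?x \<le> real_of_int l * ?x" by (rule mult_right_mono[OF l(2) x])
    ultimately show False using k by (simp add: algebra_simps)
  qed
  \<comment> \<open>The reverse inequality comes from the one just proved, applied to
    \<open>- f\<close>.\<close>
  have "m (\<lambda>x. (- 1) * f x) / ?w * ?x \<le> \<phi> (\<lambda>x. (- 1) * f x)" by (rule le[OF part_fun_cmult[OF f]])
  moreover have "\<phi> (\<lambda>x. (- 1) * f x) = real_of_int (- 1) * \<phi> f"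
    by (rule additive_cmult[of T "Xs i" \<phi>, OF add f])
  moreover have "m (\<lambda>x. (- 1) * f x) = real_of_int (- 1) * m f" by (rule m_cmult[OF part_funD(1)[OF f]])
  ultimately have "- (m f / ?w * ?x) \<le> - \<phi> f" by simp
  then show ?thesis using le[OF f] by linarith
qed

text \<open>\<open>m\<close> transported to classes; by \<open>m_cong\<close> the chosen
  representative does not matter.\<close>

definition mval :: "('a \<Rightarrow> int) set \<Rightarrow> real" where
  "mval x = m (SOME f. f \<in> C_int T \<and> c f = x)"

lemma mval_c: assumes f: "f \<in> C_int T" shows "mval (c f) = m f"
proof -
  have "(SOME g. g \<in> C_int T \<and> c g = c f) \<in> C_int T \<and> c (SOME g. g \<in> C_int T \<and> c g = c f) = c f"
    by (rule someI[of _ f]) (use f in simp)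
  then show ?thesis unfolding mval_def using m_cong f by blast
qed

lemma state_part:
  assumes i: "i \<in> {1..N}"
  shows "\<exists>\<omega>. is_state (G i) \<omega> \<and>
    (\<forall>f\<in>C_int T. supp T f \<subseteq> Xs i \<longrightarrow> \<omega> (c f) = inverse (m (chi i)) * m f) \<and>
    (\<forall>\<omega>'. is_state (G i) \<omega>' \<longrightarrow> (\<forall>x\<in>carrier (G i). \<omega>' x = \<omega> x)) \<and> has_strict_order (G i) \<omega>"
proof (intro exI[of _ "\<lambda>x. inverse (m (chi i)) * mval x"] conjI ballI allI impI)
  let ?w = "m (chi i)" and ?\<omega> = "\<lambda>x. inverse (m (chi i)) * mval x"
  have w: "0 < ?w" by (rule m_chi_pos[OF i])
  have val: "?\<omega> (c f) = inverse ?w * m f" if "f \<in> part_fun T (Xs i)" for f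
    using mval_c part_funD(1)[OF that] by simp
  show "is_state (G i) ?\<omega>"
    unfolding is_state_def
  proof (intro conjI ballI)
    fix x y assume "x \<in> carrier (G i)" "y \<in> carrier (G i)"
    then obtain f g where fg: "f \<in> part_fun T (Xs i)" "x = c f" "g \<in> part_fun T (Xs i)" "y = c g"
      unfolding carrier_part by blast
    show "?\<omega> (x \<otimes>\<^bsub>G i\<^esub> y) = ?\<omega> x + ?\<omega> y"
      unfolding fg mult_part_c[OF fg(1,3)] val[OF fg(1)] val[OF fg(3)] val[OF part_fun_plus[OF fg(1,3)]]
      using m_plus[OF part_funD(1)[OF fg(1)] part_funD(1)[OF fg(3)]] by (simp add: algebra_simps)
  next
    fix x assume x: "x \<in> nonneg (G i)"
    then obtain f where f: "f \<in> part_fun T (Xs i)" "x = c f" using nonneg_part_sub by blast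
    have "0 \<le> m f" using x nonneg_iff[OF i f(1)] m_cong[OF part_funD(1)[OF f(1)] C_int_zero] m_zero
      unfolding f(2) by auto
    then show "0 \<le> ?\<omega> x" unfolding f(2) val[OF f(1)] using w by simp
  next
    show "?\<omega> (ounit (G i)) = 1" unfolding ounit_part val[OF chi_part[OF i]] using w by simp
  qed
  show "?\<omega> (c f) = inverse ?w * m f" if "f \<in> C_int T" "supp T f \<subseteq> Xs i" for f
    using mval_c that by simp
  show "\<omega>' x = ?\<omega> x" if st: "is_state (G i) \<omega>'" and x: "x \<in> carrier (G i)" for \<omega>' x
  proof -
    obtain f where f: "f \<in> part_fun T (Xs i)" "x = c f" using x unfolding carrier_part by blast
    have "\<omega>' (c f) = m f / ?w * \<omega>' (c (chi i))"
    proof (rule positive_functional[OF i _ _ f(1), of "\<lambda>f. \<omega>' (c f)"])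
      fix f g assume fg: "f \<in> part_fun T (Xs i)" "g \<in> part_fun T (Xs i)"
      have "c f \<in> carrier (G i)" "c g \<in> carrier (G i)" using fg unfolding carrier_part by blast+
      then have "\<omega>' (c f \<otimes>\<^bsub>G i\<^esub> c g) = \<omega>' (c f) + \<omega>' (c g)" using st unfolding is_state_def by blast
      then show "\<omega>' (c (\<lambda>x. f x + g x)) = \<omega>' (c f) + \<omega>' (c g)" unfolding mult_part_c[OF fg] .
    next
      fix f assume "c f \<in> nonneg (G i)"
      then show "0 \<le> \<omega>' (c f)" using st unfolding is_state_def by blast
    qed
    moreover have "\<omega>' (c (chi i)) = 1" using st unfolding is_state_def ounit_part by blast
    ultimately show ?thesis unfolding f(2) val[OF f(1)] by (simp add: divide_inverse mult.commute)
  qed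
  show "has_strict_order (G i) ?\<omega>"
    unfolding has_strict_order_def
  proof (intro ballI)
    fix x y assume "x \<in> carrier (G i)" "y \<in> carrier (G i)"
    then obtain f g where fg: "f \<in> part_fun T (Xs i)" "x = c f" "g \<in> part_fun T (Xs i)" "y = c g"
      unfolding carrier_part by blast
    show "ole (G i) x y \<longleftrightarrow> ?\<omega> x < ?\<omega> y \<or> x = y"
      unfolding fg ole_iff[OF i fg(1,3)] val[OF fg(1)] val[OF fg(3)] using w by simp
  qed
qed

lemma transfer_star_part:
  assumes i: "i \<in> {1..N}" shows "transfer_star T \<sigma> ` carrier (G i) = carrier (G (next_index N i))"
proof
  show "transfer_star T \<sigma> ` carrier (G i) \<subseteq> carrier (G (next_index N i))"
  proof
    fix y assume "y \<in> transfer_star T \<sigma> ` carrier (G i)"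
    then obtain f where f: "f \<in> part_fun T (Xs i)" "y = transfer_star T \<sigma> (c f)" unfolding carrier_part by blast
    then have "y = c (L f)" using transfer_star_c part_funD(1) by blast
    moreover have "L f \<in> part_fun T (Xs (next_index N i))" using Lk_part[OF i f(1), of 1] by simp
    ultimately show "y \<in> carrier (G (next_index N i))" unfolding carrier_part by blast
  qed
  show "carrier (G (next_index N i)) \<subseteq> transfer_star T \<sigma> ` carrier (G i)"
  proof
    fix y assume "y \<in> carrier (G (next_index N i))"
    then obtain f where f: "f \<in> part_fun T (Xs (next_index N i))" "y = c f" unfolding carrier_part by blast
    then have f1: "f \<in> part_fun T (Xs ((next_index N ^^ 1) i))" by simp
    obtain g where g: "g \<in> part_fun T (Xs i)" "(L ^^ 1) g = f" by (rule Lk_onto[OF i f1])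
    then have "y = transfer_star T \<sigma> (c g)" using f(2) transfer_star_c[OF part_funD(1)[OF g(1)]] by simp
    then show "y \<in> transfer_star T \<sigma> ` carrier (G i)" using g(1) unfolding carrier_part by blast
  qed
qed

text \<open>On each part a positive functional is a multiple \<open>d i\<close> of \<open>m\<close>.
  Scaling by \<open>t\<close> relates consecutive parts by the factor \<open>t / s\<close>, so a
  full turn of the cycle gives \<open>(t / s) ^ N = 1\<close> and hence \<open>t = s\<close>. Then
  all \<open>d i\<close> agree, and normalization makes them \<open>1\<close>.\<close>

lemma scaled_state:
  "\<exists>\<omega>. is_state (G_group T \<sigma>) \<omega> \<and> (\<forall>f\<in>C_int T. \<omega> (c f) = m f) \<and>
    state_scaled_by (G_group T \<sigma>) (transfer_star T \<sigma>) s \<omega> \<and>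
    (\<forall>\<omega>' t. is_state (G_group T \<sigma>) \<omega>' \<and> state_scaled_by (G_group T \<sigma>) (transfer_star T \<sigma>) t \<omega>' \<longrightarrow>
      (\<forall>x\<in>carrier (G_group T \<sigma>). \<omega>' x = \<omega> x))"
proof (intro exI[of _ "mval"] conjI ballI allI impI)
  have car: "carrier (G_group T \<sigma>) = c ` C_int T"
    unfolding G_group_eq_part carrier_part part_fun_topspace ..
  show "mval (c f) = m f" if "f \<in> C_int T" for f by (rule mval_c[OF that])
  show "is_state (G_group T \<sigma>) mval"
    unfolding is_state_def
  proof (intro conjI ballI)
    fix x y assume "x \<in> carrier (G_group T \<sigma>)" "y \<in> carrier (G_group T \<sigma>)"
    then obtain f g where fg: "f \<in> C_int T" "x = c f" "g \<in> C_int T" "y = c g" unfolding car by blast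
    show "mval (x \<otimes>\<^bsub>G_group T \<sigma>\<^esub> y) = mval x + mval y"
      unfolding fg mult_c[OF fg(1,3)] mval_c[OF C_int_plus[OF fg(1,3)]] mval_c[OF fg(1)] mval_c[OF fg(3)]
      by (rule m_plus[OF fg(1,3)])
  next
    fix x assume x: "x \<in> nonneg (G_group T \<sigma>)"
    then obtain f where f: "f \<in> C_int T" "x = c f" by (auto simp: G_group_def)
    then obtain k where "\<forall>x. 0 \<le> (L ^^ k) f x" using x nonneg_c by blast
    then have "0 \<le> s ^ k * m f" using m_nonneg[OF Lk_C[OF f(1)], of k] m_Lk[OF f(1), of k] by simp
    then show "0 \<le> mval x" unfolding f(2) mval_c[OF f(1)] using zero_less_power[OF s_pos, of k]
      by (simp add: zero_le_mult_iff)
  next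
    have "ounit (G_group T \<sigma>) = c (indicator (topspace T))" by (simp add: G_group_def)
    then show "mval (ounit (G_group T \<sigma>)) = 1"
      using mval_c[OF C_int_indicator[of T "topspace T"]] m_one by simp
  qed
  show "state_scaled_by (G_group T \<sigma>) (transfer_star T \<sigma>) s mval"
    unfolding state_scaled_by_def car
    using transfer_star_c mval_c m_transfer transfer_closed by auto
  fix \<omega>' t x
  assume as: "is_state (G_group T \<sigma>) \<omega>' \<and> state_scaled_by (G_group T \<sigma>) (transfer_star T \<sigma>) t \<omega>'"
    and x: "x \<in> carrier (G_group T \<sigma>)"
  define \<phi> where "\<phi> f = \<omega>' (c f)" for f
  have add: "\<phi> (\<lambda>x. f x + g x) = \<phi> f + \<phi> g" if fg: "f \<in> C_int T" "g \<in> C_int T" for f g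
  proof -
    have "c f \<in> carrier (G_group T \<sigma>)" "c g \<in> carrier (G_group T \<sigma>)" using fg unfolding car by blast+
    then have "\<omega>' (c f \<otimes>\<^bsub>G_group T \<sigma>\<^esub> c g) = \<omega>' (c f) + \<omega>' (c g)" using as unfolding is_state_def by blast
    then show ?thesis unfolding \<phi>_def mult_c[OF fg] .
  qed
  have pos: "0 \<le> \<phi> f" if "c f \<in> nonneg (G_group T \<sigma>)" for f
    using as that unfolding is_state_def \<phi>_def by blast
  have sc: "\<phi> (L f) = t * \<phi> f" if f: "f \<in> C_int T" for f
  proof -
    have "c f \<in> carrier (G_group T \<sigma>)" using f unfolding car by blast
    then have "\<omega>' (transfer_star T \<sigma> (c f)) = t * \<omega>' (c f)" using as unfolding state_scaled_by_def by blast
    then show ?thesis unfolding \<phi>_def transfer_star_c[OF f] .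
  qed
  have one: "\<phi> (indicator (topspace T)) = 1"
    using as unfolding is_state_def \<phi>_def by (simp add: G_group_def)
  have sum: "\<phi> (\<lambda>x. \<Sum>i\<in>I. f i x) = (\<Sum>i\<in>I. \<phi> (f i))" if "finite I" "\<And>i. i \<in> I \<Longrightarrow> f i \<in> C_int T" for I f
    using that
  proof (induction I rule: finite_induct)
    case empty
    then show ?case using add[OF C_int_zero C_int_zero] by simp
  qed (auto simp: add C_int_sum)
  define d where "d i = \<phi> (chi i) / m (chi i)" for i
  have on_part: "\<phi> f = d i * m f" if i: "i \<in> {1..N}" and f: "f \<in> part_fun T (Xs i)" for i f
  proof -
    have "\<phi> f = m f / m (chi i) * \<phi> (chi i)"
    proof (rule positive_functional[OF i _ _ f])
      show "0 \<le> \<phi> f" if "f \<in> part_fun T (Xs i)" "c f \<in> nonneg (G i)" for f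
        using pos[of f] that nonneg_part_iff nonneg_c part_funD(1) by blast
    qed (use add part_funD(1) in blast)
    then show ?thesis by (simp add: d_def)
  qed
  have d0: "0 \<le> d i" if i: "i \<in> {1..N}" for i
  proof -
    have "\<exists>k. \<forall>x. 0 \<le> (L ^^ k) (chi i) x" by (rule exI[of _ 0]) simp
    then have "c (chi i) \<in> nonneg (G_group T \<sigma>)"
      using nonneg_c[OF part_funD(1)[OF chi_part[OF i]]] by blast
    then show ?thesis using pos m_chi_pos[OF i] by (simp add: d_def)
  qed
  have step: "s * d (next_index N i) = t * d i" if i: "i \<in> {1..N}" for i
  proof -
    have ni: "next_index N i \<in> {1..N}" using next_index_funpow_mem[OF i, of 1] by simp
    have C: "chi i \<in> C_int T" by (rule part_funD(1)[OF chi_part[OF i]])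
    have "L (chi i) \<in> part_fun T (Xs (next_index N i))" using Lk_part[OF i chi_part[OF i], of 1] by simp
    then have "\<phi> (L (chi i)) = d (next_index N i) * (s * m (chi i))" using on_part[OF ni] m_transfer[OF C] by simp
    moreover have "\<phi> (L (chi i)) = t * (d i * m (chi i))" using sc[OF C] on_part[OF i chi_part[OF i]] by simp
    ultimately show ?thesis using m_chi_pos[OF i] by simp
  qed
  have iter: "d ((next_index N ^^ k) i) = (t / s) ^ k * d i" if i: "i \<in> {1..N}" for i k
  proof (induction k)
    case (Suc k)
    have "d ((next_index N ^^ Suc k) i) = (t / s) * d ((next_index N ^^ k) i)"
      using step[OF next_index_funpow_mem[OF i, of k]] s_pos by (simp add: field_simps)
    then show ?case using Suc by simp
  qed simp
  have split: "\<phi> f = (\<Sum>i\<in>{1..N}. d i * m (times_chi f (Xs i)))" if f: "f \<in> C_int T" for f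
  proof -
    have "\<phi> f = \<phi> (\<lambda>x. \<Sum>i\<in>{1..N}. times_chi f (Xs i) x)" unfolding sum_times_chi[OF f] ..
    also have "\<dots> = (\<Sum>i\<in>{1..N}. \<phi> (times_chi f (Xs i)))"
      by (rule sum) (use times_chi_mem[OF f] part_funD(1) in auto)
    also have "\<dots> = (\<Sum>i\<in>{1..N}. d i * m (times_chi f (Xs i)))"
      by (rule sum.cong[OF refl on_part]) (use times_chi_mem[OF f] in auto)
    finally show ?thesis .
  qed
  have msplit: "m f = (\<Sum>i\<in>{1..N}. m (times_chi f (Xs i)))" if f: "f \<in> C_int T" for f
  proof -
    have "m f = m (\<lambda>x. \<Sum>i\<in>{1..N}. times_chi f (Xs i) x)" unfolding sum_times_chi[OF f] ..
    also have "\<dots> = (\<Sum>i\<in>{1..N}. m (times_chi f (Xs i)))"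
      by (rule m_sum) (use times_chi_mem[OF f] part_funD(1) in auto)
    finally show ?thesis .
  qed
  have C1: "indicator (topspace T) \<in> C_int T" by (rule C_int_indicator) auto
  \<comment> \<open>A state cannot vanish on every part; a nonzero \<open>d i\<close> is needed for
    cancellation after a full turn of the cycle.\<close>
  have "\<exists>i\<in>{1..N}. d i \<noteq> 0"
  proof (rule ccontr)
    assume "\<not> ?thesis"
    then have "\<phi> (indicator (topspace T)) = 0" unfolding split[OF C1] by simp
    then show False using one by simp
  qed
  then obtain i where i: "i \<in> {1..N}" "0 < d i" using d0 by force
  have "d i = (t / s) ^ N * d i" using iter[OF i(1), of N] next_index_funpow_N[OF i(1), of 1] by simp
  then have "(t / s) ^ N = 1" using i(2) by simp
  \<comment> \<open>Nonnegativity rules out the root \<open>- 1\<close> when \<open>N\<close> is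
    even.\<close>
  moreover have "0 \<le> t / s"
  proof -
    have "0 \<le> s * d (next_index N i)" using d0 next_index_funpow_mem[OF i(1), of 1] s_pos by simp
    then show ?thesis using step[OF i(1)] i(2) s_pos by (simp add: zero_le_mult_iff)
  qed
  ultimately have "t / s = 1" using N_pos power_eq_imp_eq_base[of "t / s" N 1] by simp
  have const: "d j = d i" if j: "j \<in> {1..N}" for j
  proof -
    obtain k where "(next_index N ^^ k) i = j" by (rule next_index_reach[OF i(1) j])
    then show ?thesis using iter[OF i(1), of k] \<open>t / s = 1\<close> by simp
  qed
  have proportional: "\<phi> f = d i * m f" if f: "f \<in> C_int T" for f
    unfolding split[OF f] msplit[OF f] sum_distrib_left by (rule sum.cong) (use const in auto)
  have "d i = 1" using proportional[OF C1] one m_one by simp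
  then have eq: "\<phi> f = m f" if "f \<in> C_int T" for f using proportional[OF that] by simp
  obtain f where f: "f \<in> C_int T" "x = c f" using x unfolding car by blast
  show "\<omega>' x = mval x" using eq[OF f(1)] mval_c[OF f(1)] unfolding f(2) \<phi>_def by simp
qed

section \<open>The direct sum and the return maps\<close>

lemma common_exponent:
  assumes "finite I" "\<And>i. i \<in> I \<Longrightarrow> \<exists>k. Q i k" "\<And>i k j. Q i k \<Longrightarrow> k \<le> j \<Longrightarrow> Q i j"
  shows "\<exists>k::nat. \<forall>i\<in>I. Q i k"
proof -
  obtain k where k: "\<And>i. i \<in> I \<Longrightarrow> Q i (k i)" using assms(2) by metis
  have "\<forall>i\<in>I. Q i (\<Sum>i\<in>I. k i)"
    using assms(3)[OF k member_le_sum[of _ I k]] assms(1) by auto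
  then show ?thesis by blast
qed

lemma times_chi_sum:
  assumes "\<And>i. i \<in> {1..N} \<Longrightarrow> g i \<in> part_fun T (Xs i)" "j \<in> {1..N}"
  shows "times_chi (\<lambda>x. \<Sum>i\<in>{1..N}. g i x) (Xs j) = g j"
proof
  fix x
  show "times_chi (\<lambda>x. \<Sum>i\<in>{1..N}. g i x) (Xs j) x = g j x"
  proof (cases "x \<in> Xs j")
    case True
    have "(\<Sum>i\<in>{1..N}. g i x) = (\<Sum>i\<in>{1..N}. if i = j then g j x else 0)"
    proof (rule sum.cong[OF refl])
      fix i assume i: "i \<in> {1..N}"
      show "g i x = (if i = j then g j x else 0)"
        using part_funD(2)[OF assms(1)[OF i], of x] part_unique[OF True _ assms(2) i] by auto
    qed
    then show ?thesis using True assms(2) by (simp add: times_chi_def)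
  next
    case False
    then show ?thesis using part_funD(2)[OF assms(1)[OF assms(2)]] by (simp add: times_chi_def)
  qed
qed

text \<open>A function is the sum of its restrictions, and transfer moves these to different parts,
  so equality and positivity can be tested part by part. Finitely many exponents are involved, and
  both properties persist for larger ones.\<close>

lemma decomposition:
  "\<exists>h. (\<forall>f\<in>C_int T. h (c f) = (\<lambda>i\<in>{1..N}. c (times_chi f (Xs i)))) \<and>
    unital_dimension_group_iso (G_group T \<sigma>) (ordered_direct_sum {1..N} G) h"
proof -
  let ?I = "{1..N}"
  let ?H = "ordered_direct_sum ?I G"
  let ?d = "\<lambda>f. \<lambda>i\<in>?I. c (times_chi f (Xs i))"
  have grp: "group (G i)" for i using comm_group_part comm_group_def by blast
  have carH: "carrier ?H = (\<Pi>\<^sub>E i\<in>?I. carrier (G i))"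
    unfolding ordered_direct_sum_def by (simp add: carrier_sum_group grp)
  have "group (sum_group ?I G)" by (rule sum_group) (rule grp)
  \<comment> \<open>\<open>ordered_direct_sum\<close> is another record with the operations of
    \<open>sum_group\<close>, so the group axioms carry over by unfolding.\<close>
  then have H: "group ?H"
    unfolding group_def monoid_def group_axioms_def Units_def by (simp add: ordered_direct_sum_def)
  have G: "group (G_group T \<sigma>)" unfolding G_group_eq_part using comm_group_part comm_group_def by blast
  have d_car: "?d f \<in> carrier ?H" if "f \<in> C_int T" for f
    unfolding carH carrier_part using times_chi_mem[OF that] by auto
  have d_onto: "\<exists>f\<in>C_int T. x = ?d f" if x: "x \<in> carrier ?H" for x
  proof -
    have "\<exists>g. g \<in> part_fun T (Xs i) \<and> x i = c g" if "i \<in> ?I" for i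
      using x that unfolding carH carrier_part by (auto simp: PiE_iff)
    then obtain g where g: "\<And>i. i \<in> ?I \<Longrightarrow> g i \<in> part_fun T (Xs i) \<and> x i = c (g i)" by metis
    let ?f = "\<lambda>x. \<Sum>i\<in>?I. g i x"
    have f: "?f \<in> C_int T" by (rule C_int_sum) (use g part_funD(1) in blast)+
    have "x = ?d ?f"
    proof
      fix i
      show "x i = ?d ?f i"
      proof (cases "i \<in> ?I")
        case True
        then show ?thesis using times_chi_sum[of g i] g by simp
      next
        case False
        then show ?thesis using x unfolding carH by (auto simp: PiE_iff extensional_def)
      qed
    qed
    then show ?thesis using f by blast
  qed
  have nonnegH: "x \<in> nonneg ?H \<longleftrightarrow> (\<forall>i\<in>?I. x i \<in> nonneg (G i))" if "x \<in> carrier ?H" for x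
    using that by (simp add: ordered_direct_sum_def)
  have multH: "x \<otimes>\<^bsub>?H\<^esub> y = (\<lambda>i\<in>?I. x i \<otimes>\<^bsub>G i\<^esub> y i)" for x y
    by (simp add: ordered_direct_sum_def)
  have recombine: "(L ^^ k) f = (\<lambda>x. \<Sum>i\<in>?I. (L ^^ k) (times_chi f (Xs i)) x)" if "f \<in> C_int T" for f k
    using sum_times_chi[OF that] Lk_sum[of k "\<lambda>i. times_chi f (Xs i)" ?I] by simp
  have "\<exists>h. (\<forall>f\<in>C_int T. h (c f) = ?d f) \<and> dimension_group_iso (G_group T \<sigma>) ?H h"
  proof (rule dimension_group_iso_classes[OF G H, where add = "\<lambda>f g x. f x + g x"])
    show "carrier (G_group T \<sigma>) = c ` C_int T" unfolding G_group_eq_part carrier_part part_fun_topspace ..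
    show "carrier ?H = ?d ` C_int T" using d_car d_onto by (auto simp: image_iff)
  next
    fix f g assume fg: "f \<in> C_int T" "g \<in> C_int T"
    show "(\<lambda>x. f x + g x) \<in> C_int T" by (rule C_int_plus[OF fg])
    show "c f \<otimes>\<^bsub>G_group T \<sigma>\<^esub> c g = c (\<lambda>x. f x + g x)" by (rule mult_c[OF fg])
    have "times_chi (\<lambda>x. f x + g x) A = (\<lambda>x. times_chi f A x + times_chi g A x)" for A
      by (simp add: times_chi_def algebra_simps)
    then show "?d f \<otimes>\<^bsub>?H\<^esub> ?d g = ?d (\<lambda>x. f x + g x)"
      unfolding multH using mult_part_c[OF times_chi_mem[OF fg(1)] times_chi_mem[OF fg(2)]]
      by (auto intro!: restrict_ext)
    have one: "c (times_chi f (Xs i)) = c (times_chi g (Xs i)) \<longleftrightarrow>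
        (\<exists>k. (L ^^ k) (times_chi f (Xs i)) = (L ^^ k) (times_chi g (Xs i)))" if "i \<in> ?I" for i
      using c_eq_iff part_funD(1) times_chi_mem fg that by blast
    show "c f = c g \<longleftrightarrow> ?d f = ?d g"
    proof
      assume "c f = c g"
      then obtain k where k: "(L ^^ k) f = (L ^^ k) g" using c_eq_iff fg by blast
      have "c (times_chi f (Xs i)) = c (times_chi g (Xs i))" if i: "i \<in> ?I" for i
        unfolding one[OF i] using Lk_times_chi[OF i, of k] k by metis
      then show "?d f = ?d g" by (auto intro!: restrict_ext)
    next
      assume eq: "?d f = ?d g"
      have "c (times_chi f (Xs i)) = c (times_chi g (Xs i))" if "i \<in> ?I" for i
        using fun_cong[OF eq, of i] that by simp
      then have "\<exists>k. \<forall>i\<in>?I. (L ^^ k) (times_chi f (Xs i)) = (L ^^ k) (times_chi g (Xs i))"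
        using one by (intro common_exponent) (auto intro: Lk_eq_mono)
      then obtain k where "\<forall>i\<in>?I. (L ^^ k) (times_chi f (Xs i)) = (L ^^ k) (times_chi g (Xs i))" by blast
      then have "(L ^^ k) f = (L ^^ k) g" unfolding recombine[OF fg(1)] recombine[OF fg(2)] by simp
      then show "c f = c g" using c_eq_iff fg by blast
    qed
  next
    fix f assume f: "f \<in> C_int T"
    have one: "c (times_chi f (Xs i)) \<in> nonneg (G i) \<longleftrightarrow> (\<exists>k. \<forall>x. 0 \<le> (L ^^ k) (times_chi f (Xs i)) x)"
      if "i \<in> ?I" for i by (rule nonneg_part_iff[OF times_chi_mem[OF f that]])
    show "c f \<in> nonneg (G_group T \<sigma>) \<longleftrightarrow> ?d f \<in> nonneg ?H"
      unfolding nonnegH[OF d_car[OF f]] nonneg_c[OF f]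
    proof
      assume "\<exists>k. \<forall>x. 0 \<le> (L ^^ k) f x"
      then obtain k where k: "\<forall>x. 0 \<le> (L ^^ k) f x" by blast
      have "\<forall>x. 0 \<le> (L ^^ k) (times_chi f (Xs i)) x" if i: "i \<in> ?I" for i
        unfolding Lk_times_chi[OF i] using k by (simp add: times_chi_def)
      then have "c (times_chi f (Xs i)) \<in> nonneg (G i)" if "i \<in> ?I" for i using one[OF that] that by blast
      then show "\<forall>i\<in>?I. ?d f i \<in> nonneg (G i)" by simp
    next
      assume "\<forall>i\<in>?I. ?d f i \<in> nonneg (G i)"
      then have "\<And>i. i \<in> ?I \<Longrightarrow> \<exists>k. \<forall>x. 0 \<le> (L ^^ k) (times_chi f (Xs i)) x" using one by simp
      then have "\<exists>k. \<forall>i\<in>?I. \<forall>x. 0 \<le> (L ^^ k) (times_chi f (Xs i)) x"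
        by (intro common_exponent) (use Lk_nonneg_mono in auto)
      then show "\<exists>k. \<forall>x. 0 \<le> (L ^^ k) f x" unfolding recombine[OF f] by (meson sum_nonneg)
    qed
  qed
  then obtain h where h: "\<forall>f\<in>C_int T. h (c f) = ?d f" "dimension_group_iso (G_group T \<sigma>) ?H h" by blast
  have "h (ounit (G_group T \<sigma>)) = ?d (indicator (topspace T))"
    using h(1) C_int_indicator[of T "topspace T"] by (simp add: G_group_def)
  also have "\<dots> = ounit ?H"
    unfolding ordered_direct_sum_def
  proof (simp, rule restrict_ext)
    fix i assume i: "i \<in> {Suc 0..N}"
    have "times_chi (indicator (topspace T)) (Xs i) = chi i"
      using part(4)[of i] i by (auto simp: times_chi_def indicator_def fun_eq_iff)
    then show "c (times_chi (indicator (topspace T)) (Xs i)) = ounit (G i)" by (simp add: ounit_part)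
  qed
  finally show ?thesis using h unfolding unital_dimension_group_iso_def by blast
qed

text \<open>Because \<open>Xs i\<close> is clopen, extension by zero keeps a function
  continuous.\<close>

lemma C_int_subtopology: assumes i: "i \<in> {1..N}" shows "C_int (subtopology T (Xs i)) = part_fun T (Xs i)"
proof
  have top: "topspace (subtopology T (Xs i)) = Xs i" using part(4)[OF i] by auto
  show "part_fun T (Xs i) \<subseteq> C_int (subtopology T (Xs i))"
    unfolding part_fun_def C_int_def top by (auto intro: continuous_map_from_subtopology)
  show "C_int (subtopology T (Xs i)) \<subseteq> part_fun T (Xs i)"
  proof
    fix f assume f: "f \<in> C_int (subtopology T (Xs i))"
    then have out: "\<forall>x. x \<notin> Xs i \<longrightarrow> f x = 0" unfolding C_int_def top by blast
    have "openin T {x \<in> topspace T. f x \<in> V}" for V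
    proof -
      have "openin (subtopology T (Xs i)) {x \<in> topspace (subtopology T (Xs i)). f x \<in> V}"
        by (rule C_int_preimage[OF f])
      then have o: "openin T {x \<in> Xs i. f x \<in> V}" unfolding top
        using part(2)[OF i] openin_trans_full by blast
      have "{x \<in> topspace T. f x \<in> V} = {x \<in> Xs i. f x \<in> V} \<union> (if 0 \<in> V then topspace T - Xs i else {})"
      proof (rule equalityI; rule subsetI)
        fix x assume "x \<in> {x \<in> topspace T. f x \<in> V}"
        then show "x \<in> {x \<in> Xs i. f x \<in> V} \<union> (if 0 \<in> V then topspace T - Xs i else {})"
          using out[rule_format, of x] by (cases "x \<in> Xs i") auto
      next
        fix x assume "x \<in> {x \<in> Xs i. f x \<in> V} \<union> (if 0 \<in> V then topspace T - Xs i else {})"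
        then show "x \<in> {x \<in> topspace T. f x \<in> V}"
          using out[rule_format, of x] subsetD[OF part(4)[OF i], of x] by (auto split: if_splits)
      qed
      moreover have "openin T (if 0 \<in> V then topspace T - Xs i else {})" using part(3)[OF i] by auto
      ultimately show ?thesis using openin_Un[OF o] by simp
    qed
    then have "continuous_map T (discrete_topology UNIV) f" by (simp add: continuous_map_def)
    moreover have "f x = 0" if x: "x \<notin> topspace T" for x
    proof -
      have "x \<notin> Xs i" using subsetD[OF part(4)[OF i]] x by blast
      then show ?thesis using out by simp
    qed
    ultimately show "f \<in> part_fun T (Xs i)" using out by (simp add: part_fun_def C_int_def)
  qed
qed

text \<open>On functions supported in \<open>Xs i\<close> the transfer of the return map is
  \<open>L ^^ N\<close>. Testing equality or positivity along multiples of \<open>N\<close> loses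
  nothing, since both persist and \<open>k \<le> N * k\<close>.\<close>

lemma part_iso_return_map:
  assumes i: "i \<in> {1..N}"
  shows "\<exists>h. dimension_group_iso (G i) (G_group (subtopology T (Xs i)) (\<sigma> ^^ N)) h"
proof -
  let ?T = "subtopology T (Xs i)" and ?r = "\<sigma> ^^ N"
  let ?M = "transfer ?T ?r"
  have top: "topspace ?T = Xs i" using part(4)[OF i] by auto
  note CT = C_int_subtopology[OF i]
  have M: "?M f = (L ^^ N) f" if f: "f \<in> part_fun T (Xs i)" for f
  proof
    fix x
    have "?M f x = (\<Sum>y\<in>{y \<in> Xs i. (\<sigma> ^^ N) y = x}. f y)" unfolding transfer_def top ..
    also have "\<dots> = (\<Sum>y\<in>{y \<in> topspace T. (\<sigma> ^^ N) y = x}. f y)"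
      by (rule sum.mono_neutral_left) (use finite_fibre part(4)[OF i] part_funD(2)[OF f] in auto)
    finally show "?M f x = (L ^^ N) f x" unfolding transfer_pow[OF part_funD(1)[OF f]] .
  qed
  have ret: "(L ^^ (N * k)) f \<in> part_fun T (Xs i)" if "f \<in> part_fun T (Xs i)" for f k
    using Lk_part[OF i that, of "N * k"] next_index_funpow_N[OF i, of k] by simp
  have Mk: "(?M ^^ k) f = (L ^^ (N * k)) f" if f: "f \<in> part_fun T (Xs i)" for f k
  proof (induction k)
    case (Suc k)
    have "(?M ^^ Suc k) f = ?M ((L ^^ (N * k)) f)" using Suc by simp
    also have "\<dots> = (L ^^ N) ((L ^^ (N * k)) f)" by (rule M[OF ret[OF f]])
    also have "\<dots> = (L ^^ (N + N * k)) f" by (rule Lk_add[symmetric])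
    finally show ?case by simp
  qed simp
  interpret R: transfer_group ?T ?r
  proof
    fix f assume "f \<in> C_int ?T"
    then have f: "f \<in> part_fun T (Xs i)" unfolding CT .
    show "?M f \<in> C_int ?T" unfolding CT M[OF f] using ret[OF f, of 1] by simp
  qed
  have le: "k \<le> N * k" for k using mult_le_mono1[OF N_pos, of k] by simp
  have "\<exists>h. (\<forall>f\<in>part_fun T (Xs i). h (c f) = R.c f) \<and> dimension_group_iso (G i) (G_group ?T ?r) h"
  proof (rule dimension_group_iso_classes[where add = "\<lambda>f g x. f x + g x"])
    show "group (G i)" "group (G_group ?T ?r)"
      unfolding R.G_group_eq_part using comm_group_part R.comm_group_part comm_group_def by blast+
    show "carrier (G i) = c ` part_fun T (Xs i)" by (rule carrier_part)
    show "carrier (G_group ?T ?r) = R.c ` part_fun T (Xs i)"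
      unfolding R.G_group_eq_part R.carrier_part part_fun_topspace CT ..
  next
    fix f g assume fg: "f \<in> part_fun T (Xs i)" "g \<in> part_fun T (Xs i)"
    show "(\<lambda>x. f x + g x) \<in> part_fun T (Xs i)" by (rule part_fun_plus[OF fg])
    show "c f \<otimes>\<^bsub>G i\<^esub> c g = c (\<lambda>x. f x + g x)" by (rule mult_part_c[OF fg])
    show "R.c f \<otimes>\<^bsub>G_group ?T ?r\<^esub> R.c g = R.c (\<lambda>x. f x + g x)" by (rule R.mult_c) (use fg CT in auto)
    have 1: "c f = c g \<longleftrightarrow> (\<exists>k. (L ^^ k) f = (L ^^ k) g)" by (rule c_eq_iff) (use fg part_funD(1) in auto)
    have 2: "R.c f = R.c g \<longleftrightarrow> (\<exists>k. (L ^^ (N * k)) f = (L ^^ (N * k)) g)"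
      using R.c_eq_iff[of f g] fg CT Mk by simp
    show "c f = c g \<longleftrightarrow> R.c f = R.c g" unfolding 1 2 using Lk_eq_mono[OF _ le] by blast
  next
    fix f assume f: "f \<in> part_fun T (Xs i)"
    have "R.c f \<in> nonneg (G_group ?T ?r) \<longleftrightarrow> (\<exists>k. \<forall>x. 0 \<le> (L ^^ (N * k)) f x)"
      using R.nonneg_c[of f] f CT Mk by simp
    then show "c f \<in> nonneg (G i) \<longleftrightarrow> R.c f \<in> nonneg (G_group ?T ?r)"
      unfolding nonneg_part_iff[OF f] using Lk_nonneg_mono[OF _ le] by blast
  qed
  then show ?thesis by blast
qed

end

context gap_system begin

section \<open>The gap system as a cyclic transfer\<close>

lemma C_int_iff: "f \<in> C_int T \<longleftrightarrow> lc f \<and> (\<forall>x. x \<notin> topspace T \<longrightarrow> f x = 0)"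
  unfolding C_int_def lc_iff_continuous by blast

lemma transfer_C_int: assumes "f \<in> C_int T" shows "(transfer T \<sigma> ^^ k) f = tr k f"
  by (rule transfer_funpow) (use assms C_int_iff in blast)

lemma tr_C_int: assumes "f \<in> C_int T" shows "tr k f \<in> C_int T"
  unfolding C_int_iff using assms lc_tr_int[of f k] tr_outside[of _ k f] unfolding C_int_iff by blast

text \<open>Composition with \<sigma>, cut down to a set on which \<sigma> is injective, inverts
  transfer from the right over the image of that set.\<close>

lemma tr1_section:
  fixes f :: "_ \<Rightarrow> int"
  assumes C: "openin T C" "closedin T C" "inj_on \<sigma> C" and f: "lc f"
  shows "lc (\<lambda>y. f (\<sigma> y) * indicator C y)" "tr 1 (\<lambda>y. f (\<sigma> y) * indicator C y) x = f x * indicator (\<sigma> ` C) x"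
proof -
  have "continuous_map T (discrete_topology UNIV) (f \<circ> \<sigma>)"
    using f unfolding lc_iff_continuous by (rule continuous_map_compose[OF cont])
  then have "lc (\<lambda>y. f (\<sigma> y))" unfolding lc_iff_continuous by (simp add: o_def)
  then show "lc (\<lambda>y. f (\<sigma> y) * indicator C y)"
    using lc_indicator[OF C(1,2)] by (rule lc_compose2)
  have ind: "tr 1 (indicator C) x = (indicator (\<sigma> ` C) x :: int)"
  proof -
    have "real_of_int (tr 1 (indicator C) x) = tr 1 (\<lambda>y. real_of_int (indicator C y)) x" by (rule tr_of_int[symmetric])
    also have "\<dots> = tr 1 (indicator C) x" by (rule tr_cong) (simp add: indicator_def)
    also have "\<dots> = indicator (\<sigma> ` C) x" using tr_indicator[of C 1 x] openin_subset[OF C(1)] C(3) by simp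
    also have "\<dots> = real_of_int (indicator (\<sigma> ` C) x)" by (simp add: indicator_def)
    finally show ?thesis by linarith
  qed
  have "tr 1 (\<lambda>y. f (\<sigma> y) * indicator C y) x = (\<Sum>y\<in>pull 1 x. f x * indicator C y)"
    unfolding tr_def by (rule sum.cong) (auto simp: pull_def)
  also have "\<dots> = f x * tr 1 (indicator C) x" by (simp add: tr_def sum_distrib_left)
  finally show "tr 1 (\<lambda>y. f (\<sigma> y) * indicator C y) x = f x * indicator (\<sigma> ` C) x" unfolding ind .
qed

text \<open>The images of the cells of \<open>P\<close> cover the space but may overlap;
  \<open>f\<close> is used up image by image, each piece being lifted by a section over one
  cell.\<close>

lemma transfer_onto: assumes f: "f \<in> C_int T" shows "\<exists>g\<in>C_int T. transfer T \<sigma> g = f"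
proof -
  let ?C = "\<lambda>l. {q \<in> topspace T. below P q = l}"
  have lcP: "lc (below P)" unfolding lc_def step_def using finite_P P_gaps by (intro exI[of _ P]) auto
  have C: "openin T (?C l)" "closedin T (?C l)" "inj_on \<sigma> (?C l)" for l
  proof -
    show o: "openin T (?C l)" using openin_lc[OF lcP, of "{l}"] by simp
    have "topspace T - ?C l = {x \<in> topspace T. below P x \<in> - {l}}" by auto
    then show "closedin T (?C l)" using openin_lc[OF lcP, of "- {l}"] by (simp add: closedin_def)
    show "inj_on \<sigma> (?C l)" by (rule inj_onI, rule inj_cell) auto
  qed
  have main: "\<exists>g. lc g \<and> (\<forall>x\<in>topspace T. tr 1 g x = f x)"
    if "finite K" "lc f" "\<forall>x\<in>topspace T. f x \<noteq> 0 \<longrightarrow> x \<in> (\<Union>l\<in>K. \<sigma> ` ?C l)" for K and f :: "_ \<Rightarrow> int"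
    using that
  proof (induction K arbitrary: f rule: finite_induct)
    case empty
    then show ?case by (intro exI[of _ "\<lambda>_. 0"]) (auto simp: tr_def)
  next
    case (insert l K)
    let ?S = "\<sigma> ` ?C l"
    \<comment> \<open>What remains of \<open>f\<close> outside the image treated now.\<close>
    let ?f' = "\<lambda>x. f x * (1 - indicator ?S x)"
    have "lc (indicator ?S :: _ \<Rightarrow> int)" by (rule lc_indicator) (use clopen_image[OF C(1,2)] in auto)
    then have "lc ?f'" by (rule lc_compose2[OF insert.prems(1)])
    moreover have "\<forall>x\<in>topspace T. ?f' x \<noteq> 0 \<longrightarrow> x \<in> (\<Union>l\<in>K. \<sigma> ` ?C l)"
    proof (intro ballI impI)
      fix x assume x: "x \<in> topspace T" "?f' x \<noteq> 0"
      then have "f x \<noteq> 0" "x \<notin> ?S" by (auto simp del: split_paired_All)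
      then show "x \<in> (\<Union>l\<in>K. \<sigma> ` ?C l)" using insert.prems(2) x(1) by blast
    qed
    ultimately obtain g where g: "lc g" "\<forall>x\<in>topspace T. tr 1 g x = ?f' x" using insert.IH by blast
    let ?h = "\<lambda>y. f (\<sigma> y) * indicator (?C l) y"
    have h: "lc ?h" by (rule tr1_section[OF C insert.prems(1)])
    have "lc (\<lambda>y. g y + ?h y)" by (rule lc_compose2[OF g(1) h])
    moreover have "tr 1 (\<lambda>y. g y + ?h y) x = f x" if "x \<in> topspace T" for x
    proof -
      have "tr 1 (\<lambda>y. g y + ?h y) x = ?f' x + f x * indicator ?S x"
        unfolding tr_plus tr1_section(2)[OF C insert.prems(1)] using g(2) that by simp
      then show ?thesis by (simp add: algebra_simps)
    qed
    ultimately show ?case by blast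
  qed
  have "\<exists>g. lc g \<and> (\<forall>x\<in>topspace T. tr 1 g x = f x)"
  proof (rule main)
    show "finite (below P ` topspace T)" by (rule finite_below_image[OF finite_P])
    show "lc f" using f C_int_iff by blast
    show "\<forall>x\<in>topspace T. f x \<noteq> 0 \<longrightarrow> x \<in> (\<Union>l\<in>below P ` topspace T. \<sigma> ` ?C l)"
    proof (intro ballI impI)
      fix x assume "x \<in> topspace T"
      then have "x \<in> \<sigma> ` topspace T" by (simp add: map_surj)
      then obtain y where "y \<in> topspace T" "x = \<sigma> y" by blast
      then show "x \<in> (\<Union>l\<in>below P ` topspace T. \<sigma> ` ?C l)" by blast
    qed
  qed
  then obtain g where g: "lc g" "\<forall>x\<in>topspace T. tr 1 g x = f x" by blast
  define g' where "g' x = (if x \<in> topspace T then g x else 0)" for x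
  have "lc g'" using g(1) by (rule lc_cong) (simp add: g'_def)
  then have g': "g' \<in> C_int T" unfolding C_int_iff by (simp add: g'_def)
  have "transfer T \<sigma> g' x = f x" for x
  proof (cases "x \<in> topspace T")
    case True
    have "transfer T \<sigma> g' x = tr 1 g' x" using fun_cong[OF transfer_C_int[OF g', of 1], of x] by simp
    also have "\<dots> = tr 1 g x" by (rule tr_cong) (simp add: g'_def)
    finally show ?thesis using g(2) True by simp
  next
    case False
    have "transfer T \<sigma> g' x = tr 1 g' x" using fun_cong[OF transfer_C_int[OF g', of 1], of x] by simp
    moreover have "f x = 0" using f False C_int_iff by blast
    ultimately show ?thesis using tr_outside[OF False, of 1 g'] by simp
  qed
  then show ?thesis using g' by blast
qed

lemma lc_real_of_int: "f \<in> C_int T \<Longrightarrow> lc (\<lambda>x. real_of_int (f x))"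
  unfolding C_int_iff by (rule lc_compose) blast

sublocale cyc: cyclic_transfer T \<sigma> N Xs "\<lambda>f. mean (\<lambda>x. real_of_int (f x))" s
proof
  show "cyclic_exact_partition T \<sigma> N Xs" by (rule cyclic)
  show "0 < s" by (rule s_pos)
  show "\<exists>g\<in>C_int T. transfer T \<sigma> g = f" if "f \<in> C_int T" for f by (rule transfer_onto[OF that])
  show "transfer T \<sigma> f \<in> C_int T" if "f \<in> C_int T" for f
    using transfer_C_int[OF that, of 1] tr_C_int[OF that, of 1] by simp
  show "(transfer T \<sigma> ^^ k) f x = (\<Sum>y\<in>{y \<in> topspace T. (\<sigma> ^^ k) y = x}. f y)" if "f \<in> C_int T" for f k x
    using transfer_C_int[OF that] by (simp add: tr_def pull_def)
  show "finite {y \<in> topspace T. (\<sigma> ^^ k) y = x}" for k x using finite_pull by (simp add: pull_def)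
  have "C_int T = {f. lc f \<and> (\<forall>x. x \<notin> topspace T \<longrightarrow> f x = 0)}" using C_int_iff by blast
  then show "countable (C_int T)" using countable_lc_int by simp
  show "mean (\<lambda>x. real_of_int (f x + g x)) = mean (\<lambda>x. real_of_int (f x)) + mean (\<lambda>x. real_of_int (g x))"
    if "f \<in> C_int T" "g \<in> C_int T" for f g
    unfolding of_int_add
    by (rule Bochner_Integration.integral_add; rule integrable_lc; rule lc_real_of_int; rule that)
  show "mean (\<lambda>x. real_of_int (transfer T \<sigma> f x)) = s * mean (\<lambda>x. real_of_int (f x))" if f: "f \<in> C_int T" for f
  proof -
    have "(\<lambda>x. real_of_int (transfer T \<sigma> f x)) = tr 1 (\<lambda>x. real_of_int (f x))"
      using transfer_C_int[OF f, of 1] by (intro ext) (simp add: tr_of_int)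
    then show ?thesis using mean_tr1[OF lc_real_of_int[OF f]] by (simp only:)
  qed
  have "mean (\<lambda>x. real_of_int (indicator (topspace T) x)) = mean (\<lambda>x. 1)" by (rule mean_cong) simp
  then show "mean (\<lambda>x. real_of_int (indicator (topspace T) x)) = 1" using prob_space by simp
next
  fix f assume f: "f \<in> C_int T" "\<forall>x. 0 \<le> f x" "\<exists>x. f x \<noteq> 0"
  \<comment> \<open>A nonnegative integer function dominates the indicator of the clopen set where
    it is at least one; full support makes the integral of that indicator positive.\<close>
  define U where "U = {x \<in> topspace T. f x \<in> {1..}}"
  have lcf: "lc f" using f C_int_iff by blast
  have U: "openin T U" unfolding U_def by (rule openin_lc[OF lcf])
  have "topspace T - U = {x \<in> topspace T. f x \<in> - {1..}}" by (auto simp: U_def)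
  then have "closedin T U" using openin_lc[OF lcf, of "- {1..}"] openin_subset[OF U] by (simp add: closedin_def)
  then have lcU: "lc (indicator U :: _ \<Rightarrow> real)" using lc_indicator U by blast
  obtain x where x: "f x \<noteq> 0" using f(3) by blast
  have "1 \<le> f x" using spec[OF f(2), of x] x by linarith
  moreover have "x \<in> topspace T" using x f(1) C_int_iff by blast
  ultimately have "x \<in> U" unfolding U_def by simp
  then have "0 < mean (indicator U)" using full_support[OF U] unfolding mean_indicator[OF U] by blast
  also have "\<dots> \<le> mean (\<lambda>x. real_of_int (f x))"
  proof (rule mean_mono[OF lcU lc_real_of_int[OF f(1)]])
    fix x assume "x \<in> topspace T"
    then show "indicator U x \<le> real_of_int (f x)"
      using spec[OF f(2), of x] by (cases "x \<in> U") (simp_all add: U_def)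
  qed
  finally show "0 < mean (\<lambda>x. real_of_int (f x))" .
next
  fix i f assume i: "i \<in> {1..N}" and f: "f \<in> part_fun T (Xs i)" and pos: "0 < mean (\<lambda>x. real_of_int (f x))"
  have "\<forall>x. x \<notin> Xs i \<longrightarrow> real_of_int (f x) = 0" using part_funD(2)[OF f] by simp
  then obtain k where k: "\<forall>x. 0 \<le> tr k (\<lambda>x. real_of_int (f x)) x"
    by (rule eventually_nonneg[OF i lc_real_of_int[OF part_funD(1)[OF f]] _ pos])
  have "0 \<le> (transfer T \<sigma> ^^ k) f x" for x
    using spec[OF k, of x] unfolding transfer_C_int[OF part_funD(1)[OF f]] tr_of_int by simp
  then show "\<exists>k. \<forall>x. 0 \<le> (transfer T \<sigma> ^^ k) f x" by blast
qed

lemma mean_chi: "i \<in> {1..N} \<Longrightarrow> mean (\<lambda>x. real_of_int (indicator (Xs i) x)) = measure \<mu> (Xs i)"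
proof -
  assume i: "i \<in> {1..N}"
  have "mean (\<lambda>x. real_of_int (indicator (Xs i) x)) = mean (indicator (Xs i))"
    by (rule mean_cong) (simp add: indicator_def)
  then show ?thesis using mean_indicator[OF part(2)[OF i]] by simp
qed

text \<open>The open sets omitting all images of cells not containing a given point: such a set meets
  the image of a cell only if that cell meets the fibre over the given point.\<close>

lemma small_fibre_cover:
  assumes pi: "continuous_map T Y \<pi>" "\<pi> ` topspace T = topspace Y" and Y: "Hausdorff_space Y"
    and fibre: "\<And>y. y \<in> topspace Y \<Longrightarrow> \<exists>p q. {r \<in> topspace T. \<pi> r = y} \<subseteq> {p, q}"
  shows "\<exists>U. open_cover Y U \<and> (\<forall>W\<in>U. card (lab P k ` {p \<in> topspace T. \<pi> p \<in> W}) \<le> 2)"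
proof -
  let ?L = "lab P k ` topspace T" and ?C = "\<lambda>l. {q \<in> topspace T. lab P k q = l}"
  define W where "W y = topspace Y - (\<Union>l\<in>{l \<in> ?L. y \<notin> \<pi> ` ?C l}. \<pi> ` ?C l)" for y
  note lcl = lc_lab[OF finite_P P_gaps, of k]
  have closed: "closedin Y (\<pi> ` ?C l)" for l
  proof -
    have "topspace T - ?C l = {x \<in> topspace T. lab P k x \<in> - {l}}" by blast
    then have "closedin T (?C l)" using openin_lc[OF lcl, of "- {l}"] by (simp add: closedin_def)
    then show ?thesis using continuous_imp_closed_map[OF pi(1) compact Y] unfolding closed_map_def by blast
  qed
  have openW: "openin Y (W y)" for y
  proof -
    have "finite {l \<in> ?L. y \<notin> \<pi> ` ?C l}" using finite_image_lc[OF lcl] by simp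
    then have "closedin Y (\<Union>l\<in>{l \<in> ?L. y \<notin> \<pi> ` ?C l}. \<pi> ` ?C l)"
      using closed by (intro closedin_Union) auto
    then show ?thesis unfolding W_def by (intro openin_diff openin_topspace)
  qed
  have two: "card (lab P k ` {p \<in> topspace T. \<pi> p \<in> W y}) \<le> 2" if y: "y \<in> topspace Y" for y
  proof -
    obtain p q where pq: "{r \<in> topspace T. \<pi> r = y} \<subseteq> {p, q}" using fibre[OF y] by blast
    have "lab P k ` {p \<in> topspace T. \<pi> p \<in> W y} \<subseteq> lab P k ` {p, q}"
    proof
      fix l assume "l \<in> lab P k ` {p \<in> topspace T. \<pi> p \<in> W y}"
      then obtain r where r: "r \<in> topspace T" "\<pi> r \<in> W y" "l = lab P k r" by blast
      then have "\<pi> r \<in> \<pi> ` ?C l" "l \<in> ?L" by blast+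
      then have "y \<in> \<pi> ` ?C l" using r(2) unfolding W_def by blast
      then obtain z where "z \<in> topspace T" "lab P k z = l" "\<pi> z = y" by blast
      then show "l \<in> lab P k ` {p, q}" using pq by blast
    qed
    then have "card (lab P k ` {p \<in> topspace T. \<pi> p \<in> W y}) \<le> card (lab P k ` {p, q})" by (rule card_mono[rotated]) simp
    also have "\<dots> \<le> card {p, q}" by (rule card_image_le) simp
    also have "\<dots> \<le> 2" by (simp add: card_insert_if)
    finally show ?thesis .
  qed
  have "open_cover Y (W ` topspace Y)"
    unfolding open_cover_def
  proof
    show "\<forall>U\<in>W ` topspace Y. openin Y U" using openW by blast
    show "\<Union>(W ` topspace Y) = topspace Y"
    proof
      show "\<Union>(W ` topspace Y) \<subseteq> topspace Y" unfolding W_def by blast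
      show "topspace Y \<subseteq> \<Union>(W ` topspace Y)" unfolding W_def by blast
    qed
  qed
  then show ?thesis using two by blast
qed

end

section \<open>The interval with split points\<close>

lemma point_less_simp: "point_less (x, b) (y, d) \<longleftrightarrow> x < y \<or> x = y \<and> \<not> b \<and> d"
  by (auto simp: point_less_def)

lemma point_less_trans: "point_less p q \<Longrightarrow> point_less q r \<Longrightarrow> point_less p r"
  by (auto simp: point_less_def)

lemma point_less_irrefl: "\<not> point_less p p"
  by (auto simp: point_less_def)

lemma point_less_total: "point_less p q \<or> p = q \<or> point_less q p"
  by (cases p; cases q) (auto simp: point_less_def)

lemma topspace_order_topology: "topspace (order_topology S) = S"
  unfolding order_topology_def topology_generated_by_topspace by auto

lemma openin_ray:
  assumes "p \<in> S"
  shows "openin (order_topology S) {q \<in> S. point_less q p}" "openin (order_topology S) {q \<in> S. point_less p q}"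
  unfolding order_topology_def by (rule topology_generated_by_Basis, use assms in blast)+

text \<open>Finite sets of lower and upper bounds replace order intervals, so points without a bound
  on one side need no separate treatment.\<close>

lemma order_topology_base:
  assumes "openin (order_topology S) U" "p \<in> U"
  shows "\<exists>A B. finite A \<and> finite B \<and> A \<subseteq> S \<and> B \<subseteq> S \<and> (\<forall>a\<in>A. point_less a p) \<and> (\<forall>b\<in>B. point_less p b) \<and>
    (\<forall>q\<in>S. (\<forall>a\<in>A. point_less a q) \<and> (\<forall>b\<in>B. point_less q b) \<longrightarrow> q \<in> U)"
proof -
  let ?B = "insert S ((\<lambda>p. {q \<in> S. point_less q p}) ` S \<union> (\<lambda>p. {q \<in> S. point_less p q}) ` S)"
  have "generate_topology_on ?B U"
    using assms(1) unfolding order_topology_def openin_topology_generated_by_iff .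
  then show ?thesis using assms(2)
  proof (induction rule: generate_topology_on.induct)
    case (Int U V)
    obtain A B where AB: "finite A" "finite B" "A \<subseteq> S" "B \<subseteq> S" "\<forall>a\<in>A. point_less a p" "\<forall>b\<in>B. point_less p b"
      "\<forall>q\<in>S. (\<forall>a\<in>A. point_less a q) \<and> (\<forall>b\<in>B. point_less q b) \<longrightarrow> q \<in> U"
      using Int.IH(1)[OF IntD1[OF Int.prems]] by (elim exE conjE)
    obtain A' B' where AB': "finite A'" "finite B'" "A' \<subseteq> S" "B' \<subseteq> S" "\<forall>a\<in>A'. point_less a p" "\<forall>b\<in>B'. point_less p b"
      "\<forall>q\<in>S. (\<forall>a\<in>A'. point_less a q) \<and> (\<forall>b\<in>B'. point_less q b) \<longrightarrow> q \<in> V"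
      using Int.IH(2)[OF IntD2[OF Int.prems]] by (elim exE conjE)
    have "q \<in> U \<inter> V"
      if q: "q \<in> S" "\<forall>a\<in>A \<union> A'. point_less a q" "\<forall>b\<in>B \<union> B'. point_less q b" for q
    proof
      show "q \<in> U" by (rule AB(7)[rule_format]) (use q in simp_all)
      show "q \<in> V" by (rule AB'(7)[rule_format]) (use q in simp_all)
    qed
    then have "\<forall>q\<in>S. (\<forall>a\<in>A \<union> A'. point_less a q) \<and> (\<forall>b\<in>B \<union> B'. point_less q b) \<longrightarrow> q \<in> U \<inter> V"
      by (intro ballI impI) (elim conjE)
    moreover have "\<forall>a\<in>A \<union> A'. point_less a p" "\<forall>b\<in>B \<union> B'. point_less p b"
      using AB(5,6) AB'(5,6) by (simp_all add: ball_Un)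
    moreover have "finite (A \<union> A')" "finite (B \<union> B')" "A \<union> A' \<subseteq> S" "B \<union> B' \<subseteq> S" using AB AB' by simp_all
    ultimately show ?case by (intro exI[of _ "A \<union> A'"] exI[of _ "B \<union> B'"] conjI)
  next
    case (UN K)
    then obtain W where W: "W \<in> K" "p \<in> W" by blast
    obtain A B where AB: "finite A" "finite B" "A \<subseteq> S" "B \<subseteq> S" "\<forall>a\<in>A. point_less a p" "\<forall>b\<in>B. point_less p b"
      "\<forall>q\<in>S. (\<forall>a\<in>A. point_less a q) \<and> (\<forall>b\<in>B. point_less q b) \<longrightarrow> q \<in> W"
      using UN.IH[OF W] by (elim exE conjE)
    have "\<forall>q\<in>S. (\<forall>a\<in>A. point_less a q) \<and> (\<forall>b\<in>B. point_less q b) \<longrightarrow> q \<in> \<Union>K" using AB(7) W(1) by auto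
    then show ?case using AB(1-6) by (intro exI[of _ A] exI[of _ B] conjI)
  next
    case (Basis U)
    then consider "U = S" | r where "r \<in> S" "U = {q \<in> S. point_less q r}" | r where "r \<in> S" "U = {q \<in> S. point_less r q}"
      by blast
    then show ?case
    proof cases
      case 1 then show ?thesis by (intro exI[of _ "{}"]) simp
    next
      case 2 then show ?thesis using Basis by (intro exI[of _ "{}"] exI[of _ "{r}"]) simp
    next
      case 3 then show ?thesis using Basis by (intro exI[of _ "{r}"] exI[of _ "{}"]) simp
    qed
  qed simp
qed

locale split_interval =
  fixes \<Gamma> :: "real set"
  assumes gaps: "\<Gamma> \<subseteq> {0<..<1}"
begin

definition S :: "point set" where "S = {0..1} \<times> {False} \<union> \<Gamma> \<times> {True}"

text \<open>The point of \<open>X\<close> over \<open>x\<close> that is approached from the right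
  for \<open>b = True\<close> and from the left otherwise; away from \<Gamma> both are the same
  point.\<close>

definition lift :: "bool \<Rightarrow> real \<Rightarrow> point" where "lift b x = (x, b \<and> x \<in> \<Gamma>)"

abbreviation X :: "point topology" where "X \<equiv> order_topology S"

lemma S_iff: "(x, b) \<in> S \<longleftrightarrow> 0 \<le> x \<and> x \<le> 1 \<and> (b \<longrightarrow> x \<in> \<Gamma>)"
  using gaps by (auto simp: S_def)

lemma lift_S: "0 \<le> x \<Longrightarrow> x \<le> 1 \<Longrightarrow> lift b x \<in> S"
  by (simp add: lift_def S_iff)

lemma fst_lift: "fst (lift b x) = x"
  by (simp add: lift_def)

lemma S_cases: assumes "p \<in> S" obtains b where "p = lift b (fst p)"
  using assms by (cases p) (auto simp: S_iff lift_def intro: that[of "snd p"])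

lemma open_fst_less: "openin X {q \<in> S. fst q < v}"
proof -
  consider "v \<le> 0" | "0 < v \<and> v \<le> 1" | "1 < v" by linarith
  then show ?thesis
  proof cases
    case 1
    then have "{q \<in> S. fst q < v} = {}" by (auto simp: S_iff)
    then show ?thesis by (simp only: openin_empty)
  next
    case 2
    have "{q \<in> S. fst q < v} = {q \<in> S. point_less q (v, False)}" by (auto simp: point_less_simp)
    then show ?thesis using openin_ray(1)[of "(v, False)" S] 2 by (simp add: S_iff)
  next
    case 3
    then have "{q \<in> S. fst q < v} = S" by (auto simp: S_iff)
    then show ?thesis using openin_topspace[of X] by (simp add: topspace_order_topology)
  qed
qed

lemma open_fst_greater: "openin X {q \<in> S. v < fst q}"
proof -
  consider "v < 0" | "0 \<le> v \<and> v \<le> 1" | "1 < v" by linarith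
  then show ?thesis
  proof cases
    case 1
    then have "{q \<in> S. v < fst q} = S" by (auto simp: S_iff)
    then show ?thesis using openin_topspace[of X] by (simp add: topspace_order_topology)
  next
    case 2
    have "{q \<in> S. v < fst q} = {q \<in> S. point_less (lift True v) q}"
      by (auto simp: point_less_simp lift_def S_iff)
    then show ?thesis using openin_ray(2)[of "lift True v" S] lift_S[of v True] 2 by simp
  next
    case 3
    then have "{q \<in> S. v < fst q} = {}" by (auto simp: S_iff)
    then show ?thesis by (simp only: openin_empty)
  qed
qed

lemma continuous_fst: "continuous_map X (top_of_set {0..1}) fst"
proof -
  have "continuous_map X euclideanreal fst"
    unfolding continuous_map_upper_lower_semicontinuous_lt topspace_order_topology
    using open_fst_less open_fst_greater by blast
  then show ?thesis unfolding continuous_map_in_subtopology topspace_order_topology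
    by (auto simp: S_iff)
qed

text \<open>Supremum argument for the set of points whose initial segment has a finite subcover. The
  supremum is taken in the interval and then lifted to the correct copy.\<close>

lemma compact_X: "compact_space X"
  unfolding compact_space_alt topspace_order_topology
proof (intro allI impI)
  fix \<U> assume "(\<forall>U\<in>\<U>. openin X U) \<and> S \<subseteq> \<Union>\<U>"
  then have U: "\<And>U. U \<in> \<U> \<Longrightarrow> openin X U" "S \<subseteq> \<Union>\<U>" by auto
  define le where "le p q \<longleftrightarrow> p = q \<or> point_less p q" for p q
  define G where "G = {p \<in> S. \<exists>F. finite F \<and> F \<subseteq> \<U> \<and> {q \<in> S. le q p} \<subseteq> \<Union>F}"
  define x where "x = Sup (fst ` G)"
  have z: "(0, False) \<in> G"
  proof -
    have zS: "(0, False) \<in> S" by (simp add: S_iff)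
    then obtain U where "U \<in> \<U>" "(0, False) \<in> U" using U(2) by blast
    moreover have "{q \<in> S. le q (0, False)} \<subseteq> {(0, False)}" by (auto simp: le_def point_less_simp S_iff)
    ultimately show ?thesis using zS unfolding G_def by (intro CollectI conjI exI[of _ "{U}"]) auto
  qed
  have bdd: "bdd_above (fst ` G)" by (rule bdd_aboveI[of _ 1]) (auto simp: G_def S_iff)
  have up: "fst p \<le> x" if "p \<in> G" for p unfolding x_def by (rule cSup_upper[OF _ bdd]) (use that in blast)
  have x01: "0 \<le> x" "x \<le> 1"
  proof -
    show "0 \<le> x" using up[OF z] by simp
    show "x \<le> 1" unfolding x_def by (rule cSup_least, use z in blast) (auto simp: G_def S_iff)
  qed
  \<comment> \<open>The least upper bound in \<open>X\<close>: the upper copy is taken only if it is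
    attained, since the lower copy is already the limit from the left.\<close>
  define c where "c = (if (x, True) \<in> G then (x, True) else (x, False))"
  have cS: "c \<in> S" using x01 by (auto simp: c_def G_def S_iff)
  have ub: "le p c" if "p \<in> G" for p
  proof (cases "fst p = x")
    case True
    then show ?thesis using that unfolding c_def le_def by (cases p) (auto simp: point_less_simp)
  next
    case False
    then have "fst p < x" using up[OF that] by simp
    then show ?thesis unfolding c_def le_def by (cases p) (auto simp: point_less_simp)
  qed
  have lub: "\<exists>g\<in>G. point_less a g" if "point_less a c" for a
  proof (cases "(x, True) \<in> G")
    case True then show ?thesis using that unfolding c_def by auto
  next
    case False
    then have "fst a < x" using that by (cases a) (auto simp: c_def point_less_simp)
    then obtain g where "g \<in> G" "fst a < fst g"
      unfolding x_def using less_cSupD[of "fst ` G" "fst a"] z by blast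
    then show ?thesis by (auto simp: point_less_def)
  qed
  obtain W where W: "W \<in> \<U>" "c \<in> W" using U(2) cS by blast
  obtain A B where AB: "finite A" "finite B" "A \<subseteq> S" "B \<subseteq> S" "\<forall>a\<in>A. point_less a c" "\<forall>b\<in>B. point_less c b"
      "\<forall>q\<in>S. (\<forall>a\<in>A. point_less a q) \<and> (\<forall>b\<in>B. point_less q b) \<longrightarrow> q \<in> W"
    using order_topology_base[OF U(1)[OF W(1)] W(2)] by blast
  have "\<exists>g\<in>G. \<forall>a\<in>A. point_less a g"
    using AB(1,5)
  proof (induction A rule: finite_induct)
    case empty then show ?case using z by blast
  next
    case (insert a A)
    then obtain g where g: "g \<in> G" "\<forall>a\<in>A. point_less a g" by auto
    have "point_less a c" using insert.prems by simp
    then obtain g' where g': "g' \<in> G" "point_less a g'" using lub by blast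
    consider "point_less g g'" | "g = g'" | "point_less g' g" using point_less_total by blast
    then show ?case
    proof cases
      case 1 then show ?thesis using g g' point_less_trans by blast
    next
      case 2 then show ?thesis using g g' by blast
    next
      case 3 then show ?thesis using g g' point_less_trans by blast
    qed
  qed
  then obtain g where g: "g \<in> G" "\<forall>a\<in>A. point_less a g" by blast
  then obtain F where F: "finite F" "F \<subseteq> \<U>" "{q \<in> S. le q g} \<subseteq> \<Union>F" unfolding G_def by blast
  have cover: "{q \<in> S. \<forall>b\<in>B. point_less q b} \<subseteq> \<Union>(insert W F)"
  proof
    fix q assume q: "q \<in> {q \<in> S. \<forall>b\<in>B. point_less q b}"
    show "q \<in> \<Union>(insert W F)"
    proof (cases "le q g")
      case True then show ?thesis using F q by blast
    next
      case False
      then have "point_less g q" using point_less_total unfolding le_def by blast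
      then have "\<forall>a\<in>A. point_less a q" using g(2) point_less_trans by blast
      then show ?thesis using AB(7) q by blast
    qed
  qed
  \<comment> \<open>If the neighbourhood of \<open>c\<close> were bounded above, covering its least
    bound \<open>b\<close> by one more set would place \<open>b\<close> in \<open>G\<close>, beyond
    \<open>c\<close>.\<close>
  have B: "B = {}"
  proof (rule ccontr)
    assume ne: "B \<noteq> {}"
    have "\<exists>b\<in>B. \<forall>b'\<in>B. le b b'"
      using AB(2) ne
    proof (induction B rule: finite_ne_induct)
      case (singleton b) then show ?case by (simp add: le_def)
    next
      case (insert b B)
      then obtain b' where b': "b' \<in> B" "\<forall>b''\<in>B. le b' b''" by blast
      have trans: "le p r" if "le p q" "le q r" for p q r using that point_less_trans[of p q r] by (auto simp: le_def)
      have "le b b' \<or> le b' b" using point_less_total[of b b'] by (auto simp: le_def)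
      then show ?case
      proof
        assume l: "le b b'"
        have "le b b''" if "b'' \<in> B" for b'' using trans[OF l] b'(2) that by simp
        then show ?thesis by (intro bexI[of _ b]) (simp_all add: le_def)
      next
        assume "le b' b"
        then show ?thesis using b' by (intro bexI[of _ b']) simp_all
      qed
    qed
    then obtain b where b: "b \<in> B" "\<forall>b'\<in>B. le b b'" by blast
    have bS: "b \<in> S" using b AB by blast
    obtain V where V: "V \<in> \<U>" "b \<in> V" using U(2) bS by blast
    have "{q \<in> S. le q b} \<subseteq> \<Union>(insert V (insert W F))"
    proof
      fix q assume q: "q \<in> {q \<in> S. le q b}"
      show "q \<in> \<Union>(insert V (insert W F))"
      proof (cases "q = b")
        case True then show ?thesis using V by blast
      next
        case False
        then have "point_less q b" using q unfolding le_def by blast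
        then have "\<forall>b'\<in>B. point_less q b'" using b(2) point_less_trans[of q b] unfolding le_def by auto
        then show ?thesis using cover q by blast
      qed
    qed
    then have "b \<in> G" unfolding G_def using bS V W F
      by (intro CollectI conjI exI[of _ "insert V (insert W F)"]) auto
    then have "le b c" by (rule ub)
    then show False using AB(6) b(1) point_less_trans point_less_irrefl unfolding le_def by blast
  qed
  have "S \<subseteq> \<Union>(insert W F)" using cover unfolding B by simp
  then show "\<exists>\<F>. finite \<F> \<and> \<F> \<subseteq> \<U> \<and> S \<subseteq> \<Union>\<F>"
    using F W by (intro exI[of _ "insert W F"]) auto
qed

definition H :: "real \<Rightarrow> point set" where "H t = {q \<in> S. point_less (t, False) q}"

lemma H_iff: "p \<in> H t \<longleftrightarrow> p \<in> S \<and> (t < fst p \<or> t = fst p \<and> snd p)"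
  by (cases p) (auto simp: H_def point_less_simp)

text \<open>Density separates points over different reals by a gap, and the two copies over one real
  are separated by that gap itself. The bounds of a basic neighbourhood can therefore be replaced by
  gaps.\<close>

lemma gap_space_X:
  assumes count: "countable \<Gamma>" and dense: "\<And>c d. 0 \<le> c \<Longrightarrow> c < d \<Longrightarrow> d \<le> 1 \<Longrightarrow> \<exists>t\<in>\<Gamma>. c < t \<and> t < d"
  shows "gap_space X \<Gamma> H"
proof -
  have sep: "\<exists>t\<in>\<Gamma>. p \<notin> H t \<and> q \<in> H t" if pq: "p \<in> S" "q \<in> S" "point_less p q" for p q
  proof (cases "fst p < fst q")
    case True
    then obtain t where "t \<in> \<Gamma>" "fst p < t" "t < fst q"
      using dense[of "fst p" "fst q"] pq by (cases p; cases q) (auto simp: S_iff)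
    then show ?thesis using pq by (intro bexI[of _ t]) (auto simp: H_iff)
  next
    case False
    then have "fst p = fst q" "\<not> snd p" "snd q" using pq(3) by (auto simp: point_less_def)
    moreover have "fst q \<in> \<Gamma>" using pq(2) \<open>snd q\<close> by (cases q) (simp add: S_iff)
    ultimately show ?thesis using pq by (intro bexI[of _ "fst q"]) (auto simp: H_iff)
  qed
  have conv: "point_less p q" if "p \<in> S" "q \<in> S" "p \<notin> H t" "q \<in> H t" for p q t
    using that by (cases p; cases q) (auto simp: H_iff point_less_simp)
  show ?thesis
  proof
    show "compact_space X" by (rule compact_X)
    show "countable \<Gamma>" by (rule count)
    show "openin X (H t) \<and> closedin X (H t)" if t: "t \<in> \<Gamma>" for t
    proof
      have S2: "(t, False) \<in> S" "(t, True) \<in> S" using t gaps by (auto simp: S_iff)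
      show "openin X (H t)" unfolding H_def by (rule openin_ray(2)[OF S2(1)])
      have "S - H t = {q \<in> S. point_less q (t, True)}" by (auto simp: H_def point_less_simp)
      then show "closedin X (H t)"
        using openin_ray(1)[OF S2(2)] by (simp add: closedin_def topspace_order_topology H_def)
    qed
    show "(t, False) \<in> topspace X - H t" "(t, True) \<in> H t" if "t \<in> \<Gamma>" for t
      using that gaps by (auto simp: topspace_order_topology H_iff S_iff)
    show "(t, False) \<in> H u \<longleftrightarrow> (t, True) \<in> H u" if "t \<in> \<Gamma>" "u \<in> \<Gamma>" "t \<noteq> u" for t u
      using that gaps by (auto simp: H_iff S_iff)
    show "H t \<subseteq> H u \<or> H u \<subseteq> H t" if "t \<in> \<Gamma>" "u \<in> \<Gamma>" for t u
      by (cases "t \<le> u") (auto simp: H_iff)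
    show "\<exists>t\<in>\<Gamma>. p \<in> H t \<longleftrightarrow> q \<notin> H t" if "p \<in> topspace X" "q \<in> topspace X" "p \<noteq> q" for p q
      using sep[of p q] sep[of q p] that point_less_total[of p q] unfolding topspace_order_topology by blast
    fix U p assume U: "openin X U" "p \<in> U"
    have pS: "p \<in> S" using openin_subset[OF U(1)] U(2) by (auto simp: topspace_order_topology)
    obtain A B where AB: "finite A" "finite B" "A \<subseteq> S" "B \<subseteq> S" "\<forall>a\<in>A. point_less a p" "\<forall>b\<in>B. point_less p b"
      "\<forall>q\<in>S. (\<forall>a\<in>A. point_less a q) \<and> (\<forall>b\<in>B. point_less q b) \<longrightarrow> q \<in> U"
      using order_topology_base[OF U] by blast
    have "\<forall>a\<in>A. \<exists>t. t \<in> \<Gamma> \<and> a \<notin> H t \<and> p \<in> H t" using sep AB pS by blast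
    then obtain s where s: "\<And>a. a \<in> A \<Longrightarrow> s a \<in> \<Gamma> \<and> a \<notin> H (s a) \<and> p \<in> H (s a)" by metis
    have "\<forall>b\<in>B. \<exists>t. t \<in> \<Gamma> \<and> p \<notin> H t \<and> b \<in> H t" using sep AB pS by blast
    then obtain r where r: "\<And>b. b \<in> B \<Longrightarrow> r b \<in> \<Gamma> \<and> p \<notin> H (r b) \<and> b \<in> H (r b)" by metis
    have "q \<in> U" if q: "q \<in> S" "\<forall>t\<in>s ` A \<union> r ` B. p \<in> H t \<longleftrightarrow> q \<in> H t" for q
    proof -
      have "point_less a q" if "a \<in> A" for a using conv[of a q "s a"] s[OF that] q AB(3) that by blast
      moreover have "point_less q b" if "b \<in> B" for b using conv[of q b "r b"] r[OF that] q AB(4) that by blast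
      ultimately show ?thesis using AB(7) q(1) by blast
    qed
    then show "\<exists>D. finite D \<and> D \<subseteq> \<Gamma> \<and> (\<forall>q\<in>topspace X. (\<forall>t\<in>D. p \<in> H t \<longleftrightarrow> q \<in> H t) \<longrightarrow> q \<in> U)"
      unfolding topspace_order_topology using AB(1,2) s r by (intro exI[of _ "s ` A \<union> r ` B"]) auto
  qed
qed

text \<open>Intervals are uncountable, so the approximating point can avoid \<open>K\<close>; in
  applications \<open>K\<close> is \<open>I1\<close>, over which the values of \<sigma> are known
  only through continuity.\<close>

lemma one_sided_approx:
  assumes U: "openin X U" "lift b x \<in> U" and d: "0 < d" and x: "0 \<le> x" "x \<le> 1" "b \<Longrightarrow> x < 1" "\<not> b \<Longrightarrow> 0 < x"
    and bad: "countable K"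
  obtains r where "r \<notin> K" "(r, False) \<in> U" "0 < r" "r < 1" "\<bar>r - x\<bar> < d" "b \<Longrightarrow> x < r" "\<not> b \<Longrightarrow> r < x"
proof -
  obtain A B where AB: "finite A" "finite B" "A \<subseteq> S" "B \<subseteq> S" "\<forall>a\<in>A. point_less a (lift b x)"
      "\<forall>c\<in>B. point_less (lift b x) c"
      "\<forall>q\<in>S. (\<forall>a\<in>A. point_less a q) \<and> (\<forall>c\<in>B. point_less q c) \<longrightarrow> q \<in> U"
    using order_topology_base[OF U] by blast
  have ex: "\<exists>r. r \<notin> K \<and> l < r \<and> r < u" if "l < u" for l u :: real
  proof (rule ccontr)
    assume "\<not> ?thesis"
    then have "{l<..<u} \<subseteq> K" by auto
    then show False using bad that uncountable_open_interval[of l u] countable_subset by blast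
  qed
  show thesis
  proof (cases b)
    case True
    let ?M = "insert 1 (insert (x + d) (fst ` B))"
    have "x < fst c" if "c \<in> B" for c
    proof -
      have "point_less (lift b x) c" "c \<in> S" using AB that by auto
      then show ?thesis using True by (cases c) (auto simp: lift_def point_less_simp S_iff)
    qed
    then have "x < Min ?M" using AB(2) d x(3) True by auto
    then obtain r where r: "r \<notin> K" "x < r" "r < Min ?M" using ex by blast
    then have r': "r < 1" "r < x + d" "\<And>c. c \<in> B \<Longrightarrow> r < fst c" using AB(2) by auto
    have "(r, False) \<in> U"
    proof (rule AB(7)[rule_format])
      show "(r, False) \<in> S" using r r' x by (simp add: S_iff)
      show "(\<forall>a\<in>A. point_less a (r, False)) \<and> (\<forall>c\<in>B. point_less (r, False) c)"
        using AB(5) r(2) r'(3) by (auto simp: point_less_def lift_def)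
    qed
    then show thesis using r r' x True by (intro that[of r]) auto
  next
    case False
    let ?M = "insert 0 (insert (x - d) (fst ` A))"
    have "fst c < x" if "c \<in> A" for c
    proof -
      have "point_less c (lift b x)" using AB that by auto
      then show ?thesis using False by (cases c) (auto simp: lift_def point_less_simp)
    qed
    then have "Max ?M < x" using AB(1) d x(4) False by auto
    then obtain r where r: "r \<notin> K" "r < x" "Max ?M < r" using ex by blast
    then have r': "0 < r" "x - d < r" "\<And>c. c \<in> A \<Longrightarrow> fst c < r" using AB(1) by auto
    have "(r, False) \<in> U"
    proof (rule AB(7)[rule_format])
      show "(r, False) \<in> S" using r r' x by (simp add: S_iff)
      show "(\<forall>a\<in>A. point_less a (r, False)) \<and> (\<forall>c\<in>B. point_less (r, False) c)"
        using AB(6) r(2) r'(3) by (auto simp: point_less_def lift_def)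
    qed
    then show thesis using r r' x False by (intro that[of r]) auto
  qed
qed

end

section \<open>Branches of a piecewise monotonic map\<close>

lemma strict_mono_limits:
  fixes f :: "real \<Rightarrow> real"
  assumes lr: "l < r" and mono: "strict_mono_on {l<..<r} f" and range: "f \<in> {l<..<r} \<rightarrow> {0..1}"
  obtains A B where "(f \<longlongrightarrow> A) (at_right l)" "(f \<longlongrightarrow> B) (at_left r)" "0 \<le> A" "B \<le> 1"
    "\<And>x. l < x \<Longrightarrow> x < r \<Longrightarrow> A < f x" "\<And>x. l < x \<Longrightarrow> x < r \<Longrightarrow> f x < B"
proof -
  let ?I = "{l<..<r}"
  have less: "f x < f y" if "l < x" "x < y" "y < r" for x y
    using strict_mono_onD[OF mono, of x y] that by auto
  have ne: "f ` ?I \<noteq> {}" using dense[OF lr] by auto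
  have bdd: "bdd_above (f ` ?I)" "bdd_below (f ` ?I)"
    using range by (auto intro!: bdd_aboveI[of _ 1] bdd_belowI[of _ 0] simp: Pi_iff)
  define A where "A = Inf (f ` ?I)"
  define B where "B = Sup (f ` ?I)"
  have A: "A < f x" if x: "l < x" "x < r" for x
  proof -
    obtain y where y: "l < y" "y < x" using dense[OF x(1)] by blast
    have "A \<le> f y" unfolding A_def by (rule cInf_lower[OF _ bdd(2)]) (use y x in auto)
    then show ?thesis using less[OF y x(2)] by simp
  qed
  have B: "f x < B" if x: "l < x" "x < r" for x
  proof -
    obtain y where y: "x < y" "y < r" using dense[OF x(2)] by blast
    have "f y \<le> B" unfolding B_def by (rule cSup_upper[OF _ bdd(1)]) (use y x in auto)
    then show ?thesis using less[OF x(1) y] by simp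
  qed
  show thesis
  proof (rule that[of A B])
    show "(f \<longlongrightarrow> B) (at_left r)"
    proof (rule order_tendstoI)
      fix c assume "c < B"
      then have "\<exists>y\<in>f ` ?I. c < y" unfolding B_def using less_cSupD[OF ne] by blast
      then obtain x where x: "l < x" "x < r" "c < f x" by auto
      show "\<forall>\<^sub>F y in at_left r. c < f y"
        by (rule eventually_at_leftI[of x]) (use x less in force)+
    next
      fix c assume "B < c"
      then show "\<forall>\<^sub>F y in at_left r. f y < c"
        by (intro eventually_at_leftI[of l]) (use B lr in force)+
    qed
    show "(f \<longlongrightarrow> A) (at_right l)"
    proof (rule order_tendstoI)
      fix c assume "A < c"
      then have "\<exists>y\<in>f ` ?I. y < c" unfolding A_def by (rule cInf_lessD[OF ne])
      then obtain x where x: "l < x" "x < r" "f x < c" by auto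
      show "\<forall>\<^sub>F y in at_right l. f y < c"
        by (rule eventually_at_rightI[of _ x]) (use x less in force)+
    next
      fix c assume "c < A"
      then show "\<forall>\<^sub>F y in at_right l. c < f y"
        by (intro eventually_at_rightI[of _ r]) (use A lr in force)+
    qed
    show "0 \<le> A" unfolding A_def by (rule cInf_greatest[OF ne]) (use range in auto)
    show "B \<le> 1" unfolding B_def by (rule cSup_least[OF ne]) (use range in auto)
  qed (use A B in auto)
qed

lemma extension_continuous:
  fixes f :: "real \<Rightarrow> real"
  assumes lr: "l < r" and cont: "continuous_on {l<..<r} f"
    and A: "(f \<longlongrightarrow> A) (at_right l)" and B: "(f \<longlongrightarrow> B) (at_left r)"
  shows "continuous_on {l..r} (\<lambda>x. if x = l then A else if x = r then B else f x)" (is "continuous_on _ ?g")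
proof (rule continuous_on_IccI)
  have "\<forall>\<^sub>F x in at_right l. f x = ?g x" by (rule eventually_at_rightI[of _ r]) (use lr in auto)
  then have "(?g \<longlongrightarrow> A) (at_right l)" using A by (rule Lim_transform_eventually[rotated])
  then show "(?g \<longlongrightarrow> ?g l) (at_right l)" by simp
  have "\<forall>\<^sub>F x in at_left r. f x = ?g x" by (rule eventually_at_leftI[of l]) (use lr in auto)
  then have "(?g \<longlongrightarrow> B) (at_left r)" using B by (rule Lim_transform_eventually[rotated])
  then show "(?g \<longlongrightarrow> ?g r) (at_left r)" using lr by simp
  show "l < r" by (rule lr)
  fix x assume x: "l < x" "x < r"
  have "isCont f x" using cont x by (simp add: continuous_on_eq_continuous_at)
  then have "f \<midarrow>x\<rightarrow> f x" by (simp add: isCont_def)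
  moreover have "\<forall>\<^sub>F y in at x. f y = ?g y"
    unfolding eventually_at_topological by (intro exI[of _ "{l<..<r}"]) (use x in auto)
  ultimately have "?g \<midarrow>x\<rightarrow> f x" by (rule Lim_transform_eventually)
  then show "?g \<midarrow>x\<rightarrow> ?g x" using x by simp
qed

lemma monotone_extension:
  fixes f :: "real \<Rightarrow> real"
  assumes lr: "l < r" and f: "continuous_strictly_monotonic_on {l<..<r} f" and range: "f \<in> {l<..<r} \<rightarrow> {0..1}"
  defines "g \<equiv> \<lambda>x. if x = l then Lim (at_right x) f else if x = r then Lim (at_left x) f else f x"
  shows "continuous_on {l..r} g \<and> g \<in> {l..r} \<rightarrow> {0..1} \<and> (strict_mono_on {l..r} g \<or> strict_antimono_on {l..r} g)"
proof -
  have cont: "continuous_on {l<..<r} f" using f by (simp add: continuous_strictly_monotonic_on_def)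
  have nt: "at_left r \<noteq> bot" "at_right l \<noteq> bot" for l r :: real by simp_all
  have g: "g = (\<lambda>x. if x = l then A else if x = r then B else f x)"
    if "(f \<longlongrightarrow> A) (at_right l)" "(f \<longlongrightarrow> B) (at_left r)" for A B
    using tendsto_Lim[OF nt(2) that(1)] tendsto_Lim[OF nt(1) that(2)] lr by (auto simp: g_def fun_eq_iff)
  consider "strict_mono_on {l<..<r} f" | "strict_antimono_on {l<..<r} f"
    using f unfolding continuous_strictly_monotonic_on_def by blast
  then show ?thesis
  proof cases
    case 1
    obtain A B where AB: "(f \<longlongrightarrow> A) (at_right l)" "(f \<longlongrightarrow> B) (at_left r)" "0 \<le> A" "B \<le> 1"
      "\<And>x. l < x \<Longrightarrow> x < r \<Longrightarrow> A < f x" "\<And>x. l < x \<Longrightarrow> x < r \<Longrightarrow> f x < B"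
      by (rule strict_mono_limits[OF lr 1 range]) blast
    have "A < B" using AB(5,6) dense[OF lr] by (meson less_trans)
    then have "strict_mono_on {l..r} g"
      unfolding g[OF AB(1,2)] using AB(5,6) strict_mono_onD[OF 1] by (intro strict_mono_onI) auto
    moreover have "g \<in> {l..r} \<rightarrow> {0..1}"
      unfolding g[OF AB(1,2)] using AB(3,4) \<open>A < B\<close> range by (auto simp: Pi_iff)
    ultimately show ?thesis using extension_continuous[OF lr cont AB(1,2)] unfolding g[OF AB(1,2)] by blast
  next
    case 2
    \<comment> \<open>Reflecting the range reduces the decreasing case to the increasing one and
      stays in the unit interval.\<close>
    let ?f = "\<lambda>x. 1 - f x"
    have mono: "strict_mono_on {l<..<r} ?f" using 2 by (auto simp: monotone_on_def)
    have range': "?f \<in> {l<..<r} \<rightarrow> {0..1}" using range by (auto simp: Pi_iff)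
    obtain A B where AB: "(?f \<longlongrightarrow> A) (at_right l)" "(?f \<longlongrightarrow> B) (at_left r)" "0 \<le> A" "B \<le> 1"
      "\<And>x. l < x \<Longrightarrow> x < r \<Longrightarrow> A < ?f x" "\<And>x. l < x \<Longrightarrow> x < r \<Longrightarrow> ?f x < B"
      by (rule strict_mono_limits[OF lr mono range']) blast
    have lim: "(f \<longlongrightarrow> 1 - A) (at_right l)" "(f \<longlongrightarrow> 1 - B) (at_left r)"
      using tendsto_diff[OF tendsto_const AB(1), of 1] tendsto_diff[OF tendsto_const AB(2), of 1] by simp_all
    have "A < B" using AB(5,6) dense[OF lr] by (meson less_trans)
    then have "strict_antimono_on {l..r} g"
      unfolding g[OF lim] using AB(5,6) 2 by (auto simp: monotone_on_def) force+
    moreover have "g \<in> {l..r} \<rightarrow> {0..1}"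
      unfolding g[OF lim] using AB(3,4) \<open>A < B\<close> range by (auto simp: Pi_iff)
    ultimately show ?thesis using extension_continuous[OF lr cont lim] unfolding g[OF lim] by blast
  qed
qed

locale piecewise_map =
  fixes \<tau> :: "real \<Rightarrow> real" and n :: nat and a :: "nat \<Rightarrow> real"
  assumes pm: "piecewise_monotonic \<tau> n a"
begin

abbreviation br :: "nat \<Rightarrow> real \<Rightarrow> real" where "br \<equiv> branch \<tau> a"

definition inc :: "nat \<Rightarrow> bool" where "inc i \<longleftrightarrow> strict_mono_on {a (i - 1)..a i} (br i)"

lemma tau_range: "0 \<le> x \<Longrightarrow> x \<le> 1 \<Longrightarrow> 0 \<le> \<tau> x \<and> \<tau> x \<le> 1"
  using pm unfolding piecewise_monotonic_def by (auto simp: Pi_iff)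

section \<open>Branches and sides\<close>

lemma ends: "a 0 = 0" "a n = 1"
  using pm unfolding piecewise_monotonic_def by blast+

lemma a_less: "i < j \<Longrightarrow> j \<le> n \<Longrightarrow> a i < a j"
proof -
  assume ij: "i < j" "j \<le> n"
  have "strict_mono_on {0..n} a" using pm unfolding piecewise_monotonic_def by blast
  then show "a i < a j" by (rule strict_mono_onD) (use ij in auto)
qed

lemma a_le: "i \<le> j \<Longrightarrow> j \<le> n \<Longrightarrow> a i \<le> a j"
  using a_less[of i j] by (cases "i = j") auto

lemma a_range: "i \<le> n \<Longrightarrow> 0 \<le> a i \<and> a i \<le> 1"
  using a_le[of 0 i] a_le[of i n] ends by simp

lemma a_step: "i \<in> {1..n} \<Longrightarrow> a (i - 1) < a i"
  by (rule a_less) auto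

lemma br_props:
  assumes i: "i \<in> {1..n}"
  shows "continuous_on {a (i - 1)..a i} (br i)" "br i \<in> {a (i - 1)..a i} \<rightarrow> {0..1}"
    "strict_mono_on {a (i - 1)..a i} (br i) \<or> strict_antimono_on {a (i - 1)..a i} (br i)"
proof -
  have "\<tau> \<in> {a (i - 1)<..<a i} \<rightarrow> {0..1}"
  proof
    fix x assume x: "x \<in> {a (i - 1)<..<a i}"
    have "i \<le> n" "i - 1 \<le> n" using i by auto
    then have "0 \<le> a (i - 1)" "a i \<le> 1" using a_range by blast+
    then show "\<tau> x \<in> {0..1}" using tau_range[of x] x by simp
  qed
  moreover have "continuous_strictly_monotonic_on {a (i - 1)<..<a i} \<tau>"
    using pm i unfolding piecewise_monotonic_def by blast
  ultimately have *: "continuous_on {a (i - 1)..a i} (br i) \<and> br i \<in> {a (i - 1)..a i} \<rightarrow> {0..1} \<and>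
      (strict_mono_on {a (i - 1)..a i} (br i) \<or> strict_antimono_on {a (i - 1)..a i} (br i))"
    using monotone_extension[OF a_step[OF i]] unfolding branch_def by blast
  then show "continuous_on {a (i - 1)..a i} (br i)" "br i \<in> {a (i - 1)..a i} \<rightarrow> {0..1}"
    "strict_mono_on {a (i - 1)..a i} (br i) \<or> strict_antimono_on {a (i - 1)..a i} (br i)" by blast+
qed

lemma br_less:
  assumes "i \<in> {1..n}" "a (i - 1) \<le> x" "x < y" "y \<le> a i"
  shows "if inc i then br i x < br i y else br i y < br i x"
  using br_props(3)[OF assms(1)] assms unfolding inc_def by (auto simp: monotone_on_def)

lemma br_inj: "i \<in> {1..n} \<Longrightarrow> inj_on (br i) {a (i - 1)..a i}"
proof (rule inj_onI)
  fix x y assume "i \<in> {1..n}" "x \<in> {a (i - 1)..a i}" "y \<in> {a (i - 1)..a i}" "br i x = br i y"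
  then show "x = y" using br_less[of i x y] br_less[of i y x] by (cases x y rule: linorder_cases) (auto split: if_splits)
qed

lemma br_range: "i \<in> {1..n} \<Longrightarrow> a (i - 1) \<le> x \<Longrightarrow> x \<le> a i \<Longrightarrow> 0 \<le> br i x \<and> br i x \<le> 1"
  using br_props(2) by (auto simp: Pi_iff)

lemma br_interior: "a (i - 1) < x \<Longrightarrow> x < a i \<Longrightarrow> br i x = \<tau> x"
  by (simp add: branch_def)

lemma br_interior_range:
  assumes i: "i \<in> {1..n}" and x: "a (i - 1) < x" "x < a i" shows "0 < br i x \<and> br i x < 1"
  using br_less[OF i _ x(1)] br_less[OF i _ x(2)] br_range[OF i, of "a i"] br_range[OF i, of "a (i - 1)"] x
  by (cases "inc i") auto

text \<open>Branch \<open>i\<close> is the one met when \<open>x\<close> is approached from the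
  right (\<open>b\<close>) or from the left. At an interior partition point the two sides belong to
  different branches, which removes the ambiguity of the map there.\<close>

definition side :: "bool \<Rightarrow> nat \<Rightarrow> real \<Rightarrow> bool" where
  "side b i x \<longleftrightarrow> i \<in> {1..n} \<and> (if b then a (i - 1) \<le> x \<and> x < a i else a (i - 1) < x \<and> x \<le> a i)"

lemma side_closed: "side b i x \<Longrightarrow> i \<in> {1..n} \<and> a (i - 1) \<le> x \<and> x \<le> a i"
  by (auto simp: side_def split: if_splits)

lemma side_range: "side b i x \<Longrightarrow> 0 \<le> x \<and> x \<le> 1"
  using side_closed[of b i x] a_range[of i] a_range[of "i - 1"] by fastforce

lemma side_interior: "i \<in> {1..n} \<Longrightarrow> a (i - 1) < x \<Longrightarrow> x < a i \<Longrightarrow> side b i x"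
  by (simp add: side_def)

lemma side_exists:
  assumes "0 \<le> x" "x \<le> 1" "b \<Longrightarrow> x < 1" "\<not> b \<Longrightarrow> 0 < x" shows "\<exists>i. side b i x"
proof -
  define Q where "Q i \<longleftrightarrow> (if b then x < a i else x \<le> a i)" for i
  have Qn: "Q n" using assms ends by (simp add: Q_def)
  define i where "i = (LEAST i. Q i)"
  have Qi: "Q i" unfolding i_def by (rule LeastI[of Q, OF Qn])
  have "i \<le> n" unfolding i_def by (rule Least_le) (rule Qn)
  moreover have "i \<noteq> 0" using Qi assms ends by (cases "i = 0") (auto simp: Q_def split: if_splits)
  moreover have "\<not> Q (i - 1)" using not_less_Least[of "i - 1" Q] \<open>i \<noteq> 0\<close> unfolding i_def by simp
  ultimately have "side b i x" using Qi by (auto simp: side_def Q_def split: if_splits)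
  then show ?thesis by blast
qed

lemma partition_points_iff: "x \<in> partition_points n a \<longleftrightarrow> (\<exists>i\<le>n. x = a i)"
  by (auto simp: partition_points_def)

lemma interior_exists:
  assumes "0 \<le> x" "x \<le> 1" "x \<notin> partition_points n a"
  obtains i where "i \<in> {1..n}" "a (i - 1) < x" "x < a i"
proof -
  have "x \<noteq> 1" "x \<noteq> 0" using assms(3) ends partition_points_iff by force+
  then obtain i where i: "side True i x" using side_exists[of x True] assms by auto
  then have "i - 1 \<le> n" by (auto simp: side_def)
  then have "a (i - 1) \<noteq> x" using assms(3) partition_points_iff by blast
  then show thesis using i that[of i] by (auto simp: side_def)
qed

section \<open>Generalized orbits\<close>

lemma hat_image_I: "i \<in> {1..n} \<Longrightarrow> x \<in> A \<Longrightarrow> a (i - 1) \<le> x \<Longrightarrow> x \<le> a i \<Longrightarrow> br i x \<in> hat_image \<tau> n a A"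
  unfolding hat_image_def by (rule UN_I[of i]) auto

lemma hat_preimage_I: "i \<in> {1..n} \<Longrightarrow> br i x \<in> A \<Longrightarrow> a (i - 1) \<le> x \<Longrightarrow> x \<le> a i \<Longrightarrow> x \<in> hat_preimage \<tau> n a A"
  unfolding hat_preimage_def by (rule UN_I[of i]) auto

lemma hat_range: "hat_image \<tau> n a A \<subseteq> {0..1}" "hat_preimage \<tau> n a A \<subseteq> {0..1}"
proof -
  show "hat_image \<tau> n a A \<subseteq> {0..1}" using br_range by (auto simp: hat_image_def)
  show "hat_preimage \<tau> n a A \<subseteq> {0..1}"
  proof
    fix x assume "x \<in> hat_preimage \<tau> n a A"
    then obtain i where i: "i \<in> {1..n}" "a (i - 1) \<le> x" "x \<le> a i" by (auto simp: hat_preimage_def)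
    have "i \<le> n" "i - 1 \<le> n" using i(1) by auto
    then have "0 \<le> a (i - 1)" "a i \<le> 1" using a_range by blast+
    then show "x \<in> {0..1}" using i by simp
  qed
qed

lemma countable_hat_preimage: assumes "countable A" shows "countable (hat_preimage \<tau> n a A)"
  unfolding hat_preimage_def
proof (rule countable_UN)
  fix i assume i: "i \<in> {1..n}"
  let ?B = "{x \<in> {a (i - 1)..a i}. br i x \<in> A}"
  have "br i ` ?B \<subseteq> A" by blast
  moreover have "inj_on (br i) ?B" by (rule inj_on_subset[OF br_inj[OF i]]) blast
  ultimately show "countable ?B" using assms countable_subset countable_image_inj_on by blast
qed simp

lemma countable_hat_image: "countable A \<Longrightarrow> countable (hat_image \<tau> n a A)"
  unfolding hat_image_def by (intro countable_UN countable_image) auto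

abbreviation orbit :: "real \<Rightarrow> real set" where "orbit \<equiv> generalized_orbit \<tau> n a"

text \<open>Invariance of the intersection follows from monotonicity of images and preimages. For
  countability the orbit is enclosed in a union of finite stages; preimages stay countable because
  each branch is injective.\<close>

lemma orbit_props:
  assumes x: "0 \<le> x" "x \<le> 1"
  shows "x \<in> orbit x" "orbit x \<subseteq> {0..1}" "hat_image \<tau> n a (orbit x) \<subseteq> orbit x"
    "hat_preimage \<tau> n a (orbit x) \<subseteq> orbit x" "countable (orbit x)"
proof -
  let ?\<A> = "{A. A \<subseteq> {0..1} \<and> x \<in> A \<and> hat_image \<tau> n a A \<subseteq> A \<and> hat_preimage \<tau> n a A \<subseteq> A}"
  have o: "orbit x = \<Inter>?\<A>" by (simp add: generalized_orbit_def)
  have unit: "{0..1} \<in> ?\<A>" using x hat_range by auto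
  show "x \<in> orbit x" "orbit x \<subseteq> {0..1}" unfolding o using unit by blast+
  have mono: "hat_image \<tau> n a A \<subseteq> hat_image \<tau> n a B" "hat_preimage \<tau> n a A \<subseteq> hat_preimage \<tau> n a B"
    if "A \<subseteq> B" for A B using that unfolding hat_image_def hat_preimage_def by blast+
  show "hat_image \<tau> n a (orbit x) \<subseteq> orbit x"
  proof
    fix y assume y: "y \<in> hat_image \<tau> n a (orbit x)"
    have "y \<in> A" if "A \<in> ?\<A>" for A
    proof -
      have "orbit x \<subseteq> A" unfolding o using that by blast
      then show ?thesis using mono(1)[of "orbit x" A] y that by blast
    qed
    then show "y \<in> orbit x" unfolding o by blast
  qed
  show "hat_preimage \<tau> n a (orbit x) \<subseteq> orbit x"
  proof
    fix y assume y: "y \<in> hat_preimage \<tau> n a (orbit x)"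
    have "y \<in> A" if "A \<in> ?\<A>" for A
    proof -
      have "orbit x \<subseteq> A" unfolding o using that by blast
      then show ?thesis using mono(2)[of "orbit x" A] y that by blast
    qed
    then show "y \<in> orbit x" unfolding o by blast
  qed
  define F where "F A = A \<union> hat_image \<tau> n a A \<union> hat_preimage \<tau> n a A" for A
  define R where "R = (\<Union>k. (F ^^ k) {x})"
  have cF: "countable ((F ^^ k) {x}) \<and> (F ^^ k) {x} \<subseteq> {0..1}" for k
    by (induction k) (use x hat_range countable_hat_image countable_hat_preimage in \<open>auto simp: F_def\<close>)
  have inR: "F ((F ^^ k) {x}) \<subseteq> R" for k
  proof -
    have "(F ^^ Suc k) {x} \<subseteq> R" unfolding R_def by blast
    then show ?thesis by simp
  qed
  have "hat_image \<tau> n a R \<subseteq> R"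
  proof
    fix y assume "y \<in> hat_image \<tau> n a R"
    then obtain k where "y \<in> hat_image \<tau> n a ((F ^^ k) {x})" unfolding R_def hat_image_def by blast
    then have "y \<in> F ((F ^^ k) {x})" unfolding F_def by blast
    then show "y \<in> R" using inR by blast
  qed
  moreover have "hat_preimage \<tau> n a R \<subseteq> R"
  proof
    fix y assume "y \<in> hat_preimage \<tau> n a R"
    then obtain k where "y \<in> hat_preimage \<tau> n a ((F ^^ k) {x})" unfolding R_def hat_preimage_def by blast
    then have "y \<in> F ((F ^^ k) {x})" unfolding F_def by blast
    then show "y \<in> R" using inR by blast
  qed
  moreover have "x \<in> R" unfolding R_def by (rule UN_I[of 0]) auto
  moreover have "R \<subseteq> {0..1}" using cF unfolding R_def by blast
  ultimately have "orbit x \<subseteq> R" unfolding o by blast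
  moreover have "countable R" unfolding R_def using cF by (intro countable_UN) auto
  ultimately show "countable (orbit x)" by (rule countable_subset)
qed

abbreviation I1s :: "real set" where "I1s \<equiv> I1 \<tau> n a"

lemma partition_range: "x \<in> partition_points n a \<Longrightarrow> 0 \<le> x \<and> x \<le> 1"
  using a_range by (auto simp: partition_points_iff)

lemma I1_range: "I1s \<subseteq> {0..1}"
  unfolding I1_def using orbit_props(2) partition_range by blast

lemma partition_I1: "x \<in> partition_points n a \<Longrightarrow> x \<in> I1s"
  unfolding I1_def using orbit_props(1) partition_range by blast

lemma zero_one_I1: "0 \<in> I1s" "1 \<in> I1s"
  by (rule partition_I1, use ends in \<open>force simp: partition_points_iff\<close>)+

lemma countable_I1: "countable I1s"
  unfolding I1_def
proof (rule countable_UN)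
  show "countable (partition_points n a)" by (simp add: partition_points_def)
qed (use orbit_props(5) partition_range in blast)

lemma I1_br: assumes i: "i \<in> {1..n}" "a (i - 1) \<le> x" "x \<le> a i" shows "br i x \<in> I1s \<longleftrightarrow> x \<in> I1s"
proof
  assume "br i x \<in> I1s"
  then obtain z where z: "z \<in> partition_points n a" "br i x \<in> orbit z" unfolding I1_def by blast
  then have "x \<in> orbit z" using orbit_props(4) hat_preimage_I[OF i(1) z(2) i(2,3)] partition_range[OF z(1)] by blast
  then show "x \<in> I1s" using z(1) unfolding I1_def by blast
next
  assume "x \<in> I1s"
  then obtain z where z: "z \<in> partition_points n a" "x \<in> orbit z" unfolding I1_def by blast
  then have "br i x \<in> orbit z" using orbit_props(3) hat_image_I[OF i(1) z(2) i(2,3)] partition_range[OF z(1)] by blast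
  then show "br i x \<in> I1s" using z(1) unfolding I1_def by blast
qed

lemma tau_I0:
  assumes "0 \<le> x" "x \<le> 1" "x \<notin> I1s" shows "0 \<le> \<tau> x" "\<tau> x \<le> 1" "\<tau> x \<notin> I1s"
proof -
  show "0 \<le> \<tau> x" "\<tau> x \<le> 1" using tau_range assms by auto
  obtain i where i: "i \<in> {1..n}" "a (i - 1) < x" "x < a i"
    using interior_exists[OF assms(1,2)] partition_I1 assms(3) by blast
  then show "\<tau> x \<notin> I1s" using I1_br[of i x] br_interior[OF i(2,3)] assms(3) by simp
qed

abbreviation \<Gamma> :: "real set" where "\<Gamma> \<equiv> I1s - {0, 1}"

section \<open>The split interval of the map\<close>

sublocale split_interval \<Gamma>
proof
  show "\<Gamma> \<subseteq> {0<..<1}" using I1_range by force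
qed

lemma X_eq: "X_top \<tau> n a = X"
  by (simp add: X_top_def X_points_def S_def)

lemma S_side: assumes "p \<in> S" shows "\<exists>b i x. p = lift b x \<and> side b i x"
proof -
  obtain x c where p: "p = (x, c)" by (cases p)
  have x: "0 \<le> x" "x \<le> 1" "c \<Longrightarrow> x \<in> \<Gamma>" using assms p by (auto simp: S_iff)
  show ?thesis
  \<comment> \<open>The point \<open>0\<close> can only be approached from the right; as it is not a
    gap, \<open>lift True 0\<close> is still \<open>(0, False)\<close>.\<close>
  proof (cases "c \<or> x = 0")
    case True
    have "x < 1" using True x by auto
    then obtain i where "side True i x" using side_exists[of x True] x by auto
    moreover have "p = lift True x" using True x p by (auto simp: lift_def)
    ultimately show ?thesis by blast
  next
    case False
    then obtain i where "side False i x" using side_exists[of x False] x by auto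
    moreover have "p = lift False x" using False p by (simp add: lift_def)
    ultimately show ?thesis by blast
  qed
qed

definition P :: "real set" where "P = a ` {0<..<n}"

lemma P_props: "finite P" "P \<subseteq> \<Gamma>"
proof -
  show "finite P" by (simp add: P_def)
  show "P \<subseteq> \<Gamma>"
  proof
    fix t assume "t \<in> P"
    then obtain i where i: "0 < i" "i < n" "t = a i" by (auto simp: P_def)
    then have "t \<in> I1s" by (intro partition_I1) (auto simp: partition_points_iff intro: less_imp_le)
    moreover have "0 < t" "t < 1" using a_less[of 0 i] a_less[of i n] ends i by auto
    ultimately show "t \<in> \<Gamma>" by auto
  qed
qed

lemma inj_a: "inj_on a {0..n}"
proof (rule inj_onI)
  fix i j assume "i \<in> {0..n}" "j \<in> {0..n}" "a i = a j"
  then show "i = j" using a_less[of i j] a_less[of j i] by (cases i j rule: linorder_cases) auto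
qed

lemma below_side: assumes s: "side b i x" shows "{t \<in> P. lift b x \<in> H t} = a ` {1..i - 1}"
proof
  note sc = side_closed[OF s]
  show "{t \<in> P. lift b x \<in> H t} \<subseteq> a ` {1..i - 1}"
  proof
    fix t assume t: "t \<in> {t \<in> P. lift b x \<in> H t}"
    then obtain j where j: "0 < j" "j < n" "t = a j" by (auto simp: P_def)
    have "j \<le> i - 1"
    proof (rule ccontr)
      assume "\<not> j \<le> i - 1"
      then have "a i \<le> a j" using a_le[of i j] j by auto
      then show False using t s j by (auto simp: H_iff lift_def side_def split: if_splits)
    qed
    then show "t \<in> a ` {1..i - 1}" using j by auto
  qed
  show "a ` {1..i - 1} \<subseteq> {t \<in> P. lift b x \<in> H t}"
  proof
    fix t assume "t \<in> a ` {1..i - 1}"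
    then obtain j where j: "1 \<le> j" "j \<le> i - 1" "t = a j" by auto
    have jn: "j < n" using j sc by auto
    then have tP: "t \<in> P" using j by (auto simp: P_def)
    have le: "a j \<le> a (i - 1)" using a_le[of j "i - 1"] j sc by auto
    have "lift b x \<in> H t"
    proof (cases "x = t")
      case True
      then have "b" using s le j by (auto simp: side_def split: if_splits)
      then show ?thesis using True tP P_props lift_S[of x b] side_range[OF s] by (auto simp: H_iff lift_def)
    next
      case False
      then have "t < x" using le j s by (auto simp: side_def split: if_splits)
      then show ?thesis using lift_S[of x b] side_range[OF s] by (simp add: H_iff fst_lift)
    qed
    then show "t \<in> {t \<in> P. lift b x \<in> H t}" using tP by simp
  qed
qed

text \<open>Counting interior partition gaps below a point gives the branch index even at a split
  partition point, where the two copies get different indices.\<close>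

definition idx :: "point \<Rightarrow> nat" where "idx p = Suc (card {t \<in> P. p \<in> H t})"

lemma idx_side: assumes "side b i x" shows "idx (lift b x) = i"
proof -
  have i: "i \<in> {1..n}" using side_closed[OF assms] by blast
  have "card (a ` {1..i - 1}) = card {1..i - 1}"
    by (rule card_image, rule inj_on_subset[OF inj_a]) (use i in auto)
  then show ?thesis using i unfolding idx_def below_side[OF assms] by simp
qed

lemma below_idx: assumes "p \<in> S" shows "{t \<in> P. p \<in> H t} = a ` {1..idx p - 1}"
proof -
  obtain b i x where p: "p = lift b x" "side b i x" using S_side[OF assms] by blast
  show ?thesis unfolding p(1) below_side[OF p(2)] idx_side[OF p(2)] ..
qed

text \<open>Points over \<open>I0\<close> are mapped to points over \<open>I0\<close>. By exactness
  and the cycle, an interval without split points would spread over all of \<open>X\<close> without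
  leaving \<open>I0\<close>, although \<open>0\<close> is in \<open>I1\<close>.\<close>

lemma dense_gaps:
  assumes cyc: "cyclic_exact_partition X \<sigma> N Xs" and \<sigma>: "continuous_map X X \<sigma>"
    "\<forall>p\<in>S. fst p \<notin> I1s \<longrightarrow> fst (\<sigma> p) = \<tau> (fst p)"
    and cd: "0 \<le> c" "c < d" "d \<le> 1"
  shows "\<exists>t\<in>\<Gamma>. c < t \<and> t < d"
proof (rule ccontr)
  assume neg: "\<not> ?thesis"
  let ?Z = "{p \<in> S. fst p \<notin> I1s}"
  have inv: "\<sigma> p \<in> ?Z" if "p \<in> ?Z" for p
  proof -
    have "\<sigma> p \<in> S" using continuous_map_funspace[OF \<sigma>(1)] that by (auto simp: topspace_order_topology)
    moreover have "0 \<le> fst p" "fst p \<le> 1" using that by (cases p, simp add: S_iff)+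
    ultimately show ?thesis using \<sigma>(2) that tau_I0(3)[of "fst p"] by simp
  qed
  have invk: "(\<sigma> ^^ k) p \<in> ?Z" if "p \<in> ?Z" for k p
    by (induction k) (use that inv in simp_all)
  define V where "V = {q \<in> S. c < fst q} \<inter> {q \<in> S. fst q < d}"
  have V: "openin X V" unfolding V_def by (intro openin_Int open_fst_less open_fst_greater)
  have VZ: "V \<subseteq> ?Z"
  proof
    fix q assume q: "q \<in> V"
    then have "c < fst q" "fst q < d" "q \<in> S" by (auto simp: V_def)
    then show "q \<in> ?Z" using neg cd by auto
  qed
  have cover: "(\<Union>i\<in>{1..N}. Xs i) = S"
    using cyc unfolding cyclic_exact_partition_def topspace_order_topology by blast
  have q0: "((c + d) / 2, False) \<in> V" using cd by (simp add: V_def S_iff)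
  then have "((c + d) / 2, False) \<in> (\<Union>i\<in>{1..N}. Xs i)" unfolding cover by (simp add: V_def)
  then obtain i where i: "i \<in> {1..N}" "((c + d) / 2, False) \<in> Xs i" by blast
  have part: "closedin X (Xs i)" "topologically_exact (subtopology X (Xs i)) (\<sigma> ^^ N)"
    using cyc i(1) unfolding cyclic_exact_partition_def by blast+
  have "Xs i \<subseteq> S" using closedin_subset[OF part(1)] by (simp add: topspace_order_topology)
  then have top: "topspace (subtopology X (Xs i)) = Xs i" by (auto simp: topspace_order_topology)
  have "openin (subtopology X (Xs i)) (V \<inter> Xs i)" using V by (rule openin_subtopology_Int)
  moreover have "V \<inter> Xs i \<noteq> {}" using q0 i(2) by blast
  moreover have "\<forall>V. openin (subtopology X (Xs i)) V \<and> V \<noteq> {} \<longrightarrow> (\<exists>k. ((\<sigma> ^^ N) ^^ k) ` V = Xs i)"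
    using part(2) unfolding topologically_exact_def top by (elim conjE)
  ultimately obtain k where k: "((\<sigma> ^^ N) ^^ k) ` (V \<inter> Xs i) = Xs i" by meson
  have "((\<sigma> ^^ N) ^^ k) ` (V \<inter> Xs i) \<subseteq> ?Z"
  proof
    fix y assume "y \<in> ((\<sigma> ^^ N) ^^ k) ` (V \<inter> Xs i)"
    then obtain q where q: "q \<in> V" "y = (\<sigma> ^^ (N * k)) q" unfolding funpow_mult by blast
    then have "q \<in> ?Z" using VZ by (metis subsetD)
    then show "y \<in> ?Z" unfolding q(2) by (rule invk)
  qed
  then have iZ: "Xs i \<subseteq> ?Z" unfolding k .
  have "Xs j \<subseteq> ?Z" if j: "j \<in> {1..N}" for j
  proof -
    have "i - 1 + (j + N - i) = j - 1 + N" "j - 1 < N" "1 \<le> j" using i(1) j by auto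
    then have "(i - 1 + (j + N - i)) mod N + 1 = j" by (simp only: mod_add_self2 mod_less)
    then have "(\<sigma> ^^ (j + N - i)) ` Xs i = Xs j" using cyclic_image[OF cyc i(1), of "j + N - i"] by (simp only:)
    moreover have "(\<sigma> ^^ (j + N - i)) ` Xs i \<subseteq> ?Z"
    proof
      fix y assume "y \<in> (\<sigma> ^^ (j + N - i)) ` Xs i"
      then obtain q where q: "q \<in> Xs i" "y = (\<sigma> ^^ (j + N - i)) q" by blast
      then have "q \<in> ?Z" using iZ by (metis subsetD)
      then show "y \<in> ?Z" unfolding q(2) by (rule invk)
    qed
    ultimately show ?thesis by (simp only:)
  qed
  then have "(\<Union>i\<in>{1..N}. Xs i) \<subseteq> ?Z" by (rule UN_least)
  then have "S \<subseteq> ?Z" unfolding cover .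
  moreover have "(0, False) \<in> S" by (simp add: S_iff)
  ultimately show False using zero_one_I1 by auto
qed

end

section \<open>The associated local homeomorphism\<close>

locale piecewise_system = piecewise_map \<tau> n a
  for \<tau> :: "real \<Rightarrow> real" and n :: nat and a :: "nat \<Rightarrow> real" +
  fixes \<sigma> :: "point \<Rightarrow> point" and N :: nat and Xs :: "nat \<Rightarrow> point set" and \<mu> :: "point measure" and s :: real
  assumes not_inj: "\<not> essentially_injective \<tau>"
    and assoc: "associated_local_homeomorphism \<tau> n a \<sigma>"
    and cyc: "cyclic_exact_partition (X_top \<tau> n a) \<sigma> N Xs"
    and scal: "scaled_probability_measure (X_top \<tau> n a) \<sigma> s \<mu>"
begin

section \<open>The values of \<sigma>\<close>

lemma sigma_cont: "continuous_map X X \<sigma>"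
  using assoc unfolding associated_local_homeomorphism_def X_eq by blast

lemma sigma_S: "p \<in> S \<Longrightarrow> \<sigma> p \<in> S"
  using continuous_map_funspace[OF sigma_cont] by (auto simp: topspace_order_topology)

lemma sigma_I0: "p \<in> S \<Longrightarrow> fst p \<notin> I1s \<Longrightarrow> fst (\<sigma> p) = \<tau> (fst p)"
proof -
  assume p: "p \<in> S" "fst p \<notin> I1s"
  have "0 \<le> fst p" "fst p \<le> 1" using p(1) by (cases p, simp add: S_iff)+
  then have "fst p \<in> I0 \<tau> n a" using p(2) by (simp add: I0_def)
  moreover have "p \<in> X_points \<tau> n a" using p(1) by (simp add: X_points_def S_def)
  ultimately show ?thesis using assoc unfolding associated_local_homeomorphism_def by blast
qed

lemma gap_space_S: "gap_space X \<Gamma> H"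
proof (rule gap_space_X)
  show "countable \<Gamma>" using countable_I1 by simp
  show "\<exists>t\<in>\<Gamma>. c < t \<and> t < d" if "0 \<le> c" "c < d" "d \<le> 1" for c d
    by (rule dense_gaps[OF cyc[unfolded X_eq] sigma_cont _ that]) (use sigma_I0 in blast)
qed

text \<open>Joins continuity of \<sigma> with approximation from side \<open>b\<close> by reals
  outside \<open>I1\<close>, where \<sigma> is given by the branch; all values of \<sigma> are
  determined from these.\<close>

lemma side_approx:
  assumes s: "side b i x" and V: "openin X V" "\<sigma> (lift b x) \<in> V" and d: "0 < d"
  obtains r where "a (i - 1) < r" "r < a i" "\<bar>r - x\<bar> < d" "b \<Longrightarrow> x < r" "\<not> b \<Longrightarrow> r < x"
    "\<sigma> (r, False) \<in> V" "fst (\<sigma> (r, False)) = br i r"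
proof -
  note sc = side_closed[OF s] and sr = side_range[OF s]
  \<comment> \<open>Keeps the approximating point inside the open branch interval.\<close>
  define e where "e = min d (if b then a i - x else x - a (i - 1))"
  have e: "0 < e" "e \<le> d" using s d by (auto simp: e_def side_def split: if_splits)
  have U: "openin X {q \<in> topspace X. \<sigma> q \<in> V}" by (rule openin_continuous_map_preimage[OF sigma_cont V(1)])
  have m: "lift b x \<in> {q \<in> topspace X. \<sigma> q \<in> V}" using V(2) lift_S sr by (simp add: topspace_order_topology)
  have n1: "a i \<le> 1" "0 \<le> a (i - 1)" using a_range[of i] a_range[of "i - 1"] sc by auto
  have xb: "b \<Longrightarrow> x < 1" "\<not> b \<Longrightarrow> 0 < x" using s n1 by (auto simp: side_def split: if_splits)
  obtain r where r: "r \<notin> I1s" "(r, False) \<in> {q \<in> topspace X. \<sigma> q \<in> V}" "0 < r" "r < 1" "\<bar>r - x\<bar> < e"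
      "b \<Longrightarrow> x < r" "\<not> b \<Longrightarrow> r < x"
    using one_sided_approx[OF U m e(1) _ _ xb countable_I1] sr by blast
  have rs: "a (i - 1) < r" "r < a i"
    using r(5-7) sc e_def by (cases b; auto)+
  have rS: "(r, False) \<in> S" using r by (simp add: topspace_order_topology)
  have "fst (\<sigma> (r, False)) = br i r" using sigma_I0[OF rS] r(1) br_interior[OF rs] by simp
  then show thesis using that[of r] rs r e by auto
qed

text \<open>Near \<open>x\<close> the branch values stay within half the distance to the supposed
  other value, while continuity of \<sigma> would push them beyond the midpoint.\<close>

lemma fst_sigma: assumes s: "side b i x" shows "fst (\<sigma> (lift b x)) = br i x"
proof (rule ccontr)
  let ?z = "fst (\<sigma> (lift b x))" and ?y = "br i x"
  assume "?z \<noteq> ?y"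
  then have e: "0 < \<bar>?y - ?z\<bar> / 2" by simp
  note sc = side_closed[OF s]
  have "continuous_on {a (i - 1)..a i} (br i)" using br_props(1) sc by blast
  then obtain d where d: "0 < d" "\<forall>x'\<in>{a (i - 1)..a i}. dist x' x < d \<longrightarrow> dist (br i x') ?y < \<bar>?y - ?z\<bar> / 2"
    using e sc unfolding continuous_on_iff by (metis atLeastAtMost_iff)
  have zS: "\<sigma> (lift b x) \<in> S" using sigma_S lift_S side_range[OF s] by blast
  have close: "\<bar>br i r - ?y\<bar> < \<bar>?y - ?z\<bar> / 2" if "a (i - 1) < r" "r < a i" "\<bar>r - x\<bar> < d" for r
    using d(2) that by (auto simp: dist_real_def)
  let ?w = "(?y + ?z) / 2"
  show False
  proof (cases "?z < ?y")
    case True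
    have m: "\<sigma> (lift b x) \<in> {q \<in> S. fst q < ?w}" using True zS by simp
    obtain r where r: "a (i - 1) < r" "r < a i" "\<bar>r - x\<bar> < d" "\<sigma> (r, False) \<in> {q \<in> S. fst q < ?w}"
      "fst (\<sigma> (r, False)) = br i r" by (rule side_approx[OF s open_fst_less m d(1)]) blast
    then show False using close[OF r(1-3)] True by (simp add: abs_if split: if_splits)
  next
    case False
    have m: "\<sigma> (lift b x) \<in> {q \<in> S. ?w < fst q}" using False \<open>?z \<noteq> ?y\<close> zS by simp
    obtain r where r: "a (i - 1) < r" "r < a i" "\<bar>r - x\<bar> < d" "\<sigma> (r, False) \<in> {q \<in> S. ?w < fst q}"
      "fst (\<sigma> (r, False)) = br i r" by (rule side_approx[OF s open_fst_greater m d(1)]) blast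
    then show False using close[OF r(1-3)] False by (simp add: abs_if split: if_splits)
  qed
qed

text \<open>An increasing branch preserves the side from which a point is approached, a decreasing one
  reverses it.\<close>

lemma sigma_lift: assumes s: "side b i x" shows "\<sigma> (lift b x) = lift (b = inc i) (br i x)"
proof -
  let ?y = "br i x"
  have sc: "i \<in> {1..n}" "a (i - 1) \<le> x" "x \<le> a i" using side_closed[OF s] by auto
  obtain c where c: "\<sigma> (lift b x) = (?y, c)" using fst_sigma[OF s] by (metis prod.collapse)
  have zS: "(?y, c) \<in> S" using sigma_S[of "lift b x"] lift_S side_range[OF s] c by metis
  have cG: "c \<Longrightarrow> ?y \<in> \<Gamma>" using zS by (simp only: S_iff)
  have cb: "c = (b = inc i)" if y: "?y \<in> \<Gamma>"
  proof (rule ccontr)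
    assume ne: "c \<noteq> (b = inc i)"
    have yS: "(?y, True) \<in> S" "(?y, False) \<in> S" using y gaps by (auto simp: S_iff)
    show False
    proof (cases c)
      \<comment> \<open>The points up to \<open>(br i x, False)\<close> form a neighbourhood of the
        image, so nearby branch values would be at most \<open>br i x\<close>, against strict
        monotonicity from side \<open>b\<close>.\<close>
      case False
      have m: "\<sigma> (lift b x) \<in> {q \<in> S. point_less q (?y, True)}" using False c zS by (simp add: point_less_simp)
      obtain r where r: "a (i - 1) < r" "r < a i" "b \<Longrightarrow> x < r" "\<not> b \<Longrightarrow> r < x"
          "\<sigma> (r, False) \<in> {q \<in> S. point_less q (?y, True)}" "fst (\<sigma> (r, False)) = br i r"
        by (rule side_approx[OF s openin_ray(1)[OF yS(1)] m zero_less_one]) blast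
      have less_up: "b \<Longrightarrow> if inc i then ?y < br i r else br i r < ?y"
        using br_less[OF sc(1,2) r(3) less_imp_le[OF r(2)]] by (cases "inc i") simp_all
      have less_dn: "\<not> b \<Longrightarrow> if inc i then br i r < ?y else ?y < br i r"
        using br_less[OF sc(1) less_imp_le[OF r(1)] r(4) sc(3)] by (cases "inc i") simp_all
      have "br i r \<le> ?y" using r(5,6) by (cases "\<sigma> (r, False)") (auto simp: point_less_simp)
      then show False
        using less_up less_dn ne False by (cases b; cases "inc i") auto
    next
      case True
      have m: "\<sigma> (lift b x) \<in> {q \<in> S. point_less (?y, False) q}" using True c zS by (simp add: point_less_simp)
      obtain r where r: "a (i - 1) < r" "r < a i" "b \<Longrightarrow> x < r" "\<not> b \<Longrightarrow> r < x"
          "\<sigma> (r, False) \<in> {q \<in> S. point_less (?y, False) q}" "fst (\<sigma> (r, False)) = br i r"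
        by (rule side_approx[OF s openin_ray(2)[OF yS(2)] m zero_less_one]) blast
      have less_up: "b \<Longrightarrow> if inc i then ?y < br i r else br i r < ?y"
        using br_less[OF sc(1,2) r(3) less_imp_le[OF r(2)]] by (cases "inc i") simp_all
      have less_dn: "\<not> b \<Longrightarrow> if inc i then br i r < ?y else ?y < br i r"
        using br_less[OF sc(1) less_imp_le[OF r(1)] r(4) sc(3)] by (cases "inc i") simp_all
      have "?y \<le> br i r" using r(5,6) by (cases "\<sigma> (r, False)") (auto simp: point_less_simp)
      then show False
        using less_up less_dn ne True by (cases b; cases "inc i") auto
    qed
  qed
  show ?thesis
  proof (cases "?y \<in> \<Gamma>")
    case True
    show ?thesis unfolding c unfolding lift_def cb[OF True] using True by (simp only: simp_thms)
  next
    case False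
    then have "\<not> c" using cG by blast
    then show ?thesis unfolding c unfolding lift_def using False by (simp only: simp_thms)
  qed
qed

section \<open>Injectivity and openness on branch domains\<close>

definition Q :: "nat \<Rightarrow> point set" where "Q i = {p \<in> S. idx p = i}"

lemma Q_side: "p \<in> Q i \<longleftrightarrow> (\<exists>b x. p = lift b x \<and> side b i x)"
proof
  assume "p \<in> Q i"
  then have p: "p \<in> S" "idx p = i" by (auto simp: Q_def)
  then obtain b j x where "p = lift b x" "side b j x" using S_side by blast
  then show "\<exists>b x. p = lift b x \<and> side b i x" using idx_side p(2) by blast
next
  assume "\<exists>b x. p = lift b x \<and> side b i x"
  then show "p \<in> Q i" using idx_side lift_S side_range unfolding Q_def by blast
qed

lemma inj_Q: "inj_on \<sigma> (Q i)"
proof (rule inj_onI)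
  fix p q assume "p \<in> Q i" "q \<in> Q i" and eq: "\<sigma> p = \<sigma> q"
  then obtain b x d y where p: "p = lift b x" "side b i x" and q: "q = lift d y" "side d i y"
    unfolding Q_side by blast
  note sc = side_closed[OF p(2)] side_closed[OF q(2)]
  have l: "lift (b = inc i) (br i x) = lift (d = inc i) (br i y)"
    using eq unfolding p(1) q(1) sigma_lift[OF p(2)] sigma_lift[OF q(2)] .
  then have "br i x = br i y" by (simp add: lift_def)
  then have xy: "x = y" using inj_onD[OF br_inj, of i x y] sc by auto
  show "p = q"
  proof (cases "b = d \<or> x \<notin> \<Gamma>")
    case True then show ?thesis using xy p q by (auto simp: lift_def)
  next
    case False
    \<comment> \<open>If both copies of \<open>x\<close> belong to branch \<open>i\<close>, then
      \<open>x\<close> is interior to it; its image is again a gap, and the copies go to different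
      sides.\<close>
    then have int: "a (i - 1) < x" "x < a i" using p(2) q(2) xy by (auto simp: side_def split: if_splits)
    have "br i x \<in> I1s" using I1_br[of i x] sc False by auto
    then have "br i x \<in> \<Gamma>" using br_interior_range[OF _ int] sc by auto
    then show ?thesis using l False by (auto simp: lift_def)
  qed
qed

text \<open>The image of a branch domain is an order interval. Its ends come from partition points
  and lie in \<open>I1\<close>: each is either a gap, which cuts between its two copies, or an end
  of the unit interval, which imposes nothing. Hence the image is open.\<close>

lemma image_Q:
  assumes i: "i \<in> {1..n}"
  defines "lo \<equiv> br i (if inc i then a (i - 1) else a i)" and "hi \<equiv> br i (if inc i then a i else a (i - 1))"
  shows "\<sigma> ` Q i = {q \<in> S. (lo \<in> \<Gamma> \<longrightarrow> point_less (lo, False) q) \<and> (hi \<in> \<Gamma> \<longrightarrow> point_less q (hi, True))}" (is "_ = ?R")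
proof
  let ?l = "a (i - 1)" and ?r = "a i"
  have lr: "?l < ?r" by (rule a_step[OF i])
  have lohi: "lo < hi" using br_less[OF i order_refl lr order_refl] unfolding lo_def hi_def by (cases "inc i") auto
  have between: "lo \<le> br i x \<and> br i x \<le> hi" "br i x = lo \<Longrightarrow> x = (if inc i then ?l else ?r)"
    "br i x = hi \<Longrightarrow> x = (if inc i then ?r else ?l)" if x: "?l \<le> x" "x \<le> ?r" for x
  proof -
    have 1: "x = ?l \<or> ?l < x" and 2: "x = ?r \<or> x < ?r" using x by auto
    show "lo \<le> br i x \<and> br i x \<le> hi"
      using br_less[OF i order_refl, of x] br_less[OF i x(1), of ?r] x 1 2 unfolding lo_def hi_def
      by (cases "inc i") auto
    show "br i x = lo \<Longrightarrow> x = (if inc i then ?l else ?r)" "br i x = hi \<Longrightarrow> x = (if inc i then ?r else ?l)"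
      using inj_onD[OF br_inj[OF i], of x] x lr unfolding lo_def hi_def by auto
  qed
  show "\<sigma> ` Q i \<subseteq> ?R"
  proof
    fix q assume "q \<in> \<sigma> ` Q i"
    then obtain b x where bx: "q = \<sigma> (lift b x)" "side b i x" unfolding image_iff Q_side Bex_def by blast
    note sc = side_closed[OF bx(2)]
    define \<beta> y where "\<beta> = (b = inc i)" and "y = br i x"
    have q: "q = lift \<beta> y" unfolding bx(1) sigma_lift[OF bx(2)] \<beta>_def y_def ..
    have "lift b x \<in> S" using lift_S side_range[OF bx(2)] by blast
    then have qS: "q \<in> S" unfolding bx(1) by (rule sigma_S)
    have yl: "lo \<le> y" "y \<le> hi" using between(1)[of x] sc by (auto simp: y_def)
    have F: "y = lo \<Longrightarrow> \<beta>" "y = hi \<Longrightarrow> \<not> \<beta>"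
      using between(2,3)[of x] sc bx(2) lr unfolding y_def \<beta>_def by (auto simp: side_def split: if_splits)
    have "lo \<in> \<Gamma> \<longrightarrow> point_less (lo, False) q" using yl(1) F(1) unfolding q lift_def by (auto simp: point_less_simp)
    moreover have "hi \<in> \<Gamma> \<longrightarrow> point_less q (hi, True)" using yl(2) F(2) unfolding q lift_def by (auto simp: point_less_simp)
    ultimately show "q \<in> ?R" using qS by simp
  qed
  show "?R \<subseteq> \<sigma> ` Q i"
  proof
    fix q assume R: "q \<in> ?R"
    obtain y c where q: "q = (y, c)" by (cases q)
    have yS: "0 \<le> y" "y \<le> 1" "c \<Longrightarrow> y \<in> \<Gamma>" using R unfolding q mem_Collect_eq S_iff by blast+
    have Rl: "lo \<in> \<Gamma> \<Longrightarrow> lo < y \<or> lo = y \<and> c" and Rh: "hi \<in> \<Gamma> \<Longrightarrow> y < hi \<or> y = hi \<and> \<not> c"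
      using R unfolding q by (auto simp: point_less_simp)
    have I1: "lo \<in> I1s" "hi \<in> I1s"
    proof -
      have "?l \<in> I1s" by (rule partition_I1) (unfold partition_points_iff, intro exI[of _ "i - 1"], use i in auto)
      moreover have "?r \<in> I1s" by (rule partition_I1) (unfold partition_points_iff, intro exI[of _ i], use i in auto)
      ultimately show "lo \<in> I1s" "hi \<in> I1s" unfolding lo_def hi_def using I1_br[OF i] lr by auto
    qed
    have r01: "0 \<le> lo" "hi \<le> 1" unfolding lo_def hi_def using br_range[OF i] lr by auto
    have yl: "lo \<le> y" "y \<le> hi"
    proof -
      show "lo \<le> y" using Rl I1(1) yS(1) r01 lohi by (cases "lo = 0") auto
      show "y \<le> hi" using Rh I1(2) yS(2) r01 lohi by (cases "hi = 1") auto
    qed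
    \<comment> \<open>At a gap the side is dictated by \<open>q\<close>. Elsewhere both sides give
      the same point, and the choice matters only at the ends of the image, where the side reachable
      within the branch is taken.\<close>
    define \<beta> where "\<beta> = (if y \<in> \<Gamma> then c else y = lo)"
    have qb: "q = lift \<beta> y" using yS(3) unfolding q \<beta>_def lift_def by auto
    have F: "y = lo \<Longrightarrow> \<beta>" "y = hi \<Longrightarrow> \<not> \<beta>"
      using Rl Rh lohi unfolding \<beta>_def by auto
    have "\<exists>x. ?l \<le> x \<and> x \<le> ?r \<and> br i x = y"
    proof (cases "inc i")
      case True
      then show ?thesis using IVT'[of "br i" ?l y ?r] yl br_props(1)[OF i] lr unfolding lo_def hi_def by auto
    next
      case False
      then show ?thesis using IVT2'[of "br i" ?r y ?l] yl br_props(1)[OF i] lr unfolding lo_def hi_def by auto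
    qed
    then obtain x where x: "?l \<le> x" "x \<le> ?r" "br i x = y" by blast
    define b where "b = (\<beta> = inc i)"
    have "x = ?l \<Longrightarrow> b" "x = ?r \<Longrightarrow> \<not> b"
      using F x(3) unfolding b_def lo_def hi_def by (cases "inc i"; auto)+
    moreover have "x = ?l \<or> ?l < x" "x = ?r \<or> x < ?r" using x(1,2) by auto
    ultimately have s: "side b i x" using x(1,2) i by (cases b) (auto simp: side_def)
    have "(b = inc i) = \<beta>" unfolding b_def by auto
    then have "\<sigma> (lift b x) = q" using sigma_lift[OF s] x(3) qb by simp
    moreover have "lift b x \<in> Q i" using s Q_side by blast
    ultimately show "q \<in> \<sigma> ` Q i" by blast
  qed
qed

lemma open_image_Q: assumes i: "i \<in> {1..n}" shows "openin X (\<sigma> ` Q i)"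
proof -
  have A: "openin X {q \<in> S. t \<in> \<Gamma> \<longrightarrow> point_less (t, False) q}"
    "openin X {q \<in> S. t \<in> \<Gamma> \<longrightarrow> point_less q (t, True)}" for t
  proof -
    have all: "openin X S" using openin_topspace[of X] by (simp add: topspace_order_topology)
    have ray: "(t, False) \<in> S" "(t, True) \<in> S" if "t \<in> \<Gamma>" using that gaps by (auto simp: S_iff)
    show "openin X {q \<in> S. t \<in> \<Gamma> \<longrightarrow> point_less (t, False) q}"
      using openin_ray(2)[OF ray(1)] all by (cases "t \<in> \<Gamma>") auto
    show "openin X {q \<in> S. t \<in> \<Gamma> \<longrightarrow> point_less q (t, True)}"
      using openin_ray(1)[OF ray(2)] all by (cases "t \<in> \<Gamma>") auto
  qed
  have "{q \<in> S. B q \<and> C q} = {q \<in> S. B q} \<inter> {q \<in> S. C q}" for B C by blast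
  then show ?thesis unfolding image_Q[OF i] by (simp only: openin_Int[OF A])
qed

lemma below_P: "gap_space.below H P p = {t \<in> P. p \<in> H t}"
  by (rule gap_space.below_def[OF gap_space_S])

lemma Q_clopen: "closedin X (Q i)"
proof -
  interpret gap_space X \<Gamma> H by (rule gap_space_S)
  have "lc (below P)" unfolding lc_def step_def using P_props by (intro exI[of _ P]) auto
  then have "continuous_map X (discrete_topology UNIV) (below P)" by (simp add: lc_iff_continuous)
  then have "openin X {q \<in> topspace X. below P q \<in> {l. Suc (card l) \<noteq> i}}"
    by (rule openin_continuous_map_preimage) simp
  moreover have "topspace X - Q i = {q \<in> topspace X. below P q \<in> {l. Suc (card l) \<noteq> i}}"
    by (auto simp: Q_def idx_def below_def topspace_order_topology)
  ultimately show ?thesis by (auto simp: closedin_def Q_def topspace_order_topology)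
qed

lemma idx_range: "p \<in> S \<Longrightarrow> idx p \<in> {1..n}"
  using S_side[of p] idx_side side_closed by metis

text \<open>On a branch domain \<sigma> is injective with open image, so the image of an open piece
  is that image minus the closed image of the rest of the domain.\<close>

lemma sigma_open: "open_map X X \<sigma>"
  unfolding open_map_def
proof (intro allI impI)
  interpret gap_space X \<Gamma> H by (rule gap_space_S)
  fix U assume U: "openin X U"
  have cl: "closed_map X X \<sigma>" by (rule continuous_imp_closed_map[OF sigma_cont compact Hausdorff])
  have "openin X (\<sigma> ` (U \<inter> Q i))" if i: "i \<in> {1..n}" for i
  proof -
    have "closedin X (Q i - U)" using Q_clopen U by (rule closedin_diff)
    then have "closedin X (\<sigma> ` (Q i - U))" using cl unfolding closed_map_def by blast
    then have "openin X (\<sigma> ` Q i - \<sigma> ` (Q i - U))" using open_image_Q[OF i] by (intro openin_diff)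
    moreover have "\<sigma> ` Q i - \<sigma> ` (Q i - U) = \<sigma> ` (U \<inter> Q i)"
      using inj_on_image_set_diff[OF inj_Q[of i], of "Q i" "Q i - U"] by (simp add: Diff_Diff_Int Int_commute)
    ultimately show ?thesis by simp
  qed
  moreover have "\<sigma> ` U = (\<Union>i\<in>{1..n}. \<sigma> ` (U \<inter> Q i))"
  proof
    show "\<sigma> ` U \<subseteq> (\<Union>i\<in>{1..n}. \<sigma> ` (U \<inter> Q i))"
    proof
      fix y assume "y \<in> \<sigma> ` U"
      then obtain p where p: "p \<in> U" "y = \<sigma> p" by blast
      have "p \<in> S" using openin_subset[OF U] p(1) by (auto simp: topspace_order_topology)
      then have "idx p \<in> {1..n}" "p \<in> U \<inter> Q (idx p)" using idx_range p by (auto simp: Q_def)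
      then show "y \<in> (\<Union>i\<in>{1..n}. \<sigma> ` (U \<inter> Q i))" using p(2) by blast
    qed
  qed blast
  ultimately show "openin X (\<sigma> ` U)" by auto
qed

text \<open>Over partition points a preimage of a gap may lack its partner: the two copies continue
  on different branches, and over \<open>0\<close> and \<open>1\<close> there is only one
  copy.\<close>

definition E :: "point set" where "E = {p \<in> S. fst p \<in> partition_points n a}"

lemma gap_interior:
  assumes t: "t \<in> \<Gamma>" "t \<notin> P" obtains i where "i \<in> {1..n}" "a (i - 1) < t" "t < a i"
proof -
  have "0 < t" "t < 1" using t(1) gaps by auto
  moreover have "t \<notin> partition_points n a"
  proof
    assume "t \<in> partition_points n a"
    then obtain i where i: "i \<le> n" "t = a i" by (auto simp: partition_points_iff)
    have "i \<noteq> 0" using ends(1) i(2) \<open>0 < t\<close> by (cases "i = 0") auto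
    moreover have "i \<noteq> n" using ends(2) i(2) \<open>t < 1\<close> by (cases "i = n") auto
    ultimately show False using t(2) i by (auto simp: P_def)
  qed
  ultimately show thesis using interior_exists[of t] that by auto
qed

lemma uncountable_interval_avoid:
  assumes J: "is_interval J" "\<not> (\<exists>x. J \<subseteq> {x})" and K: "countable (K :: real set)"
  obtains z where "z \<in> J" "z \<notin> K"
proof -
  have "J \<noteq> {}" using J(2) by blast
  then obtain x where x: "x \<in> J" by blast
  obtain y where y: "y \<in> J" "y \<noteq> x" using J(2) by blast
  have "{min x y<..<max x y} \<subseteq> J"
  proof
    fix z assume z: "z \<in> {min x y<..<max x y}"
    have "min x y \<in> J" "max x y \<in> J" using x y(1) by (simp_all add: min_def max_def)
    then show "z \<in> J" using J(1) z unfolding is_interval_1 by (meson greaterThanLessThan_iff less_imp_le)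
  qed
  moreover have "uncountable {min x y<..<max x y}" using y(2) by (simp add: uncountable_open_interval min_def max_def)
  ultimately have "\<not> J \<subseteq> K" using K countable_subset by (metis subset_trans)
  then show thesis using that by blast
qed

lemma sigma_I0_point:
  assumes "0 \<le> x" "x \<le> 1" "x \<notin> I1s" shows "\<sigma> (x, False) = (\<tau> x, False)"
proof -
  have xS: "(x, False) \<in> S" using assms by (simp add: S_iff)
  then have f: "fst (\<sigma> (x, False)) = \<tau> x" using sigma_I0[of "(x, False)"] assms by simp
  obtain c where c: "\<sigma> (x, False) = (\<tau> x, c)" using f by (metis prod.collapse)
  have "(\<tau> x, c) \<in> S" using sigma_S[OF xS] c by simp
  then have "\<not> c" using tau_I0(3)[OF assms] unfolding S_iff by blast
  then show ?thesis using c by simp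
qed

text \<open>Two disjoint intervals with the same image supply uncountably many collisions of \<tau>;
  one of them avoids the countable set where \<tau> and \<sigma> could disagree.\<close>

lemma sigma_not_injective: "\<exists>p\<in>S. \<exists>q\<in>S. p \<noteq> q \<and> \<sigma> p = \<sigma> q"
proof -
  obtain J J' where J: "is_interval J" "J \<subseteq> {0..1}" "\<not> (\<exists>x. J \<subseteq> {x})" "J' \<subseteq> {0..1}" "J \<inter> J' = {}" "\<tau> ` J = \<tau> ` J'"
    using not_inj unfolding essentially_injective_def by blast
  \<comment> \<open>Besides \<open>I1\<close>, preimages of the values at partition points are
    avoided: those values are arbitrary, and the partner \<open>z'\<close> must not be a partition
    point.\<close>
  let ?K = "I1s \<union> hat_preimage \<tau> n a (\<tau> ` partition_points n a)"
  have "countable ?K" using countable_I1 by (intro countable_Un countable_hat_preimage) (auto simp: partition_points_def)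
  then obtain z where z: "z \<in> J" "z \<notin> ?K" by (rule uncountable_interval_avoid[OF J(1,3)])
  have z01: "0 \<le> z" "z \<le> 1" using z(1) J(2) by auto
  have z0: "z \<notin> I1s" using z by blast
  obtain z' where z': "z' \<in> J'" "\<tau> z' = \<tau> z" using z(1) J(6) by (metis imageE imageI)
  have z'01: "0 \<le> z'" "z' \<le> 1" using z'(1) J(4) by auto
  have "z \<notin> partition_points n a" using z0 partition_I1 by blast
  then obtain i where i: "i \<in> {1..n}" "a (i - 1) < z" "z < a i" using interior_exists[OF z01] by blast
  have "z' \<notin> partition_points n a"
  proof
    assume "z' \<in> partition_points n a"
    then have "br i z \<in> \<tau> ` partition_points n a" using z'(2) br_interior[OF i(2,3)] by (metis imageI)
    then show False using z(2) hat_preimage_I[OF i(1)] i by auto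
  qed
  then obtain i' where i': "i' \<in> {1..n}" "a (i' - 1) < z'" "z' < a i'" using interior_exists[OF z'01] by blast
  have z'0: "z' \<notin> I1s" using I1_br[of i' z'] i' br_interior[OF i'(2,3)] z'(2) tau_I0(3)[OF z01 z0] by simp
  have "\<sigma> (z, False) = \<sigma> (z', False)" using sigma_I0_point[OF z01 z0] sigma_I0_point[OF z'01 z'0] z'(2) by simp
  moreover have "(z, False) \<in> S" "(z', False) \<in> S" using z01 z'01 by (simp_all add: S_iff)
  moreover have "z \<noteq> z'" using z(1) z'(1) J(5) by blast
  ultimately show ?thesis by blast
qed

sublocale gsys: gap_system X \<Gamma> H \<sigma> P E \<mu> s N Xs
proof (intro gap_system.intro gap_map.intro gap_space_S gap_map_axioms.intro gap_system_axioms.intro)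
  show "finite P" "P \<subseteq> \<Gamma>" by (rule P_props)+
  show "continuous_map X X \<sigma>" by (rule sigma_cont)
  show "open_map X X \<sigma>" by (rule sigma_open)
  show "finite E"
    by (rule finite_subset[of _ "partition_points n a \<times> UNIV"]) (auto simp: E_def partition_points_def)
  show "E \<subseteq> topspace X" by (auto simp: E_def topspace_order_topology)
  show "scaled_probability_measure X \<sigma> s \<mu>" "cyclic_exact_partition X \<sigma> N Xs" using scal cyc unfolding X_eq .
  show "\<exists>p\<in>topspace X. \<exists>q\<in>topspace X. p \<noteq> q \<and> \<sigma> p = \<sigma> q"
    unfolding topspace_order_topology by (rule sigma_not_injective)
next
  fix p q assume pq: "p \<in> topspace X" "q \<in> topspace X" "gap_space.below H P p = gap_space.below H P q" "\<sigma> p = \<sigma> q"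
  then have "idx p = idx q" unfolding below_P idx_def by simp
  then have "p \<in> Q (idx p)" "q \<in> Q (idx p)" using pq(1,2) by (simp_all add: Q_def topspace_order_topology)
  then show "p = q" using inj_onD[OF inj_Q pq(4)] by blast
next
  fix t assume t: "t \<in> \<Gamma>" "t \<notin> P"
  obtain i where i: "i \<in> {1..n}" "a (i - 1) < t" "t < a i" by (rule gap_interior[OF t])
  have l: "lift b t = (t, b)" for b using t(1) by (simp add: lift_def)
  have f: "fst (\<sigma> (t, b)) = br i t" for b
    using fst_sigma[OF side_interior[OF i], of b] unfolding l .
  have "br i t \<in> I1s" using I1_br[of i t] i t(1) by auto
  then have "br i t \<in> \<Gamma>" using br_interior_range[OF i] by auto
  then show "fst (\<sigma> (t, True)) = fst (\<sigma> (t, False)) \<and> fst (\<sigma> (t, False)) \<in> \<Gamma>" unfolding f by simp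
next
  fix p assume p: "p \<in> topspace X" "fst (\<sigma> p) \<in> \<Gamma>"
  then have pS: "p \<in> S" by (simp add: topspace_order_topology)
  obtain b i x where bx: "p = lift b x" "side b i x" using S_side[OF pS] by blast
  have "br i x \<in> I1s" using p(2) fst_sigma[OF bx(2)] unfolding bx(1) by simp
  then have x: "x \<in> I1s" using I1_br[of i x] side_closed[OF bx(2)] by blast
  show "p \<in> E \<or> fst p \<in> \<Gamma> - P"
  proof (cases "x \<in> partition_points n a")
    case True then show ?thesis using pS by (simp add: E_def bx(1) fst_lift)
  next
    case False
    then have "x \<noteq> 0" "x \<noteq> 1" using ends by (auto simp: partition_points_iff)
    moreover have "x \<notin> P" using False by (force simp: P_def partition_points_iff dest: less_imp_le)
    ultimately show ?thesis using x by (simp add: bx(1) fst_lift)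
  qed
qed

section \<open>Itineraries and entropy\<close>

lemma fst_sigma_funpow:
  assumes "\<And>j. j < k \<Longrightarrow> (\<tau> ^^ j) x \<notin> partition_points n a" "0 \<le> x" "x \<le> 1" "p \<in> S" "fst p = x"
  shows "fst ((\<sigma> ^^ k) p) = (\<tau> ^^ k) x \<and> (\<sigma> ^^ k) p \<in> S"
  using assms(1)
proof (induction k)
  case 0 then show ?case using assms by simp
next
  case (Suc k)
  let ?q = "(\<sigma> ^^ k) p" and ?y = "(\<tau> ^^ k) x"
  have q: "fst ?q = ?y" "?q \<in> S" using Suc by auto
  have y: "0 \<le> ?y" "?y \<le> 1" using q by (cases ?q, simp add: S_iff)+
  obtain i where i: "i \<in> {1..n}" "a (i - 1) < ?y" "?y < a i"
    using interior_exists[OF y] Suc.prems by blast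
  obtain b where b: "?q = lift b ?y" using S_cases[OF q(2)] q(1) by metis
  have "fst (\<sigma> ?q) = br i ?y" unfolding b by (rule fst_sigma[OF side_interior[OF i]])
  then show ?case using br_interior[OF i(2,3)] sigma_S[OF q(2)] by simp
qed

text \<open>For a continuous map the one-sided limits at partition points equal the value, so the
  collapse map is equivariant everywhere, and its fibres have at most two points.\<close>

lemma entropy_continuous:
  assumes cont: "continuous_on {0..1} \<tau>"
  shows "topological_entropy (top_of_set {0..1}) \<tau> = ereal (ln s)"
proof (rule gsys.topological_entropy_factor)
  show pc: "continuous_map X (top_of_set {0..1}) fst" by (rule continuous_fst)
  have "fst ` S = {0..1}"
  proof
    show "fst ` S \<subseteq> {0..1}" by (auto simp: S_iff)
    show "{0..1} \<subseteq> fst ` S"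
    proof
      fix x :: real assume "x \<in> {0..1}"
      then have "(x, False) \<in> S" by (simp add: S_iff)
      then show "x \<in> fst ` S" by force
    qed
  qed
  then show ps: "fst ` topspace X = topspace (top_of_set {0..1})" by (simp add: topspace_order_topology)
  show "fst (\<sigma> p) = \<tau> (fst p)" if "p \<in> topspace X" for p
  proof -
    have "p \<in> S" using that by (simp add: topspace_order_topology)
    then obtain b i x where bx: "p = lift b x" "side b i x" using S_side by blast
    note sc = side_closed[OF bx(2)]
    have lr: "a (i - 1) < a i" "0 \<le> a (i - 1)" "a i \<le> 1"
      using a_step a_range[of i] a_range[of "i - 1"] sc by auto
    have c: "continuous_on {a (i - 1)..a i} \<tau>" by (rule continuous_on_subset[OF cont]) (use lr in auto)
    have "(\<tau> \<longlongrightarrow> \<tau> (a (i - 1))) (at_right (a (i - 1)))" "(\<tau> \<longlongrightarrow> \<tau> (a i)) (at_left (a i))"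
      using continuous_on_Icc_at_rightD[OF c lr(1)] continuous_on_Icc_at_leftD[OF c lr(1)] .
    then have "br i x = \<tau> x" unfolding branch_def by (auto simp: tendsto_Lim)
    then show ?thesis using fst_sigma[OF bx(2)] bx(1) by (simp add: fst_lift)
  qed
  fix k :: nat assume "1 \<le> k"
  show "\<exists>U. open_cover (top_of_set {0..1}) U \<and> (\<forall>W\<in>U. card (gsys.lab P k ` {p \<in> topspace X. fst p \<in> W}) \<le> 2)"
  proof (rule gsys.small_fibre_cover[OF pc ps])
    show "Hausdorff_space (top_of_set {0..1::real})" by (simp add: Hausdorff_space_subtopology Hausdorff_space_euclidean)
    have "{r \<in> topspace X. fst r = y} \<subseteq> {(y, False), (y, True)}" for y by auto
    then show "\<exists>p q. {r \<in> topspace X. fst r = y} \<subseteq> {p, q}" for y by blast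
  qed
qed

definition itin :: "point \<Rightarrow> nat \<Rightarrow> nat" where "itin p k = idx ((\<sigma> ^^ k) p)"

lemma itin_lab: "(\<forall>j<k. itin q j = itin p j) \<longleftrightarrow> gsys.lab P k q = gsys.lab P k p" if "p \<in> S" "q \<in> S" for p q
proof -
  have fs: "(\<sigma> ^^ j) p \<in> S" "(\<sigma> ^^ j) q \<in> S" for j
    using gsys.funpow_space[of _ j] that by (simp_all add: topspace_order_topology)
  have "idx u = idx v \<longleftrightarrow> gsys.below P u = gsys.below P v" if "u \<in> S" "v \<in> S" for u v
  proof
    assume "idx u = idx v" then show "gsys.below P u = gsys.below P v"
      unfolding gsys.below_def below_idx[OF that(1)] below_idx[OF that(2)] by simp
  next
    assume "gsys.below P u = gsys.below P v" then show "idx u = idx v" unfolding idx_def gsys.below_def by simp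
  qed
  then show ?thesis unfolding gsys.lab_eq_iff itin_def using fs by simp
qed

text \<open>The orbit of \<open>p\<close> may lie over partition points, where membership in the
  open intervals fails. A nearby real outside \<open>I1\<close> with the same label of length
  \<open>Suc k\<close> witnesses the condition instead.\<close>

lemma itin_Sigma: assumes p: "p \<in> S" shows "itin p \<in> itinerary_space \<tau> n a"
  unfolding itinerary_space_def mem_Collect_eq
proof (intro conjI allI)
  have fs: "(\<sigma> ^^ j) p \<in> S" for j using gsys.funpow_space[of p j] p by (simp add: topspace_order_topology)
  show "itin p j \<in> {1..n}" for j unfolding itin_def by (rule idx_range[OF fs])
  fix k
  let ?U = "{q \<in> topspace X. gsys.lab P (Suc k) q \<in> {gsys.lab P (Suc k) p}}"
  have U: "openin X ?U" by (rule gsys.openin_lc[OF gsys.lc_lab[OF P_props]])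
  obtain b i x where bx: "p = lift b x" "side b i x" using S_side[OF p] by blast
  have m: "lift b x \<in> ?U" using p bx(1) by (simp add: topspace_order_topology)
  note sr = side_range[OF bx(2)]
  have n1: "a i \<le> 1" "0 \<le> a (i - 1)" using a_range[of i] a_range[of "i - 1"] side_closed[OF bx(2)] by auto
  have xb: "b \<Longrightarrow> x < 1" "\<not> b \<Longrightarrow> 0 < x"
    using bx(2) n1 by (auto simp: side_def split: if_splits)
  obtain r where r: "r \<notin> I1s" "(r, False) \<in> ?U" "0 < r" "r < 1"
    using one_sided_approx[OF U m zero_less_one _ _ xb countable_I1] sr by blast
  have rS: "(r, False) \<in> S" using r by (simp add: topspace_order_topology)
  have it: "itin (r, False) j = itin p j" if "j \<le> k" for j
    using itin_lab[OF p rS, of "Suc k"] r(2) that by auto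
  have orb: "(\<sigma> ^^ j) (r, False) = ((\<tau> ^^ j) r, False) \<and> 0 \<le> (\<tau> ^^ j) r \<and> (\<tau> ^^ j) r \<le> 1 \<and> (\<tau> ^^ j) r \<notin> I1s" for j
  proof (induction j)
    case 0 then show ?case using r by simp
  next
    case (Suc j) then show ?case using sigma_I0_point[of "(\<tau> ^^ j) r"] tau_I0[of "(\<tau> ^^ j) r"] by simp
  qed
  have "(\<tau> ^^ j) r \<in> {a (itin p j - 1)<..<a (itin p j)}" if j: "j \<le> k" for j
  proof -
    let ?y = "(\<tau> ^^ j) r"
    obtain i where i: "i \<in> {1..n}" "a (i - 1) < ?y" "?y < a i"
      using interior_exists[of ?y] orb[of j] partition_I1 by blast
    have "idx (lift False ?y) = i" by (rule idx_side[OF side_interior[OF i]])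
    then have "itin (r, False) j = i" using orb[of j] by (simp add: itin_def lift_def)
    then show ?thesis using i it[OF j] by simp
  qed
  then have "r \<in> (\<Inter>j\<in>{0..k}. {x \<in> {0..1}. (\<tau> ^^ j) x \<in> {a (itin p j - 1)<..<a (itin p j)}})"
    using r(3,4) by simp
  then show "(\<Inter>j\<in>{0..k}. {x \<in> {0..1}. (\<tau> ^^ j) x \<in> {a (itin p j - 1)<..<a (itin p j)}}) \<noteq> {}" by blast
qed

text \<open>Points following \<open>w\<close> up to time \<open>k\<close> form nonempty closed sets
  decreasing in \<open>k\<close>; compactness of \<open>X\<close> yields a point following all of
  \<open>w\<close>. Here the witnessing real may lie in \<open>I1\<close>, since admissibility only
  excludes partition points.\<close>

lemma itin_onto: assumes w: "w \<in> itinerary_space \<tau> n a" shows "\<exists>p\<in>S. itin p = w"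
proof -
  define C where "C k = {q \<in> S. \<forall>j\<le>k. itin q j = w j}" for k
  have closed: "closedin X (C k)" for k
  proof -
    have eq: "C k = {q \<in> topspace X. gsys.lab P (Suc k) q \<in> {l. \<forall>j\<le>k. Suc (card (l ! j)) = w j}}"
      unfolding C_def topspace_order_topology
      by (rule Collect_cong) (auto simp: itin_def idx_def gsys.lab_def gsys.below_def nth_append less_Suc_eq_le simp del: upt_Suc)
    have "topspace X - C k = {q \<in> topspace X. gsys.lab P (Suc k) q \<in> - {l. \<forall>j\<le>k. Suc (card (l ! j)) = w j}}"
      unfolding eq by blast
    then show ?thesis
      using gsys.openin_lc[OF gsys.lc_lab[OF P_props, of "Suc k"], of "- {l. \<forall>j\<le>k. Suc (card (l ! j)) = w j}"]
      by (simp add: closedin_def C_def topspace_order_topology subset_iff)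
  qed
  have ne: "C k \<noteq> {}" for k
  proof -
    have "(\<Inter>j\<in>{0..k}. {x \<in> {0..1}. (\<tau> ^^ j) x \<in> {a (w j - 1)<..<a (w j)}}) \<noteq> {}" and wn: "\<And>j. w j \<in> {1..n}"
      using w unfolding itinerary_space_def by blast+
    then obtain x where x: "x \<in> (\<Inter>j\<in>{0..k}. {x \<in> {0..1}. (\<tau> ^^ j) x \<in> {a (w j - 1)<..<a (w j)}})" by blast
    have x01: "0 \<le> x" "x \<le> 1" using x by auto
    have xj: "a (w j - 1) < (\<tau> ^^ j) x" "(\<tau> ^^ j) x < a (w j)" if "j \<le> k" for j using x that by auto
    have notp: "(\<tau> ^^ j) x \<notin> partition_points n a" if j: "j \<le> k" for j
    proof
      assume "(\<tau> ^^ j) x \<in> partition_points n a"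
      then obtain i where i: "i \<le> n" "(\<tau> ^^ j) x = a i" by (auto simp: partition_points_iff)
      then have "\<not> a i \<le> a (w j - 1)" "\<not> a (w j) \<le> a i" using xj[OF j] by auto
      moreover have "w j - 1 \<le> n" using wn[of j] by auto
      ultimately have "\<not> i \<le> w j - 1" "\<not> w j \<le> i" using a_le[of i "w j - 1"] a_le[of "w j" i] i(1) by blast+
      then show False by linarith
    qed
    have xS: "lift False x \<in> S" by (rule lift_S[OF x01])
    have "itin (lift False x) j = w j" if j: "j \<le> k" for j
    proof -
      have f: "fst ((\<sigma> ^^ j) (lift False x)) = (\<tau> ^^ j) x" "(\<sigma> ^^ j) (lift False x) \<in> S"
        using fst_sigma_funpow[of j x "lift False x"] notp j x01 xS by (auto simp: fst_lift)
      obtain b where "(\<sigma> ^^ j) (lift False x) = lift b ((\<tau> ^^ j) x)" using S_cases[OF f(2)] f(1) by metis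
      then show ?thesis
        unfolding itin_def using idx_side[OF side_interior[OF wn xj[OF j]], of b] by simp
    qed
    then have "lift False x \<in> C k" using xS by (simp add: C_def)
    then show ?thesis by blast
  qed
  have "decseq C" by (auto simp: C_def decseq_def)
  then have "(\<Inter>k. C k) \<noteq> {}" using compact_space_imp_nest[where C = C, OF compact_X closed ne] by blast
  then obtain p where p: "\<And>k. p \<in> C k" by blast
  then have "itin p = w" by (auto simp: C_def fun_eq_iff)
  moreover have "p \<in> S" using p[of 0] by (simp add: C_def)
  ultimately show ?thesis by blast
qed

text \<open>Cylinders of length \<open>k\<close> form an open cover over whose members the label is
  constant, which is better than the bound two in the general result.\<close>

lemma entropy_shift: "topological_entropy (itinerary_top \<tau> n a) shift = ereal (ln s)"
proof (rule gsys.topological_entropy_factor)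
  let ?Y = "itinerary_top \<tau> n a"
  have topY: "topspace ?Y = itinerary_space \<tau> n a"
    by (auto simp: itinerary_top_def itinerary_space_def PiE_iff)
  have coord: "continuous_map X (discrete_topology {1..n}) (\<lambda>p. itin p k)" for k
  proof -
    have "gsys.lc (\<lambda>p. Suc (card (gsys.lab P (Suc k) p ! k)))"
      by (rule gsys.lc_compose[OF gsys.lc_lab[OF P_props]])
    moreover have "(\<lambda>p. Suc (card (gsys.lab P (Suc k) p ! k))) = (\<lambda>p. itin p k)"
      by (simp add: itin_def idx_def gsys.lab_def gsys.below_def nth_append fun_eq_iff)
    ultimately have "continuous_map X (discrete_topology UNIV) (\<lambda>p. itin p k)"
      by (simp add: gsys.lc_iff_continuous)
    moreover have "itin p k \<in> {1..n}" if "p \<in> S" for p using itin_Sigma[OF that] unfolding itinerary_space_def by blast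
    ultimately have "continuous_map X (subtopology (discrete_topology UNIV) {1..n}) (\<lambda>p. itin p k)"
      unfolding continuous_map_in_subtopology by (auto simp: topspace_order_topology)
    then show ?thesis by simp
  qed
  then show "continuous_map X ?Y itin"
    unfolding itinerary_top_def continuous_map_in_subtopology continuous_map_componentwise_UNIV
    using itin_Sigma by (auto simp: topspace_order_topology)
  show "itin ` topspace X = topspace ?Y"
    unfolding topY topspace_order_topology using itin_Sigma itin_onto by force
  show "itin (\<sigma> p) = shift (itin p)" for p
    by (simp add: itin_def shift_def fun_eq_iff funpow_swap1)
  fix k :: nat
  define W where "W p = {w \<in> itinerary_space \<tau> n a. \<forall>j<k. w j = itin p j}" for p
  have openW: "openin ?Y (W p)" for p
  proof -
    let ?Z = "product_topology (\<lambda>_. discrete_topology {1..n}) (UNIV :: nat set)"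
    have "openin ?Z {w \<in> topspace ?Z. w j \<in> {itin p j} \<inter> {1..n}}" for j
      by (rule openin_continuous_map_preimage[OF continuous_map_product_projection]) auto
    then have "openin ?Z (topspace ?Z \<inter> (\<Inter>j\<in>{..<k}. {w \<in> topspace ?Z. w j \<in> {itin p j} \<inter> {1..n}}))" if "k \<noteq> 0"
      using that by (intro openin_Int[OF openin_topspace] openin_INT2) auto
    \<comment> \<open>For \<open>k = 0\<close> the family of coordinate conditions is empty and is
      treated apart.\<close>
    then have o: "openin ?Z (topspace ?Z \<inter> (\<Inter>j\<in>{..<k}. {w \<in> topspace ?Z. w j \<in> {itin p j} \<inter> {1..n}}))"
      using openin_topspace[of ?Z] by (cases "k = 0") (simp del: topspace_product_topology, blast)
    have "W p = itinerary_space \<tau> n a \<inter> (topspace ?Z \<inter> (\<Inter>j\<in>{..<k}. {w \<in> topspace ?Z. w j \<in> {itin p j} \<inter> {1..n}}))"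
      unfolding W_def by (auto simp: itinerary_space_def PiE_iff)
    then show ?thesis unfolding itinerary_top_def using openin_subtopology_Int2[OF o] by simp
  qed
  have "open_cover ?Y (W ` S)"
    unfolding open_cover_def topY
  proof
    show "\<forall>U\<in>W ` S. openin ?Y U" using openW by blast
    show "\<Union>(W ` S) = itinerary_space \<tau> n a"
    proof
      show "\<Union>(W ` S) \<subseteq> itinerary_space \<tau> n a" unfolding W_def by blast
      show "itinerary_space \<tau> n a \<subseteq> \<Union>(W ` S)"
      proof
        fix w assume "w \<in> itinerary_space \<tau> n a"
        then obtain p where "p \<in> S" "w = itin p" using itin_onto by blast
        then have "w \<in> W p" using itin_Sigma unfolding W_def by blast
        then show "w \<in> \<Union>(W ` S)" using \<open>p \<in> S\<close> by blast
      qed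
    qed
  qed
  moreover have "card (gsys.lab P k ` {q \<in> topspace X. itin q \<in> W p}) \<le> 2" if p: "p \<in> S" for p
  proof -
    have "gsys.lab P k ` {q \<in> topspace X. itin q \<in> W p} \<subseteq> {gsys.lab P k p}"
    proof
      fix l assume "l \<in> gsys.lab P k ` {q \<in> topspace X. itin q \<in> W p}"
      then obtain q where q: "q \<in> S" "itin q \<in> W p" "l = gsys.lab P k q" unfolding topspace_order_topology by blast
      then show "l \<in> {gsys.lab P k p}" using itin_lab[OF p q(1), of k] unfolding W_def by simp
    qed
    then have "card (gsys.lab P k ` {q \<in> topspace X. itin q \<in> W p}) \<le> card {gsys.lab P k p}"
      by (rule card_mono[rotated]) simp
    then show ?thesis by simp
  qed
  ultimately show "\<exists>U. open_cover ?Y U \<and> (\<forall>W\<in>U. card (gsys.lab P k ` {p \<in> topspace X. itin p \<in> W}) \<le> 2)"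
    by blast
qed

lemma entropy_eq: "entropy \<tau> n a = ereal (ln s)"
  unfolding entropy_def using entropy_continuous entropy_shift by simp

end

theorem theorem5p3:
  fixes \<tau> :: "real \<Rightarrow> real" and n :: nat and a :: "nat \<Rightarrow> real"
    and \<sigma> :: "point \<Rightarrow> point" and N :: nat and Xs :: "nat \<Rightarrow> point set"
    and \<mu> :: "point measure" and s :: real
  defines "X \<equiv> X_top \<tau> n a"
  defines "G \<equiv> \<lambda>i. G_part X \<sigma> (Xs i)"
  assumes "piecewise_monotonic \<tau> n a"
    and "transitive_map \<tau> n a"
    and "\<not> essentially_injective \<tau>"
    and "associated_local_homeomorphism \<tau> n a \<sigma>"
    and "cyclic_exact_partition X \<sigma> N Xs"
    and "scaled_probability_measure X \<sigma> s \<mu>"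
  shows
    "(\<exists>h. (\<forall>f\<in>C_int X. h (cls X \<sigma> f) = (\<lambda>i\<in>{1..N}. cls X \<sigma> (times_chi f (Xs i)))) \<and>
          unital_dimension_group_iso (DG \<tau> n a \<sigma>) (ordered_direct_sum {1..N} G) h) \<and>
     (\<forall>i\<in>{1..N}.
        order_unit (G i) (ounit (G i)) \<and>
        (\<exists>h. dimension_group_iso (G i) (G_group (subtopology X (Xs i)) (\<sigma> ^^ N)) h) \<and>
        simple_dimension_group (G i) \<and>
        (\<exists>\<omega>. is_state (G i) \<omega> \<and>
             (\<forall>f\<in>C_int X. supp X f \<subseteq> Xs i \<longrightarrow>
                \<omega> (cls X \<sigma> f) = inverse (measure \<mu> (Xs i)) * (\<integral>x. real_of_int (f x) \<partial>\<mu>)) \<and>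
             (\<forall>\<omega>'. is_state (G i) \<omega>' \<longrightarrow> (\<forall>x\<in>carrier (G i). \<omega>' x = \<omega> x)) \<and>
             has_strict_order (G i) \<omega>)) \<and>
     (\<exists>\<omega>. is_state (DG \<tau> n a \<sigma>) \<omega> \<and>
          (\<forall>f\<in>C_int X. \<omega> (cls X \<sigma> f) = (\<integral>x. real_of_int (f x) \<partial>\<mu>)) \<and>
          state_scaled_by (DG \<tau> n a \<sigma>) (transfer_star X \<sigma>) s \<omega> \<and>
          (\<forall>\<omega>' t. is_state (DG \<tau> n a \<sigma>) \<omega>' \<and>
                  state_scaled_by (DG \<tau> n a \<sigma>) (transfer_star X \<sigma>) t \<omega>' \<longrightarrow>
                  (\<forall>x\<in>carrier (DG \<tau> n a \<sigma>). \<omega>' x = \<omega> x))) \<and>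
     (\<forall>i\<in>{1..N}. transfer_star X \<sigma> ` carrier (G i) = carrier (G (next_index N i))) \<and>
     (\<exists>h. entropy \<tau> n a = ereal h \<and> s = exp h)"
proof -
  interpret piecewise_system \<tau> n a \<sigma> N Xs \<mu> s
    using assms(3-8) unfolding X_def
    by (intro piecewise_system.intro piecewise_map.intro piecewise_system_axioms.intro)
  have D: "DG \<tau> n a \<sigma> = G_group X \<sigma>" unfolding DG_def X_def ..
  have state: "\<exists>\<omega>. is_state (G i) \<omega> \<and>
      (\<forall>f\<in>C_int X. supp X f \<subseteq> Xs i \<longrightarrow>
        \<omega> (cls X \<sigma> f) = inverse (measure \<mu> (Xs i)) * (\<integral>x. real_of_int (f x) \<partial>\<mu>)) \<and>
      (\<forall>\<omega>'. is_state (G i) \<omega>' \<longrightarrow> (\<forall>x\<in>carrier (G i). \<omega>' x = \<omega> x)) \<and> has_strict_order (G i) \<omega>"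
    if "i \<in> {1..N}" for i
    using gsys.cyc.state_part[OF that] gsys.mean_chi[OF that]
    unfolding G_def X_def X_eq by simp
  have scaled: "\<exists>\<omega>. is_state (G_group X \<sigma>) \<omega> \<and> (\<forall>f\<in>C_int X. \<omega> (cls X \<sigma> f) = (\<integral>x. real_of_int (f x) \<partial>\<mu>)) \<and>
      state_scaled_by (G_group X \<sigma>) (transfer_star X \<sigma>) s \<omega> \<and>
      (\<forall>\<omega>' t. is_state (G_group X \<sigma>) \<omega>' \<and> state_scaled_by (G_group X \<sigma>) (transfer_star X \<sigma>) t \<omega>' \<longrightarrow>
        (\<forall>x\<in>carrier (G_group X \<sigma>). \<omega>' x = \<omega> x))"
    using gsys.cyc.scaled_state unfolding X_def X_eq .
  have "s = exp (ln s)" using gsys.s_pos by simp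
  then have ent: "\<exists>h. entropy \<tau> n a = ereal h \<and> s = exp h" using entropy_eq by blast
  show ?thesis
    unfolding D
    using gsys.cyc.decomposition gsys.cyc.order_unit_part gsys.cyc.part_iso_return_map gsys.cyc.simple_part
      state scaled gsys.cyc.transfer_star_part ent
    unfolding G_def X_def X_eq by (intro conjI ballI) simp_all
qed

end
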